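(* Let $V$ be a Euclidean vector space, let $\sigma$ be an infinitesimal manifold submetry from $V$, and let $\mathcal{S}\subset\mathcal{B}(\sigma)$ be a local separating set for $\sigma$ containing $r^2$. Then the sub-algebra $B\subset\mathbb{R}[V]$ generated by $\mathcal{S}$ coincides with $\mathcal{B}(\sigma)$ if and only if $\Delta f\in B$ and $\langle\nabla f,\nabla g\rangle\in B$ for every $f,g\in\mathcal{S}$.
   Context: A Euclidean vector space is a finite-dimensional real inner product space; $\mathbb{R}[V]$ is its algebra of real polynomial functions. In orthonormal coordinates $x_1,\dots,x_n$: $r^2=\sum_i x_i^2$, $\Delta=\sum_i\partial^2/\partial x_i^2$, $\langle\nabla f,\nabla g\rangle=\sum_i\frac{\partial f}{\partial x_i}\frac{\partial g}{\partial x_i}$. A submetry is a map between metric spaces which maps each closed metric ball of radius $\rho$ around $x$ onto the closed ball of radius $\rho$ around the image of $x$. A manifold submetry is a submetry from a Riemannian manifold to a metric space such that each fiber is a (possibly disconnected) embedded smooth submanifold. An infinitesimal manifold submetry is a manifold submetry $\sigma:V\to X$ from a Euclidean vector space $V$ such that $\{0\}$ is a fiber. $\mathcal{F}_\sigma$ denotes the partition of $V$ into the fibers of $\sigma$, and $\mathcal{B}(\sigma)\subset\mathbb{R}[V]$ the algebra of all polynomials constant on each fiber of $\sigma$. For a subset $\mathcal{S}\subset\mathbb{R}[V]$, $\mathcal{L}(\mathcal{S})$ denotes the partition of $V$ into the equivalence classes of the relation $v\sim w\iff f(v)=f(w)$ for all $f\in\mathcal{S}$. A subset of $V$ is saturated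 with respect to a partition if it is a union of members of the partition. A subset $\mathcal{S}\subset\mathcal{B}(\sigma)$ is called a local separating set for $\sigma$ if there exists a non-empty open subset $U\subset V$ such that (1) $U$ is $\mathcal{L}(\mathcal{S})$-saturated (hence also $\mathcal{F}_\sigma$-saturated), and (2) $\mathcal{S}$ separates the fibers of $\sigma$ contained in $U$, i.e. $\mathcal{L}(\mathcal{S})|_U=\mathcal{F}_\sigma|_U$. *)

theory Defs
  imports "HOL-Analysis.Analysis"
begin

text \<open>A Euclidean vector space \<open>V\<close> is a type of class \<^class>\<open>euclidean_space\<close>; its \<^const>\<open>Basis\<close> is
  orthonormal and provides the orthonormal coordinates \<open>x \<bullet> b\<close>. The algebra of real polynomial
  functions on \<open>V\<close> is \<open>Collect real_polynomial_function\<close>.\<close>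

definition r2 :: "'a::euclidean_space \<Rightarrow> real" where
  "r2 x = (\<Sum>b\<in>Basis. (x \<bullet> b)\<^sup>2)"

definition partial_deriv :: "'a::euclidean_space \<Rightarrow> ('a \<Rightarrow> real) \<Rightarrow> 'a \<Rightarrow> real" where
  "partial_deriv b f x = deriv (\<lambda>t::real. f (x + t *\<^sub>R b)) 0"

definition laplacian :: "('a::euclidean_space \<Rightarrow> real) \<Rightarrow> 'a \<Rightarrow> real" where
  "laplacian f x = (\<Sum>b\<in>Basis. partial_deriv b (partial_deriv b f) x)"

definition grad_inner :: "('a::euclidean_space \<Rightarrow> real) \<Rightarrow> ('a \<Rightarrow> real) \<Rightarrow> 'a \<Rightarrow> real" where
  "grad_inner f g x = (\<Sum>b\<in>Basis. partial_deriv b f x * partial_deriv b g x)"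

definition poly_subalgebra :: "('a::euclidean_space \<Rightarrow> real) set \<Rightarrow> bool" where
  "poly_subalgebra A \<longleftrightarrow>
     A \<subseteq> Collect real_polynomial_function \<and>
     (\<forall>c. (\<lambda>x. c) \<in> A) \<and>
     (\<forall>f\<in>A. \<forall>g\<in>A. (\<lambda>x. f x + g x) \<in> A \<and> (\<lambda>x. f x * g x) \<in> A)"

definition generated_subalgebra :: "('a::euclidean_space \<Rightarrow> real) set \<Rightarrow> ('a \<Rightarrow> real) set" where
  "generated_subalgebra S = poly_subalgebra hull S"

text \<open>\<open>C_diff k U f\<close>: on the open set \<open>U\<close>, the function \<open>f\<close> is \<open>k\<close> times continuously differentiable.\<close>

primrec C_diff :: "nat \<Rightarrow> 'a::euclidean_space set \<Rightarrow> ('a \<Rightarrow> 'b::euclidean_space) \<Rightarrow> bool" where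
  "C_diff 0 U f \<longleftrightarrow> continuous_on U f"
| "C_diff (Suc k) U f \<longleftrightarrow>
     (\<forall>x\<in>U. f differentiable (at x)) \<and>
     (\<forall>v. C_diff k U (\<lambda>x. frechet_derivative f (at x) v))"

definition smooth_on :: "'a::euclidean_space set \<Rightarrow> ('a \<Rightarrow> 'b::euclidean_space) \<Rightarrow> bool" where
  "smooth_on U f \<longleftrightarrow> (\<forall>k. C_diff k U f)"

text \<open>Embedded smooth submanifolds (without boundary) are given by slice charts: near each of its
  points, \<open>M\<close> is carried onto a piece of a \<open>d\<close>-dimensional linear subspace by a diffeomorphism between
  open subsets of the ambient space. Connectedness is not required, but \<open>d\<close> is the same at all points
  of \<open>M\<close>, including points in different components.\<close>

definition embedded_submanifold :: "nat \<Rightarrow> 'a::euclidean_space set \<Rightarrow> bool" where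
  "embedded_submanifold d M \<longleftrightarrow>
     (\<forall>p\<in>M. \<exists>U W \<phi> \<psi> E.
        open U \<and> p \<in> U \<and> open (W :: 'a set) \<and>
        homeomorphism U W \<phi> \<psi> \<and> smooth_on U \<phi> \<and> smooth_on W \<psi> \<and>
        subspace E \<and> dim E = d \<and> \<phi> ` (M \<inter> U) = E \<inter> W)"

text \<open>Submetries are automatically surjective, so the target metric space can be taken to be a type.\<close>

definition submetry :: "('a::metric_space \<Rightarrow> 'x::metric_space) \<Rightarrow> bool" where
  "submetry \<sigma> \<longleftrightarrow> (\<forall>x \<rho>. \<sigma> ` cball x \<rho> = cball (\<sigma> x) \<rho>)"

definition fibers :: "('a \<Rightarrow> 'x) \<Rightarrow> 'a set set" where
  "fibers \<sigma> = range (\<lambda>v. \<sigma> -` {\<sigma> v})"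

text \<open>Only the Riemannian manifold \<open>V\<close> with its flat metric is needed as the domain.\<close>

definition manifold_submetry :: "('a::euclidean_space \<Rightarrow> 'x::metric_space) \<Rightarrow> bool" where
  "manifold_submetry \<sigma> \<longleftrightarrow> submetry \<sigma> \<and> (\<forall>F\<in>fibers \<sigma>. \<exists>d. embedded_submanifold d F)"

definition infinitesimal_manifold_submetry :: "('a::euclidean_space \<Rightarrow> 'x::metric_space) \<Rightarrow> bool" where
  "infinitesimal_manifold_submetry \<sigma> \<longleftrightarrow> manifold_submetry \<sigma> \<and> {0} \<in> fibers \<sigma>"

definition basic_polynomials :: "('a::euclidean_space \<Rightarrow> 'x) \<Rightarrow> ('a \<Rightarrow> real) set" where
  "basic_polynomials \<sigma> = {f. real_polynomial_function f \<and> (\<forall>F\<in>fibers \<sigma>. f constant_on F)}"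

definition level_partition :: "('a \<Rightarrow> real) set \<Rightarrow> 'a set set" where
  "level_partition S = UNIV // {(v, w). \<forall>f\<in>S. f v = f w}"

definition saturated :: "'a set set \<Rightarrow> 'a set \<Rightarrow> bool" where
  "saturated P U \<longleftrightarrow> (\<exists>Q\<subseteq>P. U = \<Union>Q)"

definition partition_within :: "'a set set \<Rightarrow> 'a set \<Rightarrow> 'a set set" where
  "partition_within P U = {A \<in> P. A \<subseteq> U}"

definition local_separating_set ::
    "('a::euclidean_space \<Rightarrow> 'x) \<Rightarrow> ('a \<Rightarrow> real) set \<Rightarrow> bool" where
  "local_separating_set \<sigma> S \<longleftrightarrow>
     S \<subseteq> basic_polynomials \<sigma> \<and>
     (\<exists>U. open U \<and> U \<noteq> {} \<and>
        saturated (level_partition S) U \<and>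
        partition_within (level_partition S) U = partition_within (fibers \<sigma>) U)"

end

theory Submission
  imports Defs "HOL-Library.Function_Algebras"
begin

text \<open>
  If the generated algebra consists of all basic polynomials, closure under the gradient product holds
  because gradients of basic polynomials are orthogonal to the fibres: short segments along them
  are shortest between fibres, so \<open>x \<mapsto> x + t grad g x\<close> maps regular fibres into fibres for all \<open>t\<close>. For the
  Laplacian, the rank of this map along a fibre is tied to the multiplicity of the eigenvalue \<open>- 1 / t\<close> of the
  Hessian of \<open>g\<close>. Where the largest Hessian-invariant subspace of the tangent space of the fibre
  has minimal dimension, the map is a submersion between fibres for every \<open>t \<noteq> 0\<close>. There all multiplicities
  are at most those at any other point of the fibre, hence equal to them because both sum to the dimension, and the
  trace of the Hessian agrees along the fibre. The minimal points contain a non-empty open set, from which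
  the equality spreads to all fibres along shortest segments because it is polynomial.

  For the converse, let \<open>E\<close> be the Euler operator, which is half the gradient product with \<open>r2\<close>. The
  operator \<open>R\<^sup>2 \<Delta> - E\<^sup>2 - (n + 4) E\<close> preserves the generated algebra, is symmetric for the weight
  \<open>(max 0 (R\<^sup>2 - r2))\<^sup>2\<close>, and is triangular for the degree with strictly decreasing eigenvalues. Hence a
  basic polynomial of degree less than \<open>d\<close> which is orthogonal to the elements of degree less than \<open>d\<close> is orthogonal
  to the whole algebra. By the Stone--Weierstrass theorem the algebra approximates the product of this polynomial with a bump
  function supported in the separating open set, so the polynomial vanishes.
\<close>

section \<open>Polynomial functions\<close>

text \<open>The obstacle in the forward direction is that separation is known only on one open set,
  while a flow may end in a singular fibre, where gradients of basic polynomials need not span the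
  normal space. Two devices answer this. A condition along a line is written as the vanishing of a
  polynomial, so that it passes from an interval to all parameters; and the length of the normal
  part of a velocity is read off from distances in the target space, so that it agrees for curves
  with the same image, whether or not they start in a singular fibre. A differential that is not
  onto along the fibre would break the comparison of multiplicities. Perturbing \<open>g\<close> by
  combinations of \<open>bas\<close> leads to functions for which this does not happen, and the
  Laplacians of the perturbations are separated again by linearity. The eigenvalue 0 corresponds to
  no finite \<open>t\<close>; it is reached by adding a multiple of \<open>r2\<close>, which shifts
  the Hessian by a multiple of the identity.\<close>

lemmas rpf_linear = real_polynomial_function.intros(1)
  and rpf_const = real_polynomial_function.intros(2)
  and rpf_add = real_polynomial_function.intros(3)
  and rpf_mult = real_polynomial_function.intros(4)

definition grad :: "('a::euclidean_space \<Rightarrow> real) \<Rightarrow> 'a \<Rightarrow> 'a" where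
  "grad f x = (\<Sum>b\<in>Basis. partial_deriv b f x *\<^sub>R b)"

text \<open>The Hessian is kept as a self-map rather than a bilinear form, because its eigenspaces
  and invariant subspaces are what matters later.\<close>

definition hess :: "('a::euclidean_space \<Rightarrow> real) \<Rightarrow> 'a \<Rightarrow> 'a \<Rightarrow> 'a" where
  "hess f x h = (\<Sum>b\<in>Basis. (h \<bullet> grad (partial_deriv b f) x) *\<^sub>R b)"

lemma partial_deriv_of_has_derivative:
  assumes "(f has_derivative f') (at x)"
  shows "partial_deriv b f x = f' b"
proof -
  have "((\<lambda>t. f (x + t *\<^sub>R b)) has_derivative (\<lambda>t. f' (t *\<^sub>R b))) (at 0)"
    by (rule has_derivative_compose[where g = f and f = "\<lambda>t. x + t *\<^sub>R b", simplified])
       (auto intro!: derivative_eq_intros assms)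
  moreover have "f' (t *\<^sub>R b) = f' b * t" for t
    using linear_cmul[OF has_derivative_linear[OF assms]] by (simp add: mult.commute)
  ultimately have "((\<lambda>t. f (x + t *\<^sub>R b)) has_field_derivative f' b) (at 0)"
    by (simp add: has_field_derivative_def mult_commute_abs)
  then show ?thesis
    unfolding partial_deriv_def by (rule DERIV_imp_deriv)
qed

text \<open>Induction over the construction of polynomials yields some polynomial gradient;
  uniqueness of derivatives then identifies it with \<open>grad\<close>.\<close>

lemma polynomial_derivative_exists:
  fixes f :: "'a::euclidean_space \<Rightarrow> real"
  assumes "real_polynomial_function f"
  shows "\<exists>g. polynomial_function g \<and> (\<forall>x. (f has_derivative (\<lambda>h. h \<bullet> g x)) (at x))"
  using assms
proof induct
  case (linear f)
  define c where "c = (\<Sum>b\<in>Basis. f b *\<^sub>R b)"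
  have "f h = h \<bullet> c" for h
  proof -
    have "f h = f (\<Sum>b\<in>Basis. (h \<bullet> b) *\<^sub>R b)"
      by (simp add: euclidean_representation)
    also have "\<dots> = (\<Sum>b\<in>Basis. (h \<bullet> b) * f b)"
      by (simp add: linear_sum[OF bounded_linear.linear[OF linear]]
          linear_cmul[OF bounded_linear.linear[OF linear]])
    finally show ?thesis
      by (simp add: c_def inner_sum_right mult.commute)
  qed
  then have "f = (\<lambda>h. h \<bullet> c)"
    by blast
  then have "(f has_derivative (\<lambda>h. h \<bullet> c)) (at x)" for x
    using bounded_linear_imp_has_derivative[OF linear, of "at x"] by simp
  then show ?case
    by (intro exI[of _ "\<lambda>x. c"]) auto
next
  case (const c)
  show ?case
    by (intro exI[of _ "\<lambda>x. 0"]) auto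
next
  case (add f g)
  then obtain f' g' where "polynomial_function f'" "polynomial_function g'"
    "\<And>x. (f has_derivative (\<lambda>h. h \<bullet> f' x)) (at x)" "\<And>x. (g has_derivative (\<lambda>h. h \<bullet> g' x)) (at x)"
    by metis
  then show ?case
    by (intro exI[of _ "\<lambda>x. f' x + g' x"])
       (auto intro!: derivative_eq_intros simp: inner_add_right)
next
  case (mult f g)
  then obtain f' g' where *: "polynomial_function f'" "polynomial_function g'"
    "\<And>x. (f has_derivative (\<lambda>h. h \<bullet> f' x)) (at x)" "\<And>x. (g has_derivative (\<lambda>h. h \<bullet> g' x)) (at x)"
    by metis
  have pf: "polynomial_function f" "polynomial_function g"
    using mult real_polynomial_function_eq by auto
  have "polynomial_function (\<lambda>x. f x *\<^sub>R g' x + g x *\<^sub>R f' x)"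
    using * pf by (intro polynomial_function_add polynomial_function_mult) auto
  moreover have "((\<lambda>x. f x * g x) has_derivative (\<lambda>h. h \<bullet> (f x *\<^sub>R g' x + g x *\<^sub>R f' x))) (at x)" for x
    using * by (auto intro!: derivative_eq_intros simp: inner_add_right algebra_simps)
  ultimately show ?case
    by (intro exI[of _ "\<lambda>x. f x *\<^sub>R g' x + g x *\<^sub>R f' x"]) auto
qed

lemma grad_eqI:
  assumes "(f has_derivative (\<lambda>h. h \<bullet> g)) (at x)"
  shows "grad f x = g"
  unfolding grad_def partial_deriv_of_has_derivative[OF assms]
  by (simp add: inner_commute[of _ g] euclidean_representation)

lemma has_derivative_grad:
  assumes "real_polynomial_function f"
  shows "(f has_derivative (\<lambda>h. h \<bullet> grad f x)) (at x)"
  using polynomial_derivative_exists[OF assms] grad_eqI by metis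

lemma polynomial_function_grad:
  assumes "real_polynomial_function f"
  shows "polynomial_function (grad f)"
proof -
  obtain g where "polynomial_function g" "\<And>x. (f has_derivative (\<lambda>h. h \<bullet> g x)) (at x)"
    using polynomial_derivative_exists[OF assms] by metis
  moreover from this have "grad f = g"
    using grad_eqI by blast
  ultimately show ?thesis by simp
qed

lemma partial_deriv_eq:
  assumes "real_polynomial_function f"
  shows "partial_deriv b f x = b \<bullet> grad f x"
  by (rule partial_deriv_of_has_derivative[OF has_derivative_grad[OF assms]])

lemma real_polynomial_inner:
  fixes f g :: "'a::euclidean_space \<Rightarrow> 'b::euclidean_space"
  assumes "polynomial_function f" "polynomial_function g"
  shows "real_polynomial_function (\<lambda>x. f x \<bullet> g x)"
proof -
  have "f x \<bullet> g x = (\<Sum>b\<in>Basis. (f x \<bullet> b) * (g x \<bullet> b))" for x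
    by (rule euclidean_inner)
  moreover have "real_polynomial_function (\<lambda>x. \<Sum>b\<in>Basis. (f x \<bullet> b) * (g x \<bullet> b))"
    using assms unfolding polynomial_function_iff_Basis_inner
    by (auto intro!: real_polynomial_function_sum rpf_mult)
  ultimately show ?thesis by simp
qed

lemma real_polynomial_partial_deriv:
  assumes "real_polynomial_function f"
  shows "real_polynomial_function (partial_deriv b f)"
  using real_polynomial_inner[OF polynomial_function_const polynomial_function_grad[OF assms], of b]
  by (simp add: partial_deriv_eq[OF assms, abs_def])

lemma grad_add:
  assumes "real_polynomial_function f" "real_polynomial_function g"
  shows "grad (\<lambda>x. f x + g x) x = grad f x + grad g x"
  by (rule grad_eqI) (auto intro!: derivative_eq_intros has_derivative_grad assms simp: inner_add_right)

lemma grad_mult: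
  assumes "real_polynomial_function f" "real_polynomial_function g"
  shows "grad (\<lambda>x. f x * g x) x = f x *\<^sub>R grad g x + g x *\<^sub>R grad f x"
  by (rule grad_eqI)
     (auto intro!: derivative_eq_intros has_derivative_grad assms simp: inner_add_right algebra_simps)

lemma grad_const [simp]: "grad (\<lambda>x. c) x = 0"
  by (rule grad_eqI) auto

lemma grad_cmult:
  assumes "real_polynomial_function f"
  shows "grad (\<lambda>x. c * f x) x = c *\<^sub>R grad f x"
  using grad_mult[OF rpf_const assms, of c] by simp

lemma grad_linear: "grad (\<lambda>x. x \<bullet> v) x = v"
  by (rule grad_eqI) (auto intro!: derivative_eq_intros)

lemma grad_sum:
  assumes "\<And>i. i \<in> I \<Longrightarrow> real_polynomial_function (f i)" "finite I"
  shows "grad (\<lambda>x. \<Sum>i\<in>I. f i x) x = (\<Sum>i\<in>I. grad (f i) x)"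
  by (rule grad_eqI)
     (auto intro!: derivative_eq_intros has_derivative_grad assms simp: inner_sum_right)

lemma partial_deriv_grad_component:
  assumes "b \<in> Basis"
  shows "grad f x \<bullet> b = partial_deriv b f x"
  using assms by (simp add: grad_def inner_sum_left inner_Basis if_distrib sum.delta cong: if_cong)

lemma grad_inner_eq:
  "grad_inner f g x = grad f x \<bullet> grad g x"
  unfolding grad_inner_def by (subst euclidean_inner) (simp add: partial_deriv_grad_component)

text \<open>Trivial for linear functions; for products, the rule for mixed derivatives is symmetric
  in the two directions once this holds for both factors. It makes \<open>hess\<close> a symmetric
  map.\<close>

lemma partial_deriv_commute:
  assumes "real_polynomial_function f"
  shows "partial_deriv a (partial_deriv b f) x = partial_deriv b (partial_deriv a f) x"
  using assms
proof (induct arbitrary: x)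
  case (linear f)
  have "partial_deriv v f = (\<lambda>x. f v)" for v
    by (rule ext) (rule partial_deriv_of_has_derivative[OF bounded_linear_imp_has_derivative[OF linear]])
  then show ?case
    by (simp add: partial_deriv_def)
next
  case (const c)
  show ?case by (simp add: partial_deriv_def)
next
  case (add f g)
  have 1: "partial_deriv v (\<lambda>x. f x + g x) = (\<lambda>x. partial_deriv v f x + partial_deriv v g x)"
    if "real_polynomial_function f" "real_polynomial_function g" for v and f g :: "'a \<Rightarrow> real"
    using that by (auto simp: partial_deriv_eq rpf_add grad_add inner_add_right)
  show ?case
    using add by (simp add: 1 real_polynomial_partial_deriv)
next
  case (mult f g)
  have 1: "partial_deriv v (\<lambda>x. f x + g x) = (\<lambda>x. partial_deriv v f x + partial_deriv v g x)"
    if "real_polynomial_function f" "real_polynomial_function g" for v and f g :: "'a \<Rightarrow> real"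
    using that by (auto simp: partial_deriv_eq rpf_add grad_add inner_add_right)
  have 2: "partial_deriv v (\<lambda>x. f x * g x) = (\<lambda>x. f x * partial_deriv v g x + g x * partial_deriv v f x)"
    if "real_polynomial_function f" "real_polynomial_function g" for v and f g :: "'a \<Rightarrow> real"
    using that by (auto simp: partial_deriv_eq rpf_mult grad_mult inner_add_right)
  show ?case
    using mult
    by (simp add: 1 2 real_polynomial_partial_deriv rpf_mult algebra_simps)
qed

lemma linear_hess: "linear (hess f x)"
  unfolding hess_def
  by (rule linearI) (auto simp: inner_add_left scaleR_add_left sum.distrib scaleR_sum_right)

lemma has_derivative_grad_hess:
  assumes "real_polynomial_function f"
  shows "(grad f has_derivative hess f x) (at x)"
proof -
  have "grad f = (\<lambda>x. \<Sum>b\<in>Basis. partial_deriv b f x *\<^sub>R b)"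
    by (rule ext) (rule grad_def)
  moreover have "((\<lambda>x. \<Sum>b\<in>Basis. partial_deriv b f x *\<^sub>R b) has_derivative hess f x) (at x)"
    unfolding hess_def[abs_def]
    by (intro has_derivative_sum has_derivative_scaleR_left has_derivative_grad
        real_polynomial_partial_deriv assms)
  ultimately show ?thesis by simp
qed

lemma hess_inner:
  assumes "real_polynomial_function f"
  shows "hess f x u \<bullet> v = partial_deriv u (partial_deriv v f) x"
proof -
  have "((\<lambda>y. v \<bullet> grad f y) has_derivative (\<lambda>h. v \<bullet> hess f x h)) (at x)"
    by (rule has_derivative_inner_right[OF has_derivative_grad_hess[OF assms]])
  moreover have "partial_deriv v f = (\<lambda>y. v \<bullet> grad f y)"
    by (rule ext) (rule partial_deriv_eq[OF assms])
  ultimately show ?thesis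
    by (metis partial_deriv_of_has_derivative inner_commute)
qed

lemma hess_symmetric:
  assumes "real_polynomial_function f"
  shows "hess f x u \<bullet> v = u \<bullet> hess f x v"
  by (metis hess_inner[OF assms] partial_deriv_commute[OF assms] inner_commute)

lemma laplacian_eq_trace:
  assumes "real_polynomial_function f"
  shows "laplacian f x = (\<Sum>b\<in>Basis. hess f x b \<bullet> b)"
  unfolding laplacian_def by (simp add: hess_inner[OF assms])

lemma hess_eqI:
  assumes "real_polynomial_function f" "(grad f has_derivative H) (at x)"
  shows "hess f x = H"
  using has_derivative_unique[OF has_derivative_grad_hess[OF assms(1)] assms(2)] .

lemma hess_add:
  assumes "real_polynomial_function f" "real_polynomial_function g"
  shows "hess (\<lambda>x. f x + g x) x h = hess f x h + hess g x h"
proof -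
  have "grad (\<lambda>x. f x + g x) = (\<lambda>x. grad f x + grad g x)"
    by (rule ext) (rule grad_add[OF assms])
  then have "(grad (\<lambda>x. f x + g x) has_derivative (\<lambda>h. hess f x h + hess g x h)) (at x)"
    by (auto intro!: derivative_eq_intros has_derivative_grad_hess assms)
  then show ?thesis
    by (simp add: hess_eqI assms rpf_add)
qed

lemma hess_mult:
  assumes "real_polynomial_function f" "real_polynomial_function g"
  shows "hess (\<lambda>x. f x * g x) x h = f x *\<^sub>R hess g x h + g x *\<^sub>R hess f x h
    + (h \<bullet> grad f x) *\<^sub>R grad g x + (h \<bullet> grad g x) *\<^sub>R grad f x"
proof -
  have "grad (\<lambda>x. f x * g x) = (\<lambda>x. f x *\<^sub>R grad g x + g x *\<^sub>R grad f x)"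
    by (rule ext) (rule grad_mult[OF assms])
  then have "(grad (\<lambda>x. f x * g x) has_derivative (\<lambda>h. f x *\<^sub>R hess g x h + g x *\<^sub>R hess f x h
    + (h \<bullet> grad f x) *\<^sub>R grad g x + (h \<bullet> grad g x) *\<^sub>R grad f x)) (at x)"
    by (auto intro!: derivative_eq_intros has_derivative_grad_hess has_derivative_grad assms
        simp: algebra_simps)
  then show ?thesis
    by (simp add: hess_eqI assms rpf_mult)
qed

lemma hess_const [simp]: "hess (\<lambda>x. c) x h = 0"
proof -
  have "(grad (\<lambda>x. c) has_derivative (\<lambda>h. 0)) (at x)"
    by (simp add: grad_const[abs_def])
  then show ?thesis
    by (simp add: hess_eqI rpf_const)
qed

lemma hess_cmult:
  assumes "real_polynomial_function f"
  shows "hess (\<lambda>x. c * f x) x h = c *\<^sub>R hess f x h"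
  using hess_mult[OF rpf_const assms, of c] by simp

lemma hess_sum:
  assumes "\<And>i. i \<in> I \<Longrightarrow> real_polynomial_function (f i)" "finite I"
  shows "hess (\<lambda>x. \<Sum>i\<in>I. f i x) x h = (\<Sum>i\<in>I. hess (f i) x h)"
  using assms(2,1)
proof (induct I rule: finite_induct)
  case (insert i I)
  then show ?case
    by (simp add: hess_add real_polynomial_function_sum)
qed simp

lemma laplacian_add:
  assumes "real_polynomial_function f" "real_polynomial_function g"
  shows "laplacian (\<lambda>x. f x + g x) x = laplacian f x + laplacian g x"
  using assms by (simp add: laplacian_eq_trace hess_add inner_add_left sum.distrib rpf_add)

lemma laplacian_mult:
  assumes "real_polynomial_function f" "real_polynomial_function g"
  shows "laplacian (\<lambda>x. f x * g x) x = f x * laplacian g x + g x * laplacian f x + 2 * grad_inner f g x"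
proof -
  have "(\<Sum>b\<in>Basis. (b \<bullet> grad f x) * (grad g x \<bullet> b)) = grad_inner f g x"
    unfolding grad_inner_eq by (subst euclidean_inner) (simp add: inner_commute)
  moreover have "(\<Sum>b\<in>Basis. (b \<bullet> grad g x) * (grad f x \<bullet> b)) = grad_inner f g x"
    unfolding grad_inner_eq by (subst euclidean_inner) (simp add: inner_commute mult.commute)
  ultimately show ?thesis
    using assms
    by (simp add: laplacian_eq_trace hess_mult inner_add_left sum.distrib rpf_mult
        sum_distrib_left)
qed

lemma laplacian_const [simp]: "laplacian (\<lambda>x. c) x = 0"
  by (simp add: laplacian_eq_trace rpf_const)

lemma laplacian_cmult:
  assumes "real_polynomial_function f"
  shows "laplacian (\<lambda>x. c * f x) x = c * laplacian f x"
  using laplacian_mult[OF rpf_const assms, of c x]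
  by (simp add: grad_inner_eq)

lemma laplacian_sum:
  assumes "\<And>i. i \<in> I \<Longrightarrow> real_polynomial_function (f i)" "finite I"
  shows "laplacian (\<lambda>x. \<Sum>i\<in>I. f i x) x = (\<Sum>i\<in>I. laplacian (f i) x)"
  using assms(2,1)
proof (induct I rule: finite_induct)
  case (insert i I)
  then show ?case
    by (simp add: laplacian_add real_polynomial_function_sum)
qed simp

lemma real_polynomial_grad_inner:
  assumes "real_polynomial_function f" "real_polynomial_function g"
  shows "real_polynomial_function (grad_inner f g)"
  using real_polynomial_inner[OF polynomial_function_grad[OF assms(1)] polynomial_function_grad[OF assms(2)]]
  by (simp add: grad_inner_eq[abs_def])

lemma real_polynomial_laplacian:
  assumes "real_polynomial_function f"
  shows "real_polynomial_function (laplacian f)"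
  unfolding laplacian_def[abs_def]
  by (intro real_polynomial_function_sum real_polynomial_partial_deriv assms) auto

lemma r2_eq: "r2 x = x \<bullet> x"
  unfolding r2_def by (subst euclidean_inner) (simp add: power2_eq_square)

lemma r2_fun: "r2 = (\<lambda>x. x \<bullet> x)"
  by (rule ext) (rule r2_eq)

lemma real_polynomial_r2: "real_polynomial_function r2"
  unfolding r2_fun by (intro real_polynomial_inner polynomial_function_id)

lemma grad_r2: "grad r2 x = 2 *\<^sub>R x"
  unfolding r2_fun
  by (rule grad_eqI) (auto intro!: derivative_eq_intros simp: inner_commute)

lemma hess_r2: "hess r2 (x::'a::euclidean_space) h = 2 *\<^sub>R h"
proof -
  have "grad r2 = (\<lambda>x::'a. 2 *\<^sub>R x)"
    by (rule ext) (rule grad_r2)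
  then have "(grad (r2 :: 'a \<Rightarrow> real) has_derivative (\<lambda>h. 2 *\<^sub>R h)) (at x)"
    by (auto intro!: derivative_eq_intros)
  then show ?thesis
    by (simp add: hess_eqI real_polynomial_r2)
qed

section \<open>Polynomials on lines: finitely many zeros and continuation from intervals\<close>

lemma real_polynomial_line:
  assumes "real_polynomial_function f"
  shows "real_polynomial_function (\<lambda>s::real. f (x + s *\<^sub>R v))"
proof -
  have "polynomial_function (\<lambda>s::real. x + s *\<^sub>R v)"
    by (intro polynomial_function_add polynomial_function_mult) auto
  then show ?thesis
    using real_polynomial_function_compose[OF _ assms] by (simp add: o_def)
qed

lemma polynomial_line:
  fixes f :: "'a::euclidean_space \<Rightarrow> 'b::euclidean_space"
  assumes "polynomial_function f"
  shows "polynomial_function (\<lambda>s::real. f (x + s *\<^sub>R v))"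
  using assms unfolding polynomial_function_iff_Basis_inner
  using real_polynomial_line[of "\<lambda>y. f y \<bullet> b" for b] by blast

lemma has_derivative_line:
  assumes "real_polynomial_function f"
  shows "((\<lambda>s. f (x + s *\<^sub>R v)) has_real_derivative (v \<bullet> grad f (x + s *\<^sub>R v))) (at s)"
proof -
  have "((\<lambda>s. f (x + s *\<^sub>R v)) has_derivative (\<lambda>t. (t *\<^sub>R v) \<bullet> grad f (x + s *\<^sub>R v))) (at s)"
    by (rule has_derivative_compose[where g = f and f = "\<lambda>t. x + t *\<^sub>R v"])
       (auto intro!: derivative_eq_intros has_derivative_grad assms)
  then show ?thesis
    by (simp add: has_field_derivative_def mult_commute_abs mult.commute)
qed

lemma real_polynomial_finite_roots:
  fixes p :: "real \<Rightarrow> real"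
  assumes "real_polynomial_function p" "p s0 \<noteq> 0"
  shows "finite {s. p s = 0}"
proof -
  obtain a n where p: "p = (\<lambda>x. \<Sum>i\<le>n. a i * x^i)"
    using assms(1) real_polynomial_function_iff_sum by auto
  have "\<exists>k\<le>n. a k \<noteq> 0"
    using assms(2) unfolding p by (metis (no_types, lifting) atMost_iff mult_zero_left sum.neutral)
  then show ?thesis
    unfolding p using polyfun_finite_roots[of a n] by simp
qed

lemma real_polynomial_zero_interval:
  fixes p :: "real \<Rightarrow> real"
  assumes "real_polynomial_function p" "a < b" "\<And>s. a < s \<Longrightarrow> s < b \<Longrightarrow> p s = 0"
  shows "p s = 0"
proof (rule ccontr)
  assume "p s \<noteq> 0"
  then have "finite {s. p s = 0}"
    using real_polynomial_finite_roots[OF assms(1)] by blast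
  then have "finite {a<..<b}"
    by (rule finite_subset[rotated]) (use assms(3) in auto)
  then show False
    using infinite_Ioo[OF assms(2)] by blast
qed

lemma real_polynomial_eq_interval:
  fixes p q :: "real \<Rightarrow> real"
  assumes "real_polynomial_function p" "real_polynomial_function q" "a < b"
    "\<And>s. a < s \<Longrightarrow> s < b \<Longrightarrow> p s = q s"
  shows "p s = q s"
  using real_polynomial_zero_interval[of "\<lambda>s. p s - q s" a b s] assms
  by (auto intro: real_polynomial_function_diff)

text \<open>If \<open>f\<close> vanished on a ball, its restriction to the line from the centre
  through \<open>x0\<close> would be a one-variable polynomial vanishing on an interval, hence also
  at \<open>x0\<close>.\<close>

lemma real_polynomial_dense_nonzero:
  fixes f :: "'a::euclidean_space \<Rightarrow> real"
  assumes "real_polynomial_function f" "f x0 \<noteq> 0" "open V" "V \<noteq> {}"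
  shows "\<exists>x\<in>V. f x \<noteq> 0"
proof (rule ccontr)
  assume "\<not> ?thesis"
  then have z: "\<And>x. x \<in> V \<Longrightarrow> f x = 0" by auto
  obtain y e where e: "e > 0" "ball y e \<subseteq> V"
    using assms(3,4) openE by (metis ex_in_conv)
  define v where "v = x0 - y"
  \<comment> \<open>Adding 1 to the norm keeps the quotient meaningful when \<open>v\<close> is
    zero; the same device recurs below.\<close>
  have "f (y + s *\<^sub>R v) = 0" if "- (e / (norm v + 1)) < s" "s < e / (norm v + 1)" for s
  proof -
    have n: "0 < norm v + 1"
      by (smt (verit) norm_ge_zero)
    have "\<bar>s\<bar> < e / (norm v + 1)"
      using that by linarith
    then have "\<bar>s\<bar> * (norm v + 1) < e"
      using n by (simp add: pos_less_divide_eq)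
    moreover have "\<bar>s\<bar> * norm v \<le> \<bar>s\<bar> * (norm v + 1)"
      by (simp add: mult_left_mono)
    ultimately have "\<bar>s\<bar> * norm v < e"
      by linarith
    then have "y + s *\<^sub>R v \<in> ball y e"
      by (simp add: dist_norm)
    then show ?thesis using e z by blast
  qed
  moreover have "- (e / (norm v + 1)) < e / (norm v + 1)"
    using e by (simp add: add_nonneg_pos)
  ultimately have "f (y + 1 *\<^sub>R v) = 0"
    using real_polynomial_zero_interval[OF real_polynomial_line[OF assms(1)]] by blast
  then show False
    using assms(2) by (simp add: v_def)
qed

section \<open>Linear algebra\<close>

subsection \<open>Division-free Gram--Schmidt\<close>

text \<open>Residuals of vectors after eliminating the directions \<open>a 0, \<dots>, a (k - 1)\<close>, multiplied by the factor
  \<open>gs_gram k a\<close> so that they depend polynomially on all the vectors involved.\<close>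

primrec gs_res :: "nat \<Rightarrow> (nat \<Rightarrow> 'a::euclidean_space) \<Rightarrow> 'a \<Rightarrow> 'a" where
  "gs_res 0 a v = v"
| "gs_res (Suc k) a v =
     (gs_res k a (a k) \<bullet> gs_res k a (a k)) *\<^sub>R gs_res k a v - (gs_res k a v \<bullet> gs_res k a (a k)) *\<^sub>R gs_res k a (a k)"

text \<open>Not the Gram determinant: residuals carry earlier factors, so higher powers occur. What
  counts is that it depends polynomially on the vectors and vanishes exactly for dependent
  families.\<close>

primrec gs_gram :: "nat \<Rightarrow> (nat \<Rightarrow> 'a::euclidean_space) \<Rightarrow> real" where
  "gs_gram 0 a = 1"
| "gs_gram (Suc k) a = gs_gram k a * (gs_res k a (a k) \<bullet> gs_res k a (a k))"

text \<open>Independence of an indexed family: a repeated vector counts as a dependence, which the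
  set of its values would not show.\<close>

definition lin_indep :: "nat \<Rightarrow> (nat \<Rightarrow> 'a::euclidean_space) \<Rightarrow> bool" where
  "lin_indep k a \<longleftrightarrow> (\<forall>c. (\<Sum>j<k. c j *\<^sub>R a j) = 0 \<longrightarrow> (\<forall>j<k. c j = 0))"

lemma gs_res_expand: "\<exists>e. gs_res k a v = gs_gram k a *\<^sub>R v - (\<Sum>j<k. e j *\<^sub>R a j)"
proof (induct k arbitrary: v)
  case 0
  then show ?case by simp
next
  case (Suc k)
  obtain e where e: "gs_res k a v = gs_gram k a *\<^sub>R v - (\<Sum>j<k. e j *\<^sub>R a j)"
    using Suc by blast
  obtain d where d: "gs_res k a (a k) = gs_gram k a *\<^sub>R a k - (\<Sum>j<k. d j *\<^sub>R a j)"
    using Suc by blast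
  define p where "p = gs_res k a (a k) \<bullet> gs_res k a (a k)"
  define q where "q = gs_res k a v \<bullet> gs_res k a (a k)"
  define f where "f j = (if j < k then p * e j - q * d j else q * gs_gram k a)" for j
  have "gs_res (Suc k) a v = p *\<^sub>R gs_res k a v - q *\<^sub>R gs_res k a (a k)"
    by (simp add: p_def q_def)
  also have "\<dots> = (p * gs_gram k a) *\<^sub>R v - (\<Sum>j<k. (p * e j - q * d j) *\<^sub>R a j) - (q * gs_gram k a) *\<^sub>R a k"
    unfolding e d by (simp add: algebra_simps scaleR_sum_right sum_subtractf)
  also have "(\<Sum>j<k. (p * e j - q * d j) *\<^sub>R a j) = (\<Sum>j<k. f j *\<^sub>R a j)"
    by (simp add: f_def)
  also have "q * gs_gram k a = f k"
    by (simp add: f_def)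
  finally have "gs_res (Suc k) a v = gs_gram (Suc k) a *\<^sub>R v - (\<Sum>j<Suc k. f j *\<^sub>R a j)"
    by (simp add: p_def mult.commute)
  then show ?case by blast
qed

text \<open>A dependence met at one stage makes both terms of the recursion vanish, and the
  residuals stay zero afterwards. This is why residuals are orthogonal without any assumption of
  independence.\<close>

lemma gs_res_zero: "gs_gram k a = 0 \<Longrightarrow> gs_res k a v = 0"
proof (induct k arbitrary: v)
  case (Suc k)
  then show ?case by (cases "gs_gram k a = 0") auto
qed simp

lemma gs_res_orthogonal: "j < k \<Longrightarrow> gs_res k a v \<bullet> a j = 0"
proof (induct k arbitrary: v j)
  case (Suc k)
  define r where "r = gs_res k a (a k)"
  have eq: "gs_res (Suc k) a v = (r \<bullet> r) *\<^sub>R gs_res k a v - (gs_res k a v \<bullet> r) *\<^sub>R r"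
    by (simp add: r_def)
  have lt: "gs_res (Suc k) a v \<bullet> a i = 0" if "i < k" for i
    unfolding eq using Suc.hyps[OF that] by (simp add: r_def inner_diff_left)
  show ?case
  proof (cases "j < k")
    case False
    with Suc.prems have j: "j = k" by simp
    show ?thesis
    proof (cases "gs_gram k a = 0")
      case True
      then have "gs_res (Suc k) a v = 0"
        by (simp add: gs_res_zero)
      then show ?thesis
        by simp
    next
      case False
      \<comment> \<open>Up to a non-zero factor, \<open>a k\<close> differs from its residual
        \<open>r\<close> by earlier vectors, to which the new residual is already orthogonal;
        orthogonality to \<open>r\<close> itself is built into the recursion.\<close>
      obtain d where d: "r = gs_gram k a *\<^sub>R a k - (\<Sum>j<k. d j *\<^sub>R a j)"
        unfolding r_def using gs_res_expand by blast
      have "gs_res (Suc k) a v \<bullet> r = 0"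
        unfolding eq by (simp add: inner_diff_left)
      moreover have "gs_res (Suc k) a v \<bullet> r = gs_gram k a * (gs_res (Suc k) a v \<bullet> a k)"
        unfolding d using lt by (simp add: inner_diff_right inner_sum_right)
      ultimately show ?thesis
        using False j by simp
    qed
  qed (rule lt)
qed simp

lemma gs_res_span: "gs_res k a (\<Sum>j<k. c j *\<^sub>R a j) = 0"
proof -
  let ?v = "\<Sum>j<k. c j *\<^sub>R a j"
  obtain e where e: "gs_res k a ?v = gs_gram k a *\<^sub>R ?v - (\<Sum>j<k. e j *\<^sub>R a j)"
    using gs_res_expand by blast
  have "gs_res k a ?v \<bullet> gs_res k a ?v = gs_res k a ?v \<bullet> (gs_gram k a *\<^sub>R ?v - (\<Sum>j<k. e j *\<^sub>R a j))"
    using e by simp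
  also have "\<dots> = 0"
    using gs_res_orthogonal[of _ k a ?v] by (simp add: inner_diff_right inner_sum_right)
  finally show ?thesis by simp
qed

lemma gs_res_eq_0_iff:
  assumes "gs_gram k a \<noteq> 0"
  shows "gs_res k a v = 0 \<longleftrightarrow> (\<exists>c. v = (\<Sum>j<k. c j *\<^sub>R a j))"
proof
  assume "gs_res k a v = 0"
  moreover obtain e where "gs_res k a v = gs_gram k a *\<^sub>R v - (\<Sum>j<k. e j *\<^sub>R a j)"
    using gs_res_expand by blast
  ultimately have "gs_gram k a *\<^sub>R v = (\<Sum>j<k. e j *\<^sub>R a j)" by simp
  then have "(1 / gs_gram k a) *\<^sub>R (gs_gram k a *\<^sub>R v) = (1 / gs_gram k a) *\<^sub>R (\<Sum>j<k. e j *\<^sub>R a j)"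
    by simp
  then have "v = (\<Sum>j<k. (e j / gs_gram k a) *\<^sub>R a j)"
    using assms by (simp add: scaleR_sum_right)
  then show "\<exists>c. v = (\<Sum>j<k. c j *\<^sub>R a j)" by (intro exI[of _ "\<lambda>j. e j / gs_gram k a"])
qed (auto simp: gs_res_span)

lemma gs_gram_nonzero_iff: "gs_gram k a \<noteq> 0 \<longleftrightarrow> lin_indep k a"
proof (induct k)
  case 0
  then show ?case by (simp add: lin_indep_def)
next
  case (Suc k)
  show ?case
  proof
    assume nz: "gs_gram (Suc k) a \<noteq> 0"
    then have k: "gs_gram k a \<noteq> 0" and r: "gs_res k a (a k) \<noteq> 0" by auto
    show "lin_indep (Suc k) a"
      unfolding lin_indep_def
    proof (intro allI impI)
      fix c j assume z: "(\<Sum>j<Suc k. c j *\<^sub>R a j) = 0" and j: "j < Suc k"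
      have ck: "c k = 0"
      proof (rule ccontr)
        assume ck: "c k \<noteq> 0"
        have "c k *\<^sub>R a k = - (\<Sum>j<k. c j *\<^sub>R a j)"
          using z by (simp add: add_eq_0_iff2)
        then have "(1 / c k) *\<^sub>R (c k *\<^sub>R a k) = (1 / c k) *\<^sub>R (- (\<Sum>j<k. c j *\<^sub>R a j))"
          by simp
        then have "a k = (\<Sum>j<k. (- c j / c k) *\<^sub>R a j)"
          using ck by (simp add: scaleR_sum_right sum_negf)
        then have "gs_res k a (a k) = 0"
          using gs_res_span[of k a "\<lambda>j. - c j / c k"] by simp
        with r show False by simp
      qed
      then have "(\<Sum>j<k. c j *\<^sub>R a j) = 0" using z by simp
      then show "c j = 0"
        using k Suc ck j unfolding lin_indep_def by (metis less_SucE)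
    qed
  next
    assume ind: "lin_indep (Suc k) a"
    have "lin_indep k a"
      unfolding lin_indep_def
    proof (intro allI impI)
      fix c j assume "(\<Sum>j<k. c j *\<^sub>R a j) = 0" "j < k"
      moreover define d where "d i = (if i < k then c i else 0)" for i
      ultimately have "(\<Sum>i<Suc k. d i *\<^sub>R a i) = 0" by simp
      then have "\<forall>i<Suc k. d i = 0"
        using ind unfolding lin_indep_def by blast
      then have "d j = 0" using \<open>j < k\<close> less_SucI by blast
      then show "c j = 0" using \<open>j < k\<close> unfolding d_def by simp
    qed
    then have k: "gs_gram k a \<noteq> 0" using Suc by simp
    have "gs_res k a (a k) \<noteq> 0"
    proof
      assume "gs_res k a (a k) = 0"
      then obtain c where "a k = (\<Sum>j<k. c j *\<^sub>R a j)"
        using gs_res_eq_0_iff[OF k] by blast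
      moreover define d where "d i = (if i < k then c i else -1)" for i
      ultimately have "(\<Sum>i<Suc k. d i *\<^sub>R a i) = 0" by simp
      then have "\<forall>i<Suc k. d i = 0"
        using ind unfolding lin_indep_def by blast
      then have "d k = 0" by blast
      then show False unfolding d_def by simp
    qed
    then show "gs_gram (Suc k) a \<noteq> 0" using k by simp
  qed
qed

lemma gs_res_polynomial:
  fixes a :: "'b::euclidean_space \<Rightarrow> nat \<Rightarrow> 'a::euclidean_space"
  assumes "\<And>j. j < k \<Longrightarrow> polynomial_function (\<lambda>s. a s j)" "polynomial_function v"
  shows "polynomial_function (\<lambda>s. gs_res k (a s) (v s))"
  using assms
proof (induct k arbitrary: v)
  case (Suc k)
  have 1: "polynomial_function (\<lambda>s. gs_res k (a s) (v s))" if "polynomial_function v" for v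
    using Suc that by simp
  have 2: "polynomial_function (\<lambda>s. gs_res k (a s) (a s k))"
    by (rule 1) (use Suc in simp)
  have 3: "polynomial_function (\<lambda>s. f s \<bullet> g s)" if "polynomial_function f" "polynomial_function g"
    for f g :: "'b \<Rightarrow> 'a"
    using real_polynomial_inner[OF that] by (simp add: real_polynomial_function_eq)
  show ?case
    using 1[OF Suc.prems(2)] 2 by (auto intro!: polynomial_function_diff polynomial_function_mult 3)
qed simp

lemma gs_gram_polynomial:
  fixes a :: "'b::euclidean_space \<Rightarrow> nat \<Rightarrow> 'a::euclidean_space"
  assumes "\<And>j. j < k \<Longrightarrow> polynomial_function (\<lambda>s. a s j)"
  shows "real_polynomial_function (\<lambda>s. gs_gram k (a s))"
  using assms
proof (induct k)
  case (Suc k)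
  have "polynomial_function (\<lambda>s. gs_res k (a s) (a s k))"
    by (rule gs_res_polynomial) (use Suc in simp_all)
  then show ?case
    using Suc by (auto intro!: rpf_mult real_polynomial_inner)
qed (simp add: rpf_const)

lemma lin_indep_inj:
  assumes "lin_indep k a"
  shows "inj_on a {..<k}"
proof
  fix i j assume ij: "i \<in> {..<k}" "j \<in> {..<k}" "a i = a j"
  show "i = j"
  proof (rule ccontr)
    assume ne: "i \<noteq> j"
    define c where "c l = (if l = i then 1 else if l = j then -1 else (0::real))" for l
    have "(\<Sum>l<k. c l *\<^sub>R a l) = (\<Sum>l<k. (if l = i then a i else 0) - (if l = j then a j else 0))"
      using ne by (intro sum.cong) (auto simp: c_def)
    also have "\<dots> = 0" using ij by (simp add: sum_subtractf)
    finally have "c i = 0" using assms ij unfolding lin_indep_def by blast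
    then show False by (simp add: c_def)
  qed
qed

lemma span_image_lessThan:
  fixes a :: "nat \<Rightarrow> 'a::euclidean_space"
  shows "span (a ` {..<k}) = {v. \<exists>c. v = (\<Sum>j<k. c j *\<^sub>R a j)}"
proof
  show "span (a ` {..<k}) \<subseteq> {v. \<exists>c. v = (\<Sum>j<k. c j *\<^sub>R a j)}"
  proof (rule span_minimal)
    show "a ` {..<k} \<subseteq> {v. \<exists>c. v = (\<Sum>j<k. c j *\<^sub>R a j)}"
    proof clarsimp
      fix j assume "j < k"
      then show "\<exists>c. a j = (\<Sum>i<k. c i *\<^sub>R a i)"
        by (intro exI[of _ "\<lambda>i. if i = j then 1 else 0"]) (simp add: if_distrib[of "\<lambda>c. c *\<^sub>R _"] cong: if_cong)
    qed
    show "subspace {v. \<exists>c. v = (\<Sum>j<k. c j *\<^sub>R a j)}"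
    proof (rule subspaceI)
      show "0 \<in> {v. \<exists>c. v = (\<Sum>j<k. c j *\<^sub>R a j)}"
        by (auto intro: exI[of _ "\<lambda>_. 0"])
    next
      fix x y assume "x \<in> {v. \<exists>c. v = (\<Sum>j<k. c j *\<^sub>R a j)}" "y \<in> {v. \<exists>c. v = (\<Sum>j<k. c j *\<^sub>R a j)}"
      then obtain c d where "x = (\<Sum>j<k. c j *\<^sub>R a j)" "y = (\<Sum>j<k. d j *\<^sub>R a j)" by auto
      then show "x + y \<in> {v. \<exists>c. v = (\<Sum>j<k. c j *\<^sub>R a j)}"
        by (auto intro!: exI[of _ "\<lambda>j. c j + d j"] simp: sum.distrib scaleR_add_left)
    next
      fix r x assume "x \<in> {v. \<exists>c. v = (\<Sum>j<k. c j *\<^sub>R a j)}"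
      then obtain c where "x = (\<Sum>j<k. c j *\<^sub>R a j)" by auto
      then show "r *\<^sub>R x \<in> {v. \<exists>c. v = (\<Sum>j<k. c j *\<^sub>R a j)}"
        by (auto intro!: exI[of _ "\<lambda>j. r * c j"] simp: scaleR_sum_right)
    qed
  qed
next
  show "{v. \<exists>c. v = (\<Sum>j<k. c j *\<^sub>R a j)} \<subseteq> span (a ` {..<k})"
    by (auto intro!: span_sum span_scale intro: span_base)
qed

lemma lin_indep_dim_span:
  assumes "lin_indep k a"
  shows "dim (span (a ` {..<k})) = k"
proof -
  have "independent (a ` {..<k})"
  proof (rule ccontr)
    assume "\<not> independent (a ` {..<k})"
    then obtain u where u: "(\<Sum>v\<in>a ` {..<k}. u v *\<^sub>R v) = 0" "\<exists>v\<in>a ` {..<k}. u v \<noteq> 0"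
      using dependent_finite[of "a ` {..<k}"] by auto
    define d where "d j = u (a j)" for j
    have "(\<Sum>j<k. d j *\<^sub>R a j) = 0"
      using u(1) by (simp add: sum.reindex[OF lin_indep_inj[OF assms]] o_def d_def)
    then have "\<forall>j<k. d j = 0"
      using assms unfolding lin_indep_def by blast
    with u(2) show False by (auto simp: d_def)
  qed
  then have "dim (span (a ` {..<k})) = card (a ` {..<k})"
    by (simp add: dim_eq_card_independent)
  then show ?thesis
    by (simp add: card_image[OF lin_indep_inj[OF assms]])
qed

lemma subspace_orth_family: "subspace {y. \<forall>j<k. a j \<bullet> y = 0}"
  by (rule subspaceI) (auto simp: inner_add_right)

lemma orth_family_eq:
  fixes a :: "nat \<Rightarrow> 'a::euclidean_space"
  shows "{y. \<forall>j<k. a j \<bullet> y = 0} = orthogonal_comp (span (a ` {..<k}))"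
proof -
  have 1: "y \<bullet> v = 0" if y: "\<forall>j<k. a j \<bullet> y = 0" and v: "v \<in> span (a ` {..<k})" for y v
  proof -
    obtain c where "v = (\<Sum>j<k. c j *\<^sub>R a j)"
      using v unfolding span_image_lessThan by blast
    then show ?thesis
      using y by (simp add: inner_sum_right inner_commute[of y])
  qed
  show ?thesis
  proof (intro subset_antisym subsetI)
    fix y assume "y \<in> {y. \<forall>j<k. a j \<bullet> y = 0}"
    then have y: "\<forall>j<k. a j \<bullet> y = 0" by (rule CollectD)
    show "y \<in> orthogonal_comp (span (a ` {..<k}))"
      unfolding orthogonal_comp_def orthogonal_def
    proof (intro CollectI ballI)
      fix v assume "v \<in> span (a ` {..<k})"
      from 1[OF y this] show "v \<bullet> y = 0" by (simp only: inner_commute)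
    qed
  next
    fix y assume "y \<in> orthogonal_comp (span (a ` {..<k}))"
    then have y: "\<forall>v\<in>span (a ` {..<k}). v \<bullet> y = 0"
      unfolding orthogonal_comp_def orthogonal_def by (rule CollectD)
    have "a j \<bullet> y = 0" if "j < k" for j
      by (rule y[rule_format], rule span_base) (use that in simp)
    then show "y \<in> {y. \<forall>j<k. a j \<bullet> y = 0}" by simp
  qed
qed

lemma dim_orthogonal_comp:
  assumes "subspace (A :: 'a::euclidean_space set)"
  shows "dim (orthogonal_comp A) + dim A = DIM('a)"
  using dim_subspace_orthogonal_to_vectors[OF assms subspace_UNIV]
  by (simp add: orthogonal_comp_def)

lemma dim_orth_family:
  assumes "lin_indep k (a :: nat \<Rightarrow> 'a::euclidean_space)"
  shows "dim {y. \<forall>j<k. a j \<bullet> y = 0} + k = DIM('a)"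
  unfolding orth_family_eq
  using dim_orthogonal_comp[of "span (a ` {..<k})"] lin_indep_dim_span[OF assms] by simp

lemma orth_orth_family:
  fixes a :: "nat \<Rightarrow> 'a::euclidean_space"
  assumes "\<And>y. (\<And>j. j < k \<Longrightarrow> a j \<bullet> y = 0) \<Longrightarrow> v \<bullet> y = 0"
  shows "\<exists>c. v = (\<Sum>j<k. c j *\<^sub>R a j)"
proof -
  have "v \<bullet> y = 0" if "y \<in> {y. \<forall>j<k. a j \<bullet> y = 0}" for y
    using that by (intro assms) simp
  then have "v \<in> orthogonal_comp {y. \<forall>j<k. a j \<bullet> y = 0}"
    unfolding orthogonal_comp_def orthogonal_def by (simp add: inner_commute)
  then have "v \<in> span (a ` {..<k})"
    by (simp add: orth_family_eq orthogonal_comp_self[OF subspace_span])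
  then show ?thesis
    unfolding span_image_lessThan by blast
qed

lemma lin_indep_extend:
  assumes "lin_indep k a" "\<nexists>c. v = (\<Sum>j<k. c j *\<^sub>R a j)"
  shows "lin_indep (Suc k) (a(k := v))"
proof -
  have eq: "gs_res j (a(k := v)) = gs_res j a \<and> gs_gram j (a(k := v)) = gs_gram j a" if "j \<le> k" for j
    using that by (induct j) (auto simp: fun_eq_iff)
  have "gs_gram k a \<noteq> 0" using assms gs_gram_nonzero_iff by blast
  then have "gs_gram (Suc k) (a(k := v)) \<noteq> 0"
    using assms(2) gs_res_eq_0_iff[of k a v] eq[of k] by simp
  then show ?thesis using gs_gram_nonzero_iff by blast
qed

lemma lin_indep_le_DIM:
  assumes "lin_indep k (a :: nat \<Rightarrow> 'a::euclidean_space)"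
  shows "k \<le> DIM('a)"
  using dim_orth_family[OF assms] by linarith

subsection \<open>Limits of subspaces\<close>

text \<open>Pointwise convergence of linear maps is convergence on a finite basis, so the argument
  may vary as well.\<close>

lemma linear_pointwise_limit:
  fixes H :: "nat \<Rightarrow> 'a::euclidean_space \<Rightarrow> 'b::real_normed_vector"
  assumes "\<And>i. linear (H i)" "linear H0" "\<And>x. (\<lambda>i. H i x) \<longlonglongrightarrow> H0 x" "x \<longlonglongrightarrow> x0"
  shows "(\<lambda>i. H i (x i)) \<longlonglongrightarrow> H0 x0"
proof -
  have eq: "h y = (\<Sum>b\<in>Basis. (y \<bullet> b) *\<^sub>R h b)" if "linear h" for h :: "'a \<Rightarrow> 'b" and y
    by (metis (no_types, lifting) euclidean_representation linear_cmul linear_sum sum.cong that)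
  have "(\<lambda>i. \<Sum>b\<in>Basis. (x i \<bullet> b) *\<^sub>R H i b) \<longlonglongrightarrow> (\<Sum>b\<in>Basis. (x0 \<bullet> b) *\<^sub>R H0 b)"
    by (intro tendsto_intros assms)
  moreover have "(\<lambda>i. H i (x i)) = (\<lambda>i. \<Sum>b\<in>Basis. (x i \<bullet> b) *\<^sub>R H i b)"
    by (rule ext) (rule eq[OF assms(1)])
  moreover have "H0 x0 = (\<Sum>b\<in>Basis. (x0 \<bullet> b) *\<^sub>R H0 b)"
    by (rule eq[OF assms(2)])
  ultimately show ?thesis by metis
qed

text \<open>If \<open>A0\<close> were smaller, every \<open>A i\<close> would contain a unit vector
  orthogonal to \<open>A0\<close>; a limit of these lies in \<open>A0\<close> and is orthogonal to
  it. The limit condition is asked along subsequences because compactness supplies only those. The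
  semicontinuity arguments for dimensions below rest on this.\<close>

lemma dim_limit_subspaces:
  fixes A :: "nat \<Rightarrow> 'a::euclidean_space set"
  assumes "\<And>i. subspace (A i)" "subspace A0" "\<And>i. m \<le> dim (A i)"
    and lim: "\<And>a x r. strict_mono r \<Longrightarrow> (\<And>i. a i \<in> A (r i)) \<Longrightarrow> (\<And>i. norm (a i) = 1) \<Longrightarrow> a \<longlonglongrightarrow> x \<Longrightarrow> x \<in> A0"
  shows "m \<le> dim A0"
proof (rule ccontr)
  assume "\<not> m \<le> dim A0"
  then have lt: "dim A0 < m" by simp
  have "\<exists>x. x \<in> A i \<and> x \<in> orthogonal_comp A0 \<and> norm x = 1" for i
  proof -
    have "dim {x + y |x y. x \<in> A i \<and> y \<in> orthogonal_comp A0} + dim (A i \<inter> orthogonal_comp A0)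
        = dim (A i) + dim (orthogonal_comp A0)"
      by (rule dim_sums_Int) (auto simp: assms subspace_orthogonal_comp)
    moreover have "dim {x + y |x y. x \<in> A i \<and> y \<in> orthogonal_comp A0} \<le> DIM('a)"
      by (rule dim_subset_UNIV)
    ultimately have "0 < dim (A i \<inter> orthogonal_comp A0)"
      using lt assms(3)[of i] dim_orthogonal_comp[OF assms(2)] by linarith
    then obtain x where x: "x \<in> A i \<inter> orthogonal_comp A0" "x \<noteq> 0"
      by (metis dim_eq_0 less_irrefl subsetI singletonI)
    have "(1 / norm x) *\<^sub>R x \<in> A i \<inter> orthogonal_comp A0"
      using x by (metis IntD1 IntD2 IntI assms(1) subspace_orthogonal_comp subspace_scale)
    then show ?thesis
      using x(2) by (intro exI[of _ "(1 / norm x) *\<^sub>R x"]) auto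
  qed
  then obtain x where x: "\<And>i. x i \<in> A i" "\<And>i. x i \<in> orthogonal_comp A0" "\<And>i. norm (x i) = 1"
    by metis
  have "compact (sphere (0::'a) 1)" by simp
  then obtain l r where r: "l \<in> sphere 0 1" "strict_mono (r::nat \<Rightarrow> nat)" "(x \<circ> r) \<longlonglongrightarrow> l"
    using x(3) unfolding compact_def by (metis dist_0_norm mem_sphere)
  have "l \<in> A0"
    by (rule lim[OF r(2) _ _ r(3)]) (auto simp: x)
  moreover have "l \<in> orthogonal_comp A0"
  proof -
    have "closed (orthogonal_comp A0)"
      by (rule closed_subspace) (rule subspace_orthogonal_comp)
    then show ?thesis
      using r(3) x(2) closed_sequentially[of "orthogonal_comp A0" "x \<circ> r" l] by auto
  qed
  ultimately have "l \<bullet> l = 0"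
    unfolding orthogonal_comp_def orthogonal_def by auto
  then show False using r(1) by auto
qed

subsection \<open>Eigenspaces of symmetric maps\<close>

definition eig :: "('a::real_vector \<Rightarrow> 'a) \<Rightarrow> real \<Rightarrow> 'a set" where
  "eig H \<mu> = {x. H x = \<mu> *\<^sub>R x}"

lemma subspace_eig: "linear H \<Longrightarrow> subspace (eig H \<mu>)"
  unfolding eig_def by (rule subspaceI) (auto simp: linear_0 linear_add linear_cmul algebra_simps)

text \<open>The quadratic form of \<open>H\<close> on the unit sphere of \<open>W\<close> attains
  its maximum at an eigenvector: the first variation shows that \<open>H x - \<mu> x\<close> is
  orthogonal to \<open>W\<close>, while invariance puts it into \<open>W\<close>.\<close>

lemma symmetric_eigenvector:
  fixes H :: "'a::euclidean_space \<Rightarrow> 'a"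
  assumes H: "linear H" "\<And>x y. H x \<bullet> y = x \<bullet> H y"
    and W: "subspace W" "W \<noteq> {0}" "\<And>x. x \<in> W \<Longrightarrow> H x \<in> W"
  shows "\<exists>x\<in>W. norm x = 1 \<and> (\<exists>\<mu>. H x = \<mu> *\<^sub>R x)"
proof -
  let ?K = "sphere 0 1 \<inter> W"
  have "compact ?K"
    using W(1) by (intro compact_Int_closed closed_subspace) auto
  moreover have "?K \<noteq> {}"
  proof -
    obtain y where "y \<in> W" "y \<noteq> 0"
      using W subspace_0 by blast
    then have "(1 / norm y) *\<^sub>R y \<in> ?K"
      using W(1) by (auto simp: subspace_scale)
    then show ?thesis by blast
  qed
  moreover have "continuous_on ?K (\<lambda>x. x \<bullet> H x)"
    using linear_continuous_on[OF H(1)[unfolded linear_conv_bounded_linear]]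
    by (intro continuous_intros)
  ultimately obtain x where x: "x \<in> ?K" "\<And>y. y \<in> ?K \<Longrightarrow> y \<bullet> H y \<le> x \<bullet> H x"
    using continuous_attains_sup[of ?K "\<lambda>x. x \<bullet> H x"] by blast
  define \<mu> where "\<mu> = x \<bullet> H x"
  have le: "y \<bullet> H y \<le> \<mu> * (y \<bullet> y)" if "y \<in> W" for y
  proof (cases "y = 0")
    case False
    have "(1 / norm y) *\<^sub>R y \<in> ?K"
      using W(1) that False by (auto simp: subspace_scale)
    from x(2)[OF this] have "(1 / norm y) * ((1 / norm y) * (y \<bullet> H y)) \<le> \<mu>"
      unfolding \<mu>_def linear_cmul[OF H(1)] by simp
    also have "(1 / norm y) * ((1 / norm y) * (y \<bullet> H y)) = (y \<bullet> H y) / (y \<bullet> y)"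
      unfolding dot_square_norm power2_eq_square by simp
    finally show ?thesis
      using False by (simp add: pos_divide_le_eq)
  qed (simp add: linear_0[OF H(1)])
  have "y \<bullet> (H x - \<mu> *\<^sub>R x) = 0" if "y \<in> W" for y
  proof -
    have "2 * t * (y \<bullet> (H x - \<mu> *\<^sub>R x)) \<le> t * t * (\<mu> * (y \<bullet> y) - y \<bullet> H y)" for t
    proof -
      have "x + t *\<^sub>R y \<in> W"
        using W x(1) that by (auto simp: subspace_add subspace_scale)
      from le[OF this]
      have 1: "(x + t *\<^sub>R y) \<bullet> H (x + t *\<^sub>R y) \<le> \<mu> * ((x + t *\<^sub>R y) \<bullet> (x + t *\<^sub>R y))" .
      have "H (x + t *\<^sub>R y) = H x + t *\<^sub>R H y"
        using H(1) by (simp add: linear_add linear_cmul)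
      moreover have "x \<bullet> H y = y \<bullet> H x"
        using H(2)[of x y] by (metis inner_commute)
      ultimately have 2: "(x + t *\<^sub>R y) \<bullet> H (x + t *\<^sub>R y) = \<mu> + 2 * t * (y \<bullet> H x) + t * t * (y \<bullet> H y)"
        by (simp add: inner_add_left inner_add_right \<mu>_def[symmetric] algebra_simps)
      have "x \<bullet> x = 1"
        using x(1) by (simp add: dot_square_norm)
      then have 3: "(x + t *\<^sub>R y) \<bullet> (x + t *\<^sub>R y) = 1 + 2 * t * (y \<bullet> x) + t * t * (y \<bullet> y)"
        by (simp add: inner_add_left inner_add_right algebra_simps inner_commute)
      show ?thesis
        using 1 unfolding 2 3 by (simp add: algebra_simps)
    qed
    note A = this
    define b where "b = y \<bullet> (H x - \<mu> *\<^sub>R x)"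
    define c where "c = \<mu> * (y \<bullet> y) - y \<bullet> H y"
    \<comment> \<open>Inserted for \<open>t\<close> into \<open>2 t b \<le> t^2 c\<close>, this
      value gives \<open>s^2 (c + 2) \<le> 0\<close>; the added 1 keeps the denominator
      positive.\<close>
    define s where "s = b / (c + 1)"
    have c: "0 \<le> c" using le[OF that] by (simp add: c_def)
    then have b: "b = s * (c + 1)" by (simp add: s_def)
    have "2 * s * b \<le> s * s * c" using A[of s] by (simp only: b_def c_def)
    then have "(s * s) * (c + 2) \<le> 0" unfolding b by (simp add: algebra_simps)
    moreover have "0 \<le> (s * s) * c" using c by simp
    ultimately have "s * s \<le> 0" by (simp add: algebra_simps)
    then have "s = 0" by (smt (verit) zero_le_mult_iff mult_eq_0_iff)
    then show ?thesis using b by (simp add: b_def)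
  qed
  moreover have "H x - \<mu> *\<^sub>R x \<in> W"
    using W x(1) by (auto simp: subspace_diff subspace_scale)
  ultimately have "(H x - \<mu> *\<^sub>R x) \<bullet> (H x - \<mu> *\<^sub>R x) = 0" by blast
  then have "H x = \<mu> *\<^sub>R x" by simp
  then show ?thesis using x(1) by auto
qed

lemma symmetric_eigenbasis_subspace:
  fixes H :: "'a::euclidean_space \<Rightarrow> 'a"
  assumes H: "linear H" "\<And>x y. H x \<bullet> y = x \<bullet> H y"
    and W: "subspace W" "\<And>x. x \<in> W \<Longrightarrow> H x \<in> W"
  shows "\<exists>B\<subseteq>W. pairwise orthogonal B \<and> (\<forall>b\<in>B. norm b = 1 \<and> (\<exists>\<mu>. H b = \<mu> *\<^sub>R b)) \<and> span B = W"
  using W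
proof (induct "dim W" arbitrary: W rule: less_induct)
  case less
  show ?case
  proof (cases "W = {0}")
    case True
    then show ?thesis by (intro exI[of _ "{}"]) auto
  next
    case False
    then obtain x \<mu> where x: "x \<in> W" "norm x = 1" "H x = \<mu> *\<^sub>R x"
      using symmetric_eigenvector[OF H less(2) False less(3)] by blast
    define W' where "W' = {y\<in>W. x \<bullet> y = 0}"
    have sub: "subspace W'"
      unfolding W'_def using less(2)
      by (intro subspaceI) (auto simp: subspace_0 subspace_add subspace_scale inner_add_right)
    have inv: "H y \<in> W'" if "y \<in> W'" for y
    proof -
      have "x \<bullet> H y = H x \<bullet> y" using H(2) by simp
      then show ?thesis
        using that less(3) x(3) by (auto simp: W'_def)
    qed
    have "dim W' < dim W"
    proof (rule dim_psubset)
      have "x \<notin> W'" using x by (auto simp: W'_def)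
      then show "span W' \<subset> span W"
        using sub less(2) x(1) by (metis W'_def mem_Collect_eq psubsetI span_eq_iff subsetI)
    qed
    from less(1)[OF this sub inv] obtain B where B: "B \<subseteq> W'" "pairwise orthogonal B"
      "\<forall>b\<in>B. norm b = 1 \<and> (\<exists>\<mu>. H b = \<mu> *\<^sub>R b)" "span B = W'" by blast
    have "span (insert x B) = W"
    proof
      show "span (insert x B) \<subseteq> W"
        using x B less(2) by (intro span_minimal) (auto simp: W'_def)
      show "W \<subseteq> span (insert x B)"
      proof
        fix y assume y: "y \<in> W"
        have "y - (x \<bullet> y) *\<^sub>R x \<in> W'"
          using y x less(2) by (auto simp: W'_def subspace_diff subspace_scale inner_diff_right dot_square_norm)
        then have "y - (x \<bullet> y) *\<^sub>R x \<in> span B" using B by simp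
        then show "y \<in> span (insert x B)" by (auto simp: span_breakdown_eq)
      qed
    qed
    moreover have "pairwise orthogonal (insert x B)"
      using B by (auto simp: pairwise_insert W'_def orthogonal_def inner_commute)
    ultimately show ?thesis
      using B x by (intro exI[of _ "insert x B"]) (auto simp: W'_def)
  qed
qed

definition eigenbasis :: "('a::euclidean_space \<Rightarrow> 'a) \<Rightarrow> 'a set \<Rightarrow> ('a \<Rightarrow> real) \<Rightarrow> bool" where
  "eigenbasis H B \<mu> \<longleftrightarrow> finite B \<and> card B = DIM('a) \<and> pairwise orthogonal B \<and> (\<forall>b\<in>B. norm b = 1) \<and>
     (\<forall>b\<in>B. H b = \<mu> b *\<^sub>R b) \<and> span B = UNIV \<and> (\<forall>m. dim (eig H m) = card {b\<in>B. \<mu> b = m})"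

lemma symmetric_eigenbasis:
  fixes H :: "'a::euclidean_space \<Rightarrow> 'a"
  assumes "linear H" "\<And>x y. H x \<bullet> y = x \<bullet> H y"
  shows "\<exists>B \<mu>. eigenbasis H B \<mu>"
proof -
  obtain B where B: "pairwise orthogonal B" "\<And>b. b \<in> B \<Longrightarrow> norm b = 1"
    "\<And>b. b \<in> B \<Longrightarrow> \<exists>\<mu>. H b = \<mu> *\<^sub>R b" "span B = UNIV"
    using symmetric_eigenbasis_subspace[OF assms subspace_UNIV] by auto
  from B(3) obtain \<mu> where \<mu>: "\<And>b. b \<in> B \<Longrightarrow> H b = \<mu> b *\<^sub>R b" by metis
  have ind: "independent B"
  proof (rule pairwise_orthogonal_independent[OF B(1)])
    show "0 \<notin> B" using B(2)[of 0] by auto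
  qed
  then have fin: "finite B" using independent_imp_finite by blast
  have "card B = DIM('a)"
    using B(4) dim_span_eq_card_independent[OF ind] by simp
  have "dim (eig H m) = card {b\<in>B. \<mu> b = m}" for m
  proof -
    have "eig H m = span {b\<in>B. \<mu> b = m}"
    proof
      show "span {b\<in>B. \<mu> b = m} \<subseteq> eig H m"
      proof (rule span_minimal)
        show "{b\<in>B. \<mu> b = m} \<subseteq> eig H m"
          using \<mu> unfolding eig_def by blast
      qed (rule subspace_eig[OF assms(1)])
      show "eig H m \<subseteq> span {b\<in>B. \<mu> b = m}"
      proof
        fix x assume x: "x \<in> eig H m"
        have z: "b \<bullet> x = 0" if "b \<in> B" "\<mu> b \<noteq> m" for b
        proof -
          have "H b \<bullet> x = b \<bullet> H x" by (rule assms(2))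
          then have "\<mu> b * (b \<bullet> x) = m * (b \<bullet> x)"
            using that x \<mu> by (simp add: eig_def)
          then show ?thesis using that by simp
        qed
        have "x = (\<Sum>b\<in>B. (b \<bullet> x) *\<^sub>R b)"
          using orthonormal_basis_expand[OF B(1,2) _ fin, of x] B(4) by (simp add: inner_commute)
        also have "\<dots> = (\<Sum>b\<in>{b\<in>B. \<mu> b = m}. (b \<bullet> x) *\<^sub>R b)"
          using fin z by (intro sum.mono_neutral_right) auto
        also have "\<dots> \<in> span {b\<in>B. \<mu> b = m}"
          by (intro span_sum span_scale span_base) auto
        finally show "x \<in> span {b\<in>B. \<mu> b = m}" .
      qed
    qed
    moreover have "independent {b\<in>B. \<mu> b = m}"
      by (rule independent_mono[OF ind]) blast
    ultimately show ?thesis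
      by (simp add: dim_eq_card_independent)
  qed
  then have "eigenbasis H B \<mu>"
    unfolding eigenbasis_def using fin \<open>card B = DIM('a)\<close> B(1,2) \<mu> B(4) by blast
  then show ?thesis by blast
qed

text \<open>\<open>M\<close> may be larger than the spectrum, so that one set can serve for a whole
  sequence of maps.\<close>

lemma sum_dim_eig:
  fixes H :: "'a::euclidean_space \<Rightarrow> 'a"
  assumes "linear H" "\<And>x y. H x \<bullet> y = x \<bullet> H y" "finite M" "\<And>m. eig H m \<noteq> {0} \<Longrightarrow> m \<in> M"
  shows "(\<Sum>m\<in>M. dim (eig H m)) = DIM('a)"
proof -
  obtain B \<mu> where "eigenbasis H B \<mu>"
    using symmetric_eigenbasis[OF assms(1,2)] by blast
  then have B: "finite B" "card B = DIM('a)" "\<And>b. b \<in> B \<Longrightarrow> norm b = 1"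
    "\<And>b. b \<in> B \<Longrightarrow> H b = \<mu> b *\<^sub>R b" "\<And>m. dim (eig H m) = card {b\<in>B. \<mu> b = m}"
    unfolding eigenbasis_def by blast+
  have "\<mu> ` B \<subseteq> M"
  proof
    fix m assume "m \<in> \<mu> ` B"
    then obtain b where b: "b \<in> B" "m = \<mu> b" by blast
    then have "b \<in> eig H m" "b \<noteq> 0"
      using B(3)[OF b(1)] B(4)[OF b(1)] by (auto simp: eig_def)
    then have "eig H m \<noteq> {0}" by blast
    then show "m \<in> M" by (rule assms(4))
  qed
  then have "(\<Sum>m\<in>M. card {b\<in>B. \<mu> b = m}) = card B"
    using sum_fun_comp[OF B(1) assms(3), of \<mu> "\<lambda>_. 1::nat"] by simp
  then show ?thesis using B by simp
qed

lemma trace_eq_sum_eigenvalues: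
  fixes H :: "'a::euclidean_space \<Rightarrow> 'a"
  assumes "linear H" "finite B" "pairwise orthogonal B" "\<And>b. b \<in> B \<Longrightarrow> norm b = 1"
    "\<And>b. b \<in> B \<Longrightarrow> H b = \<mu> b *\<^sub>R b" "span B = UNIV"
    and sym: "\<And>x y. H x \<bullet> y = x \<bullet> H y"
  shows "(\<Sum>e\<in>Basis. H e \<bullet> e) = (\<Sum>b\<in>B. \<mu> b)"
proof -
  have ex: "x \<bullet> y = (\<Sum>b\<in>B. (x \<bullet> b) * (b \<bullet> y))" for x y
  proof -
    have "(\<Sum>b\<in>B. (x \<bullet> b) *\<^sub>R b) \<bullet> y = x \<bullet> y"
      using orthonormal_basis_expand[OF assms(3,4) _ assms(2), of x] assms(6) by simp
    then show ?thesis by (simp add: inner_sum_left)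
  qed
  have "(\<Sum>e\<in>Basis. H e \<bullet> e) = (\<Sum>e\<in>Basis. \<Sum>b\<in>B. \<mu> b * ((b \<bullet> e) * (b \<bullet> e)))"
  proof (rule sum.cong[OF refl])
    fix e :: 'a
    have "H e \<bullet> e = (\<Sum>b\<in>B. (H e \<bullet> b) * (b \<bullet> e))"
      by (rule ex)
    also have "\<dots> = (\<Sum>b\<in>B. \<mu> b * ((b \<bullet> e) * (b \<bullet> e)))"
    proof (rule sum.cong[OF refl])
      fix b assume b: "b \<in> B"
      have "H e \<bullet> b = \<mu> b * (b \<bullet> e)"
        unfolding sym assms(5)[OF b] by (simp add: inner_commute)
      then show "(H e \<bullet> b) * (b \<bullet> e) = \<mu> b * ((b \<bullet> e) * (b \<bullet> e))" by simp
    qed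
    finally show "H e \<bullet> e = (\<Sum>b\<in>B. \<mu> b * ((b \<bullet> e) * (b \<bullet> e)))" .
  qed
  also have "\<dots> = (\<Sum>b\<in>B. \<mu> b * (\<Sum>e\<in>Basis. (b \<bullet> e) * (b \<bullet> e)))"
    by (subst sum.swap) (simp add: sum_distrib_left)
  also have "\<dots> = (\<Sum>b\<in>B. \<mu> b)"
    using assms(4) by (intro sum.cong) (auto simp: euclidean_inner[symmetric] dot_square_norm)
  finally show ?thesis .
qed

lemma trace_eq_if_eigenspaces_le:
  fixes H K :: "'a::euclidean_space \<Rightarrow> 'a"
  assumes "linear H" "\<And>x y. H x \<bullet> y = x \<bullet> H y" "linear K" "\<And>x y. K x \<bullet> y = x \<bullet> K y"
    and le: "\<And>m. dim (eig H m) \<le> dim (eig K m)"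
  shows "(\<Sum>e\<in>Basis. H e \<bullet> e) = (\<Sum>e\<in>Basis. K e \<bullet> e)"
proof -
  obtain B \<mu> where "eigenbasis H B \<mu>"
    using symmetric_eigenbasis[OF assms(1,2)] by blast
  then have B: "finite B" "card B = DIM('a)" "pairwise orthogonal B" "\<And>b. b \<in> B \<Longrightarrow> norm b = 1"
    "\<And>b. b \<in> B \<Longrightarrow> H b = \<mu> b *\<^sub>R b" "span B = UNIV" "\<And>m. dim (eig H m) = card {b\<in>B. \<mu> b = m}"
    unfolding eigenbasis_def by blast+
  obtain C \<nu> where "eigenbasis K C \<nu>"
    using symmetric_eigenbasis[OF assms(3,4)] by blast
  then have C: "finite C" "card C = DIM('a)" "pairwise orthogonal C" "\<And>b. b \<in> C \<Longrightarrow> norm b = 1"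
    "\<And>b. b \<in> C \<Longrightarrow> K b = \<nu> b *\<^sub>R b" "span C = UNIV" "\<And>m. dim (eig K m) = card {b\<in>C. \<nu> b = m}"
    unfolding eigenbasis_def by blast+
  define M where "M = \<mu> ` B \<union> \<nu> ` C"
  have fin: "finite M" using B C by (simp add: M_def)
  have sB: "(\<Sum>m\<in>M. card {b\<in>B. \<mu> b = m} * f m) = (\<Sum>b\<in>B. f (\<mu> b))" for f :: "real \<Rightarrow> real"
    using sum_fun_comp[OF B(1) fin, of \<mu> f] by (simp add: M_def)
  have sC: "(\<Sum>m\<in>M. card {b\<in>C. \<nu> b = m} * f m) = (\<Sum>b\<in>C. f (\<nu> b))" for f :: "real \<Rightarrow> real"
    using sum_fun_comp[OF C(1) fin, of \<nu> f] by (simp add: M_def)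
  have le': "card {b\<in>B. \<mu> b = m} \<le> card {b\<in>C. \<nu> b = m}" for m
    using le B(7) C(7) by metis
  have "(\<Sum>m\<in>M. real (card {b\<in>C. \<nu> b = m}) - real (card {b\<in>B. \<mu> b = m})) = 0"
    using sB[of "\<lambda>_. 1"] sC[of "\<lambda>_. 1"] B(2) C(2) by (simp add: sum_subtractf)
  then have "\<forall>m\<in>M. real (card {b\<in>C. \<nu> b = m}) - real (card {b\<in>B. \<mu> b = m}) = 0"
    using le' by (subst (asm) sum_nonneg_eq_0_iff[OF fin]) auto
  then have "(\<Sum>m\<in>M. card {b\<in>B. \<mu> b = m} * m) = (\<Sum>m\<in>M. card {b\<in>C. \<nu> b = m} * m)"
    by (intro sum.cong) auto
  then have "(\<Sum>b\<in>B. \<mu> b) = (\<Sum>b\<in>C. \<nu> b)"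
    using sB[of "\<lambda>m. m"] sC[of "\<lambda>m. m"] by simp
  then show ?thesis
    using trace_eq_sum_eigenvalues[OF assms(1) B(1,3,4,5,6) assms(2)]
      trace_eq_sum_eigenvalues[OF assms(3) C(1,3,4,5,6) assms(4)] by simp
qed

text \<open>Unit eigenvectors for a fixed eigenvalue accumulate at eigenvectors of the limit map, so
  a multiplicity can only jump up in the limit.\<close>

lemma eventually_dim_eig_le:
  fixes H :: "nat \<Rightarrow> 'a::euclidean_space \<Rightarrow> 'a"
  assumes "\<And>i. linear (H i)" "linear H0" "\<And>x. (\<lambda>i. H i x) \<longlonglongrightarrow> H0 x"
  shows "\<forall>\<^sub>F i in sequentially. dim (eig (H i) m) \<le> dim (eig H0 m)"
proof (rule ccontr)
  assume "\<not> ?thesis"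
  then have "\<exists>\<^sub>F i in sequentially. dim (eig H0 m) < dim (eig (H i) m)"
    unfolding frequently_def by (simp add: not_less)
  then have "infinite {i. dim (eig H0 m) < dim (eig (H i) m)}"
    by (simp add: frequently_sequentially infinite_nat_iff_unbounded_le)
  then obtain r :: "nat \<Rightarrow> nat" where r: "strict_mono r" "\<And>i. dim (eig H0 m) < dim (eig (H (r i)) m)"
    using infinite_enumerate by (metis mem_Collect_eq)
  have "Suc (dim (eig H0 m)) \<le> dim (eig H0 m)"
  proof (rule dim_limit_subspaces[of "\<lambda>i. eig (H (r i)) m"])
    fix a x and s :: "nat \<Rightarrow> nat"
    assume s: "strict_mono s" "\<And>i. a i \<in> eig (H (r (s i))) m" "a \<longlonglongrightarrow> x"
    have "(\<lambda>i. H (r (s i)) (a i)) \<longlonglongrightarrow> H0 x"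
    proof (rule linear_pointwise_limit[OF assms(1,2) _ s(3)])
      fix y
      show "(\<lambda>i. H (r (s i)) y) \<longlonglongrightarrow> H0 y"
        using LIMSEQ_subseq_LIMSEQ[OF assms(3) strict_mono_o[OF r(1) s(1)]] by (simp add: o_def)
    qed
    moreover have "(\<lambda>i. H (r (s i)) (a i)) \<longlonglongrightarrow> m *\<^sub>R x"
    proof -
      have "(\<lambda>i. m *\<^sub>R a i) \<longlonglongrightarrow> m *\<^sub>R x" by (intro tendsto_intros s)
      then show ?thesis using s(2) by (simp add: eig_def)
    qed
    ultimately have "H0 x = m *\<^sub>R x" by (rule LIMSEQ_unique)
    then show "x \<in> eig H0 m" by (simp add: eig_def)
  qed (use r assms in \<open>auto simp: subspace_eig Suc_le_eq\<close>)
  then show False by simp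
qed

text \<open>All eigenvalues are confined to one finite set, so they cannot move. Multiplicities add
  up to the dimension on both sides, and the one-sided estimate leaves no room for a strict
  inequality.\<close>

lemma eventually_dim_eig_eq:
  fixes H :: "nat \<Rightarrow> 'a::euclidean_space \<Rightarrow> 'a"
  assumes "\<And>i. linear (H i)" "\<And>i x y. H i x \<bullet> y = x \<bullet> H i y"
    and "linear H0" "\<And>x y. H0 x \<bullet> y = x \<bullet> H0 y" "\<And>x. (\<lambda>i. H i x) \<longlonglongrightarrow> H0 x"
    and M: "finite M" "\<And>i m. eig (H i) m \<noteq> {0} \<Longrightarrow> m \<in> M" "\<And>m. eig H0 m \<noteq> {0} \<Longrightarrow> m \<in> M"
  shows "\<forall>\<^sub>F i in sequentially. \<forall>m. dim (eig (H i) m) = dim (eig H0 m)"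
proof -
  have "\<forall>\<^sub>F i in sequentially. \<forall>m\<in>M. dim (eig (H i) m) \<le> dim (eig H0 m)"
    by (rule eventually_ball_finite[OF M(1)]) (use eventually_dim_eig_le[OF assms(1,3,5)] in blast)
  then show ?thesis
  proof eventually_elim
    case (elim i)
    have sums: "(\<Sum>m\<in>M. dim (eig (H i) m)) = (\<Sum>m\<in>M. dim (eig H0 m))"
      by (rule trans[OF sum_dim_eig[OF assms(1,2) M(1) M(2)] sum_dim_eig[OF assms(3,4) M(1,3), symmetric]])
    have eq: "dim (eig (H i) m) = dim (eig H0 m)" if "m \<in> M" for m
    proof (rule ccontr)
      assume "dim (eig (H i) m) \<noteq> dim (eig H0 m)"
      then have "dim (eig (H i) m) < dim (eig H0 m)"
        using elim that by force
      then have "(\<Sum>m\<in>M. dim (eig (H i) m)) < (\<Sum>m\<in>M. dim (eig H0 m))"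
        using elim that by (intro sum_strict_mono_ex1[OF M(1)]) auto
      with sums show False by simp
    qed
    have "dim (eig (H i) m) = dim (eig H0 m)" if "m \<notin> M" for m
    proof -
      have "eig (H i) m = {0}" "eig H0 m = {0}" using that M(2)[of i m] M(3)[of m] by auto
      then show ?thesis by simp
    qed
    with eq show ?case by blast
  qed
qed

text \<open>Vectors killed by \<open>N + l M\<close> for different \<open>l\<close> are orthogonal
  for the form of \<open>M\<close>, and this form is positive on each of them; hence they are
  independent. Thus all but a few multiples of a degenerate operator leave no kernel vector
  transverse to its own kernel.\<close>

lemma pencil_kernel_card:
  fixes N M :: "'a::euclidean_space \<Rightarrow> 'a"
  assumes N: "linear N" "\<And>x y. N x \<bullet> y = x \<bullet> N y" and M: "linear M" "\<And>x y. M x \<bullet> y = x \<bullet> M y"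
    and psd: "\<And>x. 0 \<le> M x \<bullet> x" "\<And>x. M x \<bullet> x = 0 \<Longrightarrow> M x = 0"
    and L: "finite L" "\<And>l. l \<in> L \<Longrightarrow> \<exists>x. N x + l *\<^sub>R M x = 0 \<and> M x \<noteq> 0"
  shows "card L \<le> DIM('a)"
proof -
  obtain x where x: "\<And>l. l \<in> L \<Longrightarrow> N (x l) + l *\<^sub>R M (x l) = 0" "\<And>l. l \<in> L \<Longrightarrow> M (x l) \<noteq> 0"
    using L(2) by metis
  have orth: "M (x k) \<bullet> x l = 0" if "k \<in> L" "l \<in> L" "k \<noteq> l" for k l
  proof -
    have "N (x k) = - k *\<^sub>R M (x k)" "N (x l) = - l *\<^sub>R M (x l)"
      using x(1) that by (simp_all add: eq_neg_iff_add_eq_0)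
    then have "- k * (M (x k) \<bullet> x l) = - l * (M (x k) \<bullet> x l)"
      using N(2)[of "x k" "x l"] M(2)[of "x k" "x l"] by simp
    then show ?thesis using that(3) by simp
  qed
  have inj: "inj_on x L"
  proof
    fix k l assume "k \<in> L" "l \<in> L" "x k = x l"
    then show "k = l"
      using orth[of k l] psd(2)[of "x k"] x(2)[of k] by metis
  qed
  have "independent (x ` L)"
  proof (rule ccontr)
    assume "\<not> independent (x ` L)"
    then obtain u where u: "(\<Sum>v\<in>x ` L. u v *\<^sub>R v) = 0" "\<exists>v\<in>x ` L. u v \<noteq> 0"
      using dependent_finite[of "x ` L"] L(1) by auto
    then obtain k where k: "k \<in> L" "u (x k) \<noteq> 0" by blast
    have "(\<Sum>l\<in>L. u (x l) *\<^sub>R x l) = 0"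
      using u(1) by (simp add: sum.reindex[OF inj] o_def)
    then have "0 = M (x k) \<bullet> (\<Sum>l\<in>L. u (x l) *\<^sub>R x l)" by simp
    also have "\<dots> = (\<Sum>l\<in>L. u (x l) * (M (x k) \<bullet> x l))"
      by (simp add: inner_sum_right)
    also have "\<dots> = (\<Sum>l\<in>{k}. u (x l) * (M (x k) \<bullet> x l))"
      using orth k L(1) by (intro sum.mono_neutral_right) auto
    finally have "M (x k) \<bullet> x k = 0" using k by simp
    then show False using psd(2) x(2) k by blast
  qed
  then have "card (x ` L) \<le> DIM('a)"
    by (simp add: independent_bound)
  then show ?thesis by (simp add: card_image[OF inj])
qed

lemma dim_image_add_kernel:
  fixes N :: "'a::euclidean_space \<Rightarrow> 'b::euclidean_space"
  assumes "linear N" "subspace W"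
  shows "dim (N ` W) + dim {x\<in>W. N x = 0} = dim W"
proof -
  define E where "E = {x\<in>W. N x = 0}"
  define G where "G = {y\<in>W. \<forall>x\<in>E. orthogonal x y}"
  have E: "subspace E" "E \<subseteq> W"
    using assms unfolding E_def
    by (auto intro!: subspaceI simp: subspace_0 subspace_add subspace_scale linear_0 linear_add linear_cmul)
  have dim: "dim G + dim E = dim W"
    unfolding G_def by (rule dim_subspace_orthogonal_to_vectors[OF E(1) assms(2) E(2)])
  have subG: "subspace G"
    unfolding G_def using assms(2)
    by (intro subspaceI) (auto simp: orthogonal_def subspace_0 subspace_add subspace_scale inner_add_right)
  have inj: "inj_on N G"
  proof
    fix x y assume xy: "x \<in> G" "y \<in> G" "N x = N y"
    then have G: "x - y \<in> G" using subG by (simp add: subspace_diff)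
    then have "x - y \<in> E"
      using xy assms(1) by (simp add: E_def G_def linear_diff)
    with G have "(x - y) \<bullet> (x - y) = 0" by (auto simp: G_def orthogonal_def)
    then show "x = y" by simp
  qed
  have "N ` W = N ` G"
  proof
    show "N ` W \<subseteq> N ` G"
    proof
      fix y assume "y \<in> N ` W"
      then obtain x where x: "x \<in> W" "y = N x" by blast
      obtain e g where eg: "x = e + g" "e \<in> span E" "\<And>w. w \<in> span E \<Longrightarrow> orthogonal g w"
        using orthogonal_subspace_decomp_exists[of E x] by metis
      have e: "e \<in> E" using eg(2) E(1) by (simp add: span_eq_iff[THEN iffD2])
      then have "g \<in> W"
        using x(1) eg(1) E(2) assms(2) by (metis add_diff_cancel_left' subspace_diff subsetD)
      then have "g \<in> G"
        using eg(3) by (auto simp: G_def orthogonal_commute span_base)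
      moreover have "N x = N g" using eg(1) e assms(1) by (simp add: linear_add E_def)
      ultimately show "y \<in> N ` G" using x(2) by blast
    qed
  qed (auto simp: G_def)
  moreover have "dim (N ` G) = dim G"
    by (rule dim_image_eq[OF assms(1)]) (use inj subG in \<open>simp add: span_eq_iff[THEN iffD2]\<close>)
  ultimately show ?thesis
    using dim by (simp add: E_def)
qed

lemma subspace_decomp:
  assumes "subspace (W :: 'a::euclidean_space set)"
  obtains y z where "x = y + z" "y \<in> W" "z \<in> orthogonal_comp W"
proof -
  obtain y z where "x = y + z" "y \<in> span W" "\<And>w. w \<in> span W \<Longrightarrow> orthogonal z w"
    using orthogonal_subspace_decomp_exists[of W x] by metis
  then show thesis
    using that[of y z] assms by (auto simp: orthogonal_comp_def orthogonal_commute span_eq_iff[THEN iffD2] span_base)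
qed

text \<open>Together with the equality that follows it shows that, for given values of the two
  summands, the rank is largest where \<open>W\<close> is contained in the range.\<close>

lemma rank_symmetric_le:
  fixes N :: "'a::euclidean_space \<Rightarrow> 'a"
  assumes "linear N" "subspace W"
  shows "dim (range N) \<le> dim W + dim (N ` orthogonal_comp W)"
proof -
  have "range N \<subseteq> {x + y |x y. x \<in> N ` W \<and> y \<in> N ` orthogonal_comp W}"
  proof
    fix v assume "v \<in> range N"
    then obtain x where v: "v = N x" by blast
    obtain y z where "x = y + z" "y \<in> W" "z \<in> orthogonal_comp W"
      using subspace_decomp[OF assms(2)] by metis
    then show "v \<in> {x + y |x y. x \<in> N ` W \<and> y \<in> N ` orthogonal_comp W}"
      using v assms(1) by (auto simp: linear_add)
  qed
  then have "dim (range N) \<le> dim {x + y |x y. x \<in> N ` W \<and> y \<in> N ` orthogonal_comp W}"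
    by (rule dim_subset)
  also have "\<dots> \<le> dim (N ` W) + dim (N ` orthogonal_comp W)"
    using dim_sums_Int[of "N ` W" "N ` orthogonal_comp W"] assms
    by (simp add: linear_subspace_image subspace_orthogonal_comp)
  also have "\<dots> \<le> dim W + dim (N ` orthogonal_comp W)"
    using dim_image_le[OF assms(1)] by simp
  finally show ?thesis .
qed

text \<open>The kernel of a symmetric map is orthogonal to its range, so \<open>W\<close> inside the
  range puts the whole kernel into the complement of \<open>W\<close>. Counting dimensions on the
  full space and on that complement gives the formula.\<close>

lemma rank_symmetric_eq:
  fixes N :: "'a::euclidean_space \<Rightarrow> 'a"
  assumes N: "linear N" "\<And>x y. N x \<bullet> y = x \<bullet> N y" and W: "subspace W" "W \<subseteq> range N"
  shows "dim (range N) = dim W + dim (N ` orthogonal_comp W)"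
proof -
  let ?P = "{y \<in> range N. \<forall>x\<in>W. orthogonal x y}"
  let ?K = "{x. N x = 0}"
  have K: "subspace ?K"
    using N(1) by (intro subspaceI) (auto simp: linear_0 linear_add linear_cmul)
  have KW: "?K \<subseteq> orthogonal_comp W"
  proof clarify
    fix x assume "N x = 0"
    then have "N y \<bullet> x = 0" for y using N(2)[of y x] by simp
    then show "x \<in> orthogonal_comp W"
      using W(2) by (auto simp: orthogonal_comp_def orthogonal_def)
  qed
  have 1: "dim (range N) + dim ?K = DIM('a)"
    using dim_image_add_kernel[OF N(1) subspace_UNIV] by simp
  have "dim (N ` orthogonal_comp W) + dim {x\<in>orthogonal_comp W. N x = 0} = dim (orthogonal_comp W)"
    by (rule dim_image_add_kernel[OF N(1) subspace_orthogonal_comp])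
  moreover have "{x\<in>orthogonal_comp W. N x = 0} = ?K" using KW by blast
  ultimately show ?thesis
    using 1 dim_orthogonal_comp[OF W(1)] by simp
qed

section \<open>Submetries\<close>

lemma lipschitz_at_of_has_derivative:
  fixes F :: "'a::real_normed_vector \<Rightarrow> 'b::real_normed_vector"
  assumes "(F has_derivative F') (at x)"
  shows "\<exists>K>0. \<exists>\<delta>>0. \<forall>y. norm (y - x) < \<delta> \<longrightarrow> norm (F y - F x) \<le> K * norm (y - x)"
proof -
  have bl: "bounded_linear F'"
    using assms has_derivative_bounded_linear by blast
  obtain \<delta> where d: "\<delta> > 0" "\<And>y. norm (y - x) < \<delta> \<Longrightarrow> norm (F y - F x - F' (y - x)) \<le> 1 * norm (y - x)"
    using assms unfolding has_derivative_at_alt by (metis zero_less_one)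
  obtain K where K: "K > 0" "\<And>h. norm (F' h) \<le> norm h * K"
    using bounded_linear.pos_bounded[OF bl] by blast
  have "norm (F y - F x) \<le> (K + 1) * norm (y - x)" if "norm (y - x) < \<delta>" for y
  proof -
    have "norm (F y - F x) \<le> norm (F y - F x - F' (y - x)) + norm (F' (y - x))"
      using norm_triangle_ineq[of "F y - F x - F' (y - x)" "F' (y - x)"] by simp
    then show ?thesis
      using d(2)[OF that] K(2)[of "y - x"] by (simp add: algebra_simps)
  qed
  then show ?thesis
    using K d by (intro exI[of _ "K + 1"] conjI exI[of _ \<delta>]) auto
qed

text \<open>Mean value theorem along the segment, with a gradient that is Lipschitz at
  \<open>x\<close>. The quadratic error later bounds how fast a fibre can bend towards the
  gradient.\<close>

lemma polynomial_taylor: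
  assumes "real_polynomial_function (g :: 'a::euclidean_space \<Rightarrow> real)"
  shows "\<exists>C>0. \<exists>\<delta>>0. \<forall>m. norm (m - x) < \<delta> \<longrightarrow>
    \<bar>g m - g x - (m - x) \<bullet> grad g x\<bar> \<le> C * (norm (m - x))\<^sup>2"
proof -
  obtain C \<delta> where C: "C > 0" "\<delta> > 0"
    "\<And>y. norm (y - x) < \<delta> \<Longrightarrow> norm (grad g y - grad g x) \<le> C * norm (y - x)"
    using lipschitz_at_of_has_derivative[OF has_derivative_grad_hess[OF assms, of x]] by blast
  have "\<bar>g m - g x - (m - x) \<bullet> grad g x\<bar> \<le> C * (norm (m - x))\<^sup>2" if m: "norm (m - x) < \<delta>" for m
  proof -
    define v where "v = m - x"
    obtain s where s: "0 < s" "s < 1" "g (x + 1 *\<^sub>R v) - g (x + 0 *\<^sub>R v) = (1 - 0) * (v \<bullet> grad g (x + s *\<^sub>R v))"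
      using MVT2[of 0 1 "\<lambda>s. g (x + s *\<^sub>R v)" "\<lambda>s. v \<bullet> grad g (x + s *\<^sub>R v)"]
        has_derivative_line[OF assms] by auto
    have "norm (s *\<^sub>R v) \<le> norm v"
      using s by (simp add: mult_left_le_one_le)
    then have "norm (grad g (x + s *\<^sub>R v) - grad g x) \<le> C * norm v"
      using C(3)[of "x + s *\<^sub>R v"] C(1) m by (smt (verit) add_diff_cancel_left' mult_left_mono v_def)
    then have "\<bar>v \<bullet> (grad g (x + s *\<^sub>R v) - grad g x)\<bar> \<le> norm v * (C * norm v)"
      by (meson Cauchy_Schwarz_ineq2 mult_left_mono norm_ge_zero order_trans)
    then show ?thesis
      using s(3) by (simp add: v_def inner_diff_right power2_eq_square algebra_simps)
  qed
  then show ?thesis using C by blast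
qed

text \<open>Equality in the triangle inequality, which an inner product norm allows only for
  parallel vectors. The first length may be zero.\<close>

lemma collinear_of_dist:
  fixes a b c :: "'a::real_inner"
  assumes "dist a b \<le> \<alpha>" "dist b c \<le> \<beta>" "\<alpha> + \<beta> \<le> dist a c" "0 \<le> \<alpha>" "0 < \<beta>"
  shows "b - a = (\<alpha> / \<beta>) *\<^sub>R (c - b)" "dist a b = \<alpha>" "dist b c = \<beta>"
proof -
  have tri: "dist a c \<le> dist a b + dist b c" by (rule dist_triangle)
  show ab: "dist a b = \<alpha>" and bc: "dist b c = \<beta>" using tri assms by linarith+
  have n: "norm (b - a) = \<alpha>" "norm (c - b) = \<beta>"
    using ab bc by (simp_all add: dist_norm norm_minus_commute)
  have "norm ((b - a) + (c - b)) = norm (b - a) + norm (c - b)"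
    using tri assms ab bc n by (simp add: dist_norm norm_minus_commute)
  then have "norm (b - a) *\<^sub>R (c - b) = norm (c - b) *\<^sub>R (b - a)"
    using norm_triangle_eq by blast
  then have "(1 / \<beta>) *\<^sub>R (\<alpha> *\<^sub>R (c - b)) = (1 / \<beta>) *\<^sub>R (\<beta> *\<^sub>R (b - a))"
    using n by simp
  then show "b - a = (\<alpha> / \<beta>) *\<^sub>R (c - b)"
    using assms(5) by simp
qed

lemma vector_derivative_quotient:
  fixes \<gamma> :: "real \<Rightarrow> 'a::real_normed_vector"
  assumes "(\<gamma> has_vector_derivative X) (at 0)"
  shows "((\<lambda>s. (1 / s) *\<^sub>R (\<gamma> s - \<gamma> 0)) \<longlongrightarrow> X) (at 0)"
proof -
  have "((\<lambda>h. norm (\<gamma> h - \<gamma> 0 - h *\<^sub>R X) / norm h) \<longlongrightarrow> 0) (at 0)"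
    using assms unfolding has_vector_derivative_def has_derivative_at by simp
  moreover have "\<forall>\<^sub>F h in at 0. norm (\<gamma> h - \<gamma> 0 - h *\<^sub>R X) / norm h = norm ((1 / h) *\<^sub>R (\<gamma> h - \<gamma> 0) - X)"
    unfolding eventually_at_filter
  proof (rule always_eventually, intro allI impI)
    fix h :: real assume h: "h \<noteq> 0"
    have "(1 / h) *\<^sub>R (\<gamma> h - \<gamma> 0 - h *\<^sub>R X) = (1 / h) *\<^sub>R (\<gamma> h - \<gamma> 0) - X"
      using h by (simp add: scaleR_diff_right)
    then show "norm (\<gamma> h - \<gamma> 0 - h *\<^sub>R X) / norm h = norm ((1 / h) *\<^sub>R (\<gamma> h - \<gamma> 0) - X)"
      by (metis norm_scaleR real_norm_def abs_divide abs_one mult.commute times_divide_eq_right mult.right_neutral)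
  qed
  ultimately have "((\<lambda>h. norm ((1 / h) *\<^sub>R (\<gamma> h - \<gamma> 0) - X)) \<longlongrightarrow> 0) (at 0)"
    by (simp add: tendsto_cong)
  then show ?thesis
    by (rule LIM_zero_cancel[OF tendsto_norm_zero_cancel])
qed

subsection \<open>Tangent spaces of embedded submanifolds\<close>

text \<open>Velocities of curves that need only be differentiable at 0. There are no charts in the
  definition, so a map carrying one set into another carries tangent vectors along by the chain rule
  alone, even where the target fibre has a different dimension. Curves are defined for all real
  parameters, which saves side conditions; \<open>tangI\<close> accepts curves that stay in
  \<open>M\<close> only near 0.\<close>

definition tang :: "'a::real_normed_vector set \<Rightarrow> 'a \<Rightarrow> 'a set" where
  "tang M p = {X. \<exists>\<gamma>. \<gamma> (0::real) = p \<and> (\<forall>s. \<gamma> s \<in> M) \<and> (\<gamma> has_vector_derivative X) (at 0)}"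

lemma tangI:
  assumes "\<gamma> 0 = p" "\<forall>\<^sub>F s in nhds 0. \<gamma> s \<in> M" "(\<gamma> has_vector_derivative X) (at 0)"
  shows "X \<in> tang M p"
proof -
  define \<delta> where "\<delta> s = (if \<gamma> s \<in> M then \<gamma> s else p)" for s
  have pM: "p \<in> M" using eventually_nhds_x_imp_x[OF assms(2)] assms(1) by simp
  have "(\<delta> has_vector_derivative X) (at 0)"
    unfolding has_vector_derivative_def
  proof (rule has_derivative_transform_eventually[of \<gamma>])
    show "(\<gamma> has_derivative (\<lambda>x. x *\<^sub>R X)) (at 0)"
      using assms(3) by (simp add: has_vector_derivative_def)
    show "\<forall>\<^sub>F s in at 0. \<gamma> s = \<delta> s"
      using assms(2) by (auto simp: eventually_at_filter \<delta>_def elim: eventually_mono)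
    show "\<gamma> 0 = \<delta> 0" using assms(1) by (simp add: \<delta>_def)
  qed simp
  moreover have "\<delta> 0 = p" "\<forall>s. \<delta> s \<in> M" using assms(1) pM by (auto simp: \<delta>_def)
  ultimately show ?thesis unfolding tang_def by blast
qed

text \<open>In the chart the set is a linear piece, so tangent vectors are the images of
  \<open>E\<close> under the derivative of \<open>\<psi>\<close>. Differentiability of this
  derivative at the base point gives the two quantitative facts: the set leaves its tangent space at
  most quadratically, and a tangent vector continues to nearby points with an error linear in the
  distance.\<close>

lemma embedded_submanifold_tangent:
  fixes M :: "'a::euclidean_space set"
  assumes M: "embedded_submanifold d M" and p: "p \<in> M"
  shows "subspace (tang M p)" "dim (tang M p) = d"
    "\<exists>C>0. \<exists>\<epsilon>>0. \<forall>m\<in>M. norm (m - p) < \<epsilon> \<longrightarrow> (\<forall>u. (\<forall>X\<in>tang M p. u \<bullet> X = 0) \<longrightarrow>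
        \<bar>u \<bullet> (m - p)\<bar> \<le> C * norm u * (norm (m - p))\<^sup>2)"
    "\<forall>X\<in>tang M p. \<exists>C>0. \<exists>\<epsilon>>0. \<forall>m\<in>M. norm (m - p) < \<epsilon> \<longrightarrow>
        (\<exists>Y\<in>tang M m. norm (Y - X) \<le> C * norm (m - p))"
proof -
  obtain U W \<phi> \<psi> E where chart: "open U" "p \<in> U" "open (W :: 'a set)" "homeomorphism U W \<phi> \<psi>"
    "smooth_on U \<phi>" "smooth_on W \<psi>" "subspace E" "dim E = d" "\<phi> ` (M \<inter> U) = E \<inter> W"
    using M p unfolding embedded_submanifold_def by metis
  have hom: "\<And>x. x \<in> U \<Longrightarrow> \<psi> (\<phi> x) = x" "\<And>y. y \<in> W \<Longrightarrow> \<phi> (\<psi> y) = y" "\<And>x. x \<in> U \<Longrightarrow> \<phi> x \<in> W"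
      "\<And>y. y \<in> W \<Longrightarrow> \<psi> y \<in> U"
    using chart(4) unfolding homeomorphism_def by auto
  define D where "D e = frechet_derivative \<psi> (at e)" for e
  define e0 where "e0 = \<phi> p"
  define F where "F = frechet_derivative \<phi> (at p)"
  have e0: "e0 \<in> W" "e0 \<in> E" "\<psi> e0 = p"
    using hom chart(2,9) p by (auto simp: e0_def)
  \<comment> \<open>Two derivatives of \<open>\<psi>\<close> give the quadratic estimate; one
    derivative of \<open>\<phi>\<close> compares distances in the chart with distances in the
    ambient space.\<close>
  have C1: "C_diff (Suc 0) U \<phi>" and C2: "C_diff (Suc (Suc 0)) W \<psi>"
    using chart(5,6) unfolding smooth_on_def by blast+
  have D: "(\<psi> has_derivative D e) (at e)" if "e \<in> W" for e
    using C2 that unfolding D_def by (auto simp: frechet_derivative_works)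
  have F: "(\<phi> has_derivative F) (at p)"
    using C1 chart(2) unfolding F_def by (auto simp: frechet_derivative_works)
  have D2: "(\<lambda>e. D e v) differentiable (at e0)" for v
    using C2 e0(1) unfolding D_def by auto
  have linD: "linear (D e)" if "e \<in> W" for e
    using D[OF that] has_derivative_linear by blast
  have linF: "linear F" using F has_derivative_linear by blast
  have DF: "D e0 (F X) = X" for X
  proof -
    have "((\<lambda>x. \<psi> (\<phi> x)) has_derivative (\<lambda>X. D e0 (F X))) (at p)"
      using has_derivative_compose[OF F, of \<psi>] D[OF e0(1)] by (simp add: e0_def)
    moreover have "((\<lambda>x. \<psi> (\<phi> x)) has_derivative (\<lambda>X. X)) (at p)"
      by (rule has_derivative_transform_within_open[OF has_derivative_ident chart(1,2)]) (simp add: hom)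
    ultimately show ?thesis using has_derivative_unique by metis
  qed
  have FD: "F (D e0 \<xi>) = \<xi>" for \<xi>
  proof -
    have "((\<lambda>y. \<phi> (\<psi> y)) has_derivative (\<lambda>X. F (D e0 X))) (at e0)"
      using has_derivative_compose[OF D[OF e0(1)], of \<phi>] F e0(3) by simp
    moreover have "((\<lambda>y. \<phi> (\<psi> y)) has_derivative (\<lambda>X. X)) (at e0)"
      by (rule has_derivative_transform_within_open[OF has_derivative_ident chart(3) e0(1)]) (simp add: hom)
    ultimately show ?thesis using has_derivative_unique by metis
  qed
  have sub: "D e \<xi> \<in> tang M (\<psi> e)" if e: "e \<in> E \<inter> W" and \<xi>: "\<xi> \<in> E" for e \<xi>
  proof (rule tangI[of "\<lambda>s. \<psi> (e + s *\<^sub>R \<xi>)"])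
    have c: "((\<lambda>s. e + s *\<^sub>R \<xi>) \<longlongrightarrow> e + 0 *\<^sub>R \<xi>) (nhds 0)"
      by (intro tendsto_intros filterlim_ident)
    then have "\<forall>\<^sub>F s in nhds 0. e + s *\<^sub>R \<xi> \<in> W"
      using topological_tendstoD[OF c chart(3)] e by simp
    then show "\<forall>\<^sub>F s in nhds 0. \<psi> (e + s *\<^sub>R \<xi>) \<in> M"
    proof eventually_elim
      case (elim s)
      have "e + s *\<^sub>R \<xi> \<in> E" using e \<xi> chart(7) by (simp add: subspace_add subspace_scale)
      with elim obtain m where "m \<in> M \<inter> U" "e + s *\<^sub>R \<xi> = \<phi> m" using chart(9) by blast
      then show ?case using hom(1) by simp
    qed
    have "((\<lambda>s. \<psi> (e + s *\<^sub>R \<xi>)) has_derivative (\<lambda>t. D e (t *\<^sub>R \<xi>))) (at 0)"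
      by (rule has_derivative_compose[where g = \<psi> and f = "\<lambda>s. e + s *\<^sub>R \<xi>", simplified])
        (use D e in \<open>auto intro!: derivative_eq_intros\<close>)
    then show "((\<lambda>s. \<psi> (e + s *\<^sub>R \<xi>)) has_vector_derivative D e \<xi>) (at 0)"
      using linD e by (simp add: has_vector_derivative_def linear_cmul)
  qed simp
  have T: "tang M p = D e0 ` E"
  proof
    show "D e0 ` E \<subseteq> tang M p" using sub[of e0] e0 by auto
    show "tang M p \<subseteq> D e0 ` E"
    proof
      fix X assume "X \<in> tang M p"
      then obtain \<gamma> where g: "\<gamma> (0::real) = p" "\<And>s. \<gamma> s \<in> M" "(\<gamma> has_vector_derivative X) (at 0)"
        unfolding tang_def by blast
      have der: "((\<lambda>s. \<phi> (\<gamma> s)) has_derivative (\<lambda>t. F (t *\<^sub>R X))) (at 0)"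
        using has_derivative_compose[of \<gamma> "\<lambda>s. s *\<^sub>R X" 0 UNIV \<phi> F] g(1,3) F
        by (simp add: has_vector_derivative_def)
      have "isCont \<gamma> 0"
        using g(3) has_vector_derivative_continuous by blast
      then have "\<forall>\<^sub>F s in nhds 0. \<gamma> s \<in> U"
        using chart(1,2) g(1) unfolding continuous_at_open eventually_nhds by (metis)
      then have E: "\<forall>\<^sub>F s in nhds 0. \<phi> (\<gamma> s) \<in> E"
        by eventually_elim (use chart(9) g(2) in blast)
      \<comment> \<open>The chart image of the curve lies in \<open>E\<close> near 0, so every
        functional vanishing on \<open>E\<close> kills its velocity.\<close>
      have "w \<bullet> F X = 0" if w: "w \<in> orthogonal_comp E" for w
      proof -
        have "((\<lambda>s. w \<bullet> \<phi> (\<gamma> s)) has_derivative (\<lambda>t. w \<bullet> F (t *\<^sub>R X))) (at 0)"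
          by (rule has_derivative_inner_right[OF der])
        moreover have "((\<lambda>s. w \<bullet> \<phi> (\<gamma> s)) has_derivative (\<lambda>t. 0)) (at 0)"
        proof (rule has_derivative_transform_eventually[of "\<lambda>_. 0"])
          have z: "w \<bullet> y = 0" if "y \<in> E" for y
            using w that by (auto simp: orthogonal_comp_def orthogonal_def inner_commute)
          show "\<forall>\<^sub>F s in at 0. 0 = w \<bullet> \<phi> (\<gamma> s)"
            using E z unfolding eventually_at_filter by (auto elim!: eventually_mono)
          show "0 = w \<bullet> \<phi> (\<gamma> 0)" using z e0 g(1) e0_def by simp
        qed auto
        ultimately have "(\<lambda>t. w \<bullet> F (t *\<^sub>R X)) = (\<lambda>t. 0)"
          using has_derivative_unique by blast
        from fun_cong[OF this, of 1] show ?thesis by simp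
      qed
      then have "F X \<in> orthogonal_comp (orthogonal_comp E)"
        by (auto simp: orthogonal_comp_def orthogonal_def)
      then have "F X \<in> E" by (simp add: orthogonal_comp_self[OF chart(7)])
      then show "X \<in> D e0 ` E" using DF[of X] by (metis imageI)
    qed
  qed
  have injD: "inj (D e0)" using FD by (metis injI)
  show "subspace (tang M p)"
    unfolding T by (rule linear_subspace_image[OF linD[OF e0(1)] chart(7)])
  show "dim (tang M p) = d"
    unfolding T using dim_image_eq[OF linD[OF e0(1)], of E] injD chart(8) inj_on_subset by blast
  obtain K \<delta>1 where K: "K > 0" "\<delta>1 > 0" "\<And>y. norm (y - p) < \<delta>1 \<Longrightarrow> norm (\<phi> y - \<phi> p) \<le> K * norm (y - p)"
    using lipschitz_at_of_has_derivative[OF F] by blast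
  have "\<exists>L \<delta>. L > 0 \<and> \<delta> > 0 \<and> (\<forall>e. norm (e - e0) < \<delta> \<longrightarrow> norm (D e b - D e0 b) \<le> L * norm (e - e0))" for b
  proof -
    obtain G where "((\<lambda>e. D e b) has_derivative G) (at e0)"
      using D2[of b] unfolding differentiable_def by blast
    then show ?thesis using lipschitz_at_of_has_derivative by blast
  qed
  then obtain L \<delta> where L: "\<And>b. L b > 0" "\<And>b. \<delta> b > (0::real)"
     "\<And>b e. norm (e - e0) < \<delta> b \<Longrightarrow> norm (D e b - D e0 b) \<le> L b * norm (e - e0)" by metis
  define L0 where "L0 = (\<Sum>b\<in>Basis. L b)"
  define \<delta>2 where "\<delta>2 = Min (\<delta> ` Basis)"
  have L0: "L0 > 0" unfolding L0_def by (rule sum_pos) (auto simp: L)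
  have d2: "\<delta>2 > 0" "\<And>b. b \<in> Basis \<Longrightarrow> \<delta>2 \<le> \<delta> b" using L(2) by (auto simp: \<delta>2_def)
  obtain \<delta>3 where d3: "\<delta>3 > 0" "ball e0 \<delta>3 \<subseteq> W" using chart(3) e0(1) openE by blast
  have Dlip: "norm (D e h - D e0 h) \<le> (L0 * norm (e - e0)) * norm h"
    if e: "norm (e - e0) < \<delta>2" "e \<in> W" for e h
  proof -
    have ex: "D e' h = (\<Sum>b\<in>Basis. (h \<bullet> b) *\<^sub>R D e' b)" if "e' \<in> W" for e'
    proof -
      have "D e' h = D e' (\<Sum>b\<in>Basis. (h \<bullet> b) *\<^sub>R b)" by (simp add: euclidean_representation)
      then show ?thesis by (simp add: linear_sum[OF linD[OF that]] linear_cmul[OF linD[OF that]])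
    qed
    have "D e h - D e0 h = (\<Sum>b\<in>Basis. (h \<bullet> b) *\<^sub>R (D e b - D e0 b))"
      unfolding ex[OF e(2)] ex[OF e0(1)] by (simp add: scaleR_diff_right sum_subtractf)
    also have "norm \<dots> \<le> (\<Sum>b\<in>Basis. norm ((h \<bullet> b) *\<^sub>R (D e b - D e0 b)))" by (rule norm_sum)
    also have "\<dots> \<le> (\<Sum>b\<in>Basis. norm h * (L b * norm (e - e0)))"
    proof (rule sum_mono)
      fix b :: 'a assume b: "b \<in> Basis"
      have "norm (D e b - D e0 b) \<le> L b * norm (e - e0)"
        using L(3) e(1) d2(2)[OF b] by (meson less_le_trans)
      then show "norm ((h \<bullet> b) *\<^sub>R (D e b - D e0 b)) \<le> norm h * (L b * norm (e - e0))"
        using Basis_le_norm[OF b, of h] by (simp add: mult_mono)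
    qed
    also have "\<dots> = (L0 * norm (e - e0)) * norm h"
      by (simp add: L0_def sum_distrib_left sum_distrib_right mult_ac)
    finally show ?thesis .
  qed
  define \<rho> where "\<rho> = min \<delta>2 \<delta>3"
  have rho: "\<rho> > 0" using d2 d3 by (simp add: \<rho>_def)
  have quad: "norm (\<psi> e - \<psi> e0 - D e0 (e - e0)) \<le> L0 * (norm (e - e0))\<^sup>2" if e: "norm (e - e0) < \<rho>" for e
  proof -
    let ?r = "norm (e - e0)"
    let ?F = "\<lambda>y. \<psi> y - D e0 y"
    have in_W: "y \<in> W" "norm (y - e0) < \<delta>2" if "y \<in> cball e0 ?r" for y
      using that e d3(2) by (auto simp: dist_norm norm_minus_commute \<rho>_def subset_iff)
    \<comment> \<open>On the ball of radius \<open>?r\<close> the derivative differs from its value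
      at the centre by at most \<open>L0 * ?r\<close>, so the mean value inequality produces the
      square.\<close>
    have "norm (?F e - ?F e0) \<le> (L0 * ?r) * norm (e - e0)"
    proof (rule differentiable_bound[where f' = "\<lambda>y h. D y h - D e0 h" and S = "cball e0 ?r"])
      fix y assume y: "y \<in> cball e0 ?r"
      have "(D e0 has_derivative D e0) (at y within cball e0 ?r)"
        using linD[OF e0(1)] linear_imp_has_derivative by blast
      then show "(?F has_derivative (\<lambda>h. D y h - D e0 h)) (at y within cball e0 ?r)"
        using has_derivative_at_withinI[OF D[OF in_W(1)[OF y]]] by (intro has_derivative_diff)
      show "onorm (\<lambda>h. D y h - D e0 h) \<le> L0 * ?r"
      proof (rule onorm_le)
        fix h
        have "norm (D y h - D e0 h) \<le> (L0 * norm (y - e0)) * norm h"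
          by (rule Dlip[OF in_W(2)[OF y] in_W(1)[OF y]])
        also have "\<dots> \<le> (L0 * ?r) * norm h"
          using y L0 by (intro mult_right_mono mult_left_mono) (auto simp: dist_norm norm_minus_commute)
        finally show "norm (D y h - D e0 h) \<le> (L0 * ?r) * norm h" .
      qed
    qed (auto simp: dist_norm norm_minus_commute)
    then show ?thesis
      using linD[OF e0(1)] by (simp add: linear_diff power2_eq_square algebra_simps)
  qed
  define \<epsilon> where "\<epsilon> = min \<delta>1 (\<rho> / K)"
  obtain \<delta>4 where d4: "\<delta>4 > 0" "ball p \<delta>4 \<subseteq> U" using chart(1,2) openE by blast
  have eps: "min \<epsilon> \<delta>4 > 0" using K rho d4 by (simp add: \<epsilon>_def)
  have close: "m \<in> U" "\<phi> m \<in> E \<inter> W" "norm (\<phi> m - e0) \<le> K * norm (m - p)" "norm (\<phi> m - e0) < \<rho>"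
    if "m \<in> M" "norm (m - p) < min \<epsilon> \<delta>4" for m
  proof -
    show U: "m \<in> U" using that d4 by (auto simp: dist_norm norm_minus_commute subset_iff)
    show "\<phi> m \<in> E \<inter> W" using chart(9) U that by blast
    show le: "norm (\<phi> m - e0) \<le> K * norm (m - p)" using K(3) that by (simp add: \<epsilon>_def e0_def)
    have "norm (m - p) < \<rho> / K" using that by (simp add: \<epsilon>_def)
    then have "K * norm (m - p) < \<rho>" using K(1) by (simp add: pos_less_divide_eq mult.commute)
    with le show "norm (\<phi> m - e0) < \<rho>" by simp
  qed
  show "\<exists>C>0. \<exists>\<epsilon>>0. \<forall>m\<in>M. norm (m - p) < \<epsilon> \<longrightarrow> (\<forall>u. (\<forall>X\<in>tang M p. u \<bullet> X = 0) \<longrightarrow>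
        \<bar>u \<bullet> (m - p)\<bar> \<le> C * norm u * (norm (m - p))\<^sup>2)"
  proof (rule exI[of _ "L0 * K\<^sup>2"], intro conjI exI[of _ "min \<epsilon> \<delta>4"] ballI impI allI)
    fix m u assume m: "m \<in> M" "norm (m - p) < min \<epsilon> \<delta>4" and u: "\<forall>X\<in>tang M p. u \<bullet> X = 0"
    note c = close[OF m]
    have "\<phi> m - e0 \<in> E" using c(2) e0(2) chart(7) by (simp add: subspace_diff)
    then have "u \<bullet> D e0 (\<phi> m - e0) = 0" using u T by blast
    then have "u \<bullet> (m - p) = u \<bullet> (\<psi> (\<phi> m) - \<psi> e0 - D e0 (\<phi> m - e0))"
      using hom(1)[OF c(1)] e0(3) by (simp add: inner_diff_right)
    then have "\<bar>u \<bullet> (m - p)\<bar> \<le> norm u * norm (\<psi> (\<phi> m) - \<psi> e0 - D e0 (\<phi> m - e0))"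
      by (simp add: Cauchy_Schwarz_ineq2)
    also have "\<dots> \<le> norm u * (L0 * (norm (\<phi> m - e0))\<^sup>2)"
      by (intro mult_left_mono quad c) simp
    also have "\<dots> \<le> norm u * (L0 * (K * norm (m - p))\<^sup>2)"
      using c(3) L0 by (intro mult_left_mono power_mono) auto
    finally show "\<bar>u \<bullet> (m - p)\<bar> \<le> L0 * K\<^sup>2 * norm u * (norm (m - p))\<^sup>2"
      by (simp add: power_mult_distrib mult_ac)
  qed (use L0 K eps in auto)
  show "\<forall>X\<in>tang M p. \<exists>C>0. \<exists>\<epsilon>>0. \<forall>m\<in>M. norm (m - p) < \<epsilon> \<longrightarrow>
        (\<exists>Y\<in>tang M m. norm (Y - X) \<le> C * norm (m - p))"
  proof
    fix X assume "X \<in> tang M p"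
    then obtain \<xi> where xi: "\<xi> \<in> E" "X = D e0 \<xi>" unfolding T by blast
    have "\<exists>Y\<in>tang M m. norm (Y - X) \<le> (L0 * K * norm \<xi> + 1) * norm (m - p)"
      if m: "m \<in> M" "norm (m - p) < min \<epsilon> \<delta>4" for m
    proof
      note c = close[OF m]
      show "D (\<phi> m) \<xi> \<in> tang M m" using sub[OF c(2) xi(1)] hom(1)[OF c(1)] by simp
      have "norm (D (\<phi> m) \<xi> - X) \<le> (L0 * norm (\<phi> m - e0)) * norm \<xi>"
        unfolding xi by (rule Dlip) (use c in \<open>auto simp: \<rho>_def\<close>)
      also have "\<dots> \<le> (L0 * (K * norm (m - p))) * norm \<xi>"
        using c(3) L0 by (intro mult_right_mono mult_left_mono) auto
      also have "\<dots> \<le> (L0 * K * norm \<xi> + 1) * norm (m - p)" by (simp add: algebra_simps)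
      finally show "norm (D (\<phi> m) \<xi> - X) \<le> (L0 * K * norm \<xi> + 1) * norm (m - p)" .
    qed
    moreover have "L0 * K * norm \<xi> + 1 > 0" using L0 K(1) by (simp add: add_nonneg_pos)
    ultimately show "\<exists>C>0. \<exists>\<epsilon>>0. \<forall>m\<in>M. norm (m - p) < \<epsilon> \<longrightarrow>
        (\<exists>Y\<in>tang M m. norm (Y - X) \<le> C * norm (m - p))"
      using eps by blast
  qed
qed

subsection \<open>Submetries and their basic polynomials\<close>

locale submetry_map =
  fixes \<sigma> :: "'a::euclidean_space \<Rightarrow> 'x::metric_space"
  assumes submetry: "submetry \<sigma>"
begin

definition fib :: "'a \<Rightarrow> 'a set" where
  "fib x = \<sigma> -` {\<sigma> x}"

definition basic :: "('a \<Rightarrow> real) \<Rightarrow> bool" where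
  "basic f \<longleftrightarrow> f \<in> basic_polynomials \<sigma>"

abbreviation V :: "'a \<Rightarrow> 'a set" where
  "V x \<equiv> tang (fib x) x"

definition sat :: "'a set \<Rightarrow> 'a set" where
  "sat A = \<sigma> -` (\<sigma> ` A)"

lemma basic_iff: "basic f \<longleftrightarrow> real_polynomial_function f \<and> (\<forall>x y. \<sigma> x = \<sigma> y \<longrightarrow> f x = f y)"
proof -
  have "(\<forall>F\<in>fibers \<sigma>. f constant_on F) \<longleftrightarrow> (\<forall>x y. \<sigma> x = \<sigma> y \<longrightarrow> f x = f y)"
  proof
    assume l: "\<forall>F\<in>fibers \<sigma>. f constant_on F"
    show "\<forall>x y. \<sigma> x = \<sigma> y \<longrightarrow> f x = f y"
    proof (intro allI impI)
      fix x y assume "\<sigma> x = \<sigma> y"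
      then have "x \<in> \<sigma> -` {\<sigma> y}" "y \<in> \<sigma> -` {\<sigma> y}" by auto
      moreover have "f constant_on (\<sigma> -` {\<sigma> y})" using l by (auto simp: fibers_def)
      ultimately show "f x = f y" unfolding constant_on_def by metis
    qed
  next
    assume "\<forall>x y. \<sigma> x = \<sigma> y \<longrightarrow> f x = f y"
    note l = this
    show "\<forall>F\<in>fibers \<sigma>. f constant_on F"
    proof
      fix F assume "F \<in> fibers \<sigma>"
      then obtain v where "F = \<sigma> -` {\<sigma> v}" unfolding fibers_def by blast
      then have "\<forall>x\<in>F. f x = f v" using l by blast
      then show "f constant_on F" unfolding constant_on_def by blast
    qed
  qed
  then show ?thesis by (auto simp: basic_def basic_polynomials_def)
qed

lemma basic_poly: "basic f \<Longrightarrow> real_polynomial_function f" unfolding basic_iff by blast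

lemma basic_eq: "basic f \<Longrightarrow> \<sigma> x = \<sigma> y \<Longrightarrow> f x = f y" unfolding basic_iff by blast

text \<open>Fibres are compared only on an interval, but the values of a basic polynomial along
  lines are then equal for all parameters. This carries information about short lifts to all
  times.\<close>

lemma basic_lines_eq:
  assumes f: "basic f" and s0: "a < b" and eq: "\<And>s. a < s \<Longrightarrow> s < b \<Longrightarrow> \<sigma> (y + s *\<^sub>R w) = \<sigma> (x + s *\<^sub>R v)"
  shows "f (y + t *\<^sub>R w) = f (x + t *\<^sub>R v)"
proof (rule real_polynomial_eq_interval[OF real_polynomial_line[OF basic_poly[OF f]]
      real_polynomial_line[OF basic_poly[OF f]] s0])
  fix s assume "a < s" "s < b"
  then show "f (y + s *\<^sub>R w) = f (x + s *\<^sub>R v)" by (intro basic_eq[OF f] eq)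
qed

lemma basic_const: "basic (\<lambda>x. c)" by (simp add: basic_iff rpf_const)

lemma basic_add: "basic f \<Longrightarrow> basic g \<Longrightarrow> basic (\<lambda>x. f x + g x)"
  unfolding basic_iff by (intro conjI allI impI rpf_add) (blast, blast, metis)

lemma basic_mult: "basic f \<Longrightarrow> basic g \<Longrightarrow> basic (\<lambda>x. f x * g x)"
  unfolding basic_iff by (intro conjI allI impI rpf_mult) (blast, blast, metis)

lemma basic_sum: "finite I \<Longrightarrow> (\<And>i. i \<in> I \<Longrightarrow> basic (f i)) \<Longrightarrow> basic (\<lambda>x. \<Sum>i\<in>I. f i x)"
  by (induct I rule: finite_induct) (simp_all add: basic_const basic_add)

lemma fib_iff: "y \<in> fib x \<longleftrightarrow> \<sigma> y = \<sigma> x" by (simp add: fib_def)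

lemma fib_cong: "\<sigma> x = \<sigma> y \<Longrightarrow> fib x = fib y" by (simp add: fib_def)

lemma dist_sigma_le: "dist (\<sigma> x) (\<sigma> y) \<le> dist x y"
proof -
  have "\<sigma> y \<in> \<sigma> ` cball x (dist x y)" by simp
  then show ?thesis using submetry unfolding submetry_def by simp
qed

text \<open>The onto half of the ball condition: distances to a fibre are attained and equal
  distances in the target space.\<close>

lemma lift_point: "\<exists>y'. \<sigma> y' = \<sigma> x' \<and> dist y y' = dist (\<sigma> y) (\<sigma> x')"
proof -
  have "\<sigma> x' \<in> \<sigma> ` cball y (dist (\<sigma> y) (\<sigma> x'))"
    using submetry unfolding submetry_def by simp
  then obtain y' where "\<sigma> y' = \<sigma> x'" "dist y y' \<le> dist (\<sigma> y) (\<sigma> x')" by auto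
  then show ?thesis using dist_sigma_le[of y y'] by (intro exI[of _ y']) auto
qed

lemma continuous_sigma: "continuous_on UNIV \<sigma>"
  unfolding continuous_on_iff using dist_sigma_le le_less_trans by blast

lemma tendsto_sigma: "(f \<longlongrightarrow> l) F \<Longrightarrow> ((\<lambda>i. \<sigma> (f i)) \<longlongrightarrow> \<sigma> l) F"
  using continuous_sigma by (metis UNIV_I continuous_on_def tendsto_compose at_within_open open_UNIV continuous_on_tendsto_compose eventually_True)

lemma open_sat: "open A \<Longrightarrow> open (sat A)"
  unfolding open_dist
proof
  fix y assume A: "\<forall>x\<in>A. \<exists>e>0. \<forall>y. dist y x < e \<longrightarrow> y \<in> A" and "y \<in> sat A"
  then obtain x where x: "x \<in> A" "\<sigma> y = \<sigma> x" by (auto simp: sat_def)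
  then obtain e where e: "e > 0" "\<And>z. dist z x < e \<Longrightarrow> z \<in> A" using A by blast
  have "z \<in> sat A" if "dist z y < e" for z
  proof -
    obtain x' where x': "\<sigma> x' = \<sigma> z" "dist x x' = dist (\<sigma> x) (\<sigma> z)" using lift_point by blast
    have "dist x' x < e" using x' x(2) dist_sigma_le[of y z] that by (simp add: dist_commute)
    then have "x' \<in> A" by (rule e(2))
    then show ?thesis using x' by (auto simp: sat_def intro: rev_image_eqI)
  qed
  then show "\<exists>e>0. \<forall>z. dist z y < e \<longrightarrow> z \<in> sat A" using e(1) by blast
qed

lemma closed_fib: "closed (fib x)"
  unfolding fib_def using continuous_sigma
  by (intro continuous_closed_vimage) (auto simp: continuous_on_eq_continuous_within)

text \<open>Past an interior point of a shortest segment the lift is unique, which yields a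
  whole lifted segment at once.\<close>

lemma segment_lift:
  assumes min: "dist (\<sigma> x) (\<sigma> (x + v)) = norm v" and xy: "\<sigma> x = \<sigma> y" and s0: "0 < s0" "s0 < 1"
  shows "\<exists>w. norm w = norm v \<and> (\<forall>s\<in>{0..s0}. \<sigma> (y + s *\<^sub>R w) = \<sigma> (x + s *\<^sub>R v)) \<and> \<sigma> (y + w) = \<sigma> (x + v)"
proof (cases "v = 0")
  case True
  then show ?thesis using xy by (intro exI[of _ 0]) simp
next
  case False
  define \<rho> where "\<rho> = norm v"
  have rho: "\<rho> > 0" using False by (simp add: \<rho>_def)
  have d0: "dist (\<sigma> x) (\<sigma> (x + s *\<^sub>R v)) \<le> s * \<rho>" if "0 \<le> s" for s
    using dist_sigma_le[of x "x + s *\<^sub>R v"] that by (simp add: dist_norm \<rho>_def)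
  have dd: "dist (\<sigma> (x + s *\<^sub>R v)) (\<sigma> (x + t *\<^sub>R v)) \<le> (t - s) * \<rho>" if "s \<le> t" for s t
    using dist_sigma_le[of "x + s *\<^sub>R v" "x + t *\<^sub>R v"] that
    by (simp add: dist_norm \<rho>_def scaleR_diff_left[symmetric])
  have d1: "(1 - s) * \<rho> \<le> dist (\<sigma> (x + s *\<^sub>R v)) (\<sigma> (x + v))" if "0 \<le> s" for s
    using dist_triangle[of "\<sigma> x" "\<sigma> (x + v)" "\<sigma> (x + s *\<^sub>R v)"] d0[OF that] min
    by (simp add: \<rho>_def algebra_simps)
  obtain y1 where y1: "\<sigma> y1 = \<sigma> (x + s0 *\<^sub>R v)" "dist y y1 = dist (\<sigma> y) (\<sigma> (x + s0 *\<^sub>R v))"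
    using lift_point by blast
  obtain y2 where y2: "\<sigma> y2 = \<sigma> (x + v)" "dist y1 y2 = dist (\<sigma> y1) (\<sigma> (x + v))"
    using lift_point by blast
  have yy1: "dist y y1 \<le> s0 * \<rho>" using y1 xy d0[of s0] s0 by simp
  have y1y2: "dist y1 y2 \<le> (1 - s0) * \<rho>" using y2 y1 dd[of s0 1] s0 by simp
  have b: "0 < (1 - s0) * \<rho>" using rho s0 by simp
  \<comment> \<open>The direction is read off from the second piece, from \<open>y1\<close> to
    \<open>y2\<close>; the first piece is then shown to be its backward continuation.\<close>
  define w where "w = (1 / (1 - s0)) *\<^sub>R (y2 - y1)"
  have y2y1: "y2 - y1 = (1 - s0) *\<^sub>R w" using s0 by (simp add: w_def)
  \<comment> \<open>A path from \<open>y'\<close> over \<open>y1\<close> to \<open>y2\<close> is no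
    longer than the distance between the fibres of its ends, so it is straight and \<open>y'\<close>
    is determined. This applies to \<open>y\<close> itself and to lifts of intermediate
    points.\<close>
  have key: "y' = y1 - (s0 - s) *\<^sub>R w \<and> dist y1 y2 = (1 - s0) * \<rho>"
    if s: "0 \<le> s" "s \<le> s0" and y': "\<sigma> y' = \<sigma> (x + s *\<^sub>R v)" "dist y' y1 \<le> (s0 - s) * \<rho>" for s y'
  proof -
    have "(s0 - s) * \<rho> + (1 - s0) * \<rho> \<le> dist y' y2"
      using d1[OF s(1)] dist_sigma_le[of y' y2] y' y2 by (simp add: algebra_simps)
    moreover have "0 \<le> (s0 - s) * \<rho>" using s rho by simp
    ultimately have "y1 - y' = (((s0 - s) * \<rho>) / ((1 - s0) * \<rho>)) *\<^sub>R (y2 - y1)" "dist y1 y2 = (1 - s0) * \<rho>"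
      using collinear_of_dist[OF y'(2) y1y2 _ _ b] by auto
    moreover have "(((s0 - s) * \<rho>) / ((1 - s0) * \<rho>)) *\<^sub>R (y2 - y1) = (s0 - s) *\<^sub>R w"
      using rho by (simp add: w_def)
    ultimately have "y1 - y' = (s0 - s) *\<^sub>R w" "dist y1 y2 = (1 - s0) * \<rho>" by metis+
    then show ?thesis by (metis diff_diff_eq2 add_diff_cancel_left')
  qed
  have y: "y = y1 - s0 *\<^sub>R w" "dist y1 y2 = (1 - s0) * \<rho>"
    using key[of 0 y] xy yy1 s0 by auto
  have nw: "norm w = norm v"
  proof -
    have "(1 - s0) * norm w = (1 - s0) * \<rho>"
      using y(2) y2y1 s0 by (simp add: dist_norm norm_minus_commute[of y1])
    then show ?thesis using s0 by (simp add: \<rho>_def)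
  qed
  moreover have "\<sigma> (y + s *\<^sub>R w) = \<sigma> (x + s *\<^sub>R v)" if "s \<in> {0..s0}" for s
  proof -
    obtain y' where y': "\<sigma> y' = \<sigma> (x + s *\<^sub>R v)" "dist y1 y' = dist (\<sigma> y1) (\<sigma> (x + s *\<^sub>R v))"
      using lift_point by blast
    have "dist y' y1 \<le> (s0 - s) * \<rho>"
      using dd[of s s0] y' y1 that by (simp add: dist_commute)
    then have "y' = y1 - (s0 - s) *\<^sub>R w" using key[of s y'] y'(1) that by simp
    then have "y' = y + s *\<^sub>R w" unfolding y(1) scaleR_diff_left by simp
    then show ?thesis using y' by simp
  qed
  moreover have "y + w = y2"
  proof -
    have "y2 = y1 + (1 - s0) *\<^sub>R w" using y2y1 by (metis add.commute diff_add_cancel)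
    then show ?thesis unfolding y(1) scaleR_diff_left by simp
  qed
  ultimately show ?thesis using y2 by (intro exI[of _ w]) auto
qed

text \<open>The fibre of \<open>x\<close> stays outside the open ball of radius \<open>s |u|\<close>
  about \<open>x + s u\<close>: nearby points because the fibre bends too little, distant ones
  because \<open>s\<close> is small.\<close>

lemma minimal_segment:
  assumes "C > 0" "\<epsilon> > 0"
    "\<And>m. \<sigma> m = \<sigma> x \<Longrightarrow> norm (m - x) < \<epsilon> \<Longrightarrow> u \<bullet> (m - x) \<le> C * (norm (m - x))\<^sup>2"
  shows "\<exists>s0>0. \<forall>s\<in>{0..s0}. dist (\<sigma> x) (\<sigma> (x + s *\<^sub>R u)) = s * norm u"
proof -
  \<comment> \<open>The first entry gives \<open>2 s C \<le> 1\<close>, which absorbs the quadratic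
    term; the second gives \<open>2 s |u| \<le> \<epsilon>\<close>, which settles points at distance
    at least \<open>\<epsilon>\<close> from \<open>x\<close>.\<close>
  define s0 where "s0 = min (1 / (2 * C)) (\<epsilon> / (2 * norm u + 1))"
  have p: "2 * norm u + 1 > 0" by (simp add: add_nonneg_pos)
  have s0: "s0 > 0" using assms p by (simp add: s0_def)
  have "dist (\<sigma> x) (\<sigma> (x + s *\<^sub>R u)) = s * norm u" if s: "s \<in> {0..s0}" for s
  proof (rule antisym)
    show "dist (\<sigma> x) (\<sigma> (x + s *\<^sub>R u)) \<le> s * norm u"
      using dist_sigma_le[of x "x + s *\<^sub>R u"] s by (simp add: dist_norm)
    obtain m where m: "\<sigma> m = \<sigma> x" "dist (x + s *\<^sub>R u) m = dist (\<sigma> (x + s *\<^sub>R u)) (\<sigma> x)"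
      using lift_point by blast
    have "s * norm u \<le> dist (x + s *\<^sub>R u) m"
    proof (cases "norm (m - x) < \<epsilon>")
      case True
      have "s \<le> 1 / (2 * C)" using s by (simp add: s0_def)
      then have sC: "2 * s * C \<le> 1" using assms(1) by (simp add: pos_le_divide_eq)
      have "2 * s * (u \<bullet> (m - x)) \<le> 2 * s * (C * (norm (m - x))\<^sup>2)"
        using assms(3)[OF m(1) True] s by (intro mult_left_mono) auto
      also have "\<dots> \<le> 1 * (norm (m - x))\<^sup>2"
        using mult_right_mono[OF sC zero_le_power2[of "norm (m - x)"]] by (simp add: mult_ac)
      finally have le: "2 * s * (u \<bullet> (m - x)) \<le> (norm (m - x))\<^sup>2" by simp
      have "(norm (s *\<^sub>R u - (m - x)))\<^sup>2 = (s * norm u)\<^sup>2 - 2 * s * (u \<bullet> (m - x)) + (norm (m - x))\<^sup>2"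
        unfolding power2_norm_eq_inner power_mult_distrib
        by (simp add: inner_diff_left inner_diff_right inner_commute power2_eq_square algebra_simps)
      then have "(s * norm u)\<^sup>2 \<le> (norm (s *\<^sub>R u - (m - x)))\<^sup>2" using le by simp
      then have "s * norm u \<le> norm (s *\<^sub>R u - (m - x))" by (rule power2_le_imp_le) simp
      then show ?thesis by (simp add: dist_norm algebra_simps)
    next
      case False
      have "s \<le> \<epsilon> / (2 * norm u + 1)" using s by (simp add: s0_def)
      then have "s * (2 * norm u + 1) \<le> \<epsilon>" using p by (simp add: pos_le_divide_eq)
      moreover have "dist m x \<le> dist m (x + s *\<^sub>R u) + dist (x + s *\<^sub>R u) x" by (rule dist_triangle)
      moreover have "dist (x + s *\<^sub>R u) x = s * norm u" using s by (simp add: dist_norm)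
      moreover have "\<epsilon> \<le> dist m x" using False by (simp add: dist_norm)
      moreover have "s * (2 * norm u + 1) = 2 * (s * norm u) + s" by (simp add: algebra_simps)
      moreover have "0 \<le> s" using s by simp
      ultimately show ?thesis by (simp add: dist_commute)
    qed
    then show "s * norm u \<le> dist (\<sigma> x) (\<sigma> (x + s *\<^sub>R u))"
      using m(2) by (simp add: dist_commute)
  qed
  then show ?thesis using s0 by blast
qed

text \<open>Since \<open>g\<close> is constant on the fibre, Taylor expansion bounds the product of
  the gradient with \<open>m - x\<close> by the quadratic error.\<close>

lemma minimal_gradient:
  assumes "basic g"
  shows "\<exists>s0>0. \<forall>s\<in>{0..s0}. dist (\<sigma> x) (\<sigma> (x + s *\<^sub>R grad g x)) = s * norm (grad g x)"
proof -
  obtain C \<delta> where C: "C > 0" "\<delta> > 0"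
    "\<And>m. norm (m - x) < \<delta> \<Longrightarrow> \<bar>g m - g x - (m - x) \<bullet> grad g x\<bar> \<le> C * (norm (m - x))\<^sup>2"
    using polynomial_taylor[OF basic_poly[OF assms], of x] by blast
  show ?thesis
  proof (rule minimal_segment[OF C(1,2)])
    fix m assume "\<sigma> m = \<sigma> x" "norm (m - x) < \<delta>"
    then show "grad g x \<bullet> (m - x) \<le> C * (norm (m - x))\<^sup>2"
      using C(3)[of m] basic_eq[OF assms, of m x] by (simp add: inner_commute)
  qed
qed

text \<open>The direction obtained by lifting is not yet known to be the gradient at
  \<open>y\<close>. Recorded are its length and, from comparing the derivatives of \<open>g\<close>
  along both segments, its product with \<open>grad g y\<close>; these will pin it down.\<close>

lemma gradient_lift:
  assumes "basic g" "\<sigma> x = \<sigma> y"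
  shows "\<exists>s0>0. \<exists>w. norm w = norm (grad g x) \<and> w \<bullet> grad g y = grad g x \<bullet> grad g x \<and>
    (\<forall>s\<in>{0..s0}. \<sigma> (y + s *\<^sub>R w) = \<sigma> (x + s *\<^sub>R grad g x))"
proof -
  define v where "v = grad g x"
  obtain s1 where s1: "s1 > 0" "\<And>s. s \<in> {0..s1} \<Longrightarrow> dist (\<sigma> x) (\<sigma> (x + s *\<^sub>R v)) = s * norm v"
    using minimal_gradient[OF assms(1), of x] unfolding v_def by blast
  have "dist (\<sigma> x) (\<sigma> (x + s1 *\<^sub>R v)) = norm (s1 *\<^sub>R v)" using s1 by simp
  then obtain w0 where w0: "norm w0 = norm (s1 *\<^sub>R v)"
    "\<And>s. s \<in> {0..1/2} \<Longrightarrow> \<sigma> (y + s *\<^sub>R w0) = \<sigma> (x + s *\<^sub>R s1 *\<^sub>R v)"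
    using segment_lift[OF _ assms(2), of "s1 *\<^sub>R v" "1/2"] by auto
  define w where "w = (1 / s1) *\<^sub>R w0"
  define s0 where "s0 = s1 / 2"
  have s0: "s0 > 0" using s1 by (simp add: s0_def)
  have nw: "norm w = norm v" using w0(1) s1(1) by (simp add: w_def)
  have lift: "\<sigma> (y + s *\<^sub>R w) = \<sigma> (x + s *\<^sub>R v)" if "s \<in> {0..s0}" for s
    using w0(2)[of "s / s1"] that s1(1) by (simp add: w_def s0_def field_simps)
  have pg: "real_polynomial_function g" using basic_poly assms(1) .
  have eq: "g (y + s *\<^sub>R w) = g (x + s *\<^sub>R v)" for s
    by (rule basic_lines_eq[OF assms(1) s0]) (use lift in simp)
  have "w \<bullet> grad g (y + 0 *\<^sub>R w) = v \<bullet> grad g (x + 0 *\<^sub>R v)"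
    using has_derivative_line[OF pg, of y w 0] has_derivative_line[OF pg, of x v 0]
    unfolding eq by (rule DERIV_unique)
  then show ?thesis using s0 nw lift v_def by (intro exI[of _ s0] conjI exI[of _ w]) auto
qed

lemma norm_grad_basic:
  assumes "basic g" "\<sigma> x = \<sigma> y"
  shows "norm (grad g x) = norm (grad g y)"
proof -
  have "norm (grad g x) \<le> norm (grad g y)" if xy: "\<sigma> x = \<sigma> y" for x y
  proof -
    obtain w where w: "norm w = norm (grad g x)" "w \<bullet> grad g y = grad g x \<bullet> grad g x"
      using gradient_lift[OF assms(1) xy] by blast
    have "norm (grad g x) * norm (grad g x) \<le> norm (grad g x) * norm (grad g y)"
      using norm_cauchy_schwarz[of w "grad g y"] w by (simp add: dot_square_norm power2_eq_square)
    then show ?thesis by (cases "grad g x = 0") auto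
  qed
  then show ?thesis using assms(2) by (metis antisym)
qed

text \<open>Equality case of the Cauchy-Schwarz inequality: as the gradients at \<open>x\<close> and
  \<open>y\<close> are equally long, the lifted direction can only be the gradient at
  \<open>y\<close>.\<close>

lemma gradient_flow_short:
  assumes "basic g" "\<sigma> x = \<sigma> y"
  shows "\<exists>s0>0. \<forall>s\<in>{0..s0}. \<sigma> (y + s *\<^sub>R grad g y) = \<sigma> (x + s *\<^sub>R grad g x)"
proof -
  obtain s0 w where w: "s0 > 0" "norm w = norm (grad g x)" "w \<bullet> grad g y = grad g x \<bullet> grad g x"
    "\<And>s. s \<in> {0..s0} \<Longrightarrow> \<sigma> (y + s *\<^sub>R w) = \<sigma> (x + s *\<^sub>R grad g x)"
    using gradient_lift[OF assms] by blast
  have "(norm (w - grad g y))\<^sup>2 = (norm w)\<^sup>2 - 2 * (w \<bullet> grad g y) + (norm (grad g y))\<^sup>2"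
    unfolding power2_norm_eq_inner by (simp add: inner_diff_left inner_diff_right inner_commute)
  also have "\<dots> = 0"
    using w(2,3) norm_grad_basic[OF assms] by (simp add: dot_square_norm)
  finally have "w = grad g y" by simp
  then show ?thesis using w by blast
qed

lemma gradient_flow_basic:
  assumes "basic f" "basic g" "\<sigma> x = \<sigma> y"
  shows "f (x + t *\<^sub>R grad g x) = f (y + t *\<^sub>R grad g y)"
proof -
  obtain s0 where "s0 > 0" "\<And>s. s \<in> {0..s0} \<Longrightarrow> \<sigma> (y + s *\<^sub>R grad g y) = \<sigma> (x + s *\<^sub>R grad g x)"
    using gradient_flow_short[OF assms(2,3)] by blast
  then have "f (y + t *\<^sub>R grad g y) = f (x + t *\<^sub>R grad g x)"
    by (intro basic_lines_eq[OF assms(1), of 0 s0]) auto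
  then show ?thesis ..
qed

lemma basic_gradient_flow:
  assumes "basic f" "basic g"
  shows "basic (\<lambda>x. f (x + t *\<^sub>R grad g x))"
  unfolding basic_iff
proof
  have "polynomial_function (\<lambda>x. x + t *\<^sub>R grad g x)"
    by (intro polynomial_function_add polynomial_function_mult polynomial_function_grad basic_poly assms) auto
  then show "real_polynomial_function (\<lambda>x. f (x + t *\<^sub>R grad g x))"
    using real_polynomial_function_compose[OF _ basic_poly[OF assms(1)]] by (simp add: o_def)
qed (use gradient_flow_basic[OF assms] in blast)

text \<open>The gradient product is the derivative at time 0 of \<open>f\<close> along the flow of
  \<open>g\<close>, and that function of time is the same for all points of a fibre.\<close>

lemma basic_grad_inner:
  assumes "basic f" "basic g"
  shows "basic (grad_inner f g)"
  unfolding basic_iff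
proof (intro conjI allI impI)
  show "real_polynomial_function (grad_inner f g)"
    by (intro real_polynomial_grad_inner basic_poly assms)
  fix x y assume xy: "\<sigma> x = \<sigma> y"
  have "grad g x \<bullet> grad f (x + 0 *\<^sub>R grad g x) = grad g y \<bullet> grad f (y + 0 *\<^sub>R grad g y)"
    using has_derivative_line[OF basic_poly[OF assms(1)], of x "grad g x" 0]
      has_derivative_line[OF basic_poly[OF assms(1)], of y "grad g y" 0]
    unfolding gradient_flow_basic[OF assms xy] by (rule DERIV_unique)
  then show "grad_inner f g x = grad_inner f g y" by (simp add: grad_inner_eq inner_commute)
qed

lemma grad_orthogonal_tangent:
  assumes "basic f" "X \<in> V x"
  shows "grad f x \<bullet> X = 0"
proof -
  obtain \<gamma> where g: "\<gamma> (0::real) = x" "\<And>s. \<gamma> s \<in> fib x" "(\<gamma> has_vector_derivative X) (at 0)"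
    using assms(2) unfolding tang_def by blast
  have "((\<lambda>s. f (\<gamma> s)) has_derivative (\<lambda>t. (t *\<^sub>R X) \<bullet> grad f x)) (at 0)"
  proof (rule has_derivative_compose[of \<gamma> "\<lambda>s. s *\<^sub>R X" 0 UNIV f "\<lambda>h. h \<bullet> grad f x"])
    show "(\<gamma> has_derivative (\<lambda>s. s *\<^sub>R X)) (at 0)" using g(3) by (simp add: has_vector_derivative_def)
    show "(f has_derivative (\<lambda>h. h \<bullet> grad f x)) (at (\<gamma> 0))"
      unfolding g(1) by (rule has_derivative_grad[OF basic_poly[OF assms(1)]])
  qed
  moreover have "(\<lambda>s. f (\<gamma> s)) = (\<lambda>s. f x)"
    by (rule ext, rule basic_eq[OF assms(1)]) (use g(2) in \<open>simp add: fib_iff\<close>)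
  ultimately have "(\<lambda>t. (t *\<^sub>R X) \<bullet> grad f x) = (\<lambda>t. 0)"
    by (metis has_derivative_const has_derivative_unique)
  from fun_cong[OF this, of 1] show ?thesis by (simp add: inner_commute)
qed

text \<open>First variation of the squared distance from \<open>x\<close> along a curve in the fibre
  of its nearest point \<open>y\<close>.\<close>

lemma nearest_orthogonal:
  assumes "dist x y = dist (\<sigma> x) (\<sigma> y)" "X \<in> V y"
  shows "(x - y) \<bullet> X = 0"
proof -
  obtain \<gamma> where g: "\<gamma> (0::real) = y" "\<And>s. \<gamma> s \<in> fib y" "(\<gamma> has_vector_derivative X) (at 0)"
    using assms(2) unfolding tang_def by blast
  define h where "h s = (x - \<gamma> s) \<bullet> (x - \<gamma> s)" for s
  have hd: "(h has_derivative (\<lambda>t. (x - \<gamma> 0) \<bullet> (0 - t *\<^sub>R X) + (0 - t *\<^sub>R X) \<bullet> (x - \<gamma> 0))) (at 0)"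
    unfolding h_def using g(3) unfolding has_vector_derivative_def
    by (intro has_derivative_inner has_derivative_diff has_derivative_const)
  have "(h has_real_derivative - 2 * ((x - y) \<bullet> X)) (at 0)"
  proof -
    have "(\<lambda>t. (x - \<gamma> 0) \<bullet> (0 - t *\<^sub>R X) + (0 - t *\<^sub>R X) \<bullet> (x - \<gamma> 0)) = (*) (- 2 * ((x - y) \<bullet> X))"
      unfolding g(1) by (rule ext) (simp add: inner_commute algebra_simps)
    with hd show ?thesis unfolding has_field_derivative_def by simp
  qed
  moreover have "h 0 \<le> h s" for s
  proof -
    have "dist x y \<le> dist x (\<gamma> s)"
      using dist_sigma_le[of x "\<gamma> s"] g(2)[of s] assms(1) by (simp add: fib_iff)
    then have "(dist x y)\<^sup>2 \<le> (dist x (\<gamma> s))\<^sup>2" by (simp add: power_mono)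
    then show ?thesis by (simp add: h_def g(1) dist_norm power2_norm_eq_inner)
  qed
  ultimately have "- 2 * ((x - y) \<bullet> X) = 0"
    by (intro DERIV_local_min[of h _ 0 1]) auto
  then show ?thesis by simp
qed

end

text \<open>The image is shrunk to a ball so that straight segments between image points can be
  pulled back by the inverse.\<close>

lemma polynomial_local_inverse:
  fixes \<Xi> :: "'a::euclidean_space \<Rightarrow> 'a"
  assumes "polynomial_function \<Xi>" "(\<Xi> has_derivative D) (at x)" "\<And>h. D h = 0 \<Longrightarrow> h = 0" "open R" "x \<in> R"
  shows "\<exists>A \<delta> g. open A \<and> x \<in> A \<and> A \<subseteq> R \<and> \<delta> > 0 \<and> homeomorphism A (ball (\<Xi> x) \<delta>) \<Xi> g \<and>
    (\<forall>y\<in>ball (\<Xi> x) \<delta>. g differentiable (at y))"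
proof -
  have pb: "real_polynomial_function (\<lambda>y. \<Xi> y \<bullet> b)" if "b \<in> Basis" for b
    using assms(1) that unfolding polynomial_function_iff_Basis_inner by blast
  define F where "F y h = (\<Sum>b\<in>Basis. (h \<bullet> grad (\<lambda>y. \<Xi> y \<bullet> b) y) *\<^sub>R b)" for y h
  have blF: "bounded_linear (F y)" for y
    unfolding F_def by (intro bounded_linear_sum bounded_linear_scaleR_left[THEN bounded_linear_compose] bounded_linear_inner_left)
  have derF: "(\<Xi> has_derivative F y) (at y)" for y
  proof -
    have "((\<lambda>y. \<Sum>b\<in>Basis. (\<Xi> y \<bullet> b) *\<^sub>R b) has_derivative F y) (at y)"
      unfolding F_def by (intro has_derivative_sum has_derivative_scaleR_left has_derivative_grad pb)
    then show ?thesis by (simp add: euclidean_representation)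
  qed
  have FD: "F x = D" using has_derivative_unique[OF derF assms(2)] .
  define f' where "f' y = Blinfun (F y)" for y
  have app: "blinfun_apply (f' y) = F y" for y
    unfolding f'_def by (rule bounded_linear_Blinfun_apply[OF blF])
  have cont: "continuous_on UNIV f'"
  proof (rule continuous_on_blinfun_componentwise)
    fix h :: 'a
    have "continuous_on UNIV (\<lambda>y. F y h)"
      unfolding F_def
      by (intro continuous_intros continuous_on_polymonial_function polynomial_function_grad pb)
    then show "continuous_on UNIV (\<lambda>y. blinfun_apply (f' y) h)" by (simp add: app)
  qed
  have lin: "linear D" using assms(2) has_derivative_linear by blast
  moreover have "inj D"
    using assms(3) lin by (simp add: linear_injective_0)
  ultimately obtain G where G: "linear G" "G \<circ> D = id"
    using linear_injective_left_inverse by blast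
  have blG: "bounded_linear G" using G(1) linear_conv_bounded_linear by blast
  have inv: "Blinfun G o\<^sub>L f' x = id_blinfun"
  proof (rule blinfun_eqI)
    fix h show "blinfun_apply (Blinfun G o\<^sub>L f' x) h = blinfun_apply id_blinfun h"
      using fun_cong[OF G(2), of h] by (simp add: app FD bounded_linear_Blinfun_apply[OF blG])
  qed
  obtain A W g g' where A: "open A" "A \<subseteq> R" "x \<in> A" "open W" "\<Xi> x \<in> W" "homeomorphism A W \<Xi> g"
    "\<And>y. y \<in> W \<Longrightarrow> (g has_derivative (g' y)) (at y)"
  proof (rule inverse_function_theorem[where U = R and f = \<Xi> and f' = f' and invf = "Blinfun G"])
    show "(\<Xi> has_derivative blinfun_apply (f' y)) (at y)" for y using derF app by simp
    show "continuous_on R f'" by (rule continuous_on_subset[OF cont]) simp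
    fix A W g g'
    assume "open A" "A \<subseteq> R" "x \<in> A" "open W" "\<Xi> x \<in> W" "homeomorphism A W \<Xi> g"
      "\<And>y. y \<in> W \<Longrightarrow> (g has_derivative (g' y)) (at y)"
    then show thesis by (rule that)
  qed (rule assms(4), rule assms(5), rule inv)
  obtain \<delta> where d: "\<delta> > 0" "ball (\<Xi> x) \<delta> \<subseteq> W" using A(4,5) openE by blast
  define A' where "A' = A \<inter> \<Xi> -` ball (\<Xi> x) \<delta>"
  have "open A'"
    unfolding A'_def using continuous_on_polymonial_function[OF assms(1)] A(1)
    by (intro continuous_open_preimage) auto
  moreover have "homeomorphism A' (ball (\<Xi> x) \<delta>) \<Xi> g"
  proof (rule homeomorphism_of_subsets[OF A(6)])
    have "ball (\<Xi> x) \<delta> \<subseteq> \<Xi> ` A'"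
    proof
      fix y assume y: "y \<in> ball (\<Xi> x) \<delta>"
      then have "g y \<in> A" "\<Xi> (g y) = y" using A(6) d(2) unfolding homeomorphism_def by auto
      then show "y \<in> \<Xi> ` A'" using y unfolding A'_def by (metis IntI imageI vimageI)
    qed
    then show "\<Xi> ` A' = ball (\<Xi> x) \<delta>" unfolding A'_def by blast
  qed (use d in \<open>auto simp: A'_def\<close>)
  moreover have "g differentiable (at y)" if "y \<in> ball (\<Xi> x) \<delta>" for y
    using A(7) d(2) that unfolding differentiable_def by blast
  moreover have "x \<in> A'" using A(3) d(1) by (simp add: A'_def)
  moreover have "A' \<subseteq> R" using A(2) by (auto simp: A'_def)
  ultimately show ?thesis using d(1) by blast
qed

lemma mem_orthogonal_comp: "u \<in> orthogonal_comp W \<longleftrightarrow> (\<forall>X\<in>W. u \<bullet> X = 0)"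
proof -
  have "X \<bullet> u = u \<bullet> X" for X by (rule inner_commute)
  then show ?thesis by (simp add: orthogonal_comp_def orthogonal_def)
qed

lemma linear_gs_res: "linear (gs_res k a)"
proof (induct k)
  case 0
  then show ?case by (simp add: linear_iff)
next
  case (Suc k)
  then show ?case
    by (intro linearI) (simp_all add: linear_add linear_cmul inner_add_left scaleR_add_left scaleR_add_right
        scaleR_diff_right mult.commute)
qed

lemma gs_res_of_orthogonal:
  assumes "\<And>j. j < k \<Longrightarrow> a j \<bullet> y = 0"
  shows "gs_res k a y = gs_gram k a *\<^sub>R y"
proof -
  obtain e where e: "gs_res k a y = gs_gram k a *\<^sub>R y - (\<Sum>j<k. e j *\<^sub>R a j)"
    using gs_res_expand by blast
  define z where "z = gs_gram k a *\<^sub>R y - gs_res k a y"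
  have z1: "z = (\<Sum>j<k. e j *\<^sub>R a j)" using e by (simp add: z_def)
  have z2: "z \<bullet> a j = 0" if "j < k" for j
  proof -
    have "y \<bullet> a j = 0" using assms[OF that] by (simp only: inner_commute)
    then show ?thesis using gs_res_orthogonal[OF that, of a y] by (simp add: z_def inner_diff_left)
  qed
  have "z \<bullet> z = (\<Sum>j<k. e j * (z \<bullet> a j))"
    by (subst (2) z1) (simp add: inner_sum_right)
  also have "\<dots> = 0" using z2 by simp
  finally show ?thesis by (simp add: z_def)
qed

section \<open>Regular points\<close>

text \<open>\<open>sep_U\<close> tests with all basic polynomials, since this part of the proof
  concerns the whole algebra. It includes that a level set of the basic polynomials meeting
  \<open>U\<close> stays inside \<open>U\<close>.\<close>

locale manifold_map = submetry_map +
  fixes U :: "'a set"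
  assumes emb: "\<exists>d. embedded_submanifold d (\<sigma> -` {\<sigma> x})"
    and basic_r2: "basic r2"
    and open_U: "open U" and U_nonempty: "U \<noteq> {}"
    and sep_U: "x \<in> U \<Longrightarrow> (\<And>f. basic f \<Longrightarrow> f y = f x) \<Longrightarrow> y \<in> U \<and> \<sigma> y = \<sigma> x"
begin

lemma emb_fib: "\<exists>d. embedded_submanifold d (fib x)"
  using emb by (simp add: fib_def)

lemma self_fib: "x \<in> fib x" by (simp add: fib_iff)

lemma subspace_V: "subspace (V x)"
  using emb_fib embedded_submanifold_tangent(1)[OF _ self_fib] by blast

lemma dim_V_cong: "\<sigma> x = \<sigma> y \<Longrightarrow> dim (V x) = dim (V y)"
proof -
  assume xy: "\<sigma> x = \<sigma> y"
  obtain d where d: "embedded_submanifold d (fib x)" using emb_fib by blast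
  have "y \<in> fib x" using xy by (simp add: fib_iff)
  then have "dim (tang (fib x) y) = d" by (rule embedded_submanifold_tangent(2)[OF d])
  moreover have "dim (V x) = d" by (rule embedded_submanifold_tangent(2)[OF d self_fib])
  ultimately show ?thesis using fib_cong[OF xy] by simp
qed

lemma V_quadratic:
  "\<exists>C>0. \<exists>\<epsilon>>0. \<forall>m u. \<sigma> m = \<sigma> z \<longrightarrow> norm (m - z) < \<epsilon> \<longrightarrow> u \<in> orthogonal_comp (V z) \<longrightarrow>
        \<bar>u \<bullet> (m - z)\<bar> \<le> C * norm u * (norm (m - z))\<^sup>2"
proof -
  obtain d where d: "embedded_submanifold d (fib z)" using emb_fib by blast
  show ?thesis
    using embedded_submanifold_tangent(3)[OF d self_fib]
    unfolding mem_orthogonal_comp[symmetric] fib_iff[symmetric] by blast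
qed

lemma V_field:
  assumes "X \<in> V z"
  shows "\<exists>C>0. \<exists>\<epsilon>>0. \<forall>m. \<sigma> m = \<sigma> z \<longrightarrow> norm (m - z) < \<epsilon> \<longrightarrow> (\<exists>Y\<in>V m. norm (Y - X) \<le> C * norm (m - z))"
proof -
  obtain d where d: "embedded_submanifold d (fib z)" using emb_fib by blast
  obtain C \<epsilon> where C: "C > 0" "\<epsilon> > 0" "\<And>m. m \<in> fib z \<Longrightarrow> norm (m - z) < \<epsilon> \<Longrightarrow>
        \<exists>Y\<in>tang (fib z) m. norm (Y - X) \<le> C * norm (m - z)"
    using embedded_submanifold_tangent(4)[OF d self_fib] assms by blast
  have "\<exists>Y\<in>V m. norm (Y - X) \<le> C * norm (m - z)" if "\<sigma> m = \<sigma> z" "norm (m - z) < \<epsilon>" for m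
    using C(3)[of m] that fib_cong[OF that(1)] by (simp add: fib_iff)
  then show ?thesis using C(1,2) by blast
qed

text \<open>The argument for gradients with the chart estimate in place of Taylor expansion. It
  covers every normal direction of every fibre, including those that are not gradients of basic
  polynomials.\<close>

lemma normal_minimal:
  assumes "u \<in> orthogonal_comp (V z)"
  shows "\<exists>s0>0. \<forall>s\<in>{0..s0}. dist (\<sigma> z) (\<sigma> (z + s *\<^sub>R u)) = s * norm u"
proof -
  obtain C \<epsilon> where C: "C > 0" "\<epsilon> > 0" "\<And>m u. \<sigma> m = \<sigma> z \<Longrightarrow> norm (m - z) < \<epsilon> \<Longrightarrow> u \<in> orthogonal_comp (V z) \<Longrightarrow>
        \<bar>u \<bullet> (m - z)\<bar> \<le> C * norm u * (norm (m - z))\<^sup>2"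
    using V_quadratic by blast
  show ?thesis
  proof (rule minimal_segment[of "C * norm u + 1" \<epsilon>])
    show "C * norm u + 1 > 0" using C(1) by (simp add: add_nonneg_pos)
    fix m assume "\<sigma> m = \<sigma> z" "norm (m - z) < \<epsilon>"
    then have "u \<bullet> (m - z) \<le> C * norm u * (norm (m - z))\<^sup>2" using C(3) assms by fastforce
    also have "\<dots> \<le> (C * norm u + 1) * (norm (m - z))\<^sup>2" by (intro mult_right_mono) auto
    finally show "u \<bullet> (m - z) \<le> (C * norm u + 1) * (norm (m - z))\<^sup>2" .
  qed (rule C)
qed

text \<open>To first order only the normal part of the velocity moves away from the fibre. From
  above, a curve in the fibre with velocity \<open>a\<close> keeps pace up to the normal part; from
  below, testing a nearest point of the fibre against \<open>b\<close> loses only a quadratic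
  term.\<close>

lemma dist_first_order:
  assumes x: "x (0::real) = z" "(x has_vector_derivative a + b) (at 0)"
    and ab: "a \<in> V z" "b \<in> orthogonal_comp (V z)"
  shows "((\<lambda>s. dist (\<sigma> (x s)) (\<sigma> z) / s) \<longlongrightarrow> norm b) (at_right 0)"
proof -
  obtain \<gamma> where g: "\<gamma> (0::real) = z" "\<And>s. \<gamma> s \<in> fib z" "(\<gamma> has_vector_derivative a) (at 0)"
    using ab(1) unfolding tang_def by blast
  obtain C \<epsilon> where C: "C > 0" "\<epsilon> > 0" "\<And>m u. \<sigma> m = \<sigma> z \<Longrightarrow> norm (m - z) < \<epsilon> \<Longrightarrow> u \<in> orthogonal_comp (V z) \<Longrightarrow>
        \<bar>u \<bullet> (m - z)\<bar> \<le> C * norm u * (norm (m - z))\<^sup>2"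
    using V_quadratic by blast
  have at: "at_right (0::real) \<le> at 0" by (simp add: at_le)
  have X: "((\<lambda>s. (1 / s) *\<^sub>R (x s - z)) \<longlongrightarrow> a + b) (at_right 0)"
    using vector_derivative_quotient[OF x(2)] x(1) tendsto_mono[OF at] by simp
  have G: "((\<lambda>s. (1 / s) *\<^sub>R (\<gamma> s - z)) \<longlongrightarrow> a) (at_right 0)"
    using vector_derivative_quotient[OF g(3)] g(1) tendsto_mono[OF at] by simp
  have "((\<lambda>s. norm ((1 / s) *\<^sub>R (x s - z) - (1 / s) *\<^sub>R (\<gamma> s - z))) \<longlongrightarrow> norm (a + b - a)) (at_right 0)"
    by (intro tendsto_intros X G)
  then have up: "((\<lambda>s. norm ((1 / s) *\<^sub>R (x s - z) - (1 / s) *\<^sub>R (\<gamma> s - z))) \<longlongrightarrow> norm b) (at_right 0)" by simp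
  have pos: "\<forall>\<^sub>F s in at_right (0::real). 0 < s" by (simp add: eventually_at_filter)
  have upper: "\<forall>\<^sub>F s in at_right 0. dist (\<sigma> (x s)) (\<sigma> z) / s \<le> norm ((1 / s) *\<^sub>R (x s - z) - (1 / s) *\<^sub>R (\<gamma> s - z))"
    using pos
  proof eventually_elim
    case (elim s)
    have "dist (\<sigma> (x s)) (\<sigma> z) \<le> norm (x s - \<gamma> s)"
      using dist_sigma_le[of "x s" "\<gamma> s"] g(2)[of s] by (simp add: fib_iff dist_norm)
    moreover have "norm ((1 / s) *\<^sub>R (x s - z) - (1 / s) *\<^sub>R (\<gamma> s - z)) = norm (x s - \<gamma> s) / s"
      using elim by (simp add: scaleR_diff_right[symmetric])
    ultimately show ?case using elim by (simp add: divide_right_mono)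
  qed
  show ?thesis
  proof (cases "b = 0")
    case True
    show ?thesis
    proof (rule tendsto_sandwich[OF _ upper _ up])
      show "\<forall>\<^sub>F s in at_right 0. 0 \<le> dist (\<sigma> (x s)) (\<sigma> z) / s" using pos by eventually_elim simp
    qed (simp add: True)
  next
    case False
    have bx: "((\<lambda>s. b \<bullet> ((1 / s) *\<^sub>R (x s - z)) / norm b) \<longlongrightarrow> b \<bullet> (a + b) / norm b) (at_right 0)"
      using False by (intro tendsto_intros X) auto
    have "b \<bullet> a = 0" using ab by (simp add: mem_orthogonal_comp)
    then have bb: "b \<bullet> (a + b) / norm b = norm b"
      using False by (simp add: inner_add_right dot_square_norm power2_eq_square)
    have xz: "(x \<longlongrightarrow> z) (at_right 0)"
      using has_vector_derivative_continuous[OF x(2)] x(1) tendsto_mono[OF at] by (simp add: continuous_at)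
    have err: "((\<lambda>s. 4 * C * norm ((1 / s) *\<^sub>R (x s - z)) * norm (x s - z)) \<longlongrightarrow> 4 * C * norm (a + b) * norm (z - z)) (at_right 0)"
      by (intro tendsto_intros X xz)
    have "((\<lambda>s. b \<bullet> ((1 / s) *\<^sub>R (x s - z)) / norm b - 4 * C * norm ((1 / s) *\<^sub>R (x s - z)) * norm (x s - z)) \<longlongrightarrow> norm b) (at_right 0)"
      using tendsto_diff[OF bx err] bb by simp
    moreover have "\<forall>\<^sub>F s in at_right 0. b \<bullet> ((1 / s) *\<^sub>R (x s - z)) / norm b - 4 * C * norm ((1 / s) *\<^sub>R (x s - z)) * norm (x s - z)
       \<le> dist (\<sigma> (x s)) (\<sigma> z) / s"
    proof -
      have "\<forall>\<^sub>F s in at_right 0. dist (x s) z < \<epsilon> / 2"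
        using tendstoD[OF xz, of "\<epsilon> / 2"] C(2) by simp
      with pos show ?thesis
      proof eventually_elim
        case (elim s)
        obtain m where m: "\<sigma> m = \<sigma> z" "dist (x s) m = dist (\<sigma> (x s)) (\<sigma> z)" using lift_point by blast
        have "norm (m - z) \<le> dist (x s) m + dist (x s) z"
          using dist_triangle[of m z "x s"] by (simp add: dist_norm norm_minus_commute)
        \<comment> \<open>A nearest point of the fibre is as close to \<open>z\<close> as the curve
          is, up to the factor 2, so the quadratic error is of order \<open>s^2\<close>; the
          constant 4 below is the square of this factor.\<close>
        then have mz: "norm (m - z) \<le> 2 * norm (x s - z)"
          using m(2) dist_sigma_le[of "x s" z] by (simp add: dist_norm)
        then have "norm (m - z) < \<epsilon>" using elim(2) by (simp add: dist_norm)
        then have "b \<bullet> (m - z) \<le> C * norm b * (norm (m - z))\<^sup>2" using C(3)[OF m(1) _ ab(2)] by fastforce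
        also have "\<dots> \<le> C * norm b * (2 * norm (x s - z))\<^sup>2"
          using mz C(1) by (intro mult_left_mono power_mono) auto
        finally have 1: "b \<bullet> (m - z) \<le> 4 * C * norm b * (norm (x s - z))\<^sup>2" by (simp add: power_mult_distrib)
        have "b \<bullet> (x s - m) \<le> norm b * norm (x s - m)" by (rule norm_cauchy_schwarz)
        moreover have "b \<bullet> (x s - m) = b \<bullet> (x s - z) - b \<bullet> (m - z)" by (simp add: inner_diff_right)
        ultimately have "b \<bullet> (x s - z) - 4 * C * norm b * (norm (x s - z))\<^sup>2 \<le> norm b * dist (\<sigma> (x s)) (\<sigma> z)"
          using 1 m(2) by (simp add: dist_norm)
        then have "(b \<bullet> (x s - z) - 4 * C * norm b * (norm (x s - z))\<^sup>2) / (norm b * s) \<le> norm b * dist (\<sigma> (x s)) (\<sigma> z) / (norm b * s)"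
          using elim(1) False by (intro divide_right_mono) auto
        moreover have "norm b * dist (\<sigma> (x s)) (\<sigma> z) / (norm b * s) = dist (\<sigma> (x s)) (\<sigma> z) / s"
          using False by simp
        moreover have "(b \<bullet> (x s - z) - 4 * C * norm b * (norm (x s - z))\<^sup>2) / (norm b * s)
          = b \<bullet> ((1 / s) *\<^sub>R (x s - z)) / norm b - 4 * C * norm ((1 / s) *\<^sub>R (x s - z)) * norm (x s - z)"
        proof -
          have n: "norm ((1 / s) *\<^sub>R (x s - z)) = norm (x s - z) / s" using elim(1) by simp
          have alg: "(P - 4 * C * nb * N\<^sup>2) / (nb * s) = 1 / s * P / nb - 4 * C * (N / s) * N"
            if "nb \<noteq> 0" for P N nb :: real
            using that elim(1) by (simp add: field_simps power2_eq_square)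
          show ?thesis unfolding n inner_scaleR_right by (rule alg) (use False in simp)
        qed
        ultimately show ?case by simp
      qed
    qed
    ultimately show ?thesis
      by (intro tendsto_sandwich[OF _ upper _ up])
  qed
qed

text \<open>The length of the normal part of a velocity is determined by the image curve in the
  target space. Being metric, it can be compared at singular fibres, too.\<close>

lemma normal_part_eq:
  assumes "x (0::real) = z" "(x has_vector_derivative a + b) (at 0)" "a \<in> V z" "b \<in> orthogonal_comp (V z)"
    and "x' (0::real) = z'" "(x' has_vector_derivative a' + b') (at 0)" "a' \<in> V z'" "b' \<in> orthogonal_comp (V z')"
    and "\<sigma> z = \<sigma> z'" "\<forall>\<^sub>F s in at_right 0. \<sigma> (x s) = \<sigma> (x' s)"
  shows "norm b = norm b'"
proof (rule tendsto_unique)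
  show "((\<lambda>s. dist (\<sigma> (x s)) (\<sigma> z) / s) \<longlongrightarrow> norm b) (at_right 0)"
    by (rule dist_first_order[OF assms(1-4)])
  have "((\<lambda>s. dist (\<sigma> (x' s)) (\<sigma> z') / s) \<longlongrightarrow> norm b') (at_right 0)"
    by (rule dist_first_order[OF assms(5-8)])
  moreover have "\<forall>\<^sub>F s in at_right 0. dist (\<sigma> (x' s)) (\<sigma> z') / s = dist (\<sigma> (x s)) (\<sigma> z) / s"
    using assms(10) by eventually_elim (simp add: assms(9))
  ultimately show "((\<lambda>s. dist (\<sigma> (x s)) (\<sigma> z) / s) \<longlongrightarrow> norm b') (at_right 0)"
    by (rule Lim_transform_eventually)
qed simp

subsection \<open>A maximal family of basic polynomials with independent gradients\<close>

definition rank_at_least :: "nat \<Rightarrow> (nat \<Rightarrow> 'a \<Rightarrow> real) \<Rightarrow> 'a \<Rightarrow> bool" where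
  "rank_at_least k F x \<longleftrightarrow> (\<forall>j<k. basic (F j)) \<and> lin_indep k (\<lambda>j. grad (F j) x)"

definition kmax :: nat where
  "kmax = Max {k. \<exists>F x. rank_at_least k F x}"

text \<open>One family of maximal rank is fixed for the whole proof; it plays the role of
  coordinates transverse to the regular fibres.\<close>

definition bas :: "nat \<Rightarrow> 'a \<Rightarrow> real" where
  "bas = (SOME F. \<exists>x. rank_at_least kmax F x)"

text \<open>Tied to the single family \<open>bas\<close>, so that regularity is the non-vanishing of
  one polynomial: it holds on an open dense set, and on a line it fails at finitely many points or
  everywhere.\<close>

definition reg :: "'a \<Rightarrow> bool" where
  "reg x \<longleftrightarrow> lin_indep kmax (\<lambda>j. grad (bas j) x)"

text \<open>The relation seen by basic polynomials alone. At regular points it will turn out to be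
  equality of fibres, by \<open>reg_separates\<close>.\<close>

definition beq :: "'a \<Rightarrow> 'a \<Rightarrow> bool" where
  "beq x y \<longleftrightarrow> (\<forall>f. basic f \<longrightarrow> f x = f y)"

text \<open>Constant coefficients suffice: a vector normal to the fibre at one regular point is the
  gradient there of such a combination, and the combination transports it to the other points of the
  fibre.\<close>

definition comb :: "(nat \<Rightarrow> real) \<Rightarrow> 'a \<Rightarrow> real" where
  "comb c x = (\<Sum>j<kmax. c j * bas j x)"

abbreviation K :: "'a \<Rightarrow> 'a set" where
  "K x \<equiv> {Y. \<forall>j<kmax. grad (bas j) x \<bullet> Y = 0}"

lemma finite_ranks: "finite {k. \<exists>F x. rank_at_least k F x}"
  by (rule finite_subset[of _ "{..DIM('a)}"]) (auto simp: rank_at_least_def dest: lin_indep_le_DIM)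

lemma kmax_maximal: "rank_at_least k F x \<Longrightarrow> k \<le> kmax"
  unfolding kmax_def by (rule Max_ge[OF finite_ranks]) blast

lemma bas_exists: "\<exists>x. rank_at_least kmax bas x"
proof -
  have "rank_at_least 0 (\<lambda>_ _. 0) 0" by (simp add: rank_at_least_def lin_indep_def)
  then have "{k. \<exists>F x. rank_at_least k F x} \<noteq> {}" by blast
  from Max_in[OF finite_ranks this] have "\<exists>F x. rank_at_least kmax F x"
    unfolding kmax_def by simp
  then show ?thesis unfolding bas_def by (rule someI_ex)
qed

lemma bas_basic: "j < kmax \<Longrightarrow> basic (bas j)"
  using bas_exists by (auto simp: rank_at_least_def)

lemma bas_poly: "j < kmax \<Longrightarrow> real_polynomial_function (bas j)"
  by (rule basic_poly[OF bas_basic])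

lemma basic_cmult: "basic f \<Longrightarrow> basic (\<lambda>x. c * f x)"
  by (rule basic_mult[OF basic_const])

lemma basic_comb: "basic (comb c)"
  unfolding comb_def[abs_def] by (intro basic_sum basic_cmult bas_basic) auto

lemma grad_comb: "grad (comb c) x = (\<Sum>j<kmax. c j *\<^sub>R grad (bas j) x)"
proof -
  have "grad (comb c) x = (\<Sum>j<kmax. grad (\<lambda>x. c j * bas j x) x)"
    unfolding comb_def[abs_def] by (rule grad_sum) (auto intro: rpf_mult rpf_const bas_poly)
  also have "\<dots> = (\<Sum>j<kmax. c j *\<^sub>R grad (bas j) x)"
    by (rule sum.cong) (auto simp: grad_cmult bas_poly)
  finally show ?thesis .
qed

text \<open>Otherwise \<open>f\<close> could be added to \<open>bas\<close>, and the rank at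
  \<open>x\<close> would exceed the maximum.\<close>

lemma grad_span:
  assumes "reg x" "basic f"
  shows "\<exists>c. grad f x = grad (comb c) x"
proof (rule ccontr)
  assume no: "\<not> ?thesis"
  have "lin_indep (Suc kmax) ((\<lambda>j. grad (bas j) x)(kmax := grad f x))"
    by (rule lin_indep_extend) (use assms(1) no in \<open>auto simp: reg_def grad_comb\<close>)
  moreover have "(\<lambda>j. grad (bas j) x)(kmax := grad f x) = (\<lambda>j. grad ((bas(kmax := f)) j) x)" by auto
  ultimately have "rank_at_least (Suc kmax) (bas(kmax := f)) x"
    using assms(2) bas_basic by (auto simp: rank_at_least_def less_Suc_eq)
  then show False using kmax_maximal by fastforce
qed

definition regP :: "'a \<Rightarrow> real" where
  "regP x = gs_gram kmax (\<lambda>j. grad (bas j) x)"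

lemma reg_iff: "reg x \<longleftrightarrow> regP x \<noteq> 0"
  by (simp add: reg_def regP_def gs_gram_nonzero_iff)

lemma regP_poly: "real_polynomial_function regP"
  unfolding regP_def[abs_def] by (intro gs_gram_polynomial polynomial_function_grad bas_poly)

lemma open_reg: "open {x. reg x}"
proof -
  have "continuous_on UNIV regP"
    using continuous_on_polymonial_function[of regP UNIV] regP_poly real_polynomial_function_eq by blast
  then have "open (regP -` (- {0}))" by (intro open_vimage) auto
  moreover have "regP -` (- {0}) = {x. reg x}" by (auto simp: reg_iff)
  ultimately show ?thesis by simp
qed

lemma reg_dense: "open A \<Longrightarrow> A \<noteq> {} \<Longrightarrow> \<exists>x\<in>A. reg x"
proof -
  assume A: "open A" "A \<noteq> {}"
  obtain x0 where "rank_at_least kmax bas x0" using bas_exists by blast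
  then have "regP x0 \<noteq> 0" by (simp add: rank_at_least_def regP_def gs_gram_nonzero_iff)
  from real_polynomial_dense_nonzero[OF regP_poly this A] show ?thesis by (simp add: reg_iff)
qed

lemma beq_sigma: "\<sigma> x = \<sigma> y \<Longrightarrow> beq x y"
  unfolding beq_def using basic_eq by blast

lemma beq_sym: "beq x y \<Longrightarrow> beq y x"
  unfolding beq_def by metis

lemma norm_grad_beq:
  assumes "beq x y" "basic f"
  shows "norm (grad f x) = norm (grad f y)"
proof -
  have "grad_inner f f x = grad_inner f f y"
    using assms basic_grad_inner[OF assms(2,2)] unfolding beq_def by blast
  then show ?thesis by (simp add: grad_inner_eq dot_square_norm)
qed

text \<open>The squared norm of \<open>grad (comb c)\<close> is a basic polynomial for every
  \<open>c\<close>, so the gradients of \<open>bas\<close> satisfy the same linear relations at both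
  points.\<close>

lemma reg_beq:
  assumes "reg x" "beq x y"
  shows "reg y"
  unfolding reg_def lin_indep_def
proof (intro allI impI)
  fix c j assume z: "(\<Sum>j<kmax. c j *\<^sub>R grad (bas j) y) = 0" and j: "j < kmax"
  then have "norm (grad (comb c) x) = 0"
    using norm_grad_beq[OF assms(2) basic_comb, of c] by (simp add: grad_comb)
  then have "(\<Sum>j<kmax. c j *\<^sub>R grad (bas j) x) = 0" by (simp add: grad_comb)
  then show "c j = 0" using assms(1) j unfolding reg_def lin_indep_def by blast
qed

lemma reg_sigma: "\<sigma> x = \<sigma> y \<Longrightarrow> reg x \<Longrightarrow> reg y"
  using reg_beq beq_sigma by blast

text \<open>This is the equality case of the Cauchy--Schwarz inequality.\<close>

lemma horizontal_unique:
  assumes "beq x y" "v = grad (comb c) x" "norm w \<le> norm v"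
    "\<And>j. j < kmax \<Longrightarrow> grad (bas j) y \<bullet> w = grad (bas j) x \<bullet> v"
  shows "w = grad (comb c) y"
proof -
  define v' where "v' = grad (comb c) y"
  have n: "norm v' = norm v"
    using norm_grad_beq[OF assms(1) basic_comb, of c] by (simp add: v'_def assms(2))
  have "v' \<bullet> w = (\<Sum>j<kmax. c j * (grad (bas j) y \<bullet> w))"
    by (simp add: v'_def grad_comb inner_sum_left)
  also have "\<dots> = (\<Sum>j<kmax. c j * (grad (bas j) x \<bullet> v))"
    by (rule sum.cong) (auto simp: assms(4))
  also have "\<dots> = v \<bullet> v"
  proof -
    have "v \<bullet> v = (\<Sum>j<kmax. c j *\<^sub>R grad (bas j) x) \<bullet> v" using assms(2) grad_comb by metis
    then show ?thesis by (simp add: inner_sum_left)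
  qed
  finally have "v' \<bullet> w = (norm v)\<^sup>2" by (simp add: dot_square_norm)
  moreover have "(norm (w - v'))\<^sup>2 = (norm w)\<^sup>2 - 2 * (v' \<bullet> w) + (norm v')\<^sup>2"
    unfolding power2_norm_eq_inner by (simp add: inner_diff_left inner_diff_right inner_commute)
  moreover have "(norm w)\<^sup>2 \<le> (norm v)\<^sup>2" using assms(3) by (simp add: power_mono)
  ultimately have "(norm (w - v'))\<^sup>2 \<le> 0" using n by simp
  then show ?thesis by (simp add: v'_def)
qed

text \<open>Lying in the span of the gradients is expressed by a polynomial residual along the line,
  which vanishes everywhere once it vanishes on an interval. At a regular parameter a zero residual
  means membership again.\<close>

lemma comb_span_line:
  assumes "a < b" "\<And>s. a < s \<Longrightarrow> s < b \<Longrightarrow> \<exists>c. w = grad (comb c) (x + s *\<^sub>R v)" "reg (x + t *\<^sub>R v)"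
  shows "\<exists>c. w = grad (comb c) (x + t *\<^sub>R v)"
proof -
  define r where "r s = gs_res kmax (\<lambda>j. grad (bas j) (x + s *\<^sub>R v)) w" for s
  have pr: "polynomial_function r"
    unfolding r_def[abs_def]
    by (intro gs_res_polynomial polynomial_line[OF polynomial_function_grad[OF bas_poly]]) auto
  have z: "r s = 0" if "a < s" "s < b" for s
    using assms(2)[OF that] gs_res_span by (auto simp: r_def grad_comb)
  have "r t \<bullet> e = 0" for e
    by (rule real_polynomial_zero_interval[of "\<lambda>s. r s \<bullet> e" a b])
      (use assms(1) z real_polynomial_inner[OF pr polynomial_function_const] in auto)
  from this[of "r t"] have "r t = 0" by simp
  then show ?thesis
    using gs_res_eq_0_iff[of kmax "\<lambda>j. grad (bas j) (x + t *\<^sub>R v)" w] assms(3)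
    by (simp add: r_def reg_def gs_gram_nonzero_iff grad_comb)
qed

text \<open>At regular points gradients of basic polynomials are combinations of those of
  \<open>bas\<close>, so a curve along which all \<open>bas j\<close> are constant has velocity
  orthogonal to all of them.\<close>

lemma level_curve_beq:
  assumes \<gamma>: "\<And>s. a < s \<Longrightarrow> s < b \<Longrightarrow> \<gamma> differentiable (at s)"
    and reg: "\<And>s. a < s \<Longrightarrow> s < b \<Longrightarrow> reg (\<gamma> s)"
    and const: "\<And>s j. a < s \<Longrightarrow> s < b \<Longrightarrow> j < kmax \<Longrightarrow> bas j (\<gamma> s) = e j"
    and st: "a < s" "s < b" "a < t" "t < b"
  shows "beq (\<gamma> s) (\<gamma> (t::real))"
  unfolding beq_def
proof (intro allI impI)
  fix f assume f: "basic f"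
  have chain: "((\<lambda>s. h (\<gamma> s)) has_real_derivative (X \<bullet> grad h (\<gamma> s))) (at s)"
    if "(\<gamma> has_vector_derivative X) (at s)" "real_polynomial_function h" for h s X
  proof -
    have "((\<lambda>s. h (\<gamma> s)) has_derivative (\<lambda>t. (t *\<^sub>R X) \<bullet> grad h (\<gamma> s))) (at s)"
      by (rule has_derivative_compose[OF that(1)[unfolded has_vector_derivative_def] has_derivative_grad[OF that(2)]])
    then show ?thesis by (simp add: has_field_derivative_def mult_commute_abs)
  qed
  have "((\<lambda>s. f (\<gamma> s)) has_real_derivative 0) (at r)" if r: "a < r" "r < b" for r
  proof -
    obtain X where X: "(\<gamma> has_vector_derivative X) (at r)"
      using \<gamma>[OF r] vector_derivative_works by blast
    have j0: "X \<bullet> grad (bas j) (\<gamma> r) = 0" if j: "j < kmax" for j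
    proof -
      have "((\<lambda>s. bas j (\<gamma> s)) has_real_derivative (X \<bullet> grad (bas j) (\<gamma> r))) (at r)"
        by (rule chain[OF X bas_poly[OF j]])
      moreover have "((\<lambda>s. bas j (\<gamma> s)) has_real_derivative 0) (at r)"
      proof (rule has_field_derivative_transform_within_open[of "\<lambda>s. e j" _ _ "{a<..<b}"])
        fix s assume "s \<in> {a<..<b}"
        then show "e j = bas j (\<gamma> s)" using const j by simp
      qed (use r in auto)
      ultimately show ?thesis by (rule DERIV_unique)
    qed
    obtain c where "grad f (\<gamma> r) = grad (comb c) (\<gamma> r)" using grad_span[OF reg[OF r] f] by blast
    then have "X \<bullet> grad f (\<gamma> r) = 0" using j0 by (simp add: grad_comb inner_sum_right)
    then show ?thesis using chain[OF X basic_poly[OF f]] by simp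
  qed
  then show "f (\<gamma> s) = f (\<gamma> t)"
    using DERIV_isconst3[of a b s t "\<lambda>s. f (\<gamma> s)"] st by auto
qed

text \<open>Moving in a direction of \<open>K x\<close> in the coordinates \<open>\<Xi>\<close> keeps every \<open>bas j\<close>, hence every basic
  polynomial, constant.\<close>

lemma level_coordinates:
  assumes x: "reg x" and A: "A \<subseteq> {y. reg y}"
    and L: "\<And>y. L y \<in> K x"
    and \<Xi>: "\<And>y. \<Xi> y = (\<Sum>j<kmax. bas j y *\<^sub>R grad (bas j) x) + L y"
    and hom: "homeomorphism A (ball p \<delta>) \<Xi> g" and diff: "\<And>y. y \<in> ball p \<delta> \<Longrightarrow> g differentiable (at y)"
    and cd: "\<And>s. a < s \<Longrightarrow> s < b \<Longrightarrow> q + s *\<^sub>R d \<in> ball p \<delta>" "d \<in> K x"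
    and st: "a < s" "s < b" "a < t" "t < b"
  shows "beq (g (q + s *\<^sub>R d)) (g (q + t *\<^sub>R d))"
proof (rule level_curve_beq[where \<gamma> = "\<lambda>s. g (q + s *\<^sub>R d)" and a = a and b = b, OF _ _ _ st])
  fix s assume s: "a < s" "s < b"
  have "(\<lambda>s. q + s *\<^sub>R d) differentiable (at s)" by (auto intro!: derivative_intros)
  then show "(\<lambda>s. g (q + s *\<^sub>R d)) differentiable (at s)"
    using differentiable_chain_at[of "\<lambda>s. q + s *\<^sub>R d" s g] diff[OF cd(1)[OF s]] by (simp add: o_def)
  have "g (q + s *\<^sub>R d) \<in> A" using hom cd(1)[OF s] unfolding homeomorphism_def by blast
  then show "reg (g (q + s *\<^sub>R d))" using A by blast
  fix j assume j: "j < kmax"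
  define c where "c j = bas j (g (q + s *\<^sub>R d)) - bas j (g (q + t *\<^sub>R d))" for j
  have Xg: "\<Xi> (g (q + r *\<^sub>R d)) = q + r *\<^sub>R d" if "a < r" "r < b" for r
    using hom cd(1)[OF that] unfolding homeomorphism_def by blast
  have sub: "subspace (K x)" by (rule subspace_orth_family)
  have "(\<Sum>j<kmax. c j *\<^sub>R grad (bas j) x) =
     (s - t) *\<^sub>R d - (L (g (q + s *\<^sub>R d)) - L (g (q + t *\<^sub>R d)))"
  proof -
    have "(\<Sum>j<kmax. c j *\<^sub>R grad (bas j) x) = (\<Sum>j<kmax. bas j (g (q + s *\<^sub>R d)) *\<^sub>R grad (bas j) x)
      - (\<Sum>j<kmax. bas j (g (q + t *\<^sub>R d)) *\<^sub>R grad (bas j) x)"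
      by (simp add: c_def scaleR_diff_left sum_subtractf)
    also have "\<dots> = (\<Xi> (g (q + s *\<^sub>R d)) - L (g (q + s *\<^sub>R d))) - (\<Xi> (g (q + t *\<^sub>R d)) - L (g (q + t *\<^sub>R d)))"
      by (simp add: \<Xi>)
    also have "\<dots> = (s - t) *\<^sub>R d - (L (g (q + s *\<^sub>R d)) - L (g (q + t *\<^sub>R d)))"
      unfolding Xg[OF s] Xg[OF st(3,4)] by (simp add: algebra_simps)
    finally show ?thesis .
  qed
  moreover have "(s - t) *\<^sub>R d - (L (g (q + s *\<^sub>R d)) - L (g (q + t *\<^sub>R d))) \<in> K x"
    using sub cd(2) L by (meson subspace_diff subspace_scale)
  \<comment> \<open>The sum is a combination of the gradients at \<open>x\<close> and at the same
    time orthogonal to all of them; hence it is zero.\<close>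
  ultimately have "(\<Sum>j<kmax. c j *\<^sub>R grad (bas j) x) \<in> K x" by simp
  then have "(\<Sum>j<kmax. c j *\<^sub>R grad (bas j) x) \<bullet> (\<Sum>j<kmax. c j *\<^sub>R grad (bas j) x) = 0"
    by (subst inner_sum_left) simp
  then have "(\<Sum>j<kmax. c j *\<^sub>R grad (bas j) x) = 0" by simp
  then have "c j = 0" using x j unfolding reg_def lin_indep_def by blast
  then show "bas j (g (q + s *\<^sub>R d)) = bas j (g (q + t *\<^sub>R d))" by (simp add: c_def)
qed

lemma tangent_subset: "V x \<subseteq> K x"
  using grad_orthogonal_tangent bas_basic by blast

text \<open>An implicit function argument: \<open>\<Xi>\<close> combines the values of
  \<open>bas\<close> with a multiple of the projection to \<open>K x\<close>, and pulling back a
  line in direction \<open>Y\<close> gives a curve on which basic polynomials are constant.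
  Separation at \<open>x\<close> is a hypothesis because it is at first available only inside
  \<open>U\<close>; used there, this lemma helps to extend separation to all regular points.\<close>

lemma tangent_eq_kernel_aux:
  assumes x: "reg x" and sep: "\<And>y. beq y x \<Longrightarrow> \<sigma> y = \<sigma> x"
  shows "V x = K x"
proof (intro subset_antisym tangent_subset subsetI)
  fix Y assume Y: "Y \<in> K x"
  define gr where "gr j = grad (bas j) x" for j
  define L where "L = gs_res kmax gr"
  define \<Xi> where "\<Xi> y = (\<Sum>j<kmax. bas j y *\<^sub>R grad (bas j) x) + L y" for y
  have gram: "gs_gram kmax gr \<noteq> 0" using x unfolding reg_def gr_def gs_gram_nonzero_iff .
  have LK: "L y \<in> K x" for y
    using gs_res_orthogonal[of _ kmax gr y] by (simp add: L_def gr_def inner_commute)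
  have L_Y: "L y = gs_gram kmax gr *\<^sub>R y" if "y \<in> K x" for y
    unfolding L_def by (rule gs_res_of_orthogonal) (use that in \<open>simp add: gr_def\<close>)
  have linL: "linear L" unfolding L_def by (rule linear_gs_res)
  have poly: "polynomial_function \<Xi>"
    unfolding \<Xi>_def[abs_def] L_def
    by (intro polynomial_function_add polynomial_function_sum polynomial_function_mult gs_res_polynomial)
      (auto simp: real_polynomial_function_eq[symmetric] bas_poly)
  define D where "D h = (\<Sum>j<kmax. (h \<bullet> gr j) *\<^sub>R gr j) + L h" for h
  have der: "(\<Xi> has_derivative D) (at x)"
    unfolding \<Xi>_def D_def gr_def
    by (intro has_derivative_add has_derivative_sum has_derivative_scaleR_left has_derivative_grad bas_poly
        linear_imp_has_derivative linL) auto
  have DY: "D Y = gs_gram kmax gr *\<^sub>R Y"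
    using Y L_Y[OF Y] by (simp add: D_def gr_def inner_commute)
  have subK: "subspace (K x)" by (rule subspace_orth_family)
  have li: "lin_indep kmax gr" using x unfolding reg_def gr_def[abs_def] .
  have inj: "h = 0" if "D h = 0" for h
  proof -
    have "(\<Sum>j<kmax. (h \<bullet> gr j) *\<^sub>R gr j) = - L h" using that by (simp add: D_def add_eq_0_iff2)
    then have "(\<Sum>j<kmax. (h \<bullet> gr j) *\<^sub>R gr j) \<in> K x"
      by (simp only:) (rule subspace_neg[OF subK LK])
    then have "(\<Sum>j<kmax. (h \<bullet> gr j) *\<^sub>R gr j) \<bullet> (\<Sum>j<kmax. (h \<bullet> gr j) *\<^sub>R gr j) = 0"
      by (subst inner_sum_left) (simp add: gr_def)
    then have z: "(\<Sum>j<kmax. (h \<bullet> gr j) *\<^sub>R gr j) = 0" by simp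
    have "\<forall>j<kmax. h \<bullet> gr j = 0"
      using li[unfolded lin_indep_def, THEN spec[where x = "\<lambda>j. h \<bullet> gr j"]] z by blast
    then have "h \<in> K x" by (simp add: gr_def inner_commute)
    moreover have "L h = 0" using that z by (simp add: D_def)
    ultimately show "h = 0" using L_Y[of h] gram by simp
  qed
  obtain A \<delta> g where A: "open A" "x \<in> A" "A \<subseteq> {y. reg y}" "\<delta> > 0" "homeomorphism A (ball (\<Xi> x) \<delta>) \<Xi> g"
    "\<forall>y\<in>ball (\<Xi> x) \<delta>. g differentiable (at y)"
    using polynomial_local_inverse[OF poly der inj open_reg] x by auto
  define \<gamma> where "\<gamma> s = g (\<Xi> x + s *\<^sub>R Y)" for s :: real
  have g0: "\<gamma> 0 = x" using A(2,5) unfolding homeomorphism_def by (simp add: \<gamma>_def)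
  define b where "b = \<delta> / (norm Y + 1)"
  have b: "b > 0" using A(4) by (simp add: b_def add_nonneg_pos)
  have in_ball: "\<Xi> x + s *\<^sub>R Y \<in> ball (\<Xi> x) \<delta>" if "- b < s" "s < b" for s
  proof -
    have "\<bar>s\<bar> * (norm Y + 1) < \<delta>"
      using that by (simp add: b_def pos_less_divide_eq[symmetric] add_nonneg_pos abs_less_iff)
    moreover have "\<bar>s\<bar> * norm Y \<le> \<bar>s\<bar> * (norm Y + 1)" by (simp add: mult_left_mono)
    ultimately show ?thesis by (simp add: dist_norm)
  qed
  have mem: "\<gamma> s \<in> fib x" if "- b < s" "s < b" for s
  proof -
    have "beq (\<gamma> s) (\<gamma> 0)"
      unfolding \<gamma>_def
      by (rule level_coordinates[OF x A(3) LK \<Xi>_def A(5) A(6)[rule_format] in_ball Y]) (use that b in auto)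
    then show ?thesis using sep g0 by (simp add: fib_iff)
  qed
  have "g differentiable (at (\<Xi> x))" using A(4,6) by simp
  then obtain g' where g': "(g has_derivative g') (at (\<Xi> x))" unfolding differentiable_def by blast
  have "((\<lambda>y. g (\<Xi> y)) has_derivative (\<lambda>h. g' (D h))) (at x)"
    by (rule has_derivative_compose[OF der g'])
  moreover have "((\<lambda>y. g (\<Xi> y)) has_derivative (\<lambda>h. h)) (at x)"
    by (rule has_derivative_transform_within_open[OF has_derivative_ident A(1,2)])
      (use A(5) in \<open>auto simp: homeomorphism_def\<close>)
  ultimately have g'D: "g' (D h) = h" for h using has_derivative_unique by metis
  have lin': "linear g'" using g' has_derivative_linear by blast
  have g'Y: "g' Y = (1 / gs_gram kmax gr) *\<^sub>R Y"
  proof -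
    have "gs_gram kmax gr *\<^sub>R g' Y = Y" using g'D[of Y] lin' by (simp add: DY linear_cmul)
    then have "(1 / gs_gram kmax gr) *\<^sub>R (gs_gram kmax gr *\<^sub>R g' Y) = (1 / gs_gram kmax gr) *\<^sub>R Y" by simp
    then show ?thesis using gram by simp
  qed
  \<comment> \<open>The unnormalised residual multiplies vectors of \<open>K x\<close> by
    \<open>gs_gram\<close>, hence the reciprocal in the velocity; the factor is removed at the
    end.\<close>
  have "(1 / gs_gram kmax gr) *\<^sub>R Y \<in> V x"
  proof (rule tangI[of \<gamma>])
    show "\<gamma> 0 = x" by (rule g0)
    have "\<forall>\<^sub>F s in nhds (0::real). s \<in> {-b<..<b}" by (rule eventually_nhds_in_open) (use b in auto)
    then show "\<forall>\<^sub>F s in nhds 0. \<gamma> s \<in> fib x" by eventually_elim (use mem in auto)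
    have "((\<lambda>s. \<Xi> x + s *\<^sub>R Y) has_derivative (\<lambda>t. t *\<^sub>R Y)) (at 0)"
      by (auto intro!: derivative_eq_intros)
    then have "(\<gamma> has_derivative (\<lambda>t. g' (t *\<^sub>R Y))) (at 0)"
      unfolding \<gamma>_def by (rule has_derivative_compose) (use g' in simp)
    then show "(\<gamma> has_vector_derivative (1 / gs_gram kmax gr) *\<^sub>R Y) (at 0)"
      unfolding has_vector_derivative_def by (simp add: linear_cmul[OF lin'] g'Y)
  qed
  from subspace_scale[OF subspace_V this, of "gs_gram kmax gr"] show "Y \<in> V x" using gram by simp
qed

section \<open>Regular fibres are level sets of the basic polynomials\<close>

lemma orthogonal_kernel:
  assumes "\<And>X. X \<in> K x \<Longrightarrow> v \<bullet> X = 0"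
  shows "\<exists>c. v = grad (comb c) x"
  using orth_orth_family[of kmax "\<lambda>j. grad (bas j) x" v] assms by (auto simp: grad_comb)

lemma derivative_match:
  assumes f: "real_polynomial_function f" and eq: "\<And>s. f (y + s *\<^sub>R w) = f (x + s *\<^sub>R v)"
  shows "grad f (y + t *\<^sub>R w) \<bullet> w = grad f (x + t *\<^sub>R v) \<bullet> v"
proof -
  have "w \<bullet> grad f (y + t *\<^sub>R w) = v \<bullet> grad f (x + t *\<^sub>R v)"
    using has_derivative_line[OF f, of y w t] has_derivative_line[OF f, of x v t] unfolding eq by (rule DERIV_unique)
  then show ?thesis by (simp add: inner_commute)
qed

lemma beq_flow:
  assumes "beq x y" "basic g"
  shows "beq (x + t *\<^sub>R grad g x) (y + t *\<^sub>R grad g y)"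
  unfolding beq_def
proof (intro allI impI)
  fix f assume "basic f"
  from assms(1)[unfolded beq_def, rule_format, OF basic_gradient_flow[OF this assms(2)]]
  show "f (x + t *\<^sub>R grad g x) = f (y + t *\<^sub>R grad g y)" .
qed

text \<open>A shortest segment from \<open>x\<close> to a fibre in \<open>U\<close> is orthogonal to
  the fibres it meets near its end, where tangent spaces are known; by continuation its direction is
  a gradient already at \<open>x\<close>. The corresponding flow takes \<open>y\<close> to a point
  \<open>w\<close> with the same basic values as the end \<open>u\<close>, hence in the fibre of
  \<open>u\<close> since \<open>u\<close> lies in \<open>U\<close>. Lifting the reversed segment
  from \<open>w\<close> leads to the fibre of \<open>x\<close>, and it ends at \<open>y\<close>
  because, up to sign, both directions at \<open>w\<close> are the same gradient.\<close>

theorem reg_separates: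
  assumes x: "reg x" and xy: "beq x y"
  shows "\<sigma> x = \<sigma> y"
proof -
  obtain u0 where u0: "u0 \<in> U" "reg u0" using reg_dense[OF open_U U_nonempty] by blast
  obtain u where u: "\<sigma> u = \<sigma> u0" "dist x u = dist (\<sigma> x) (\<sigma> u0)" using lift_point by blast
  have sepU: "p \<in> U \<and> \<sigma> p = \<sigma> q" if "q \<in> U" "beq p q" for p q
    using sep_U[OF that(1)] that(2) unfolding beq_def by blast
  have uU: "u \<in> U" using sepU[OF u0(1)] beq_sigma[OF u(1)] by blast
  have ureg: "reg u" using reg_sigma[OF u(1)[symmetric] u0(2)] .
  define v where "v = u - x"
  have nv: "norm v = dist (\<sigma> x) (\<sigma> u)" using u by (simp add: v_def dist_norm norm_minus_commute)
  have "open (U \<inter> {y. reg y})" using open_U open_reg by blast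
  then obtain \<eta> where eta: "\<eta> > 0" "ball u \<eta> \<subseteq> U \<inter> {y. reg y}" using uU ureg openE by blast
  define b where "b = min 1 (\<eta> / (norm v + 1))"
  have b: "b > 0" "b \<le> 1" using eta(1) by (simp_all add: b_def add_nonneg_pos)
  have near: "u + s *\<^sub>R (- v) \<in> U \<and> reg (u + s *\<^sub>R (- v))" if "0 \<le> s" "s < b" for s
  proof -
    have "s * (norm v + 1) < \<eta>"
      using that by (simp add: b_def pos_less_divide_eq[symmetric] add_nonneg_pos)
    moreover have "s * norm v \<le> s * (norm v + 1)" using that by (simp add: mult_left_mono)
    ultimately have "u + s *\<^sub>R (- v) \<in> ball u \<eta>" using that by (simp add: dist_norm)
    then show ?thesis using eta(2) by blast
  qed
  have hor: "\<exists>c. v = grad (comb c) (u + s *\<^sub>R (- v))" if s: "0 \<le> s" "s < b" for s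
  proof (rule orthogonal_kernel)
    define p where "p = u + s *\<^sub>R (- v)"
    have xp: "x - p = (s - 1) *\<^sub>R v" by (simp add: p_def v_def algebra_simps)
    have "dist (\<sigma> x) (\<sigma> p) = dist x p"
    proof (rule antisym)
      have "dist (\<sigma> x) (\<sigma> u) \<le> dist (\<sigma> x) (\<sigma> p) + dist (\<sigma> p) (\<sigma> u)" by (rule dist_triangle)
      moreover have "dist (\<sigma> p) (\<sigma> u) \<le> s * norm v"
        using dist_sigma_le[of p u] s by (simp add: p_def dist_norm)
      moreover have "dist x p = (1 - s) * norm v" using s b xp by (simp add: dist_norm)
      ultimately show "dist x p \<le> dist (\<sigma> x) (\<sigma> p)" using nv by (simp add: algebra_simps)
    qed (rule dist_sigma_le)
    then have orth: "(x - p) \<bullet> X = 0" if "X \<in> V p" for X using nearest_orthogonal[OF _ that, of x] by simp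
    have "V p = K p"
    proof (rule tangent_eq_kernel_aux)
      show "reg p" using near[OF s] by (simp add: p_def)
      show "\<sigma> q = \<sigma> p" if "beq q p" for q using sepU[OF _ that] near[OF s] by (simp add: p_def)
    qed
    then show "v \<bullet> X = 0" if "X \<in> K (u + s *\<^sub>R (- v))" for X
      using orth[of X] that s b unfolding xp p_def[symmetric] by auto
  qed
  have x1: "x = u + 1 *\<^sub>R (- v)" by (simp add: v_def)
  obtain c where c: "v = grad (comb c) x"
    using comb_span_line[of 0 b v u "-v" 1] hor b(1) x unfolding x1[symmetric] by auto
  obtain a where a: "v = grad (comb a) u" using hor[of 0] b by auto
  define vy where "vy = grad (comb c) y"
  define w where "w = y + vy"
  have xu: "x + 1 *\<^sub>R v = u" by (simp add: v_def)
  have flow: "beq (x + t *\<^sub>R v) (y + t *\<^sub>R vy)" for t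
    unfolding c vy_def by (rule beq_flow[OF xy basic_comb])
  have uw: "beq u w" using flow[of 1] by (simp add: xu[simplified] w_def)
  have w: "w \<in> U" "\<sigma> w = \<sigma> u" using sepU[OF uU beq_sym[OF uw]] by auto
  have nvy: "norm vy = norm v" using norm_grad_beq[OF xy basic_comb] by (simp add: c vy_def)
  have 1: "vy = grad (comb a) w"
  proof (rule horizontal_unique[OF uw a])
    show "norm vy \<le> norm v" by (simp add: nvy)
    fix j assume j: "j < kmax"
    have "bas j (y + s *\<^sub>R vy) = bas j (x + s *\<^sub>R v)" for s
      using flow[of s] bas_basic[OF j] unfolding beq_def by metis
    from derivative_match[OF bas_poly[OF j] this, of 1]
    show "grad (bas j) w \<bullet> vy = grad (bas j) u \<bullet> v" unfolding xu w_def by simp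
  qed
  have "dist (\<sigma> u) (\<sigma> (u + - v)) = norm (- v)"
    using nv by (simp only: norm_minus_cancel) (simp add: v_def dist_commute)
  then obtain w' where w': "norm w' = norm (- v)" "\<And>s. s \<in> {0..1/2} \<Longrightarrow> \<sigma> (w + s *\<^sub>R w') = \<sigma> (u + s *\<^sub>R - v)"
    "\<sigma> (w + w') = \<sigma> (u + - v)"
    using segment_lift[OF _ w(2)[symmetric], of "-v" "1/2"] by auto
  have 2: "- w' = grad (comb a) w"
  proof (rule horizontal_unique[OF uw a])
    show "norm (- w') \<le> norm v" using w'(1) by simp
    fix j assume j: "j < kmax"
    have "bas j (w + s *\<^sub>R w') = bas j (u + s *\<^sub>R - v)" for s
      by (rule basic_lines_eq[OF bas_basic[OF j], of 0 "1/2"]) (use w'(2) in auto)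
    from derivative_match[OF bas_poly[OF j] this, of 0]
    show "grad (bas j) w \<bullet> - w' = grad (bas j) u \<bullet> v" by simp
  qed
  have "w + w' = y" using 1 2 by (simp add: w_def) (metis add.right_inverse add.inverse_inverse minus_add_cancel add.commute)
  then show ?thesis using w'(3) by (simp add: v_def)
qed

lemma sigma_eq_iff_beq: "reg x \<Longrightarrow> \<sigma> y = \<sigma> x \<longleftrightarrow> beq y x"
  using reg_separates beq_sigma beq_sym by metis

lemma tangent_eq_kernel:
  assumes "reg x"
  shows "V x = K x"
  by (rule tangent_eq_kernel_aux[OF assms]) (use sigma_eq_iff_beq[OF assms] in blast)

lemma dim_V_reg: "reg x \<Longrightarrow> dim (V x) + kmax = DIM('a)"
  using dim_orth_family[of kmax "\<lambda>j. grad (bas j) x"] by (simp add: tangent_eq_kernel reg_def)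

lemma finite_nonreg:
  assumes "reg (x + s0 *\<^sub>R v)"
  shows "finite {s. \<not> reg (x + s *\<^sub>R v)}"
  using real_polynomial_finite_roots[OF real_polynomial_line[OF regP_poly], of x s0 v] assms
  by (simp add: reg_iff)

lemma eventually_reg_line:
  assumes "reg (x + s0 *\<^sub>R v)"
  shows "\<forall>\<^sub>F s in at t. reg (x + s *\<^sub>R v)"
proof -
  have "\<forall>\<^sub>F s in at t. s \<notin> {s. \<not> reg (x + s *\<^sub>R v)}"
  proof -
    have "open (- ({s. \<not> reg (x + s *\<^sub>R v)} - {t}))"
      using finite_nonreg[OF assms] by (intro open_Compl finite_imp_closed) auto
    then have "\<forall>\<^sub>F s in nhds t. s \<in> - ({s. \<not> reg (x + s *\<^sub>R v)} - {t})"
      by (rule eventually_nhds_in_open) auto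
    then show ?thesis unfolding eventually_at_filter by eventually_elim auto
  qed
  then show ?thesis by simp
qed

text \<open>Where the moved point is regular, equal basic values mean equal fibres. The remaining
  parameters are isolated and follow by continuity of \<open>\<sigma>\<close>.\<close>

theorem flow_equiv:
  assumes "reg x" "\<sigma> x = \<sigma> y" "basic g"
  shows "\<sigma> (x + t *\<^sub>R grad g x) = \<sigma> (y + t *\<^sub>R grad g y)"
proof -
  have "\<forall>\<^sub>F s in at t. reg (x + s *\<^sub>R grad g x)"
    by (rule eventually_reg_line[of x 0]) (use assms(1) in simp)
  then have "\<forall>\<^sub>F s in at t. \<sigma> (x + s *\<^sub>R grad g x) = \<sigma> (y + s *\<^sub>R grad g y)"
    by eventually_elim (rule reg_separates[OF _ beq_flow[OF beq_sigma[OF assms(2)] assms(3)]])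
  moreover have "((\<lambda>s. \<sigma> (x + s *\<^sub>R grad g x)) \<longlongrightarrow> \<sigma> (x + t *\<^sub>R grad g x)) (at t)"
    by (intro tendsto_sigma tendsto_intros)
  moreover have "((\<lambda>s. \<sigma> (y + s *\<^sub>R grad g y)) \<longlongrightarrow> \<sigma> (y + t *\<^sub>R grad g y)) (at t)"
    by (intro tendsto_sigma tendsto_intros)
  ultimately show ?thesis
    by (intro tendsto_unique[OF at_neq_bot Lim_transform_eventually])
qed

end

lemma lin_indep_extend_map:
  fixes a :: "nat \<Rightarrow> 'a::euclidean_space" and b :: "nat \<Rightarrow> 'b::real_vector"
  assumes "lin_indep k a"
  shows "\<exists>T. linear T \<and> (\<forall>j<k. T (a j) = b j)"
proof -
  have inj: "inj_on a {..<k}" by (rule lin_indep_inj[OF assms])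
  have ind: "independent (a ` {..<k})"
  proof (rule card_le_dim_spanning[of _ "span (a ` {..<k})"])
    show "card (a ` {..<k}) \<le> dim (span (a ` {..<k}))"
      by (simp only: lin_indep_dim_span[OF assms] card_image[OF inj] card_lessThan order_refl)
  qed (auto intro: span_base)
  obtain T where T: "linear T" "\<forall>x\<in>a ` {..<k}. T x = b (inv_into {..<k} a x)"
    using linear_independent_extend[OF ind, of "\<lambda>x. b (inv_into {..<k} a x)"] by blast
  have "T (a j) = b j" if "j < k" for j using T(2) that inj by (simp add: inv_into_f_f)
  then show ?thesis using T(1) by blast
qed

lemma tendsto_hess:
  assumes "real_polynomial_function f" "(x \<longlongrightarrow> x0) F"
  shows "((\<lambda>i. hess f (x i) h) \<longlongrightarrow> hess f x0 h) F"
proof -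
  have "isCont (grad (partial_deriv b f)) x0" for b
    using continuous_on_polymonial_function[OF polynomial_function_grad[OF real_polynomial_partial_deriv[OF assms(1)]], of UNIV b]
    by (simp add: continuous_on_eq_continuous_at)
  then have "((\<lambda>i. grad (partial_deriv b f) (x i)) \<longlongrightarrow> grad (partial_deriv b f) x0) F" for b
    using isCont_tendsto_compose assms(2) by blast
  then show ?thesis unfolding hess_def by (intro tendsto_intros)
qed

lemma tendsto_grad:
  assumes "real_polynomial_function f" "(x \<longlongrightarrow> x0) F"
  shows "((\<lambda>i. grad f (x i)) \<longlongrightarrow> grad f x0) F"
proof -
  have "isCont (grad f) x0"
    using continuous_on_polymonial_function[OF polynomial_function_grad[OF assms(1)], of UNIV]
    by (simp add: continuous_on_eq_continuous_at)
  then show ?thesis using isCont_tendsto_compose assms(2) by blast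
qed

lemma finite_spectrum:
  fixes H :: "'a::euclidean_space \<Rightarrow> 'a"
  assumes "linear H" "\<And>x y. H x \<bullet> y = x \<bullet> H y"
  shows "finite {m. eig H m \<noteq> {0}}"
proof -
  obtain B \<mu> where B: "eigenbasis H B \<mu>" using symmetric_eigenbasis[OF assms] by blast
  have mB: "m \<in> \<mu> ` B" if "eig H m \<noteq> {0}" for m
  proof -
    have "0 \<in> eig H m" using subspace_eig[OF assms(1)] subspace_0 by blast
    then have "dim (eig H m) \<noteq> 0" using that by (auto simp: dim_eq_0)
    then have "card {b\<in>B. \<mu> b = m} \<noteq> 0" using B unfolding eigenbasis_def by metis
    then have "{b\<in>B. \<mu> b = m} \<noteq> {}" by (metis card.empty)
    then show ?thesis by blast
  qed
  have "finite B" using B unfolding eigenbasis_def by blast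
  then have "finite (\<mu> ` B)" by (rule finite_imageI)
  then show ?thesis by (rule rev_finite_subset) (use mB in blast)
qed

lemma dim_range_add_eig:
  fixes N H :: "'a::euclidean_space \<Rightarrow> 'a"
  assumes "linear N" "\<And>h. N h = h + t *\<^sub>R H h" "t \<noteq> 0"
  shows "dim (range N) + dim (eig H (- 1 / t)) = DIM('a)"
proof -
  have "N x = 0 \<longleftrightarrow> x \<in> eig H (- 1 / t)" for x
  proof -
    have "t *\<^sub>R (H x - (- 1 / t) *\<^sub>R x) = N x" using assms(3) by (simp add: assms(2) scaleR_add_right)
    then have "N x = 0 \<longleftrightarrow> H x - (- 1 / t) *\<^sub>R x = 0"
      using assms(3) by (metis scaleR_eq_0_iff)
    then show ?thesis by (simp only: eig_def mem_Collect_eq right_minus_eq)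
  qed
  then have "eig H (- 1 / t) = {x\<in>UNIV. N x = 0}" by blast
  then show ?thesis using dim_image_add_kernel[OF assms(1) subspace_UNIV] by simp
qed

section \<open>Gradient flows along fibres\<close>

definition flw :: "('a::euclidean_space \<Rightarrow> real) \<Rightarrow> real \<Rightarrow> 'a \<Rightarrow> 'a" where
  "flw g t x = x + t *\<^sub>R grad g x"

definition dfl :: "('a::euclidean_space \<Rightarrow> real) \<Rightarrow> real \<Rightarrow> 'a \<Rightarrow> 'a \<Rightarrow> 'a" where
  "dfl g t x h = h + t *\<^sub>R hess g x h"

lemma linear_dfl: "linear (dfl g t x)"
  unfolding dfl_def[abs_def] using linear_hess[of g x]
  by (intro linear_compose_add linear_compose_scale_right linear_ident)

lemma dfl_sym:
  assumes "real_polynomial_function g"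
  shows "dfl g t x h \<bullet> k = h \<bullet> dfl g t x k"
  by (simp add: dfl_def inner_add_left inner_add_right hess_symmetric[OF assms])

lemma has_derivative_flw:
  assumes "real_polynomial_function g"
  shows "(flw g t has_derivative dfl g t x) (at x)"
  unfolding flw_def[abs_def] dfl_def[abs_def]
  by (intro has_derivative_add has_derivative_ident has_derivative_scaleR_right has_derivative_grad_hess assms)

lemma flw_vector_derivative:
  assumes "real_polynomial_function g" "(\<gamma> has_vector_derivative Y) (at s)"
  shows "((\<lambda>s. flw g t (\<gamma> s)) has_vector_derivative dfl g t (\<gamma> s) Y) (at s)"
proof -
  have "((\<lambda>s. flw g t (\<gamma> s)) has_derivative (\<lambda>h. dfl g t (\<gamma> s) (h *\<^sub>R Y))) (at s)"
    by (rule has_derivative_compose[OF assms(2)[unfolded has_vector_derivative_def] has_derivative_flw[OF assms(1)]])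
  then show ?thesis unfolding has_vector_derivative_def by (simp add: linear_cmul[OF linear_dfl])
qed

lemma polynomial_flw:
  assumes "real_polynomial_function g"
  shows "polynomial_function (flw g t)"
  unfolding flw_def[abs_def]
  by (intro polynomial_function_add polynomial_function_mult polynomial_function_grad assms polynomial_function_const polynomial_function_id)

lemma dim_image_inj:
  fixes N :: "'a::euclidean_space \<Rightarrow> 'b::euclidean_space"
  assumes "linear N" "subspace W" "\<And>x. x \<in> W \<Longrightarrow> N x = 0 \<Longrightarrow> x = 0"
  shows "dim (N ` W) = dim W"
proof -
  have "{x\<in>W. N x = 0} \<subseteq> {0}" using assms(3) by blast
  then have "dim {x\<in>W. N x = 0} = 0" by (simp only: dim_eq_0)
  then show ?thesis using dim_image_add_kernel[OF assms(1,2)] by linarith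
qed

text \<open>By symmetry \<open>N\<close> maps the complement of \<open>W\<close> into that of
  \<open>Z\<close>, and \<open>u\<close> is orthogonal to this image exactly if \<open>N u\<close>
  lies in \<open>W\<close>. In the application a rank on the normal space at the end point becomes
  the dimension of a subspace of the normal space at the starting point, where the points of a fibre
  can be compared.\<close>

lemma sum_dim_orthogonal_comp_within:
  fixes N :: "'a::euclidean_space \<Rightarrow> 'a"
  assumes N: "linear N" "\<And>x y. N x \<bullet> y = x \<bullet> N y" and W: "subspace W" "subspace Z"
    and NZ: "\<And>Y. Y \<in> Z \<Longrightarrow> N Y \<in> W"
  shows "dim (N ` orthogonal_comp W) + dim {u\<in>orthogonal_comp Z. N u \<in> W} = dim (orthogonal_comp Z)"
proof -
  have sub: "N ` orthogonal_comp W \<subseteq> orthogonal_comp Z"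
    using NZ by (auto simp: mem_orthogonal_comp N(2))
  have "subspace (N ` orthogonal_comp W)" "subspace (orthogonal_comp Z)"
    using N(1) subspace_orthogonal_comp linear_subspace_image by blast+
  from dim_subspace_orthogonal_to_vectors[OF this sub]
  have "dim {y \<in> orthogonal_comp Z. \<forall>x\<in>N ` orthogonal_comp W. orthogonal x y} + dim (N ` orthogonal_comp W)
      = dim (orthogonal_comp Z)" .
  moreover have "(\<forall>x\<in>N ` orthogonal_comp W. orthogonal x y) \<longleftrightarrow> N y \<in> W" for y
  proof -
    have "(\<forall>x\<in>N ` orthogonal_comp W. orthogonal x y) \<longleftrightarrow> N y \<in> orthogonal_comp (orthogonal_comp W)"
      by (simp add: mem_orthogonal_comp orthogonal_def N(2) inner_commute[of _ "N y"])
    then show ?thesis using orthogonal_comp_self[OF W(1)] by simp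
  qed
  ultimately show ?thesis by (simp add: add.commute)
qed

context manifold_map
begin

lemma flw_sigma:
  assumes "reg x" "\<sigma> x = \<sigma> y" "basic g"
  shows "\<sigma> (flw g t x) = \<sigma> (flw g t y)"
  unfolding flw_def by (rule flow_equiv[OF assms])

lemma dfl_tangent:
  assumes "reg q" "basic g" "Y \<in> V q"
  shows "dfl g t q Y \<in> V (flw g t q)"
proof -
  obtain \<gamma> where g: "\<gamma> (0::real) = q" "\<And>s. \<gamma> s \<in> fib q" "(\<gamma> has_vector_derivative Y) (at 0)"
    using assms(3) unfolding tang_def by blast
  show ?thesis
  proof (rule tangI[of "\<lambda>s. flw g t (\<gamma> s)"])
    have "flw g t (\<gamma> s) \<in> fib (flw g t q)" for s
    proof -
      have "\<sigma> q = \<sigma> (\<gamma> s)" using g(2)[of s] unfolding fib_iff by (rule sym)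
      from flw_sigma[OF assms(1) this assms(2)] show ?thesis unfolding fib_iff by (rule sym)
    qed
    then show "\<forall>\<^sub>F s in nhds 0. flw g t (\<gamma> s) \<in> fib (flw g t q)" by simp
    show "((\<lambda>s. flw g t (\<gamma> s)) has_vector_derivative dfl g t q Y) (at 0)"
      using flw_vector_derivative[OF basic_poly[OF assms(2)] g(3), of t] g(1) by simp
  qed (simp add: g(1))
qed

text \<open>The squared norm of the gradient is basic, so its gradient, twice the Hessian applied to
  \<open>grad g\<close>, is orthogonal to the fibre.\<close>

lemma grad_inner_dfl:
  assumes "basic g" "Y \<in> V q"
  shows "grad g q \<bullet> dfl g t q Y = 0"
proof -
  note p = basic_poly[OF assms(1)]
  have eq: "grad_inner g g = (\<lambda>x. grad g x \<bullet> grad g x)" by (simp add: fun_eq_iff grad_inner_eq)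
  have "((\<lambda>x. grad g x \<bullet> grad g x) has_derivative (\<lambda>h. grad g q \<bullet> hess g q h + hess g q h \<bullet> grad g q)) (at q)"
    by (rule has_derivative_inner[OF has_derivative_grad_hess[OF p] has_derivative_grad_hess[OF p]])
  moreover have "(\<lambda>h. grad g q \<bullet> hess g q h + hess g q h \<bullet> grad g q) = (\<lambda>h. h \<bullet> (2 *\<^sub>R hess g q (grad g q)))"
  proof
    fix h
    have "grad g q \<bullet> hess g q h = hess g q h \<bullet> grad g q" by (rule inner_commute)
    then show "grad g q \<bullet> hess g q h + hess g q h \<bullet> grad g q = h \<bullet> (2 *\<^sub>R hess g q (grad g q))"
      using hess_symmetric[OF p, of q h "grad g q"] by simp
  qed
  ultimately have "grad (grad_inner g g) q = 2 *\<^sub>R hess g q (grad g q)"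
    unfolding eq by (intro grad_eqI) simp
  then have "2 *\<^sub>R hess g q (grad g q) \<bullet> Y = 0"
    using grad_orthogonal_tangent[OF basic_grad_inner[OF assms(1,1)] assms(2)] by simp
  then have "grad g q \<bullet> hess g q Y = 0" by (simp add: hess_symmetric[OF p])
  then show ?thesis using grad_orthogonal_tangent[OF assms] by (simp add: dfl_def inner_add_right)
qed

text \<open>For short times the segment is shortest and so orthogonal to the fibres it reaches; this
  continues along the line to any regular end point. It provides a basic polynomial whose flow runs
  backwards.\<close>

lemma grad_span_line:
  assumes q: "reg q" and g: "basic g" and z: "reg (q + t *\<^sub>R grad g q)"
  shows "\<exists>c. grad g q = grad (comb c) (q + t *\<^sub>R grad g q)"
proof -
  define v where "v = grad g q"
  obtain s0 where s0: "s0 > 0" "\<forall>s\<in>{0..s0}. dist (\<sigma> q) (\<sigma> (q + s *\<^sub>R v)) = s * norm v"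
    using minimal_gradient[OF g, of q] unfolding v_def by blast
  have "\<forall>\<^sub>F s in at 0. reg (q + s *\<^sub>R v)"
    by (rule eventually_reg_line[of q 0]) (use q in simp)
  then obtain e where e: "e > 0" "\<And>s. s \<noteq> 0 \<Longrightarrow> \<bar>s\<bar> < e \<Longrightarrow> reg (q + s *\<^sub>R v)"
    unfolding eventually_at by (auto simp: dist_real_def)
  have "\<exists>c. v = grad (comb c) (q + s *\<^sub>R v)" if s: "0 < s" "s < min s0 e" for s
  proof (rule orthogonal_kernel)
    define p where "p = q + s *\<^sub>R v"
    have "reg p" unfolding p_def by (rule e(2)) (use s in auto)
    have "dist q p = dist (\<sigma> q) (\<sigma> p)"
      using s0(2)[rule_format, of s] s by (simp add: p_def dist_norm)
    then have "(q - p) \<bullet> X = 0" if "X \<in> V p" for X by (rule nearest_orthogonal) (rule that)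
    then show "v \<bullet> X = 0" if "X \<in> K (q + s *\<^sub>R v)" for X
      using that s tangent_eq_kernel[OF \<open>reg p\<close>] by (simp add: p_def)
  qed
  then show ?thesis
    using comb_span_line[of 0 "min s0 e" v q v t] s0(1) e(1) z unfolding v_def by auto
qed

lemma gradient_transport:
  assumes "reg q" "basic g" "grad g q = grad (comb c) (q + t *\<^sub>R grad g q)" "\<sigma> q = \<sigma> q'"
  shows "grad g q' = grad (comb c) (q' + t *\<^sub>R grad g q')"
proof (rule horizontal_unique[OF _ assms(3)])
  show "beq (q + t *\<^sub>R grad g q) (q' + t *\<^sub>R grad g q')"
    by (rule beq_flow[OF beq_sigma[OF assms(4)] assms(2)])
  show "norm (grad g q') \<le> norm (grad g q)" using norm_grad_basic[OF assms(2,4)] by simp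
  fix j assume j: "j < kmax"
  have "bas j (q' + s *\<^sub>R grad g q') = bas j (q + s *\<^sub>R grad g q)" for s
    by (rule basic_eq[OF bas_basic[OF j] flow_equiv[OF assms(1,4,2), symmetric]])
  from derivative_match[OF bas_poly[OF j] this, of t]
  show "grad (bas j) (q' + t *\<^sub>R grad g q') \<bullet> grad g q' = grad (bas j) (q + t *\<^sub>R grad g q) \<bullet> grad g q" .
qed

text \<open>On the fibre, the flow of \<open>comb c\<close> for time \<open>- t\<close> undoes the
  flow of \<open>g\<close>. Differentiating along curves in the fibre gives an inverse on tangent
  vectors.\<close>

lemma dfl_inverse:
  assumes q: "reg q" and g: "basic g" and z: "reg (flw g t q)"
  shows "\<exists>c. \<forall>Y\<in>V q. dfl (comb c) (- t) (flw g t q) (dfl g t q Y) = Y"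
proof -
  obtain c where c: "grad g q = grad (comb c) (q + t *\<^sub>R grad g q)"
    using grad_span_line[OF q g] z unfolding flw_def by blast
  have undo: "flw (comb c) (- t) (flw g t q') = q'" if "\<sigma> q = \<sigma> q'" for q'
    using gradient_transport[OF q g c that] by (simp add: flw_def)
  have "dfl (comb c) (- t) (flw g t q) (dfl g t q Y) = Y" if Y: "Y \<in> V q" for Y
  proof -
    obtain \<gamma> where \<gamma>: "\<gamma> (0::real) = q" "\<And>s. \<gamma> s \<in> fib q" "(\<gamma> has_vector_derivative Y) (at 0)"
      using Y unfolding tang_def by blast
    have "((\<lambda>s. flw (comb c) (- t) (flw g t (\<gamma> s))) has_vector_derivative
        dfl (comb c) (- t) (flw g t (\<gamma> 0)) (dfl g t (\<gamma> 0) Y)) (at 0)"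
      by (intro flw_vector_derivative basic_poly[OF basic_comb] basic_poly[OF g] \<gamma>(3))
    moreover have "flw (comb c) (- t) (flw g t (\<gamma> s)) = \<gamma> s" for s
    proof (rule undo)
      show "\<sigma> q = \<sigma> (\<gamma> s)" using \<gamma>(2)[of s] unfolding fib_iff by (rule sym)
    qed
    ultimately have "(\<gamma> has_vector_derivative dfl (comb c) (- t) (flw g t q) (dfl g t q Y)) (at 0)"
      using \<gamma>(1) by simp
    then show ?thesis using \<gamma>(3) vector_derivative_unique_at by blast
  qed
  then show ?thesis by blast
qed

lemma dfl_image_reg:
  assumes q: "reg q" and g: "basic g" and z: "reg (flw g t q)"
  shows "dfl g t q ` V q = V (flw g t q)"
proof -
  obtain c where c: "\<And>Y. Y \<in> V q \<Longrightarrow> dfl (comb c) (- t) (flw g t q) (dfl g t q Y) = Y"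
    using dfl_inverse[OF assms] by blast
  have "dim (dfl g t q ` V q) = dim (V q)"
  proof (rule dim_image_inj[OF linear_dfl subspace_V])
    fix Y assume "Y \<in> V q" "dfl g t q Y = 0"
    then show "Y = 0" using c[of Y] linear_0[OF linear_dfl] by metis
  qed
  moreover have "dim (V q) = dim (V (flw g t q))" using dim_V_reg[OF q] dim_V_reg[OF z] by simp
  ultimately show ?thesis
    using dfl_tangent[OF q g]
    by (intro subspace_dim_equal linear_subspace_image linear_dfl subspace_V) auto
qed

subsection \<open>Ranks of the differentials\<close>

text \<open>Moving first along \<open>f\<close> and then along \<open>g\<close> gives curves with
  the same image from \<open>p\<close> and from \<open>q\<close>, so the normal parts of their
  velocities are equally long even if the end point is singular.\<close>

lemma normal_component_eq:
  assumes p: "reg p" and pq: "\<sigma> p = \<sigma> q" and g: "basic g" and f: "basic f"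
    and "dfl g t p (grad f p) = a + b" "a \<in> V (flw g t p)" "b \<in> orthogonal_comp (V (flw g t p))"
    and "dfl g t q (grad f q) = a' + b'" "a' \<in> V (flw g t q)" "b' \<in> orthogonal_comp (V (flw g t q))"
  shows "norm b = norm b'"
proof -
  have der: "((\<lambda>s. flw g t (x + s *\<^sub>R grad f x)) has_vector_derivative dfl g t x (grad f x)) (at 0)" for x
  proof -
    have "((\<lambda>s. x + s *\<^sub>R grad f x) has_vector_derivative grad f x) (at 0)"
      by (auto intro!: derivative_eq_intros)
    from flw_vector_derivative[OF basic_poly[OF g] this] show ?thesis by simp
  qed
  have "\<forall>\<^sub>F s in at 0. reg (p + s *\<^sub>R grad f p)"
    by (rule eventually_reg_line[of p 0]) (use p in simp)
  then have ev: "\<forall>\<^sub>F s in at 0. \<sigma> (flw g t (p + s *\<^sub>R grad f p)) = \<sigma> (flw g t (q + s *\<^sub>R grad f q))"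
    by eventually_elim (rule flw_sigma[OF _ flow_equiv[OF p pq f] g])
  show ?thesis
  proof (rule normal_part_eq)
    show "((\<lambda>s. flw g t (p + s *\<^sub>R grad f p)) has_vector_derivative a + b) (at 0)"
      using der[of p] assms(5) by simp
    show "((\<lambda>s. flw g t (q + s *\<^sub>R grad f q)) has_vector_derivative a' + b') (at 0)"
      using der[of q] assms(8) by simp
    show "\<sigma> (flw g t p) = \<sigma> (flw g t q)" by (rule flw_sigma[OF p pq g])
    show "\<forall>\<^sub>F s in at_right 0. \<sigma> (flw g t (p + s *\<^sub>R grad f p)) = \<sigma> (flw g t (q + s *\<^sub>R grad f q))"
      using ev by (rule filter_leD[rotated]) (simp add: at_le)
  qed (simp_all add: assms)
qed

text \<open>The linear map matching \<open>grad (comb c) p\<close> with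
  \<open>grad (comb c) q\<close> preserves lengths of normal vectors. It takes a normal vector whose
  image is tangent to another such vector, because the normal parts of the two images have the same
  length.\<close>

lemma dim_normal_kernel_le:
  assumes p: "reg p" and pq: "\<sigma> p = \<sigma> q" and g: "basic g"
  shows "dim {u\<in>orthogonal_comp (V p). dfl g t p u \<in> V (flw g t p)}
    \<le> dim {u\<in>orthogonal_comp (V q). dfl g t q u \<in> V (flw g t q)}" (is "dim ?Z \<le> dim ?Z'")
proof -
  obtain T where T: "linear T" "\<And>j. j < kmax \<Longrightarrow> T (grad (bas j) p) = grad (bas j) q"
    using lin_indep_extend_map[OF p[unfolded reg_def], of "\<lambda>j. grad (bas j) q"] by blast
  have Tc: "T (grad (comb c) p) = grad (comb c) q" for c
    using T by (simp add: grad_comb linear_sum linear_cmul)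
  have hor: "\<exists>c. u = grad (comb c) p" if "u \<in> orthogonal_comp (V p)" for u
    by (rule orthogonal_kernel) (use that in \<open>simp add: mem_orthogonal_comp tangent_eq_kernel[OF p]\<close>)
  have sub: "subspace ?Z"
  proof -
    have "?Z = orthogonal_comp (V p) \<inter> dfl g t p -` V (flw g t p)" by blast
    then show ?thesis
      by (simp add: subspace_inter subspace_orthogonal_comp linear_subspace_vimage[OF linear_dfl subspace_V])
  qed
  have "dim ?Z = dim (T ` ?Z)"
  proof (rule dim_image_inj[OF T(1) sub, symmetric])
    fix u assume "u \<in> ?Z" and u: "T u = 0"
    then obtain c where c: "u = grad (comb c) p" using hor by blast
    have "norm u = norm (T u)" unfolding c Tc by (rule norm_grad_basic[OF basic_comb pq])
    then show "u = 0" by (simp add: u)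
  qed
  also have "\<dots> \<le> dim ?Z'"
  proof (intro dim_subset subsetI)
    fix y assume "y \<in> T ` ?Z"
    then obtain u where u: "u \<in> ?Z" "y = T u" by blast
    then obtain c where c: "u = grad (comb c) p" using hor by blast
    have y: "y = grad (comb c) q" by (simp add: u(2) c Tc)
    obtain a b where ab: "dfl g t q y = a + b" "a \<in> V (flw g t q)" "b \<in> orthogonal_comp (V (flw g t q))"
      using subspace_decomp[OF subspace_V] by metis
    have "norm (0::'a) = norm b"
    proof (rule normal_component_eq[OF p pq g basic_comb])
      show "dfl g t p (grad (comb c) p) = dfl g t p u + 0" by (simp add: c)
      show "dfl g t p u \<in> V (flw g t p)" using u(1) by simp
      show "0 \<in> orthogonal_comp (V (flw g t p))" by (simp add: mem_orthogonal_comp)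
      show "dfl g t q (grad (comb c) q) = a + b" using ab(1) y by simp
    qed (rule ab)+
    then have "dfl g t q y \<in> V (flw g t q)" using ab by simp
    moreover have "y \<in> orthogonal_comp (V q)"
      unfolding y mem_orthogonal_comp using grad_orthogonal_tangent[OF basic_comb] by blast
    ultimately show "y \<in> ?Z'" by simp
  qed
  finally show ?thesis .
qed

lemma dim_normal_image_eq:
  assumes p: "reg p" and pq: "\<sigma> p = \<sigma> q" and g: "basic g"
  shows "dim (dfl g t p ` orthogonal_comp (V (flw g t p))) = dim (dfl g t q ` orthogonal_comp (V (flw g t q)))"
proof -
  note q = reg_sigma[OF pq p]
  have "dim (dfl g t x ` orthogonal_comp (V (flw g t x))) +
      dim {u\<in>orthogonal_comp (V x). dfl g t x u \<in> V (flw g t x)} = dim (orthogonal_comp (V x))" if "reg x" for x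
    by (rule sum_dim_orthogonal_comp_within[OF linear_dfl dfl_sym[OF basic_poly[OF g]] subspace_V subspace_V])
      (rule dfl_tangent[OF that g])
  from this[OF p] this[OF q] show ?thesis
    using dim_normal_kernel_le[OF p pq g, of t] dim_normal_kernel_le[OF q pq[symmetric] g, of t]
      dim_V_cong[OF pq] dim_orthogonal_comp[OF subspace_V[of p]] dim_orthogonal_comp[OF subspace_V[of q]] by linarith
qed

text \<open>The rank is at most the dimension of the end fibre plus a transverse rank, and both
  summands agree at \<open>p\<close> and \<open>q\<close>. At \<open>p\<close> the bound is
  attained, so the kernel, which is the eigenspace for \<open>- 1 / t\<close>, is smallest
  there.\<close>

theorem dim_eig_le:
  assumes p: "reg p" and pq: "\<sigma> p = \<sigma> q" and g: "basic g" and t: "t \<noteq> 0"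
    and onto: "V (flw g t p) \<subseteq> range (dfl g t p)"
  shows "dim (eig (hess g p) (- 1 / t)) \<le> dim (eig (hess g q) (- 1 / t))"
proof -
  have "dim (range (dfl g t q)) \<le> dim (V (flw g t q)) + dim (dfl g t q ` orthogonal_comp (V (flw g t q)))"
    by (rule rank_symmetric_le[OF linear_dfl subspace_V])
  also have "\<dots> = dim (V (flw g t p)) + dim (dfl g t p ` orthogonal_comp (V (flw g t p)))"
    by (simp only: dim_V_cong[OF flw_sigma[OF p pq g]] dim_normal_image_eq[OF p pq g])
  also have "\<dots> = dim (range (dfl g t p))"
    by (rule rank_symmetric_eq[OF linear_dfl dfl_sym[OF basic_poly[OF g]] subspace_V onto, symmetric])
  finally show ?thesis
    using dim_range_add_eig[OF linear_dfl dfl_def t, of g p] dim_range_add_eig[OF linear_dfl dfl_def t, of g q] by linarith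
qed

text \<open>An eigenvalue \<open>- 1 / t\<close> with regular end point cannot be new: there the
  differential maps onto the tangent space at every point of the fibre, and multiplicities can be
  compared with those at \<open>p\<close>. What remains are the eigenvalues at \<open>p\<close>,
  zero, and the finitely many values from singular end times.\<close>

lemma finite_spectrum_fib:
  assumes p: "reg p" and g: "basic g"
  shows "\<exists>M. finite M \<and> (\<forall>q m. \<sigma> q = \<sigma> p \<longrightarrow> eig (hess g q) m \<noteq> {0} \<longrightarrow> m \<in> M)"
proof -
  define M where "M = {m. eig (hess g p) m \<noteq> {0}} \<union> {0} \<union> (\<lambda>t. - 1 / t) ` {t. \<not> reg (p + t *\<^sub>R grad g p)}"
  have "finite M"
    using finite_spectrum[OF linear_hess hess_symmetric[OF basic_poly[OF g]], of p] finite_nonreg[of p 0 "grad g p"] p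
    by (simp add: M_def)
  moreover have "m \<in> M" if qp: "\<sigma> q = \<sigma> p" and m: "eig (hess g q) m \<noteq> {0}" for q m
  proof (rule ccontr)
    assume "m \<notin> M"
    then have mM: "eig (hess g p) m = {0}" "m \<noteq> 0" "m \<notin> (\<lambda>t. - 1 / t) ` {t. \<not> reg (p + t *\<^sub>R grad g p)}"
      by (auto simp: M_def)
    define t where "t = - 1 / m"
    have mt: "m = - 1 / t" "t \<noteq> 0" using mM(2) by (simp_all add: t_def)
    then have z: "reg (flw g t p)" using mM(3) unfolding flw_def by blast
    note q = reg_sigma[OF qp[symmetric] p]
    note zq = reg_sigma[OF flw_sigma[OF q qp g, symmetric] z]
    have "dim (eig (hess g q) m) \<le> dim (eig (hess g p) m)"
      unfolding mt(1) by (rule dim_eig_le[OF q qp g mt(2)]) (use dfl_image_reg[OF q g zq] in blast)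
    then have "dim (eig (hess g q) m) = 0" by (simp add: mM(1))
    then have "eig (hess g q) m \<subseteq> {0}" by (simp only: dim_eq_0)
    moreover have "0 \<in> eig (hess g q) m" using subspace_eig[OF linear_hess] subspace_0 by blast
    ultimately show False using m by blast
  qed
  ultimately show ?thesis by blast
qed

text \<open>Adding squares of functions vanishing on the fibre leaves the gradients along the fibre
  unchanged, and for most multiples it removes the kernel of the differential transverse to the fibre.
  Thus the rank on the tangent space is governed by an eigenvalue multiplicity.\<close>

definition stiff :: "'a \<Rightarrow> ('a \<Rightarrow> real) \<Rightarrow> real \<Rightarrow> 'a \<Rightarrow> real" where
  "stiff p g l x = g x + l * (\<Sum>j<kmax. (bas j x - bas j p) * (bas j x - bas j p))"

text \<open>Half the Hessian, on the fibre, of the sum of squares in \<open>stiff\<close>; it is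
  positive semidefinite with kernel \<open>K q\<close>.\<close>

definition normal_op :: "'a \<Rightarrow> 'a \<Rightarrow> 'a" where
  "normal_op q h = (\<Sum>j<kmax. (h \<bullet> grad (bas j) q) *\<^sub>R grad (bas j) q)"

lemma normal_op_sym: "normal_op q x \<bullet> y = x \<bullet> normal_op q y"
  unfolding normal_op_def inner_sum_left inner_sum_right
  by (rule sum.cong[OF refl]) (simp add: inner_commute[of y] mult.commute)

lemma linear_normal_op: "linear (normal_op q)"
  unfolding normal_op_def[abs_def]
  by (intro linear_compose_sum ballI linearI) (simp_all add: inner_add_left scaleR_add_left)

lemma normal_op_psd:
  "0 \<le> normal_op q x \<bullet> x" "normal_op q x \<bullet> x = 0 \<Longrightarrow> x \<in> K q"
proof -
  have eq: "normal_op q x \<bullet> x = (\<Sum>j<kmax. (x \<bullet> grad (bas j) q)\<^sup>2)"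
    unfolding normal_op_def inner_sum_left
    by (rule sum.cong[OF refl]) (simp add: inner_commute[of x] power2_eq_square)
  show "0 \<le> normal_op q x \<bullet> x" unfolding eq by (simp add: sum_nonneg)
  assume "normal_op q x \<bullet> x = 0"
  then have "\<forall>j\<in>{..<kmax}. (x \<bullet> grad (bas j) q)\<^sup>2 = 0"
    unfolding eq by (subst (asm) sum_nonneg_eq_0_iff) auto
  then show "x \<in> K q" by (simp add: inner_commute)
qed

lemma normal_op_kernel: "x \<in> K q \<Longrightarrow> normal_op q x = 0"
  unfolding normal_op_def by (rule sum.neutral) (simp add: inner_commute)

lemma basic_stiff: "basic g \<Longrightarrow> basic (stiff p g l)"
proof -
  assume g: "basic g"
  have "basic (\<lambda>x. bas j x - bas j p)" if "j < kmax" for j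
    using basic_add[OF bas_basic[OF that] basic_const[of "- bas j p"]] by simp
  then show ?thesis
    unfolding stiff_def[abs_def] by (intro basic_add basic_cmult basic_sum basic_mult g) auto
qed

lemma hess_stiff:
  assumes g: "basic g" and qp: "\<sigma> q = \<sigma> p"
  shows "grad (stiff p g l) q = grad g q" "hess (stiff p g l) q h = hess g q h + (2 * l) *\<^sub>R normal_op q h"
proof -
  define d where "d j x = bas j x - bas j p" for j x
  have dp: "real_polynomial_function (d j)" if "j < kmax" for j
    using rpf_add[OF bas_poly[OF that] rpf_const[of "- bas j p"]] by (simp add: d_def[abs_def])
  have d0: "d j q = 0" if "j < kmax" for j
    using basic_eq[OF bas_basic[OF that] qp] by (simp add: d_def)
  have dg: "grad (d j) q = grad (bas j) q" if "j < kmax" for j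
    using grad_add[OF bas_poly[OF that] rpf_const[of "- bas j p"]] by (simp add: d_def[abs_def])
  have sp: "real_polynomial_function (\<lambda>x. \<Sum>j<kmax. d j x * d j x)"
    by (intro real_polynomial_function_sum rpf_mult dp) auto
  have eq: "stiff p g l = (\<lambda>x. g x + l * (\<Sum>j<kmax. d j x * d j x))"
    by (simp add: stiff_def[abs_def] d_def)
  have "grad (\<lambda>x. \<Sum>j<kmax. d j x * d j x) q = (\<Sum>j<kmax. grad (\<lambda>x. d j x * d j x) q)"
    by (rule grad_sum) (auto intro: rpf_mult dp)
  also have "\<dots> = 0" by (rule sum.neutral) (simp add: grad_mult dp d0)
  finally show "grad (stiff p g l) q = grad g q"
    unfolding eq by (simp add: grad_add grad_cmult basic_poly[OF g] sp rpf_mult rpf_const)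
  have "hess (\<lambda>x. \<Sum>j<kmax. d j x * d j x) q h = (\<Sum>j<kmax. hess (\<lambda>x. d j x * d j x) q h)"
    by (rule hess_sum) (auto intro: rpf_mult dp)
  also have "\<dots> = (\<Sum>j<kmax. 2 *\<^sub>R ((h \<bullet> grad (bas j) q) *\<^sub>R grad (bas j) q))"
    by (rule sum.cong[OF refl]) (simp add: hess_mult dp d0 dg scaleR_add_left[symmetric] del: scaleR_add_left)
  also have "\<dots> = 2 *\<^sub>R normal_op q h" by (simp only: normal_op_def scaleR_sum_right)
  finally show "hess (stiff p g l) q h = hess g q h + (2 * l) *\<^sub>R normal_op q h"
    unfolding eq by (simp add: hess_add hess_cmult basic_poly[OF g] sp rpf_mult rpf_const)
qed

text \<open>For such an \<open>l\<close> a kernel vector of \<open>dfl + l normal_op\<close> is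
  killed by \<open>normal_op\<close>, so it is tangent to the fibre. The factor
  \<open>1 / (2 t)\<close> cancels the 2 from the Hessian of a square and the \<open>t\<close> in
  front of the Hessian.\<close>

lemma stiff_eig_dim:
  assumes q: "reg q" and g: "basic g" and qp: "\<sigma> q = \<sigma> p" and t: "t \<noteq> 0"
    and l: "\<nexists>x. dfl g t q x + l *\<^sub>R normal_op q x = 0 \<and> normal_op q x \<noteq> 0"
  shows "dim (eig (hess (stiff p g (l / (2 * t))) q) (- 1 / t)) + dim (dfl g t q ` V q) = dim (V q)"
proof -
  have VK: "V q = K q" by (rule tangent_eq_kernel[OF q])
  have "x \<in> eig (hess (stiff p g (l / (2 * t))) q) (- 1 / t) \<longleftrightarrow> x \<in> V q \<and> dfl g t q x = 0" for x
  proof -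
    have "x \<in> eig (hess (stiff p g (l / (2 * t))) q) (- 1 / t) \<longleftrightarrow>
       hess g q x + (l / t) *\<^sub>R normal_op q x = (- 1 / t) *\<^sub>R x"
      by (simp add: eig_def hess_stiff(2)[OF g qp])
    also have "\<dots> \<longleftrightarrow> t *\<^sub>R (hess g q x + (l / t) *\<^sub>R normal_op q x) = t *\<^sub>R ((- 1 / t) *\<^sub>R x)"
      using t by (simp only: scaleR_cancel_left simp_thms)
    also have "\<dots> \<longleftrightarrow> dfl g t q x + l *\<^sub>R normal_op q x = 0"
    proof -
      have 1: "t *\<^sub>R (hess g q x + (l / t) *\<^sub>R normal_op q x) = (dfl g t q x + l *\<^sub>R normal_op q x) - x"
        using t by (simp add: dfl_def scaleR_add_right)
      have 2: "t *\<^sub>R ((- 1 / t) *\<^sub>R x) = 0 - x" using t by simp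
      show ?thesis unfolding 1 2 by (simp only: diff_eq_eq diff_add_cancel)
    qed
    also have "\<dots> \<longleftrightarrow> x \<in> V q \<and> dfl g t q x = 0"
    proof
      assume a: "dfl g t q x + l *\<^sub>R normal_op q x = 0"
      then have n: "normal_op q x = 0" using l by blast
      then have "x \<in> K q" using normal_op_psd(2)[of q x] by simp
      then show "x \<in> V q \<and> dfl g t q x = 0" using a n VK by simp
    next
      assume a: "x \<in> V q \<and> dfl g t q x = 0"
      then have "normal_op q x = 0" using VK by (intro normal_op_kernel) blast
      then show "dfl g t q x + l *\<^sub>R normal_op q x = 0" using a by simp
    qed
    finally show ?thesis .
  qed
  then have "eig (hess (stiff p g (l / (2 * t))) q) (- 1 / t) = {x\<in>V q. dfl g t q x = 0}" by blast
  then show ?thesis using dim_image_add_kernel[OF linear_dfl subspace_V, of g t q q] by simp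
qed

text \<open>The eigenvalues along the fibre form a finite set, so for each stiffened function the
  multiplicities are constant near \<open>p\<close>. For a multiple that is good at both points they
  determine the rank on the tangent space.\<close>

lemma eventually_dim_tangent_image_eq:
  assumes p: "reg p" and g: "basic g" and qp: "\<And>i. \<sigma> (q i) = \<sigma> p" and lim: "q \<longlonglongrightarrow> p"
  shows "\<forall>\<^sub>F i in sequentially. dim (dfl g t (q i) ` V (q i)) = dim (dfl g t p ` V p)"
proof (cases "t = 0")
  case True
  then have "dfl g t x = (\<lambda>h. h)" for x by (simp add: dfl_def[abs_def])
  then show ?thesis using dim_V_cong[OF qp] by simp
next
  case t: False
  define bad where "bad x = {l. \<exists>h. dfl g t x h + l *\<^sub>R normal_op x h = 0 \<and> normal_op x h \<noteq> 0}" for x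
  \<comment> \<open>At most \<open>DIM('a)\<close> candidates are bad at \<open>p\<close> and as
    many at \<open>q i\<close>, so one of \<open>2 * DIM('a) + 1\<close> is good at both; the list
    does not depend on \<open>i\<close>.\<close>
  define cand where "cand = real ` {..2 * DIM('a)}"
  have fc: "finite cand" "card cand = 2 * DIM('a) + 1" by (simp_all add: cand_def card_image)
  have bad: "card (bad x \<inter> cand) \<le> DIM('a)" if x: "reg x" for x
  proof (rule pencil_kernel_card[OF linear_dfl dfl_sym[OF basic_poly[OF g]] linear_normal_op normal_op_sym])
    show "0 \<le> normal_op x h \<bullet> h" for h by (rule normal_op_psd)
    show "normal_op x h = 0" if "normal_op x h \<bullet> h = 0" for h
      using normal_op_psd(2)[OF that] by (rule normal_op_kernel)
    show "finite (bad x \<inter> cand)" using fc by simp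
  qed (auto simp: bad_def)
  define G where "G l = stiff p g (l / (2 * t))" for l
  have bG: "basic (G l)" for l unfolding G_def by (rule basic_stiff[OF g])
  have ev: "\<forall>\<^sub>F i in sequentially. \<forall>m. dim (eig (hess (G l) (q i)) m) = dim (eig (hess (G l) p) m)" for l
  proof -
    obtain M where M: "finite M" "\<And>q m. \<sigma> q = \<sigma> p \<Longrightarrow> eig (hess (G l) q) m \<noteq> {0} \<Longrightarrow> m \<in> M"
      using finite_spectrum_fib[OF p bG] by blast
    show ?thesis
    proof (rule eventually_dim_eig_eq[OF linear_hess hess_symmetric[OF basic_poly[OF bG]] linear_hess
          hess_symmetric[OF basic_poly[OF bG]] tendsto_hess[OF basic_poly[OF bG] lim] M(1)])
      show "m \<in> M" if "eig (hess (G l) (q i)) m \<noteq> {0}" for i m using M(2)[OF qp that] .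
      show "m \<in> M" if "eig (hess (G l) p) m \<noteq> {0}" for m using M(2)[OF refl that] .
    qed
  qed
  have "\<forall>\<^sub>F i in sequentially. \<forall>l\<in>cand. \<forall>m. dim (eig (hess (G l) (q i)) m) = dim (eig (hess (G l) p) m)"
    by (rule eventually_ball_finite[OF fc(1)]) (use ev in blast)
  then show ?thesis
  proof eventually_elim
    case (elim i)
    note qi = reg_sigma[OF qp[symmetric, of i] p]
    have "card (bad p \<inter> cand \<union> bad (q i) \<inter> cand) \<le> 2 * DIM('a)"
      using card_Un_le[of "bad p \<inter> cand" "bad (q i) \<inter> cand"] bad[OF p] bad[OF qi] by linarith
    then have "\<not> cand \<subseteq> bad p \<inter> cand \<union> bad (q i) \<inter> cand"
      using card_mono[of "bad p \<inter> cand \<union> bad (q i) \<inter> cand" cand] fc by auto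
    then obtain l where l: "l \<in> cand" "l \<notin> bad p" "l \<notin> bad (q i)" by blast
    have 1: "dim (eig (hess (G l) (q i)) (- 1 / t)) + dim (dfl g t (q i) ` V (q i)) = dim (V (q i))"
      unfolding G_def by (rule stiff_eig_dim[OF qi g qp t]) (use l(3) in \<open>simp add: bad_def\<close>)
    have 2: "dim (eig (hess (G l) p) (- 1 / t)) + dim (dfl g t p ` V p) = dim (V p)"
      unfolding G_def by (rule stiff_eig_dim[OF p g refl t]) (use l(2) in \<open>simp add: bad_def\<close>)
    show ?case using 1 2 elim[rule_format, OF l(1), of "- 1 / t"] dim_V_cong[OF qp[of i]] by linarith
  qed
qed

end

lemma orthogonal_projection_exists:
  assumes "subspace (W :: 'a::euclidean_space set)"
  shows "\<exists>P. linear P \<and> (\<forall>x. P x \<in> W \<and> x - P x \<in> orthogonal_comp W)"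
proof -
  define P where "P x = (SOME y. y \<in> W \<and> x - y \<in> orthogonal_comp W)" for x
  have P: "P x \<in> W \<and> x - P x \<in> orthogonal_comp W" for x
  proof -
    obtain y z where "x = y + z" "y \<in> W" "z \<in> orthogonal_comp W" using subspace_decomp[OF assms] by blast
    then have "y \<in> W \<and> x - y \<in> orthogonal_comp W" by simp
    then show ?thesis unfolding P_def by (rule someI)
  qed
  note s = subspace_orthogonal_comp[of W]
  have uniq: "P x = y" if "y \<in> W" "x - y \<in> orthogonal_comp W" for x y
  proof -
    have "P x - y \<in> W" using P[of x] that(1) assms by (simp add: subspace_diff)
    moreover have "P x - y \<in> orthogonal_comp W"
    proof -
      have "(x - y) - (x - P x) \<in> orthogonal_comp W" using subspace_diff[OF s that(2)] P[of x] by blast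
      moreover have "(x - y) - (x - P x) = P x - y" by simp
      ultimately show ?thesis by simp
    qed
    ultimately have "(P x - y) \<bullet> (P x - y) = 0" by (simp add: mem_orthogonal_comp)
    then show ?thesis by simp
  qed
  have "linear P"
  proof (rule linearI)
    fix x y
    have "x - P x + (y - P y) \<in> orthogonal_comp W" using P subspace_add[OF s] by blast
    moreover have "x - P x + (y - P y) = x + y - (P x + P y)" by simp
    ultimately show "P (x + y) = P x + P y" using P subspace_add[OF assms] by (intro uniq) auto
  next
    fix r x
    have "r *\<^sub>R (x - P x) \<in> orthogonal_comp W" using P subspace_scale[OF s] by blast
    then show "P (r *\<^sub>R x) = r *\<^sub>R P x"
      using P subspace_scale[OF assms] by (intro uniq) (auto simp: scaleR_diff_right)
  qed
  then show ?thesis using P by blast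
qed

lemma avoid_finite:
  assumes "finite (S :: real set)"
  shows "\<exists>\<tau>. (\<forall>i. \<tau> i \<notin> S) \<and> \<tau> \<longlonglongrightarrow> t"
proof -
  have "\<exists>x. t < x \<and> x < t + inverse (real (Suc i)) \<and> x \<notin> S" for i
  proof -
    have "infinite {t<..<t + inverse (real (Suc i))}" by (rule infinite_Ioo) simp
    then have "\<not> {t<..<t + inverse (real (Suc i))} \<subseteq> S" using assms finite_subset by blast
    then show ?thesis by auto
  qed
  then obtain \<tau> where \<tau>: "\<And>i. t < \<tau> i" "\<And>i. \<tau> i < t + inverse (real (Suc i))" "\<And>i. \<tau> i \<notin> S"
    by metis
  have "\<tau> \<longlonglongrightarrow> t"
  proof (rule real_tendsto_sandwich[where f = "\<lambda>_. t"])
    have "(\<lambda>i. t + inverse (real (Suc i))) \<longlonglongrightarrow> t + 0"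
      by (intro tendsto_intros LIMSEQ_inverse_real_of_nat)
    then show "(\<lambda>i. t + inverse (real (Suc i))) \<longlonglongrightarrow> t" by simp
    show "\<forall>\<^sub>F i in sequentially. t \<le> \<tau> i" using \<tau>(1) by (simp add: less_imp_le)
    show "\<forall>\<^sub>F i in sequentially. \<tau> i \<le> t + inverse (real (Suc i))"
      using \<tau>(2) by (simp add: less_imp_le del: of_nat_Suc)
  qed simp
  then show ?thesis using \<tau>(3) by blast
qed

lemma polynomial_function_linear:
  fixes T :: "'a::euclidean_space \<Rightarrow> 'b::euclidean_space" and f :: "'c::euclidean_space \<Rightarrow> 'a"
  assumes "linear T" "polynomial_function f"
  shows "polynomial_function (\<lambda>x. T (f x))"
proof -
  have "polynomial_function T"
    using assms(1) by (intro polynomial_function_bounded_linear) (simp add: linear_conv_bounded_linear)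
  from polynomial_function_compose[OF assms(2) this] show ?thesis by (simp add: o_def)
qed

text \<open>The margin makes 0 and 1 interior parameters, so that derivatives make sense at both
  ends of the segment.\<close>

lemma segment_in_ball:
  fixes q d :: "'a::euclidean_space"
  assumes "q \<in> ball c r" "q + d \<in> ball c r"
  shows "\<exists>\<eta>>0. \<forall>s. - \<eta> < s \<longrightarrow> s < 1 + \<eta> \<longrightarrow> q + s *\<^sub>R d \<in> ball c r"
proof -
  define T where "T = (\<lambda>s::real. q + s *\<^sub>R d) -` ball c r"
  have "open T" unfolding T_def by (intro open_vimage continuous_intros) auto
  moreover have "0 \<in> T" "1 \<in> T" using assms by (auto simp: T_def)
  ultimately obtain a b where ab: "a > 0" "ball 0 a \<subseteq> T" "b > 0" "ball 1 b \<subseteq> T"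
    using openE by metis
  define \<eta> where "\<eta> = min a b"
  have "s \<in> T" if s: "- \<eta> < s" "s < 1 + \<eta>" for s
  proof -
    consider "s \<le> 0" | "0 \<le> s" "s \<le> 1" | "1 \<le> s" by linarith
    then show ?thesis
    proof cases
      case 1
      then have "s \<in> ball 0 a" using s by (simp add: \<eta>_def dist_real_def)
      then show ?thesis using ab by blast
    next
      case 2
      have "(1 - s) *\<^sub>R q + s *\<^sub>R (q + d) \<in> ball c r"
        using convexD[OF convex_ball assms, of "1 - s" s] 2 by simp
      moreover have "(1 - s) *\<^sub>R q + s *\<^sub>R (q + d) = q + s *\<^sub>R d" by (simp add: algebra_simps)
      ultimately show ?thesis by (simp only: T_def vimage_eq)
    next
      case 3
      then have "s \<in> ball 1 b" using s by (simp add: \<eta>_def dist_real_def)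
      then show ?thesis using ab by blast
    qed
  qed
  moreover have "\<eta> > 0" using ab by (simp add: \<eta>_def)
  ultimately show ?thesis unfolding T_def by blast
qed

text \<open>A finite Baire argument relative to \<open>M\<close>: the closed sets are avoided one
  after the other by shrinking the open set.\<close>

lemma nowhere_dense_finite_union:
  assumes "finite I" "\<And>i. i \<in> I \<Longrightarrow> closed (C i)"
    "\<And>i A. i \<in> I \<Longrightarrow> open A \<Longrightarrow> A \<inter> M \<noteq> {} \<Longrightarrow> \<exists>x\<in>A \<inter> M. x \<notin> C i"
    and "open A" "A \<inter> M \<noteq> {}"
  shows "\<exists>A'. open A' \<and> A' \<subseteq> A \<and> A' \<inter> M \<noteq> {} \<and> (\<forall>i\<in>I. A' \<inter> C i = {})"
  using assms
proof (induct I)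
  case empty
  then show ?case by blast
next
  case (insert i I)
  obtain A' where A': "open A'" "A' \<subseteq> A" "A' \<inter> M \<noteq> {}" "\<forall>i\<in>I. A' \<inter> C i = {}"
    using insert(3)[OF insert(4) insert(5) insert(6,7)] by blast
  obtain x where x: "x \<in> A' \<inter> M" "x \<notin> C i" using insert(5)[OF insertI1 A'(1,3)] by blast
  have "open (A' - C i)" using A'(1) insert(4) by (simp add: open_Diff)
  then show ?case using A' x by (intro exI[of _ "A' - C i"]) auto
qed

lemma vector_derivative_in_tang:
  assumes "(\<alpha> has_vector_derivative Y) (at (s::real))" "\<forall>\<^sub>F u in nhds s. \<alpha> u \<in> M"
  shows "Y \<in> tang M (\<alpha> s)"
proof (rule tangI[of "\<lambda>u. \<alpha> (s + u)"])
  have "((\<lambda>u. s + u) has_vector_derivative 1) (at 0)" by (auto intro!: derivative_eq_intros)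
  from vector_diff_chain_at[OF this, of \<alpha> Y] assms(1)
  show "((\<lambda>u. \<alpha> (s + u)) has_vector_derivative Y) (at 0)" by (simp add: o_def)
  have "filterlim (\<lambda>u. s + u) (nhds (s + 0)) (nhds 0)" by (intro tendsto_intros filterlim_ident)
  then show "\<forall>\<^sub>F u in nhds 0. \<alpha> (s + u) \<in> M"
    using assms(2) unfolding filterlim_iff by (simp only: add_0_right) blast
qed simp

context manifold_map
begin

subsection \<open>Fibres are carried onto fibres\<close>

text \<open>The basic polynomial that reverses the flow at the end point is evaluated at
  \<open>y'\<close> instead; its flow leads back to the fibre of \<open>p\<close>, and the gradient
  of \<open>g\<close> found there is the direction just travelled.\<close>

lemma flw_onto_reg:
  assumes p: "reg p" and g: "basic g" and y: "reg (flw g t p)" and y': "\<sigma> y' = \<sigma> (flw g t p)"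
  shows "\<exists>q. \<sigma> q = \<sigma> p \<and> flw g t q = y'"
proof -
  define v where "v = grad g p"
  define y where "y = p + t *\<^sub>R v"
  have ry: "reg y" and sy: "\<sigma> y = \<sigma> y'" using assms(3,4) by (simp_all add: y_def v_def flw_def)
  obtain c where c: "v = grad (comb c) y"
    using grad_span_line[OF p g] ry unfolding y_def v_def by blast
  obtain a where a: "v = grad (comb a) p" using grad_span[OF p g] unfolding v_def by blast
  define w where "w = grad (comb c) y'"
  define q where "q = y' - t *\<^sub>R w"
  have yp: "y + (- t) *\<^sub>R v = p" by (simp add: y_def)
  have "\<sigma> (y + (- t) *\<^sub>R grad (comb c) y) = \<sigma> (y' + (- t) *\<^sub>R grad (comb c) y')"
    by (rule flow_equiv[OF ry sy basic_comb])
  then have pq: "\<sigma> p = \<sigma> q" unfolding c[symmetric] yp by (simp add: q_def w_def)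
  have "grad (comb c) y' = grad (comb a) (y' + (- t) *\<^sub>R grad (comb c) y')"
    by (rule gradient_transport[OF ry basic_comb _ sy]) (simp only: c[symmetric] yp a[symmetric])
  then have wq: "w = grad (comb a) q" by (simp add: w_def q_def)
  have "grad g q = grad (comb a) (q + 0 *\<^sub>R grad g q)"
    by (rule gradient_transport[OF p g _ pq]) (simp only: scaleR_zero_left add_0_right v_def[symmetric] a[symmetric])
  then have "grad g q = w" using wq by simp
  then have "flw g t q = y'" by (simp add: flw_def q_def)
  then show ?thesis using pq by metis
qed

text \<open>Since \<open>r2\<close> is basic, a fibre lies on a sphere about the origin.\<close>

lemma compact_fib: "compact (fib x)"
proof (rule compact_eq_bounded_closed[THEN iffD2, OF conjI[OF _ closed_fib]])
  have "norm y = norm x" if "y \<in> fib x" for y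
  proof -
    have "r2 y = r2 x" using basic_eq[OF basic_r2] that unfolding fib_iff by blast
    then show ?thesis by (simp add: r2_eq dot_square_norm)
  qed
  then show "bounded (fib x)" unfolding bounded_iff by (metis order_refl)
qed

lemma reg_times:
  assumes "reg p"
  shows "\<exists>\<tau>. (\<forall>i. reg (flw g (\<tau> i) p)) \<and> \<tau> \<longlonglongrightarrow> t"
  using avoid_finite[OF finite_nonreg[of p 0 "grad g p"], of t] assms by (simp add: flw_def)

text \<open>The end time is approximated by times with regular end point, whose fibres have points
  close to \<open>z'\<close>; preimages of these accumulate in the compact starting fibre.\<close>

lemma flw_onto:
  assumes p: "reg p" and g: "basic g" and z': "\<sigma> z' = \<sigma> (flw g t p)"
  shows "\<exists>q. \<sigma> q = \<sigma> p \<and> flw g t q = z'"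
proof -
  obtain \<tau> where \<tau>: "\<And>i. reg (flw g (\<tau> i) p)" and \<tau>lim: "\<tau> \<longlonglongrightarrow> t"
    using reg_times[OF p] by blast
  have "\<exists>q. \<sigma> q = \<sigma> p \<and> dist z' (flw g (\<tau> i) q) \<le> \<bar>\<tau> i - t\<bar> * norm (grad g p)" for i
  proof -
    obtain y' where y': "\<sigma> y' = \<sigma> (flw g (\<tau> i) p)" "dist z' y' = dist (\<sigma> z') (\<sigma> (flw g (\<tau> i) p))"
      using lift_point by blast
    obtain q where q: "\<sigma> q = \<sigma> p" "flw g (\<tau> i) q = y'" using flw_onto_reg[OF p g \<tau> y'(1)] by blast
    have "dist z' y' \<le> dist (flw g t p) (flw g (\<tau> i) p)"
      unfolding y'(2) z' by (rule dist_sigma_le)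
    also have "\<dots> = \<bar>\<tau> i - t\<bar> * norm (grad g p)"
      by (simp add: flw_def dist_norm scaleR_diff_left[symmetric] abs_minus_commute)
    finally show ?thesis using q by blast
  qed
  then obtain q where q: "\<And>i. \<sigma> (q i) = \<sigma> p" "\<And>i. dist z' (flw g (\<tau> i) (q i)) \<le> \<bar>\<tau> i - t\<bar> * norm (grad g p)"
    by metis
  have "\<forall>i. q i \<in> fib p" using q(1) by (simp add: fib_iff)
  then obtain q0 r where r: "q0 \<in> fib p" "strict_mono r" "(q \<circ> r) \<longlonglongrightarrow> q0"
    using compact_fib unfolding compact_def by blast
  have \<tau>r: "(\<lambda>i. \<tau> (r i)) \<longlonglongrightarrow> t" using LIMSEQ_subseq_LIMSEQ[OF \<tau>lim r(2)] by (simp add: o_def)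
  have qr: "(\<lambda>i. q (r i)) \<longlonglongrightarrow> q0" using r(3) by (simp add: o_def)
  have "(\<lambda>i. flw g (\<tau> (r i)) (q (r i))) \<longlonglongrightarrow> flw g t q0"
    unfolding flw_def by (intro tendsto_intros \<tau>r qr tendsto_grad basic_poly g)
  moreover have "(\<lambda>i. flw g (\<tau> (r i)) (q (r i))) \<longlonglongrightarrow> z'"
  proof (rule metric_tendsto_imp_tendsto)
    have "(\<lambda>i. (\<tau> (r i) - t) * norm (grad g p)) \<longlonglongrightarrow> (t - t) * norm (grad g p)"
      by (intro tendsto_intros \<tau>r)
    then show "(\<lambda>i. (\<tau> (r i) - t) * norm (grad g p)) \<longlonglongrightarrow> 0" by simp
    show "\<forall>\<^sub>F i in sequentially. dist (flw g (\<tau> (r i)) (q (r i))) z' \<le> dist ((\<tau> (r i) - t) * norm (grad g p)) 0"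
      using q(2)[of "r _"] by (simp add: dist_commute abs_mult)
  qed
  ultimately have "flw g t q0 = z'" by (rule LIMSEQ_unique)
  then show ?thesis using r(1) by (auto simp: fib_iff)
qed

lemma limit_in_V:
  assumes "reg q0" "q \<longlonglongrightarrow> q0" "\<And>i. h i \<in> V (q i)" "h \<longlonglongrightarrow> h0"
  shows "h0 \<in> V q0"
proof -
  have "grad (bas j) q0 \<bullet> h0 = 0" if j: "j < kmax" for j
  proof (rule LIMSEQ_unique)
    show "(\<lambda>i. grad (bas j) (q i) \<bullet> h i) \<longlonglongrightarrow> grad (bas j) q0 \<bullet> h0"
      by (intro tendsto_intros tendsto_grad bas_poly j assms)
    show "(\<lambda>i. grad (bas j) (q i) \<bullet> h i) \<longlonglongrightarrow> 0"
      using grad_orthogonal_tangent[OF bas_basic[OF j] assms(3)] by simp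
  qed
  then show ?thesis using tangent_eq_kernel[OF assms(1)] by simp
qed

text \<open>The constant rank makes the bound at \<open>q0\<close> persist at nearby points: otherwise the kernels there,
  enlarged by a further direction, would accumulate at too big a subspace.\<close>

lemma image_bound:
  assumes q0: "reg q0" and g: "basic g" and P: "linear (P :: 'a \<Rightarrow> 'a)"
    and inj: "\<And>h. h \<in> V q0 \<Longrightarrow> P (dfl g t q0 h) = 0 \<Longrightarrow> dfl g t q0 h = 0"
  shows "\<exists>C>0. \<exists>\<epsilon>>0. \<forall>q h. \<sigma> q = \<sigma> q0 \<longrightarrow> norm (q - q0) < \<epsilon> \<longrightarrow> h \<in> V q \<longrightarrow>
    norm (dfl g t q h) \<le> C * norm (P (dfl g t q h))"
proof (rule ccontr)
  assume neg: "\<not> ?thesis"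
  have "\<exists>q h. \<sigma> q = \<sigma> q0 \<and> norm (q - q0) < inverse (real (Suc i)) \<and> h \<in> V q \<and>
      norm (dfl g t q h) > real (Suc i) * norm (P (dfl g t q h))" for i
  proof (rule ccontr)
    assume "\<not> ?thesis"
    then have "\<forall>q h. \<sigma> q = \<sigma> q0 \<longrightarrow> norm (q - q0) < inverse (real (Suc i)) \<longrightarrow> h \<in> V q \<longrightarrow>
      norm (dfl g t q h) \<le> real (Suc i) * norm (P (dfl g t q h))" by force
    moreover have "real (Suc i) > 0" "inverse (real (Suc i)) > 0" by simp_all
    ultimately show False using neg by blast
  qed
  then obtain q h where q: "\<And>i. \<sigma> (q i) = \<sigma> q0" "\<And>i. norm (q i - q0) < inverse (real (Suc i))"
    and h: "\<And>i. h i \<in> V (q i)" "\<And>i. norm (dfl g t (q i) (h i)) > real (Suc i) * norm (P (dfl g t (q i) (h i)))"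
    by metis
  have qlim: "q \<longlonglongrightarrow> q0"
    by (rule metric_tendsto_imp_tendsto[OF LIMSEQ_inverse_real_of_nat])
      (use q(2) in \<open>auto simp: dist_norm intro!: always_eventually less_imp_le\<close>)
  obtain N0 where N0: "\<And>i. i \<ge> N0 \<Longrightarrow> dim (dfl g t (q i) ` V (q i)) = dim (dfl g t q0 ` V q0)"
    using eventually_dim_tangent_image_eq[OF q0 g q(1) qlim] unfolding eventually_sequentially by blast
  define E where "E x = {y\<in>V x. dfl g t x y = 0}" for x
  have subE: "subspace (E x)" for x
  proof -
    have "E x = V x \<inter> dfl g t x -` {0}" by (auto simp: E_def)
    then show ?thesis
      by (simp add: subspace_inter subspace_V linear_subspace_vimage[OF linear_dfl] subspace_single_0)
  qed
  have dimE: "dim (dfl g t x ` V x) + dim (E x) = dim (V x)" for x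
    unfolding E_def by (rule dim_image_add_kernel[OF linear_dfl subspace_V])
  define A where "A i = span (insert (h (i + N0)) (E (q (i + N0))))" for i
  have "dim (E q0) + 1 \<le> dim (E q0)"
  proof (rule dim_limit_subspaces[where A = A])
    show "subspace (A i)" for i by (simp add: A_def)
    show "subspace (E q0)" by (rule subE)
    show "dim (E q0) + 1 \<le> dim (A i)" for i
    proof -
      have "dfl g t (q (i + N0)) (h (i + N0)) \<noteq> 0" using h(2)[of "i + N0"] by (auto simp: linear_0[OF P])
      then have "h (i + N0) \<notin> E (q (i + N0))" by (simp add: E_def)
      then have "h (i + N0) \<notin> span (E (q (i + N0)))" by (simp add: span_eq_iff[THEN iffD2, OF subE])
      then have "dim (A i) = dim (E (q (i + N0))) + 1" by (simp add: A_def dim_insert)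
      moreover have "dim (E (q (i + N0))) = dim (E q0)"
        using dimE[of "q (i + N0)"] dimE[of q0] N0[of "i + N0"] dim_V_cong[OF q(1)[of "i + N0"]] by simp
      ultimately show ?thesis by simp
    qed
    fix a x r assume r: "strict_mono (r :: nat \<Rightarrow> nat)" and a: "\<And>i. a i \<in> A (r i)" "\<And>i. norm (a i) = 1"
      and ax: "a \<longlonglongrightarrow> x"
    define m where "m i = r i + N0" for i
    have m: "filterlim m sequentially sequentially"
      unfolding m_def using filterlim_subseq[OF r] by (intro filterlim_compose[OF filterlim_add_const_nat_at_top])
    have qm: "(\<lambda>i. q (m i)) \<longlonglongrightarrow> q0" by (rule filterlim_compose[OF qlim m])
    have aV: "a i \<in> V (q (m i))" for i
    proof -
      have "A (r i) \<subseteq> V (q (m i))"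
        unfolding A_def m_def by (rule span_minimal[OF _ subspace_V]) (use h(1) in \<open>auto simp: E_def\<close>)
      then show ?thesis using a(1) by blast
    qed
    have "x \<in> V q0" by (rule limit_in_V[OF q0 qm aV ax])
    have lim: "(\<lambda>i. dfl g t (q (m i)) (a i)) \<longlonglongrightarrow> dfl g t q0 x"
    proof (rule linear_pointwise_limit[OF linear_dfl linear_dfl _ ax])
      show "(\<lambda>i. dfl g t (q (m i)) y) \<longlonglongrightarrow> dfl g t q0 y" for y
        unfolding dfl_def by (intro tendsto_intros tendsto_hess basic_poly g qm)
    qed
    have blP: "bounded_linear P" using P linear_conv_bounded_linear by blast
    \<comment> \<open>Modulo the kernel every element of \<open>A (r i)\<close> is a multiple of
      \<open>h (m i)\<close> and inherits the violated estimate, so \<open>P\<close> of its image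
      tends to zero.\<close>
    have bound: "norm (P (dfl g t (q (m i)) (a i))) \<le> inverse (real (Suc (m i))) * norm (dfl g t (q (m i)) (a i))" for i
    proof -
      obtain k where k: "a i - k *\<^sub>R h (m i) \<in> span (E (q (m i)))"
        using a(1)[of i] by (auto simp: A_def m_def span_insert)
      then have "a i - k *\<^sub>R h (m i) \<in> E (q (m i))" by (simp only: span_eq_iff[THEN iffD2, OF subE])
      then have "dfl g t (q (m i)) (a i - k *\<^sub>R h (m i)) = 0" by (simp add: E_def)
      then have eq: "dfl g t (q (m i)) (a i) = k *\<^sub>R dfl g t (q (m i)) (h (m i))"
        by (simp add: linear_diff[OF linear_dfl] linear_cmul[OF linear_dfl])
      have "real (Suc (m i)) * norm (P (dfl g t (q (m i)) (h (m i)))) \<le> norm (dfl g t (q (m i)) (h (m i)))"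
        using h(2)[of "m i"] by simp
      then have "norm (P (dfl g t (q (m i)) (h (m i)))) \<le> inverse (real (Suc (m i))) * norm (dfl g t (q (m i)) (h (m i)))"
        by (simp add: field_simps)
      then have "\<bar>k\<bar> * norm (P (dfl g t (q (m i)) (h (m i)))) \<le> \<bar>k\<bar> * (inverse (real (Suc (m i))) * norm (dfl g t (q (m i)) (h (m i))))"
        by (rule mult_left_mono) simp
      then show ?thesis unfolding eq linear_cmul[OF P] norm_scaleR by (simp only: mult.left_commute)
    qed
    have "(\<lambda>i. P (dfl g t (q (m i)) (a i))) \<longlonglongrightarrow> 0"
    proof (rule Lim_null_comparison)
      show "\<forall>\<^sub>F i in sequentially. norm (P (dfl g t (q (m i)) (a i))) \<le> inverse (real (Suc (m i))) * norm (dfl g t (q (m i)) (a i))"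
        using bound by simp
      have "(\<lambda>i. inverse (real (Suc (m i))) * norm (dfl g t (q (m i)) (a i))) \<longlonglongrightarrow> 0 * norm (dfl g t q0 x)"
        by (intro tendsto_intros lim filterlim_compose[OF LIMSEQ_inverse_real_of_nat m])
      then show "(\<lambda>i. inverse (real (Suc (m i))) * norm (dfl g t (q (m i)) (a i))) \<longlonglongrightarrow> 0" by simp
    qed
    moreover have "(\<lambda>i. P (dfl g t (q (m i)) (a i))) \<longlonglongrightarrow> P (dfl g t q0 x)"
      by (rule bounded_linear.tendsto[OF blP lim])
    ultimately have "P (dfl g t q0 x) = 0" using LIMSEQ_unique by blast
    then show "x \<in> E q0" using inj \<open>x \<in> V q0\<close> by (simp add: E_def)
  qed
  then show False by simp
qed

text \<open>Near \<open>q0\<close> the moved fibre is controlled by a linear map of rank at most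
  that of the differential at \<open>q0\<close>. Two nearby points of the fibre are joined by the
  path that is straight in the coordinates \<open>\<Xi>\<close>; the velocity of its image is
  bounded by the value of \<open>P\<close> on it, and that value is constant along the path.\<close>

lemma fibre_image_estimate:
  assumes q0: "reg q0" and g: "basic g"
  shows "\<exists>P. linear (P :: 'a \<Rightarrow> 'a) \<and> dim (range P) \<le> dim (dfl g t q0 ` V q0) \<and>
    (\<exists>C>0. \<exists>\<epsilon>>0. \<forall>q1 q2. \<sigma> q1 = \<sigma> q0 \<longrightarrow> \<sigma> q2 = \<sigma> q0 \<longrightarrow> dist q1 q0 < \<epsilon> \<longrightarrow> dist q2 q0 < \<epsilon> \<longrightarrow>
      norm (flw g t q2 - flw g t q1) \<le> C * norm (P (flw g t q2 - flw g t q1)))"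
proof -
  note gp = basic_poly[OF g]
  define N where "N = dfl g t q0"
  have linN: "linear N" unfolding N_def by (rule linear_dfl)
  have symN: "N x \<bullet> y = x \<bullet> N y" for x y unfolding N_def by (rule dfl_sym[OF gp])
  define E where "E = {y\<in>V q0. N y = 0}"
  have subE: "subspace E"
  proof -
    have "E = V q0 \<inter> N -` {0}" by (auto simp: E_def)
    then show ?thesis
      by (simp add: subspace_inter subspace_V linear_subspace_vimage[OF linN] subspace_single_0)
  qed
  define G where "G = V q0 \<inter> orthogonal_comp E"
  have subG: "subspace G" by (simp add: G_def subspace_inter subspace_V subspace_orthogonal_comp)
  obtain PG where PG: "linear PG" "\<And>x. PG x \<in> G" "\<And>x. x - PG x \<in> orthogonal_comp G"
    using orthogonal_projection_exists[OF subG] by blast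
  obtain PE where PE: "linear PE" "\<And>x. PE x \<in> E" "\<And>x. x - PE x \<in> orthogonal_comp E"
    using orthogonal_projection_exists[OF subE] by blast
  have GN: "h = 0" if "h \<in> G" "N h = 0" for h
  proof -
    have "h \<in> E" using that by (simp add: E_def G_def)
    then have "h \<bullet> h = 0" using that(1) by (simp add: G_def mem_orthogonal_comp)
    then show ?thesis by simp
  qed
  have PG0: "PG x \<bullet> h = x \<bullet> h" if "h \<in> G" for x h
    using PG(3)[of x] that by (simp add: mem_orthogonal_comp inner_diff_left)
  have GE: "PG x = 0" if "x \<in> E" for x
  proof -
    have "PG x \<bullet> PG x = x \<bullet> PG x" by (rule PG0[OF PG(2)])
    also have "\<dots> = PG x \<bullet> x" by (rule inner_commute)
    also have "\<dots> = 0" using PG(2)[of x] that by (simp add: G_def mem_orthogonal_comp)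
    finally show ?thesis by simp
  qed
  have PGN: "N h = 0" if "h \<in> V q0" "PG (N (N h)) = 0" for h
  proof -
    have 1: "h - PE h \<in> G"
      using that(1) PE(2,3) subspace_V by (simp add: G_def E_def subspace_diff)
    have 2: "N (h - PE h) = N h" using PE(2)[of h] by (simp add: E_def linear_diff[OF linN])
    have "N (N h) \<bullet> (h - PE h) = 0" using PG0[OF 1, of "N (N h)"] that(2) by simp
    then have "N h \<bullet> N h = 0" by (simp add: symN[of "N h"] 2)
    then show ?thesis by simp
  qed
  \<comment> \<open>\<open>N\<close> followed by the projection to the complement of its kernel in
    the tangent space. For tangent \<open>h\<close> the product of \<open>N (N h)\<close> with the
    \<open>G\<close>-part of \<open>h\<close> is the squared norm of \<open>N h\<close>, so
    \<open>P\<close> is injective on the image of the tangent space.\<close>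
  define P where "P x = PG (N x)" for x
  have linP: "linear P" using linear_compose[OF linN PG(1)] by (simp add: P_def[abs_def] o_def)
  have blP: "bounded_linear P" using linP linear_conv_bounded_linear by blast
  have "dim (range P) \<le> dim G" by (rule dim_subset) (auto simp: P_def PG(2))
  also have "\<dots> = dim (N ` G)" by (rule dim_image_inj[OF linN subG GN, symmetric])
  also have "\<dots> \<le> dim (N ` V q0)" by (rule dim_subset) (auto simp: G_def)
  finally have dimP: "dim (range P) \<le> dim (dfl g t q0 ` V q0)" by (simp add: N_def)
  obtain C \<epsilon> where C: "C > 0" "\<epsilon> > 0" "\<And>q h. \<sigma> q = \<sigma> q0 \<Longrightarrow> norm (q - q0) < \<epsilon> \<Longrightarrow> h \<in> V q \<Longrightarrow>
    norm (dfl g t q h) \<le> C * norm (P (dfl g t q h))"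
    using image_bound[OF q0 g linP] PGN unfolding P_def N_def by blast
  have VK: "V q0 = K q0" by (rule tangent_eq_kernel[OF q0])
  \<comment> \<open>Along the fibre the coordinates are the \<open>P\<close>-part of the moved
    point, which lies in \<open>G\<close>, and the kernel part of the point itself, which lies in
    \<open>E\<close>.\<close>
  define L where "L y = P (flw g t y) + PE y" for y
  define \<Xi> where "\<Xi> y = (\<Sum>j<kmax. bas j y *\<^sub>R grad (bas j) q0) + L y" for y
  have GV: "x \<in> V q0" if "x \<in> G" for x using that by (simp add: G_def)
  have EV: "x \<in> V q0" if "x \<in> E" for x using that by (simp add: E_def)
  have LK: "L y \<in> K q0" for y
    unfolding VK[symmetric] L_def P_def by (intro subspace_add subspace_V GV EV PG(2) PE(2))
  have poly: "polynomial_function \<Xi>"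
    unfolding \<Xi>_def[abs_def] L_def
    by (intro polynomial_function_add polynomial_function_sum polynomial_function_mult polynomial_function_linear[OF linP] polynomial_flw gp
        polynomial_function_linear[OF PE(1)] polynomial_function_id)
      (auto simp: real_polynomial_function_eq[symmetric] bas_poly)
  define D where "D h = (\<Sum>j<kmax. (h \<bullet> grad (bas j) q0) *\<^sub>R grad (bas j) q0) + (P (N h) + PE h)" for h
  have der: "(\<Xi> has_derivative D) (at q0)"
  proof -
    have "((\<lambda>y. P (flw g t y)) has_derivative (\<lambda>h. P (N h))) (at q0)"
      unfolding N_def by (rule bounded_linear.has_derivative[OF blP has_derivative_flw[OF gp]])
    then show ?thesis
      unfolding \<Xi>_def L_def D_def
      by (intro has_derivative_add has_derivative_sum has_derivative_scaleR_left has_derivative_grad bas_poly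
          linear_imp_has_derivative PE(1)) auto
  qed
  have inj: "h = 0" if D0: "D h = 0" for h
  proof -
    define y where "y = P (N h) + PE h"
    have yV: "y \<in> V q0" unfolding y_def P_def by (intro subspace_add subspace_V GV EV PG(2) PE(2))
    have "(\<Sum>j<kmax. (h \<bullet> grad (bas j) q0) *\<^sub>R grad (bas j) q0) = - y"
      using D0 by (simp add: D_def y_def add_eq_0_iff2)
    moreover have "(\<Sum>j<kmax. (h \<bullet> grad (bas j) q0) *\<^sub>R grad (bas j) q0) \<bullet> y = 0"
      unfolding inner_sum_left by (rule sum.neutral) (use yV in \<open>simp add: VK\<close>)
    ultimately have y0: "y = 0" by simp
    then have "(\<Sum>j<kmax. (h \<bullet> grad (bas j) q0) *\<^sub>R grad (bas j) q0) = 0" using D0 by (simp add: D_def y_def)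
    then have "normal_op q0 h = 0" by (simp add: normal_op_def)
    then have hV: "h \<in> V q0" using normal_op_psd(2)[of q0 h] VK by simp
    have "PE h = - P (N h)" using y0 by (simp add: y_def add_eq_0_iff)
    then have "PE h \<in> G" using subspace_neg[OF subG PG(2)] by (simp add: P_def)
    then have "PE h \<bullet> PE h = 0" using PE(2)[of h] by (auto simp: G_def mem_orthogonal_comp)
    then have e0: "PE h = 0" by simp
    then have "PG (N (N h)) = 0" using y0 by (simp add: y_def P_def)
    then have "N h = 0" by (rule PGN[OF hV])
    then have "h \<in> E" using hV by (simp add: E_def)
    then have "(h - PE h) \<bullet> h = 0" using PE(3)[of h] by (simp add: mem_orthogonal_comp)
    then show "h = 0" using e0 by simp
  qed
  define R where "R = {y. reg y} \<inter> ball q0 \<epsilon>"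
  have R: "open R" "q0 \<in> R" using open_reg q0 C(2) by (auto simp: R_def)
  obtain A \<delta> \<psi> where A: "open A" "q0 \<in> A" "A \<subseteq> R" "\<delta> > 0" "homeomorphism A (ball (\<Xi> q0) \<delta>) \<Xi> \<psi>"
    "\<And>y. y \<in> ball (\<Xi> q0) \<delta> \<Longrightarrow> \<psi> differentiable (at y)"
    using polynomial_local_inverse[OF poly der inj R] by blast
  obtain \<epsilon>' where \<epsilon>': "\<epsilon>' > 0" "ball q0 \<epsilon>' \<subseteq> A" using A(1,2) openE by blast
  have Areg: "A \<subseteq> {y. reg y}" using A(3) by (auto simp: R_def)
  have PGXi: "PG (\<Xi> x) = P (flw g t x)" for x
  proof -
    define b where "b = (\<Sum>j<kmax. bas j x *\<^sub>R grad (bas j) q0)"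
    have b0: "PG b = 0"
    proof -
      have "PG b \<bullet> PG b = b \<bullet> PG b" by (rule PG0[OF PG(2)])
      also have "\<dots> = 0"
        unfolding b_def inner_sum_left by (rule sum.neutral) (use GV[OF PG(2)] in \<open>simp add: VK\<close>)
      finally show ?thesis by simp
    qed
    have pp: "PG (P (flw g t x)) = P (flw g t x)"
    proof -
      have m: "P (flw g t x) \<in> G" by (simp add: P_def PG(2))
      have s: "PG (P (flw g t x)) - P (flw g t x) \<in> G" by (rule subspace_diff[OF subG PG(2) m])
      have "(PG (P (flw g t x)) - P (flw g t x)) \<bullet> (PG (P (flw g t x)) - P (flw g t x)) = 0"
        using PG0[OF s, of "P (flw g t x)"] by (simp add: inner_diff_left)
      then show ?thesis by simp
    qed
    have "\<Xi> x = b + (P (flw g t x) + PE x)" by (simp add: \<Xi>_def L_def b_def)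
    then show ?thesis by (simp add: linear_add[OF PG(1)] b0 pp GE[OF PE(2)])
  qed
  have est: "norm (flw g t q2 - flw g t q1) \<le> C * norm (P (flw g t q2 - flw g t q1))"
    if q: "\<sigma> q1 = \<sigma> q0" "\<sigma> q2 = \<sigma> q0" "dist q1 q0 < \<epsilon>'" "dist q2 q0 < \<epsilon>'" for q1 q2
  proof -
    have qA: "q1 \<in> A" "q2 \<in> A" using q(3,4) \<epsilon>'(2) by (auto simp: dist_commute)
    define d where "d = \<Xi> q2 - \<Xi> q1"
    have b12: "bas j q1 = bas j q2" if "j < kmax" for j
      using basic_eq[OF bas_basic[OF that], of q1 q2] q(1,2) by simp
    have "d = L q2 - L q1"
      unfolding d_def \<Xi>_def using b12 by simp
    then have dK: "d \<in> K q0" using subspace_diff[OF subspace_orth_family LK LK] by simp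
    have "\<Xi> q1 \<in> ball (\<Xi> q0) \<delta>" "\<Xi> q1 + d \<in> ball (\<Xi> q0) \<delta>"
      using A(5) qA unfolding homeomorphism_def d_def by auto
    then obtain \<eta> where \<eta>: "\<eta> > 0" "\<And>s. - \<eta> < s \<Longrightarrow> s < 1 + \<eta> \<Longrightarrow> \<Xi> q1 + s *\<^sub>R d \<in> ball (\<Xi> q0) \<delta>"
      using segment_in_ball by blast
    define \<alpha> where "\<alpha> s = \<psi> (\<Xi> q1 + s *\<^sub>R d)" for s
    have \<alpha>0: "\<alpha> 0 = q1" and \<alpha>1: "\<alpha> 1 = q2"
      using A(5) qA unfolding homeomorphism_def \<alpha>_def d_def by auto
    have \<alpha>A: "\<alpha> s \<in> A" and \<Xi>\<alpha>: "\<Xi> (\<alpha> s) = \<Xi> q1 + s *\<^sub>R d" if "- \<eta> < s" "s < 1 + \<eta>" for s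
      using A(5) \<eta>(2)[OF that] unfolding homeomorphism_def \<alpha>_def by auto
    have \<alpha>fib: "\<sigma> (\<alpha> s) = \<sigma> q0" if s: "- \<eta> < s" "s < 1 + \<eta>" for s
    proof -
      have "beq (\<alpha> s) (\<alpha> 0)"
        unfolding \<alpha>_def
        by (rule level_coordinates[OF q0 Areg LK \<Xi>_def A(5,6) \<eta>(2) dK s]) (use \<eta>(1) in auto)
      moreover have "reg (\<alpha> s)" using \<alpha>A[OF s] Areg by blast
      ultimately have "\<sigma> (\<alpha> s) = \<sigma> (\<alpha> 0)" by (intro reg_separates)
      then show ?thesis using \<alpha>0 q(1) by simp
    qed
    have der\<beta>: "\<exists>B. ((\<lambda>s. flw g t (\<alpha> s)) has_vector_derivative B) (at s) \<and> norm B \<le> C * norm (PG d)"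
      if s: "- \<eta> < s" "s < 1 + \<eta>" for s
    proof -
      have "(\<lambda>s. \<Xi> q1 + s *\<^sub>R d) differentiable (at s)" by (auto intro!: derivative_intros)
      then have "\<alpha> differentiable (at s)"
        using differentiable_chain_at[of "\<lambda>s. \<Xi> q1 + s *\<^sub>R d" s \<psi>] A(6)[OF \<eta>(2)[OF s]]
        by (simp add: o_def \<alpha>_def[abs_def])
      then obtain Y where Y: "(\<alpha> has_vector_derivative Y) (at s)" using vector_derivative_works by blast
      have near: "\<forall>\<^sub>F u in nhds s. u \<in> {- \<eta><..<1 + \<eta>}"
        by (rule eventually_nhds_in_open) (use s in auto)
      have "Y \<in> V (\<alpha> s)"
      proof (rule vector_derivative_in_tang[OF Y])
        show "\<forall>\<^sub>F u in nhds s. \<alpha> u \<in> fib (\<alpha> s)"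
          using near by eventually_elim (use \<alpha>fib s in \<open>auto simp: fib_iff\<close>)
      qed
      define B where "B = dfl g t (\<alpha> s) Y"
      have B: "((\<lambda>s. flw g t (\<alpha> s)) has_vector_derivative B) (at s)"
        unfolding B_def by (rule flw_vector_derivative[OF gp Y])
      have "norm (\<alpha> s - q0) < \<epsilon>" using \<alpha>A[OF s] A(3) by (auto simp: R_def dist_norm norm_minus_commute)
      from C(3)[OF \<alpha>fib[OF s] this \<open>Y \<in> V (\<alpha> s)\<close>] have le: "norm B \<le> C * norm (P B)" by (simp add: B_def)
      have "((\<lambda>s. P (flw g t (\<alpha> s))) has_vector_derivative P B) (at s)"
        by (rule bounded_linear.has_vector_derivative[OF blP B])
      moreover have "((\<lambda>s. P (flw g t (\<alpha> s))) has_vector_derivative PG d) (at s)"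
      proof (rule has_vector_derivative_transform_within_open[of "\<lambda>s. PG (\<Xi> q1) + s *\<^sub>R PG d" _ _ "{- \<eta><..<1 + \<eta>}"])
        show "((\<lambda>s. PG (\<Xi> q1) + s *\<^sub>R PG d) has_vector_derivative PG d) (at s)"
          by (auto intro!: derivative_eq_intros)
        show "PG (\<Xi> q1) + u *\<^sub>R PG d = P (flw g t (\<alpha> u))" if "u \<in> {- \<eta><..<1 + \<eta>}" for u
          using \<Xi>\<alpha>[of u] that PGXi[of "\<alpha> u"] by (simp add: linear_add[OF PG(1)] linear_cmul[OF PG(1)])
      qed (use s in auto)
      \<comment> \<open>In these coordinates the \<open>P\<close>-part of the moved path is affine,
        so its velocity is the same vector throughout.\<close>
      ultimately have "P B = PG d" using vector_derivative_unique_at by blast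
      then show ?thesis using B le by auto
    qed
    then obtain B where B: "\<And>s. - \<eta> < s \<Longrightarrow> s < 1 + \<eta> \<Longrightarrow> ((\<lambda>s. flw g t (\<alpha> s)) has_vector_derivative B s) (at s) \<and> norm (B s) \<le> C * norm (PG d)"
      by metis
    have "\<exists>s\<in>{0<..<1}. norm (flw g t (\<alpha> 1) - flw g t (\<alpha> 0)) \<le> norm ((1 - 0 :: real) *\<^sub>R B s)"
    proof (rule mvt_general)
      show "continuous_on {0..1} (\<lambda>s. flw g t (\<alpha> s))"
        by (intro continuous_at_imp_continuous_on ballI has_vector_derivative_continuous[OF conjunct1[OF B]])
          (use \<eta>(1) in auto)
      show "((\<lambda>s. flw g t (\<alpha> s)) has_derivative (\<lambda>h. h *\<^sub>R B s)) (at s)" if "0 < s" "s < 1" for s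
        using B[of s] that \<eta>(1) unfolding has_vector_derivative_def by auto
    qed simp
    then obtain s where s: "s \<in> {0<..<1}" "norm (flw g t (\<alpha> 1) - flw g t (\<alpha> 0)) \<le> norm (B s)" by auto
    then have "norm (flw g t (\<alpha> 1) - flw g t (\<alpha> 0)) \<le> C * norm (PG d)" using B[of s] \<eta>(1) by fastforce
    moreover have "PG d = P (flw g t q2 - flw g t q1)"
      by (simp add: d_def linear_diff[OF PG(1)] PGXi linear_diff[OF linP])
    ultimately show ?thesis using \<alpha>0 \<alpha>1 by simp
  qed
  then show ?thesis using linP dimP C(1) \<epsilon>'(1) by blast
qed

text \<open>Every point of the image fibre is hit at a point where the flow is a submersion onto that fibre: by the
  preceding estimate, the points of smaller rank have a nowhere dense image.\<close>

theorem submersive_preimage: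
  assumes p: "reg p" and g: "basic g" and z': "\<sigma> z' = \<sigma> (flw g t p)"
  shows "\<exists>q. \<sigma> q = \<sigma> p \<and> flw g t q = z' \<and> dfl g t q ` V q = V z'"
proof -
  define r where "r q = dim (dfl g t q ` V q)" for q
  define dz where "dz = dim (V z')"
  have rq: "reg q" if "q \<in> fib p" for q using reg_sigma[OF _ p] that unfolding fib_iff by metis
  have zq: "\<sigma> (flw g t q) = \<sigma> z'" if "q \<in> fib p" for q
    using flw_sigma[OF rq[OF that] _ g, of p t] that z' unfolding fib_iff by metis
  have dimz: "dim (V y) = dz" if "\<sigma> y = \<sigma> z'" for y using dim_V_cong[OF that] by (simp add: dz_def)
  have rle: "r q \<le> dz" if "q \<in> fib p" for q
    unfolding r_def dimz[OF zq[OF that], symmetric]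
    by (rule dim_subset) (use dfl_tangent[OF rq[OF that] g] in blast)
  have seq: "\<forall>\<^sub>F i in sequentially. r (q i) = r q0" if "\<And>i. q i \<in> fib p" "q \<longlonglongrightarrow> q0" for q q0
  proof -
    have "q0 \<in> fib p" using closed_fib[of p] that closed_sequentially by blast
    moreover have "\<sigma> (q i) = \<sigma> q0" for i using that(1)[of i] \<open>q0 \<in> fib p\<close> by (simp add: fib_iff)
    ultimately show ?thesis
      unfolding r_def by (intro eventually_dim_tangent_image_eq[OF rq g _ that(2)])
  qed
  \<comment> \<open>Along convergent sequences in the fibre the rank is eventually constant, so
    every set of ranks gives a closed set; this is used for deficient and for full rank.\<close>
  have cl: "closed {q\<in>fib p. r q \<in> S}" for S
    unfolding closed_sequential_limits
  proof (intro allI impI)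
    fix q q0 assume a: "(\<forall>n. q n \<in> {q\<in>fib p. r q \<in> S}) \<and> q \<longlonglongrightarrow> q0"
    then have q: "\<And>i. q i \<in> fib p" "q \<longlonglongrightarrow> q0" by auto
    obtain i where "r (q i) = r q0"
      using seq[OF q] unfolding eventually_sequentially by blast
    moreover have "q0 \<in> fib p" using closed_fib[of p] q closed_sequentially by blast
    ultimately show "q0 \<in> {q\<in>fib p. r q \<in> S}" using a by (metis (mono_tags, lifting) mem_Collect_eq)
  qed
  have cptS: "compact {q\<in>fib p. r q \<in> S}" for S
  proof -
    have eq: "fib p \<inter> {q\<in>fib p. r q \<in> S} = {q\<in>fib p. r q \<in> S}" by blast
    show ?thesis using compact_Int_closed[OF compact_fib cl, of p S] unfolding eq .
  qed
  have contf: "continuous_on UNIV (flw g t)"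
    by (rule continuous_on_polymonial_function[OF polynomial_flw[OF basic_poly[OF g]]])
  have cpt: "compact (flw g t ` ({q\<in>fib p. r q \<in> S} \<inter> cball q0 e))" for S q0 e
  proof (rule compact_continuous_image[OF continuous_on_subset[OF contf subset_UNIV]])
    show "compact ({q\<in>fib p. r q \<in> S} \<inter> cball q0 e)"
      by (rule compact_Int_closed[OF cptS closed_cball])
  qed
  define Bd where "Bd = {q\<in>fib p. r q \<in> {..<dz}}"
  have thin: "\<exists>e>0. \<forall>A. open A \<longrightarrow> A \<inter> fib z' \<noteq> {} \<longrightarrow> (\<exists>x\<in>A \<inter> fib z'. x \<notin> flw g t ` (Bd \<inter> cball q0 e))"
    if q0: "q0 \<in> Bd" for q0
  proof -
    have q0p: "q0 \<in> fib p" and rlt: "r q0 < dz" using q0 by (auto simp: Bd_def)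
    have sq: "\<sigma> q = \<sigma> q0" if "q \<in> Bd" for q using that q0p by (simp add: Bd_def fib_iff)
    obtain P C \<epsilon> where P: "linear (P :: 'a \<Rightarrow> 'a)" "dim (range P) \<le> r q0" and C: "C > 0" "\<epsilon> > 0"
      and est: "\<And>q1 q2. \<sigma> q1 = \<sigma> q0 \<Longrightarrow> \<sigma> q2 = \<sigma> q0 \<Longrightarrow> dist q1 q0 < \<epsilon> \<Longrightarrow> dist q2 q0 < \<epsilon> \<Longrightarrow>
        norm (flw g t q2 - flw g t q1) \<le> C * norm (P (flw g t q2 - flw g t q1))"
      using fibre_image_estimate[OF rq[OF q0p] g, of t] unfolding r_def by metis
    have "\<exists>x\<in>A \<inter> fib z'. x \<notin> flw g t ` (Bd \<inter> cball q0 (\<epsilon> / 2))" if A: "open A" "A \<inter> fib z' \<noteq> {}" for A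
    proof (rule ccontr)
      assume "\<not> ?thesis"
      then have cov: "\<And>x. x \<in> A \<Longrightarrow> \<sigma> x = \<sigma> z' \<Longrightarrow> \<exists>q\<in>Bd \<inter> cball q0 (\<epsilon> / 2). x = flw g t q"
        by (auto simp: fib_iff)
      obtain z1 where z1: "z1 \<in> A" "\<sigma> z1 = \<sigma> z'" using A(2) by (auto simp: fib_iff)
      \<comment> \<open>The rank of \<open>P\<close> is smaller than the dimension of the target
        fibre. If images of nearby deficient points covered an open part of that fibre, a curve
        there with velocity \<open>X\<close> would contradict the estimate.\<close>
      have "\<exists>X\<in>V z1. P X = 0 \<and> X \<noteq> 0"
      proof (rule ccontr)
        assume "\<not> ?thesis"
        then have "dim (P ` V z1) = dim (V z1)" by (intro dim_image_inj[OF P(1) subspace_V]) blast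
        moreover have "dim (P ` V z1) \<le> dim (range P)" by (intro dim_subset) blast
        ultimately show False using P(2) rlt dimz[OF z1(2)] by linarith
      qed
      then obtain X where X: "X \<in> V z1" "P X = 0" "X \<noteq> 0" by blast
      obtain \<gamma> where \<gamma>: "\<gamma> (0::real) = z1" "\<And>s. \<gamma> s \<in> fib z1" "(\<gamma> has_vector_derivative X) (at 0)"
        using X(1) unfolding tang_def by blast
      have blP: "bounded_linear P" using P(1) linear_conv_bounded_linear by blast
      have quot: "((\<lambda>s. (1 / s) *\<^sub>R (\<gamma> s - \<gamma> 0)) \<longlongrightarrow> X) (at 0)"
        by (rule vector_derivative_quotient[OF \<gamma>(3)])
      have up: "((\<lambda>s. C * norm (P ((1 / s) *\<^sub>R (\<gamma> s - \<gamma> 0)))) \<longlongrightarrow> C * norm (P X)) (at 0)"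
        by (intro tendsto_intros bounded_linear.tendsto[OF blP] quot)
      have "isCont \<gamma> 0" by (rule has_vector_derivative_continuous[OF \<gamma>(3)])
      then have "(\<gamma> \<longlongrightarrow> z1) (at 0)" using \<gamma>(1) by (simp add: isCont_def)
      then have near: "\<forall>\<^sub>F s in at 0. \<gamma> s \<in> A" using A(1) z1(1) topological_tendstoD by blast
      have "norm X \<le> C * norm (P X)"
      proof (rule tendsto_le[OF _ up tendsto_norm[OF quot]])
        show "\<forall>\<^sub>F s in at 0. norm ((1 / s) *\<^sub>R (\<gamma> s - \<gamma> 0)) \<le> C * norm (P ((1 / s) *\<^sub>R (\<gamma> s - \<gamma> 0)))"
          using near
        proof eventually_elim
          case (elim s)
          have "\<sigma> (\<gamma> s) = \<sigma> z'" using \<gamma>(2)[of s] z1(2) by (simp add: fib_iff)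
          then obtain q2 where q2: "q2 \<in> Bd" "dist q2 q0 < \<epsilon>" "\<gamma> s = flw g t q2"
            using cov[OF elim] C(2) by (force simp: dist_commute)
          obtain q1 where q1: "q1 \<in> Bd" "dist q1 q0 < \<epsilon>" "\<gamma> 0 = flw g t q1"
            using cov[OF z1] C(2) \<gamma>(1) by (force simp: dist_commute)
          have "norm (\<gamma> s - \<gamma> 0) \<le> C * norm (P (\<gamma> s - \<gamma> 0))"
            unfolding q1(3) q2(3) by (rule est[OF sq[OF q1(1)] sq[OF q2(1)] q1(2) q2(2)])
          then have "\<bar>1 / s\<bar> * norm (\<gamma> s - \<gamma> 0) \<le> \<bar>1 / s\<bar> * (C * norm (P (\<gamma> s - \<gamma> 0)))"
            by (rule mult_left_mono) simp
          then show ?case by (simp only: linear_cmul[OF P(1)] norm_scaleR mult.left_commute)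
        qed
      qed simp
      then show False using X(2,3) by simp
    qed
    then show ?thesis using C(2) by (intro exI[of _ "\<epsilon> / 2"]) auto
  qed
  define Q where "Q q0 e \<longleftrightarrow> e > 0 \<and> (\<forall>A. open A \<longrightarrow> A \<inter> fib z' \<noteq> {} \<longrightarrow>
    (\<exists>x\<in>A \<inter> fib z'. x \<notin> flw g t ` (Bd \<inter> cball q0 e)))" for q0 e
  have "\<forall>q0\<in>Bd. \<exists>e. Q q0 e" using thin unfolding Q_def by blast
  then obtain e where eQ: "\<forall>q0\<in>Bd. Q q0 (e q0)" by (rule bchoice[THEN exE])
  have e: "e q0 > 0" "open A \<Longrightarrow> A \<inter> fib z' \<noteq> {} \<Longrightarrow> \<exists>x\<in>A \<inter> fib z'. x \<notin> flw g t ` (Bd \<inter> cball q0 (e q0))"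
    if "q0 \<in> Bd" for q0 A
    using eQ that unfolding Q_def by blast+
  have "compact Bd" unfolding Bd_def by (rule cptS)
  then obtain I where I: "I \<subseteq> Bd" "finite I" "Bd \<subseteq> (\<Union>q\<in>I. ball q (e q))"
  proof (rule compactE_image[of Bd Bd "\<lambda>q. ball q (e q)"])
    show "Bd \<subseteq> (\<Union>q\<in>Bd. ball q (e q))" using e(1) by force
  qed auto
  \<comment> \<open>The ball of radius \<open>norm p\<close> contains the whole fibre; it merely
    matches the form of \<open>cpt\<close>.\<close>
  have "z' \<in> flw g t ` ({q\<in>fib p. r q \<in> {dz}} \<inter> cball 0 (norm p))" (is "z' \<in> ?Im")
  proof (rule ccontr)
    assume no: "z' \<notin> ?Im"
    have "open (- ?Im)" using cpt[of "{dz}" 0 "norm p"] by (simp add: compact_imp_closed open_Compl)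
    moreover have "(- ?Im) \<inter> fib z' \<noteq> {}" using no self_fib by blast
    moreover have "closed (flw g t ` (Bd \<inter> cball q (e q)))" for q
      unfolding Bd_def by (rule compact_imp_closed[OF cpt])
    ultimately have "\<exists>A'. open A' \<and> A' \<subseteq> - ?Im \<and> A' \<inter> fib z' \<noteq> {} \<and>
        (\<forall>q\<in>I. A' \<inter> flw g t ` (Bd \<inter> cball q (e q)) = {})"
      by (intro nowhere_dense_finite_union[OF I(2)] e(2)) (use I(1) in auto)
    then obtain A' where A': "open A'" "A' \<subseteq> - ?Im" "A' \<inter> fib z' \<noteq> {}"
      "\<forall>q\<in>I. A' \<inter> flw g t ` (Bd \<inter> cball q (e q)) = {}"
      by blast
    obtain x where x: "x \<in> A'" "\<sigma> x = \<sigma> z'" using A'(3) by (auto simp: fib_iff)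
    obtain q where q: "\<sigma> q = \<sigma> p" "flw g t q = x" using flw_onto[OF p g, of x t] x(2) z' by auto
    have qp: "q \<in> fib p" using q(1) by (simp add: fib_iff)
    have "norm q = norm p"
      using basic_eq[OF basic_r2 q(1)] by (simp add: r2_eq dot_square_norm)
    then have "q \<in> cball 0 (norm p)" by simp
    moreover have "x \<notin> ?Im" using x(1) A'(2) by blast
    ultimately have "r q \<noteq> dz" using q(2) qp by blast
    then have "q \<in> Bd" using rle[OF qp] qp by (simp add: Bd_def)
    then obtain q' where "q' \<in> I" "q \<in> ball q' (e q')" using I(3) by blast
    then have "x \<in> flw g t ` (Bd \<inter> cball q' (e q'))"
      using \<open>q \<in> Bd\<close> q(2) by auto
    then show False using A'(4) \<open>q' \<in> I\<close> x(1) by blast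
  qed
  then obtain q where q: "q \<in> fib p" "r q = dz" "flw g t q = z'" by blast
  have "dfl g t q ` V q = V z'"
  proof (rule subspace_dim_equal)
    show "dfl g t q ` V q \<subseteq> V z'" using dfl_tangent[OF rq[OF q(1)] g] q(3) by blast
    show "dim (V z') \<le> dim (dfl g t q ` V q)" using q(2) by (simp add: r_def dz_def)
  qed (intro linear_subspace_image linear_dfl subspace_V)+
  then show ?thesis using q by (auto simp: fib_iff)
qed

text \<open>At a submersive preimage \<open>q\<close> the gradient is orthogonal to the image of the
  tangent space, which is the whole tangent space at the end point. Both flow lines have the same
  image curve, so at \<open>p\<close> the normal part has the full length of the gradient too, and
  no tangential part is left.\<close>

lemma grad_orthogonal_image:
  assumes p: "reg p" and g: "basic g"
  shows "grad g p \<in> orthogonal_comp (V (flw g t p))"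
proof -
  obtain q where q: "\<sigma> q = \<sigma> p" "flw g t q = flw g t p" "dfl g t q ` V q = V (flw g t p)"
    using submersive_preimage[OF p g refl] by blast
  obtain a b where ab: "grad g p = a + b" "a \<in> V (flw g t p)" "b \<in> orthogonal_comp (V (flw g t p))"
    using subspace_decomp[OF subspace_V] by metis
  have der: "((\<lambda>s. flw g (t + s) x) has_vector_derivative grad g x) (at 0)" for x
    unfolding flw_def by (auto intro!: derivative_eq_intros)
  have "norm b = norm (grad g q)"
  proof (rule normal_part_eq)
    show "((\<lambda>s. flw g (t + s) p) has_vector_derivative a + b) (at 0)" using der[of p] ab(1) by simp
    show "((\<lambda>s. flw g (t + s) q) has_vector_derivative 0 + grad g q) (at 0)" using der[of q] by simp
    show "grad g q \<in> orthogonal_comp (V (flw g t q))"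
      unfolding q(2) q(3)[symmetric] using grad_inner_dfl[OF g] by (auto simp: mem_orthogonal_comp)
    show "0 \<in> V (flw g t q)" by (rule subspace_0[OF subspace_V])
    show "\<forall>\<^sub>F s in at_right 0. \<sigma> (flw g (t + s) p) = \<sigma> (flw g (t + s) q)"
      using flw_sigma[OF p q(1)[symmetric] g] by simp
    show "\<sigma> (flw g t p) = \<sigma> (flw g t q)" using q(2) by simp
  qed (simp_all add: ab)
  also have "\<dots> = norm (a + b)" using norm_grad_basic[OF g q(1)] ab(1) by simp
  finally have "(norm b)\<^sup>2 = (norm (a + b))\<^sup>2" by simp
  moreover have "(norm (a + b))\<^sup>2 = (norm a)\<^sup>2 + (norm b)\<^sup>2"
    by (rule norm_add_Pythagorean) (use ab(2,3) in \<open>simp add: mem_orthogonal_comp orthogonal_def inner_commute[of a]\<close>)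
  ultimately have "a = 0" by simp
  then show ?thesis using ab by simp
qed

text \<open>Orthogonality of the gradients is differentiated along a curve with velocity
  \<open>Y\<close>. The moved curve has velocity zero, so \<open>X\<close> continues along it with
  negligible error, and the Hessian applied to \<open>Y\<close> is orthogonal to \<open>X\<close>.
  By the kernel equation \<open>Y\<close> is a multiple of that vector.\<close>

lemma kernel_orthogonal_image:
  assumes p: "reg p" and g: "basic g" and Y: "Y \<in> V p" "dfl g t p Y = 0"
  shows "Y \<in> orthogonal_comp (V (flw g t p))"
  unfolding mem_orthogonal_comp
proof
  fix X assume X: "X \<in> V (flw g t p)"
  define z where "z = flw g t p"
  note gp = basic_poly[OF g]
  obtain C \<epsilon> where C: "C > 0" "\<epsilon> > 0" "\<And>m. \<sigma> m = \<sigma> z \<Longrightarrow> norm (m - z) < \<epsilon> \<Longrightarrow>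
      \<exists>Y\<in>V m. norm (Y - X) \<le> C * norm (m - z)"
    using V_field X unfolding z_def by blast
  obtain \<gamma> where \<gamma>: "\<gamma> (0::real) = p" "\<And>s. \<gamma> s \<in> fib p" "(\<gamma> has_vector_derivative Y) (at 0)"
    using Y(1) unfolding tang_def by blast
  define \<zeta> where "\<zeta> s = flw g t (\<gamma> s)" for s
  have sp: "\<sigma> (\<gamma> s) = \<sigma> p" for s using \<gamma>(2)[of s] unfolding fib_iff .
  have rg: "reg (\<gamma> s)" for s by (rule reg_sigma[OF sp[symmetric] p])
  have d\<zeta>: "(\<zeta> has_vector_derivative 0) (at 0)"
    unfolding \<zeta>_def using flw_vector_derivative[OF gp \<gamma>(3), of t] \<gamma>(1) Y(2) by simp
  have \<zeta>0: "\<zeta> 0 = z" by (simp add: \<zeta>_def z_def \<gamma>(1))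
  have q\<zeta>: "((\<lambda>s. (1 / s) *\<^sub>R (\<zeta> s - z)) \<longlongrightarrow> 0) (at 0)"
    using vector_derivative_quotient[OF d\<zeta>] \<zeta>0 by simp
  have "((\<lambda>s. grad g (\<gamma> s)) has_derivative (\<lambda>h. hess g (\<gamma> 0) (h *\<^sub>R Y))) (at 0)"
    by (rule has_derivative_compose[OF \<gamma>(3)[unfolded has_vector_derivative_def] has_derivative_grad_hess[OF gp]])
  then have "((\<lambda>s. grad g (\<gamma> s)) has_vector_derivative hess g p Y) (at 0)"
    unfolding has_vector_derivative_def by (simp add: linear_cmul[OF linear_hess] \<gamma>(1))
  from vector_derivative_quotient[OF this]
  have qg: "((\<lambda>s. (1 / s) *\<^sub>R (grad g (\<gamma> s) - grad g p)) \<longlongrightarrow> hess g p Y) (at 0)" by (simp add: \<gamma>(1))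
  have "isCont \<zeta> 0" by (rule has_vector_derivative_continuous[OF d\<zeta>])
  then have "(\<zeta> \<longlongrightarrow> z) (at 0)" using \<zeta>0 by (simp add: isCont_def)
  then have near: "\<forall>\<^sub>F s in at 0. dist (\<zeta> s) z < \<epsilon>" using C(2) tendstoD by blast
  have "((\<lambda>s. ((1 / s) *\<^sub>R (grad g (\<gamma> s) - grad g p)) \<bullet> X) \<longlongrightarrow> 0) (at 0)"
  proof (rule Lim_null_comparison)
    have "((\<lambda>s. norm (grad g p) * C * norm ((1 / s) *\<^sub>R (\<zeta> s - z))) \<longlongrightarrow> norm (grad g p) * C * norm (0::'a)) (at 0)"
      by (intro tendsto_intros q\<zeta>)
    then show "((\<lambda>s. norm (grad g p) * C * norm ((1 / s) *\<^sub>R (\<zeta> s - z))) \<longlongrightarrow> 0) (at 0)" by simp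
    show "\<forall>\<^sub>F s in at 0. norm (((1 / s) *\<^sub>R (grad g (\<gamma> s) - grad g p)) \<bullet> X) \<le> norm (grad g p) * C * norm ((1 / s) *\<^sub>R (\<zeta> s - z))"
      using near
    proof eventually_elim
      case (elim s)
      have "\<sigma> (\<zeta> s) = \<sigma> z" unfolding \<zeta>_def z_def by (rule flw_sigma[OF rg sp g])
      then obtain Y' where Y': "Y' \<in> V (\<zeta> s)" "norm (Y' - X) \<le> C * norm (\<zeta> s - z)"
        using C(3) elim by (auto simp: dist_norm)
      have o1: "grad g (\<gamma> s) \<bullet> Y' = 0"
        using grad_orthogonal_image[OF rg g, of s t] Y'(1) by (simp add: mem_orthogonal_comp \<zeta>_def)
      have o2: "grad g p \<bullet> X = 0"
        using grad_orthogonal_image[OF p g, of t] X by (simp add: mem_orthogonal_comp)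
      have "(grad g (\<gamma> s) - grad g p) \<bullet> X = - (grad g (\<gamma> s) \<bullet> (Y' - X))"
        using o1 o2 by (simp add: inner_diff_left inner_diff_right)
      then have "\<bar>(grad g (\<gamma> s) - grad g p) \<bullet> X\<bar> \<le> norm (grad g (\<gamma> s)) * norm (Y' - X)"
        using Cauchy_Schwarz_ineq2[of "grad g (\<gamma> s)" "Y' - X"] by simp
      also have "\<dots> \<le> norm (grad g p) * (C * norm (\<zeta> s - z))"
        using Y'(2) norm_grad_basic[OF g sp[of s]] by (simp add: mult_left_mono)
      finally have "\<bar>1 / s\<bar> * \<bar>(grad g (\<gamma> s) - grad g p) \<bullet> X\<bar> \<le> \<bar>1 / s\<bar> * (norm (grad g p) * (C * norm (\<zeta> s - z)))"
        by (rule mult_left_mono) simp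
      then show ?case
        unfolding inner_scaleR_left real_norm_def abs_mult norm_scaleR by (simp only: mult_ac)
    qed
  qed
  moreover have "((\<lambda>s. ((1 / s) *\<^sub>R (grad g (\<gamma> s) - grad g p)) \<bullet> X) \<longlongrightarrow> hess g p Y \<bullet> X) (at 0)"
    by (intro tendsto_intros qg)
  ultimately have "hess g p Y \<bullet> X = 0" by (rule tendsto_unique[OF at_neq_bot, rotated])
  moreover have "Y = - (t *\<^sub>R hess g p Y)" using Y(2) by (simp add: dfl_def eq_neg_iff_add_eq_0)
  ultimately show "Y \<bullet> X = 0" by (metis inner_minus_left inner_scaleR_left mult_zero_right neg_0_equal_iff_equal)
qed

end

subsection \<open>Largest invariant subspaces\<close>

text \<open>Vectors all of whose iterates stay in \<open>A\<close>. For linear \<open>H\<close> and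
  a subspace \<open>A\<close> this is the largest invariant subspace inside \<open>A\<close>, and
  the description by iterates passes to limits.\<close>

definition inv_part :: "('a \<Rightarrow> 'a) \<Rightarrow> 'a set \<Rightarrow> 'a set" where
  "inv_part H A = {a. \<forall>j. (H ^^ j) a \<in> A}"

lemma linear_funpow:
  fixes H :: "'a::real_vector \<Rightarrow> 'a"
  assumes "linear H"
  shows "linear (H ^^ j)"
proof (induct j)
  case 0
  show ?case using linear_ident by (simp add: id_def)
next
  case (Suc j)
  show ?case using linear_compose[OF Suc assms] by (simp only: funpow.simps)
qed

lemma subspace_inv_part:
  assumes "linear H" "subspace A"
  shows "subspace (inv_part H A)"
proof -
  have "inv_part H A = (\<Inter>j. (H ^^ j) -` A)" by (auto simp: inv_part_def)
  then show ?thesis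
    using linear_subspace_vimage[OF linear_funpow[OF assms(1)] assms(2)] by (simp add: subspace_Inter)
qed

lemma inv_part_subset: "inv_part H A \<subseteq> A"
proof
  fix a assume "a \<in> inv_part H A"
  then have "(H ^^ 0) a \<in> A" unfolding inv_part_def by blast
  then show "a \<in> A" by simp
qed

lemma inv_part_invariant: "a \<in> inv_part H A \<Longrightarrow> H a \<in> inv_part H A"
proof -
  assume a: "a \<in> inv_part H A"
  have "(H ^^ j) (H a) \<in> A" for j
  proof -
    have "(H ^^ Suc j) a \<in> A" using a unfolding inv_part_def by blast
    then show ?thesis by (simp add: funpow_swap1)
  qed
  then show ?thesis by (simp add: inv_part_def)
qed

lemma inv_part_largest:
  assumes "S \<subseteq> A" "\<And>a. a \<in> S \<Longrightarrow> H a \<in> S"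
  shows "S \<subseteq> inv_part H A"
proof
  fix a assume a: "a \<in> S"
  have "(H ^^ j) a \<in> S" for j by (induct j) (use a assms(2) in auto)
  then show "a \<in> inv_part H A" using assms(1) by (auto simp: inv_part_def)
qed

lemma inv_part_shift_le:
  assumes "linear H" "subspace A" "\<And>x. H' x = H x + e *\<^sub>R x"
  shows "inv_part H A \<subseteq> inv_part H' A"
proof (rule inv_part_largest[OF inv_part_subset])
  fix a assume "a \<in> inv_part H A"
  then show "H' a \<in> inv_part H A"
    unfolding assms(3)
    by (intro subspace_add subspace_scale subspace_inv_part assms(1,2) inv_part_invariant)
qed

lemma inv_part_shift:
  assumes "linear H" "linear H'" "subspace A" "\<And>x. H' x = H x + e *\<^sub>R x"
  shows "inv_part H' A = inv_part H A"
proof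
  have "H x = H' x + (- e) *\<^sub>R x" for x by (simp add: assms(4))
  then show "inv_part H' A \<subseteq> inv_part H A" by (rule inv_part_shift_le[OF assms(2,3)])
qed (rule inv_part_shift_le[OF assms(1,3,4)])

lemma eigenvector_inv_part:
  assumes "linear H" "subspace A" "x \<in> A" "H x = m *\<^sub>R x"
  shows "x \<in> inv_part H A"
proof -
  have "range (\<lambda>c. c *\<^sub>R x) \<subseteq> inv_part H A"
  proof (rule inv_part_largest)
    show "range (\<lambda>c. c *\<^sub>R x) \<subseteq> A" using assms(2,3) by (auto simp: subspace_scale)
    fix a assume "a \<in> range (\<lambda>c. c *\<^sub>R x)"
    then obtain c where "a = c *\<^sub>R x" by blast
    then have "H a = (c * m) *\<^sub>R x" using assms(4) by (simp add: linear_cmul[OF assms(1)])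
    then show "H a \<in> range (\<lambda>c. c *\<^sub>R x)" by blast
  qed
  then have "1 *\<^sub>R x \<in> inv_part H A" by blast
  then show ?thesis by simp
qed

text \<open>The projection to \<open>A\<close> maps \<open>B\<close> onto \<open>A\<close>, since a
  vector of \<open>A\<close> orthogonal to the image would be orthogonal to \<open>B\<close>; the
  intersection is its kernel on \<open>B\<close>.\<close>

lemma dim_inter_orthogonal_comp:
  fixes A B :: "'a::euclidean_space set"
  assumes A: "subspace A" and B: "subspace B" and triv: "\<And>X. X \<in> A \<Longrightarrow> X \<in> orthogonal_comp B \<Longrightarrow> X = 0"
  shows "dim (B \<inter> orthogonal_comp A) + dim A = dim B"
proof -
  obtain P where P: "linear P" "\<And>x. P x \<in> A" "\<And>x. x - P x \<in> orthogonal_comp A"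
    using orthogonal_projection_exists[OF A] by blast
  have PX: "P x \<bullet> X = x \<bullet> X" if "X \<in> A" for x X
    using P(3)[of x] that by (simp add: mem_orthogonal_comp inner_diff_left)
  have "P x = 0 \<longleftrightarrow> x \<in> orthogonal_comp A" for x
  proof
    assume "P x = 0" then show "x \<in> orthogonal_comp A" using P(3)[of x] by simp
  next
    assume "x \<in> orthogonal_comp A"
    then have "P x \<bullet> P x = 0" using PX[OF P(2), of x x] P(2)[of x] by (simp add: mem_orthogonal_comp)
    then show "P x = 0" by simp
  qed
  then have ker: "{x\<in>B. P x = 0} = B \<inter> orthogonal_comp A" by blast
  have sub: "subspace (P ` B)" by (rule linear_subspace_image[OF P(1) B])
  have "{y\<in>A. \<forall>x\<in>P ` B. orthogonal x y} \<subseteq> {0}"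
  proof
    fix y assume y: "y \<in> {y\<in>A. \<forall>x\<in>P ` B. orthogonal x y}"
    have "y \<bullet> b = 0" if "b \<in> B" for b
    proof -
      have "P b \<bullet> y = 0" using y that by (simp add: orthogonal_def)
      then have "b \<bullet> y = 0" using PX[of y b] y by simp
      then show ?thesis by (simp only: inner_commute)
    qed
    then have "y \<in> orthogonal_comp B" by (simp add: mem_orthogonal_comp)
    then show "y \<in> {0}" using triv y by blast
  qed
  then have "dim {y\<in>A. \<forall>x\<in>P ` B. orthogonal x y} = 0" by (simp only: dim_eq_0)
  moreover have "dim {y\<in>A. \<forall>x\<in>P ` B. orthogonal x y} + dim (P ` B) = dim A"
    by (rule dim_subspace_orthogonal_to_vectors[OF sub A]) (use P(2) in blast)
  ultimately show ?thesis using dim_image_add_kernel[OF P(1) B] unfolding ker by linarith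
qed

lemma dim_add_orthogonal_le:
  fixes A B W :: "'a::euclidean_space set"
  assumes "subspace A" "subspace B" "subspace W" "A \<subseteq> W" "B \<subseteq> W" "A \<subseteq> orthogonal_comp B"
  shows "dim A + dim B \<le> dim W"
proof -
  have "dim {y\<in>W. \<forall>x\<in>B. orthogonal x y} + dim B = dim W"
    by (rule dim_subspace_orthogonal_to_vectors[OF assms(2,3,5)])
  moreover have "dim A \<le> dim {y\<in>W. \<forall>x\<in>B. orthogonal x y}"
  proof (rule dim_subset, rule subsetI)
    fix y assume "y \<in> A"
    then have "y \<in> W" "y \<in> orthogonal_comp B" using assms(4,6) by blast+
    then show "y \<in> {y\<in>W. \<forall>x\<in>B. orthogonal x y}" by (simp add: mem_orthogonal_comp orthogonal_def inner_commute[of _ y])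
  qed
  ultimately show ?thesis by linarith
qed

context manifold_map
begin

section \<open>Perturbations of a basic polynomial and the size of its invariant part\<close>

definition pert :: "('a \<Rightarrow> real) \<Rightarrow> (nat \<Rightarrow> real) \<Rightarrow> 'a \<Rightarrow> real" where
  "pert g c x = g x + comb c x"

text \<open>The invariant part contains the kernels of \<open>dfl g t p\<close> on the tangent space
  for all \<open>t \<noteq> 0\<close> at once, because they consist of eigenvectors; making it
  minimal treats all times together.\<close>

definition kap :: "'a \<Rightarrow> ('a \<Rightarrow> real) \<Rightarrow> nat" where
  "kap p g = dim (inv_part (hess g p) (V p))"

lemma basic_pert: "basic g \<Longrightarrow> basic (pert g c)"
  unfolding pert_def[abs_def] by (rule basic_add[OF _ basic_comb])

lemma grad_pert: "basic g \<Longrightarrow> grad (pert g c) x = grad g x + grad (comb c) x"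
  unfolding pert_def[abs_def] by (rule grad_add[OF basic_poly basic_poly[OF basic_comb]])

lemma hess_comb: "hess (comb c) x h = (\<Sum>j<kmax. c j *\<^sub>R hess (bas j) x h)"
proof -
  have "hess (comb c) x h = (\<Sum>j<kmax. hess (\<lambda>x. c j * bas j x) x h)"
    unfolding comb_def[abs_def] by (rule hess_sum) (auto intro: rpf_mult rpf_const bas_poly)
  also have "\<dots> = (\<Sum>j<kmax. c j *\<^sub>R hess (bas j) x h)"
    by (rule sum.cong) (auto simp: hess_cmult bas_poly)
  finally show ?thesis .
qed

lemma hess_pert: "basic g \<Longrightarrow> hess (pert g c) x h = hess g x h + hess (comb c) x h"
  unfolding pert_def[abs_def] by (rule hess_add[OF basic_poly basic_poly[OF basic_comb]])

lemma tendsto_hess_pert: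
  assumes "basic g" "x \<longlonglongrightarrow> x0" "\<And>j. j < kmax \<Longrightarrow> (\<lambda>i. c i j) \<longlonglongrightarrow> 0"
  shows "(\<lambda>i. hess (pert g (c i)) (x i) h) \<longlonglongrightarrow> hess g x0 h"
proof -
  have "(\<lambda>i. hess g (x i) h + (\<Sum>j<kmax. c i j *\<^sub>R hess (bas j) (x i) h)) \<longlonglongrightarrow> hess g x0 h + (\<Sum>j<kmax. 0 *\<^sub>R hess (bas j) x0 h)"
    by (intro tendsto_intros tendsto_hess basic_poly assms bas_poly) auto
  then show ?thesis by (simp add: hess_pert[OF assms(1)] hess_comb)
qed

lemma inv_part_limit:
  assumes p: "reg p" and g: "basic g" and x: "x \<longlonglongrightarrow> p" and c: "\<And>j. j < kmax \<Longrightarrow> (\<lambda>i. c i j) \<longlonglongrightarrow> 0"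
    and a: "\<And>i. a i \<in> inv_part (hess (pert g (c i)) (x i)) (V (x i))" "a \<longlonglongrightarrow> a0"
  shows "a0 \<in> inv_part (hess g p) (V p)"
proof -
  have "(\<lambda>i. (hess (pert g (c i)) (x i) ^^ j) (a i)) \<longlonglongrightarrow> (hess g p ^^ j) a0" for j
  proof (induct j)
    case 0
    then show ?case using a(2) by simp
  next
    case (Suc j)
    have "(\<lambda>i. hess (pert g (c i)) (x i) ((hess (pert g (c i)) (x i) ^^ j) (a i))) \<longlonglongrightarrow> hess g p ((hess g p ^^ j) a0)"
      by (rule linear_pointwise_limit[OF linear_hess linear_hess tendsto_hess_pert[OF g x c] Suc])
    then show ?case by simp
  qed
  moreover have "(hess (pert g (c i)) (x i) ^^ j) (a i) \<in> V (x i)" for i j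
    using a(1)[of i] by (simp add: inv_part_def)
  ultimately have "(hess g p ^^ j) a0 \<in> V p" for j
    by (intro limit_in_V[OF p x])
  then show ?thesis by (simp add: inv_part_def)
qed

lemma kap_semicontinuous:
  assumes p: "reg p" and g: "basic g"
  shows "\<exists>\<epsilon>>0. \<forall>x c. norm (x - p) < \<epsilon> \<longrightarrow> (\<forall>j<kmax. \<bar>c j\<bar> < \<epsilon>) \<longrightarrow> kap x (pert g c) \<le> kap p g"
proof (rule ccontr)
  assume neg: "\<not> ?thesis"
  have "\<exists>x c. norm (x - p) < inverse (real (Suc i)) \<and> (\<forall>j<kmax. \<bar>c j\<bar> < inverse (real (Suc i))) \<and> kap p g + 1 \<le> kap x (pert g c)" for i
  proof (rule ccontr)
    assume no: "\<not> ?thesis"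
    have "kap x (pert g c) \<le> kap p g"
      if "norm (x - p) < inverse (real (Suc i))" "\<forall>j<kmax. \<bar>c j\<bar> < inverse (real (Suc i))" for x c
    proof (rule ccontr)
      assume "\<not> kap x (pert g c) \<le> kap p g"
      then have "kap p g + 1 \<le> kap x (pert g c)" by simp
      then show False using no that by blast
    qed
    moreover have "inverse (real (Suc i)) > 0" by simp
    ultimately show False using neg by blast
  qed
  then obtain x c where x: "\<And>i. norm (x i - p) < inverse (real (Suc i))"
    and c: "\<And>i j. j < kmax \<Longrightarrow> \<bar>c i j\<bar> < inverse (real (Suc i))"
    and k: "\<And>i. kap p g + 1 \<le> kap (x i) (pert g (c i))"
    by metis
  have xlim: "x \<longlonglongrightarrow> p"
    by (rule metric_tendsto_imp_tendsto[OF LIMSEQ_inverse_real_of_nat])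
      (use x in \<open>auto simp: dist_norm intro!: always_eventually less_imp_le\<close>)
  have clim: "(\<lambda>i. c i j) \<longlonglongrightarrow> 0" if "j < kmax" for j
    by (rule metric_tendsto_imp_tendsto[OF LIMSEQ_inverse_real_of_nat])
      (use c[OF that] in \<open>auto simp: dist_norm intro!: always_eventually less_imp_le\<close>)
  have "kap p g + 1 \<le> dim (inv_part (hess g p) (V p))"
  proof (rule dim_limit_subspaces[where A = "\<lambda>i. inv_part (hess (pert g (c i)) (x i)) (V (x i))"])
    show "kap p g + 1 \<le> dim (inv_part (hess (pert g (c i)) (x i)) (V (x i)))" for i
      using k[of i] by (simp add: kap_def)
    fix a a0 r assume r: "strict_mono (r :: nat \<Rightarrow> nat)"
      and a: "\<And>i. a i \<in> inv_part (hess (pert g (c (r i))) (x (r i))) (V (x (r i)))" "a \<longlonglongrightarrow> a0"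
    show "a0 \<in> inv_part (hess g p) (V p)"
    proof (rule inv_part_limit[OF p g _ _ a])
      show "(\<lambda>i. x (r i)) \<longlonglongrightarrow> p" using LIMSEQ_subseq_LIMSEQ[OF xlim r] by (simp add: o_def)
      show "(\<lambda>i. c (r i) j) \<longlonglongrightarrow> 0" if "j < kmax" for j
        using LIMSEQ_subseq_LIMSEQ[OF clim[OF that] r] by (simp add: o_def)
    qed
  qed (intro subspace_inv_part linear_hess subspace_V)+
  then show False by (simp add: kap_def)
qed

text \<open>Vectors dual to the gradients at \<open>p\<close> are almost dual nearby; once the total
  defect \<open>\<eta>\<close> is below one half it is absorbed into the sum of the coefficients. It
  shows that perturbations whose gradients tend to zero near \<open>p\<close> have coefficients
  tending to zero.\<close>

lemma coefficient_bound:
  assumes p: "reg p"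
  shows "\<exists>C>0. \<forall>\<^sub>F x in nhds p. \<forall>c. \<forall>l<kmax. \<bar>c l\<bar> \<le> C * norm (grad (comb c) x)"
proof -
  have "\<exists>d. \<forall>j<kmax. d \<bullet> grad (bas j) p = (if j = l then 1 else 0)" for l
  proof -
    obtain T where T: "linear T" "\<forall>j<kmax. T (grad (bas j) p) = (if j = l then 1 else 0 :: real)"
      using lin_indep_extend_map[OF p[unfolded reg_def], of "\<lambda>j. if j = l then 1 else 0"] by blast
    have "adjoint T 1 \<bullet> x = T x" for x
      using adjoint_works[OF T(1), of x 1] by (simp add: inner_commute)
    then show ?thesis using T(2) by metis
  qed
  then obtain d where d: "\<And>l j. j < kmax \<Longrightarrow> d l \<bullet> grad (bas j) p = (if j = l then 1 else 0)" by metis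
  define S where "S = (\<Sum>l<kmax. norm (d l)) + 1"
  have S: "S > 0" by (simp add: S_def add_nonneg_pos sum_nonneg)
  define \<eta> where "\<eta> x = (\<Sum>l<kmax. \<Sum>j<kmax. \<bar>d l \<bullet> grad (bas j) x - (if j = l then 1 else 0)\<bar>)" for x
  have "((\<lambda>x. \<eta> x) \<longlongrightarrow> \<eta> p) (nhds p)"
    unfolding \<eta>_def by (intro tendsto_intros tendsto_grad bas_poly filterlim_ident) auto
  moreover have "\<eta> p = 0" unfolding \<eta>_def by (intro sum.neutral ballI) (simp add: d)
  ultimately have "\<forall>\<^sub>F x in nhds p. \<eta> x < 1 / 2" using order_tendstoD(2)[of \<eta> 0 "nhds p" "1/2"] by simp
  then have "\<forall>\<^sub>F x in nhds p. \<forall>c. \<forall>l<kmax. \<bar>c l\<bar> \<le> (2 * S) * norm (grad (comb c) x)"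
  proof eventually_elim
    case (elim x)
    show ?case
    proof (intro allI impI)
      fix c l assume l: "l < kmax"
      define w where "w = grad (comb c) x"
      define M where "M = (\<Sum>l<kmax. \<bar>c l\<bar>)"
      have cM: "\<bar>c j\<bar> \<le> M" if "j < kmax" for j
        unfolding M_def by (rule member_le_sum) (use that in auto)
      have M0: "0 \<le> M" by (simp add: M_def sum_nonneg)
      have each: "\<bar>c i\<bar> \<le> norm (d i) * norm w + M * (\<Sum>j<kmax. \<bar>d i \<bullet> grad (bas j) x - (if j = i then 1 else 0)\<bar>)"
        if i: "i < kmax" for i
      proof -
        have "d i \<bullet> w = (\<Sum>j<kmax. c j * (d i \<bullet> grad (bas j) x))"
          by (simp add: w_def grad_comb inner_sum_right)
        also have "\<dots> = (\<Sum>j<kmax. c j * (if j = i then 1 else 0)) + (\<Sum>j<kmax. c j * (d i \<bullet> grad (bas j) x - (if j = i then 1 else 0)))"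
          by (simp only: sum.distrib[symmetric] distrib_left[symmetric]) simp
        also have "(\<Sum>j<kmax. c j * (if j = i then 1 else 0)) = (\<Sum>j<kmax. if j = i then c i else 0)"
          by (rule sum.cong) auto
        also have "\<dots> = c i" using i by simp
        finally have "c i = d i \<bullet> w - (\<Sum>j<kmax. c j * (d i \<bullet> grad (bas j) x - (if j = i then 1 else 0)))" by simp
        then have "\<bar>c i\<bar> \<le> \<bar>d i \<bullet> w\<bar> + \<bar>\<Sum>j<kmax. c j * (d i \<bullet> grad (bas j) x - (if j = i then 1 else 0))\<bar>" by linarith
        also have "\<dots> \<le> norm (d i) * norm w + (\<Sum>j<kmax. M * \<bar>d i \<bullet> grad (bas j) x - (if j = i then 1 else 0)\<bar>)"
          by (intro add_mono Cauchy_Schwarz_ineq2 order_trans[OF sum_abs] sum_mono)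
            (auto simp: abs_mult intro!: mult_right_mono cM)
        finally show ?thesis by (simp add: sum_distrib_left)
      qed
      have "M \<le> (\<Sum>i<kmax. norm (d i) * norm w + M * (\<Sum>j<kmax. \<bar>d i \<bullet> grad (bas j) x - (if j = i then 1 else 0)\<bar>))"
        unfolding M_def by (rule sum_mono) (use each[unfolded M_def] in auto)
      also have "\<dots> = (\<Sum>i<kmax. norm (d i)) * norm w + M * \<eta> x"
        by (simp only: sum.distrib sum_distrib_right[symmetric] sum_distrib_left[symmetric] \<eta>_def)
      also have "\<dots> \<le> S * norm w + M * (1 / 2)"
        using elim M0 by (intro add_mono mult_right_mono mult_left_mono) (auto simp: S_def)
      finally have "M \<le> 2 * S * norm w" by simp
      then show "\<bar>c l\<bar> \<le> (2 * S) * norm (grad (comb c) x)" using cM[OF l] by (simp add: w_def)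
    qed
  qed
  then show ?thesis using S by (intro exI[of _ "2 * S"]) simp
qed

subsection \<open>Regular points in normal slices\<close>

text \<open>The flow line of a submersive preimage \<open>q\<close> runs in the normal slice and is
  regular at all but finitely many times. Unit vectors tangent at \<open>z\<close> but orthogonal to
  the tangent spaces at nearby times would have a limit of the form \<open>dfl g t q Y\<close>; it
  is orthogonal to itself, because the differentials at those times map \<open>Y\<close> into those
  tangent spaces.\<close>

lemma normal_slice_regular:
  assumes p: "reg p" and g: "basic g"
  shows "\<exists>u\<in>orthogonal_comp (V (flw g t p)). reg (flw g t p + u) \<and>
    (\<forall>X\<in>V (flw g t p). X \<in> orthogonal_comp (V (flw g t p + u)) \<longrightarrow> X = 0)"
proof (rule ccontr)
  assume neg: "\<not> ?thesis"
  define z where "z = flw g t p"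
  obtain q where q: "\<sigma> q = \<sigma> p" "flw g t q = z" "dfl g t q ` V q = V z"
    using submersive_preimage[OF p g refl] unfolding z_def by blast
  have rq: "reg q" by (rule reg_sigma[OF q(1)[symmetric] p])
  obtain \<tau> where \<tau>: "\<And>i. reg (flw g (\<tau> i) q)" "\<tau> \<longlonglongrightarrow> t" using reg_times[OF rq] by blast
  define u where "u i = (\<tau> i - t) *\<^sub>R grad g q" for i
  have zu: "z + u i = flw g (\<tau> i) q" for i
    unfolding q(2)[symmetric] by (simp add: flw_def u_def algebra_simps)
  have u\<nu>: "u i \<in> orthogonal_comp (V z)" for i
    using grad_orthogonal_image[OF rq g, of t] unfolding u_def q(2) by (simp add: subspace_scale[OF subspace_orthogonal_comp])
  have "\<exists>X\<in>V z. X \<in> orthogonal_comp (V (z + u i)) \<and> norm X = 1" for i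
  proof -
    obtain X where X: "X \<in> V z" "X \<in> orthogonal_comp (V (z + u i))" "X \<noteq> 0"
      using neg u\<nu>[of i] \<tau>(1)[of i] unfolding zu[of i, symmetric] z_def by blast
    then show ?thesis
      by (intro bexI[of _ "(1 / norm X) *\<^sub>R X"]) (auto intro: subspace_scale subspace_V subspace_orthogonal_comp)
  qed
  then obtain X where X: "\<And>i. X i \<in> V z" "\<And>i. X i \<in> orthogonal_comp (V (z + u i))" "\<And>i. norm (X i) = 1"
    by metis
  have "\<forall>i. X i \<in> sphere 0 1" using X(3) by simp
  then obtain X0 r where r: "X0 \<in> sphere 0 1" "strict_mono r" "(X \<circ> r) \<longlonglongrightarrow> X0"
    using compact_sphere unfolding compact_def by blast
  have Xr: "(\<lambda>i. X (r i)) \<longlonglongrightarrow> X0" using r(3) by (simp add: o_def)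
  have "X0 \<in> V z"
    by (rule closed_sequentially[OF closed_subspace[OF subspace_V] _ Xr]) (use X(1) in simp)
  then obtain Y where Y: "Y \<in> V q" "X0 = dfl g t q Y" using q(3) by blast
  have "X0 \<bullet> dfl g t q Y = 0"
  proof (rule LIMSEQ_unique)
    have "(\<lambda>i. \<tau> (r i)) \<longlonglongrightarrow> t" using LIMSEQ_subseq_LIMSEQ[OF \<tau>(2) r(2)] by (simp add: o_def)
    then show "(\<lambda>i. X (r i) \<bullet> dfl g (\<tau> (r i)) q Y) \<longlonglongrightarrow> X0 \<bullet> dfl g t q Y"
      unfolding dfl_def by (intro tendsto_intros Xr)
    have "X (r i) \<bullet> dfl g (\<tau> (r i)) q Y = 0" for i
      using X(2)[of "r i"] dfl_tangent[OF rq g Y(1), of "\<tau> (r i)"] unfolding zu mem_orthogonal_comp by blast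
    then show "(\<lambda>i. X (r i) \<bullet> dfl g (\<tau> (r i)) q Y) \<longlonglongrightarrow> 0" by simp
  qed
  then have "X0 = 0" using Y(2) by simp
  then show False using r(1) by simp
qed

lemma normal_horizontal:
  assumes u: "u \<in> orthogonal_comp (V z)" and r: "reg (z + u)"
  shows "\<exists>c. u = grad (comb c) (z + u)"
proof -
  obtain s0 where s0: "s0 > 0" "\<forall>s\<in>{0..s0}. dist (\<sigma> z) (\<sigma> (z + s *\<^sub>R u)) = s * norm u"
    using normal_minimal[OF u] by blast
  have "\<forall>\<^sub>F s in at 0. reg (z + s *\<^sub>R u)"
    by (rule eventually_reg_line[of z 1]) (use r in simp)
  then obtain e where e: "e > 0" "\<And>s. s \<noteq> 0 \<Longrightarrow> \<bar>s\<bar> < e \<Longrightarrow> reg (z + s *\<^sub>R u)"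
    unfolding eventually_at by (auto simp: dist_real_def)
  have "\<exists>c. u = grad (comb c) (z + s *\<^sub>R u)" if s: "0 < s" "s < min s0 e" for s
  proof (rule orthogonal_kernel)
    define x where "x = z + s *\<^sub>R u"
    have rx: "reg x" unfolding x_def by (rule e(2)) (use s in auto)
    have "dist z x = dist (\<sigma> z) (\<sigma> x)"
      using s0(2)[rule_format, of s] s by (simp add: x_def dist_norm)
    then have "(z - x) \<bullet> X = 0" if "X \<in> V x" for X by (rule nearest_orthogonal) (rule that)
    then show "u \<bullet> X = 0" if "X \<in> K (z + s *\<^sub>R u)" for X
      using that s tangent_eq_kernel[OF rx] by (simp add: x_def)
  qed
  then show ?thesis
    using comb_span_line[of 0 "min s0 e" u z u 1] s0(1) e(1) r by auto
qed

text \<open>Both conditions wanted in the slice say together that the gradients stay independent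
  after their components in \<open>A\<close> are removed; along a line this is the non-vanishing of
  one polynomial.\<close>

lemma slice_regular_iff:
  assumes A: "subspace A" and P: "linear P" "\<And>x. P x \<in> A" "\<And>x. x - P x \<in> orthogonal_comp A"
  shows "lin_indep kmax (\<lambda>j. grad (bas j) x - P (grad (bas j) x)) \<longleftrightarrow>
    reg x \<and> (\<forall>X\<in>A. X \<in> orthogonal_comp (V x) \<longrightarrow> X = 0)"
proof -
  have sum: "(\<Sum>j<kmax. c j *\<^sub>R (grad (bas j) x - P (grad (bas j) x))) = grad (comb c) x - P (grad (comb c) x)" for c
    by (simp add: grad_comb linear_sum[OF P(1)] linear_cmul[OF P(1)] scaleR_diff_right sum_subtractf)
  have PA: "P X = X" if "X \<in> A" for X
  proof -
    have "X - P X \<in> A" using subspace_diff[OF A that P(2)] .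
    then have "(X - P X) \<bullet> (X - P X) = 0" using P(3)[of X] unfolding mem_orthogonal_comp by blast
    then show ?thesis by simp
  qed
  show ?thesis
  proof
    assume li: "lin_indep kmax (\<lambda>j. grad (bas j) x - P (grad (bas j) x))"
    then have zero: "\<forall>j<kmax. c j = 0" if "grad (comb c) x - P (grad (comb c) x) = 0" for c
      using that unfolding lin_indep_def sum by blast
    have rx: "reg x" unfolding reg_def lin_indep_def
    proof (intro allI impI)
      fix c j assume "(\<Sum>j<kmax. c j *\<^sub>R grad (bas j) x) = 0" and j: "j < kmax"
      then have "grad (comb c) x = 0" by (simp add: grad_comb)
      then have "grad (comb c) x - P (grad (comb c) x) = 0" by (simp add: linear_0[OF P(1)])
      then show "c j = 0" using zero j by blast
    qed
    moreover have "X = 0" if X: "X \<in> A" "X \<in> orthogonal_comp (V x)" for X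
    proof -
      obtain c where c: "X = grad (comb c) x"
        using orthogonal_kernel[of x X] X(2) tangent_eq_kernel[OF rx] by (auto simp: mem_orthogonal_comp)
      have "\<forall>j<kmax. c j = 0" by (rule zero) (use PA[OF X(1)] c in simp)
      then show ?thesis by (simp add: c grad_comb)
    qed
    ultimately show "reg x \<and> (\<forall>X\<in>A. X \<in> orthogonal_comp (V x) \<longrightarrow> X = 0)" by blast
  next
    assume r: "reg x \<and> (\<forall>X\<in>A. X \<in> orthogonal_comp (V x) \<longrightarrow> X = 0)"
    show "lin_indep kmax (\<lambda>j. grad (bas j) x - P (grad (bas j) x))"
      unfolding lin_indep_def sum
    proof (intro allI impI)
      fix c j assume z: "grad (comb c) x - P (grad (comb c) x) = 0" and j: "j < kmax"
      then have "grad (comb c) x \<in> A" using P(2)[of "grad (comb c) x"] by simp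
      moreover have "grad (comb c) x \<in> orthogonal_comp (V x)"
        unfolding mem_orthogonal_comp using grad_orthogonal_tangent[OF basic_comb] by blast
      ultimately have "grad (comb c) x = 0" using r by blast
      then have "(\<Sum>j<kmax. c j *\<^sub>R grad (bas j) x) = 0" by (simp add: grad_comb)
      then show "c j = 0" using r j unfolding reg_def lin_indep_def by blast
    qed
  qed
qed

text \<open>The points lie on the line from \<open>p\<close> to a good point of the normal slice at
  the end point \<open>z\<close>; on it the bad parameters are finite in number. The perturbation is
  chosen so that its flow leads from the new point exactly to \<open>z\<close>, and its coefficients
  tend to zero because the required change of gradient vanishes at \<open>p\<close>.\<close>

lemma regular_approximation:
  assumes p: "reg p" and g: "basic g" and t: "t \<noteq> 0"
  shows "\<exists>x c. x \<longlonglongrightarrow> p \<and> (\<forall>j<kmax. (\<lambda>i. c i j) \<longlonglongrightarrow> 0) \<and>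
    (\<forall>i. reg (x i) \<and> flw (pert g (c i)) t (x i) = flw g t p \<and>
      (\<forall>X\<in>V (flw g t p). X \<in> orthogonal_comp (V (x i)) \<longrightarrow> X = 0))"
proof -
  define z where "z = flw g t p"
  define \<nu> where "\<nu> = orthogonal_comp (V z)"
  have sub\<nu>: "subspace \<nu>" by (simp add: \<nu>_def subspace_orthogonal_comp)
  obtain P where P: "linear P" "\<And>x. P x \<in> V z" "\<And>x. x - P x \<in> orthogonal_comp (V z)"
    using orthogonal_projection_exists[OF subspace_V] by blast
  obtain u1 where u1: "u1 \<in> \<nu>" "reg (z + u1)" "\<forall>X\<in>V z. X \<in> orthogonal_comp (V (z + u1)) \<longrightarrow> X = 0"
    using normal_slice_regular[OF p g, of t] unfolding z_def \<nu>_def by blast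
  define u0 where "u0 = p - z"
  have u0t: "u0 = (- t) *\<^sub>R grad g p" by (simp add: u0_def z_def flw_def)
  have u0: "u0 \<in> \<nu>"
    unfolding u0t \<nu>_def z_def by (rule subspace_scale[OF subspace_orthogonal_comp grad_orthogonal_image[OF p g]])
  define w where "w = u1 - u0"
  have w: "w \<in> \<nu>" unfolding w_def by (rule subspace_diff[OF sub\<nu> u1(1) u0])
  define D where "D s = gs_gram kmax (\<lambda>j. grad (bas j) (p + s *\<^sub>R w) - P (grad (bas j) (p + s *\<^sub>R w)))" for s
  have D: "D s \<noteq> 0 \<longleftrightarrow> reg (p + s *\<^sub>R w) \<and> (\<forall>X\<in>V z. X \<in> orthogonal_comp (V (p + s *\<^sub>R w)) \<longrightarrow> X = 0)" for s
    unfolding D_def gs_gram_nonzero_iff by (rule slice_regular_iff[OF subspace_V P])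
  have polyD: "real_polynomial_function D"
    unfolding D_def[abs_def]
    by (intro gs_gram_polynomial polynomial_function_diff polynomial_function_linear[OF P(1)]
        polynomial_line[OF polynomial_function_grad[OF bas_poly]])
  have "p + 1 *\<^sub>R w = z + u1" by (simp add: w_def u0_def)
  then have "D 1 \<noteq> 0" using D[of 1] u1 by simp
  then have "finite {s. D s = 0}" by (rule real_polynomial_finite_roots[OF polyD])
  then obtain s where s: "\<And>i. D (s i) \<noteq> 0" "s \<longlonglongrightarrow> 0" using avoid_finite[of _ 0] by blast
  define x where "x i = p + s i *\<^sub>R w" for i
  have rx: "reg (x i)" "\<forall>X\<in>V z. X \<in> orthogonal_comp (V (x i)) \<longrightarrow> X = 0" for i
    using s(1)[of i] D[of "s i"] unfolding x_def by blast+
  have xlim: "x \<longlonglongrightarrow> p"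
  proof -
    have "(\<lambda>i. p + s i *\<^sub>R w) \<longlonglongrightarrow> p + 0 *\<^sub>R w" by (intro tendsto_intros s(2))
    then show ?thesis by (simp add: x_def[abs_def])
  qed
  \<comment> \<open>The right side is the gradient that leads from \<open>x i\<close> to
    \<open>z\<close> in time \<open>t\<close>, minus the gradient of \<open>g\<close>. It is
    attained since \<open>x i - z\<close> is normal at \<open>z\<close> and hence a gradient at
    \<open>x i\<close>.\<close>
  have "\<exists>c. grad (comb c) (x i) = - (1 / t) *\<^sub>R (x i - z) - grad g (x i)" for i
  proof -
    have "x i - z = u0 + s i *\<^sub>R w" by (simp add: x_def u0_def)
    then have "x i - z \<in> \<nu>" using u0 w sub\<nu> by (simp add: subspace_add subspace_scale)
    then obtain a where a: "x i - z = grad (comb a) (x i)"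
      using normal_horizontal[of "x i - z" z] rx(1)[of i] by (auto simp: \<nu>_def)
    obtain b where b: "grad g (x i) = grad (comb b) (x i)" using grad_span[OF rx(1) g] by blast
    have "grad (comb (\<lambda>j. - (1 / t) * a j - b j)) (x i) = - (1 / t) *\<^sub>R grad (comb a) (x i) - grad (comb b) (x i)"
      by (simp add: grad_comb scaleR_diff_left sum_subtractf scaleR_sum_right sum_negf)
    then show ?thesis using a b by metis
  qed
  then obtain c where c: "\<And>i. grad (comb (c i)) (x i) = - (1 / t) *\<^sub>R (x i - z) - grad g (x i)" by metis
  have "flw (pert g (c i)) t (x i) = z" for i
    using t by (simp add: flw_def grad_pert[OF g] c)
  moreover have "(\<lambda>i. c i j) \<longlonglongrightarrow> 0" if j: "j < kmax" for j
  proof -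
    obtain C where C: "C > 0" "\<forall>\<^sub>F x in nhds p. \<forall>c. \<forall>l<kmax. \<bar>c l\<bar> \<le> C * norm (grad (comb c) x)"
      using coefficient_bound[OF p] by blast
    have "(\<lambda>i. C * norm (- (1 / t) *\<^sub>R (x i - z) - grad g (x i))) \<longlonglongrightarrow> C * norm (- (1 / t) *\<^sub>R (p - z) - grad g p)"
      by (intro tendsto_intros xlim tendsto_grad basic_poly g)
    moreover have "- (1 / t) *\<^sub>R (p - z) - grad g p = 0" using u0t t by (simp add: u0_def[symmetric])
    ultimately have lim: "(\<lambda>i. C * norm (grad (comb (c i)) (x i))) \<longlonglongrightarrow> 0" by (simp add: c)
    show ?thesis
    proof (rule Lim_null_comparison[OF _ lim])
      show "\<forall>\<^sub>F i in sequentially. norm (c i j) \<le> C * norm (grad (comb (c i)) (x i))"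
        using eventually_compose_filterlim[OF C(2) xlim] by eventually_elim (use j in auto)
    qed
  qed
  ultimately show ?thesis using xlim rx unfolding z_def by blast
qed

text \<open>Where \<open>kap\<close> is minimal the flow is a submersion between the fibres for all times: approximate the
  base point by regular points in the normal slice, where the kernels are small, and compare the
  images of the invariant parts with the kernel in the limit.\<close>

lemma minimal_submersive:
  assumes p: "reg p" and g: "basic g" and t: "t \<noteq> 0"
    and min: "\<And>x c. reg x \<Longrightarrow> kap p g \<le> kap x (pert g c)"
  shows "dfl g t p ` V p = V (flw g t p)"
proof -
  define z where "z = flw g t p"
  obtain x c where x: "x \<longlonglongrightarrow> p" and c: "\<And>j. j < kmax \<Longrightarrow> (\<lambda>i. c i j) \<longlonglongrightarrow> 0" and rx: "\<And>i. reg (x i)"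
    and xz: "\<And>i. flw (pert g (c i)) t (x i) = z"
    and triv: "\<And>i X. X \<in> V z \<Longrightarrow> X \<in> orthogonal_comp (V (x i)) \<Longrightarrow> X = 0"
    using regular_approximation[OF p g t] unfolding z_def by blast
  define W where "W i = inv_part (hess (pert g (c i)) (x i)) (V (x i))" for i
  define A where "A i = dfl (pert g (c i)) t (x i) ` W i" for i
  define W0 where "W0 = inv_part (hess g p) (V p)"
  define E where "E = {y\<in>V p. dfl g t p y = 0}"
  have subW: "subspace (W i)" for i unfolding W_def by (rule subspace_inv_part[OF linear_hess subspace_V])
  have subW0: "subspace W0" unfolding W0_def by (rule subspace_inv_part[OF linear_hess subspace_V])
  have dimx: "dim (V (x i)) = dim (V p)" for i using dim_V_reg[OF rx[of i]] dim_V_reg[OF p] by simp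
  have dimF: "dim (V (x i) \<inter> orthogonal_comp (V z)) + dim (V z) = dim (V p)" for i
    using dim_inter_orthogonal_comp[OF subspace_V subspace_V triv] dimx by simp
  have AW: "A i \<subseteq> V z \<inter> W i" for i
  proof
    fix y assume "y \<in> A i"
    then obtain a where a: "a \<in> W i" "y = dfl (pert g (c i)) t (x i) a" by (auto simp: A_def)
    have "a \<in> V (x i)" by (rule subsetD[OF inv_part_subset a(1)[unfolded W_def]])
    from dfl_tangent[OF rx basic_pert[OF g, of "c i"] this, of t] have "y \<in> V z" unfolding a(2) xz .
    moreover have "y \<in> W i"
      unfolding a(2) dfl_def by (intro subspace_add subspace_scale subW a(1)) (use a(1) inv_part_invariant in \<open>auto simp: W_def\<close>)
    ultimately show "y \<in> V z \<inter> W i" by blast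
  qed
  \<comment> \<open>On the invariant part the kernel is confined to the intersection of
    \<open>V (x i)\<close> with the complement of \<open>V z\<close>, whose dimension is
    \<open>dim (V p) - dim (V z)\<close>; minimality of \<open>kap\<close> bounds the invariant part
    from below.\<close>
  have dimA: "dim W0 - (dim (V p) - dim (V z)) \<le> dim (A i)" for i
  proof -
    have "{y\<in>W i. dfl (pert g (c i)) t (x i) y = 0} \<subseteq> V (x i) \<inter> orthogonal_comp (V z)"
    proof
      fix y assume y: "y \<in> {y\<in>W i. dfl (pert g (c i)) t (x i) y = 0}"
      then have "y \<in> W i" by simp
      then have "y \<in> V (x i)" unfolding W_def by (rule subsetD[OF inv_part_subset])
      moreover have "y \<in> orthogonal_comp (V (flw (pert g (c i)) t (x i)))"
        by (rule kernel_orthogonal_image[OF rx basic_pert[OF g] \<open>y \<in> V (x i)\<close>]) (use y in simp)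
      ultimately show "y \<in> V (x i) \<inter> orthogonal_comp (V z)" unfolding xz by blast
    qed
    then have "dim {y\<in>W i. dfl (pert g (c i)) t (x i) y = 0} \<le> dim (V (x i) \<inter> orthogonal_comp (V z))"
      by (rule dim_subset)
    moreover have "dim (A i) + dim {y\<in>W i. dfl (pert g (c i)) t (x i) y = 0} = dim (W i)"
      unfolding A_def by (rule dim_image_add_kernel[OF linear_dfl subW])
    moreover have "dim W0 \<le> dim (W i)" using min[OF rx, of i "c i"] by (simp add: kap_def W_def W0_def)
    ultimately show ?thesis using dimF[of i] by linarith
  qed
  have lim: "dim W0 - (dim (V p) - dim (V z)) \<le> dim (V z \<inter> W0)"
  proof (rule dim_limit_subspaces[where A = A])
    show "subspace (A i)" for i unfolding A_def by (rule linear_subspace_image[OF linear_dfl subW])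
    show "subspace (V z \<inter> W0)" by (rule subspace_inter[OF subspace_V subW0])
    fix a a0 r assume r: "strict_mono (r :: nat \<Rightarrow> nat)" and a: "\<And>i. a i \<in> A (r i)" "a \<longlonglongrightarrow> a0"
    have "a0 \<in> V z"
      by (rule closed_sequentially[OF closed_subspace[OF subspace_V] _ a(2)]) (use a(1) AW in blast)
    moreover have "a0 \<in> W0"
      unfolding W0_def
    proof (rule inv_part_limit[OF p g _ _ _ a(2)])
      show "(\<lambda>i. x (r i)) \<longlonglongrightarrow> p" using LIMSEQ_subseq_LIMSEQ[OF x r] by (simp add: o_def)
      show "(\<lambda>i. c (r i) j) \<longlonglongrightarrow> 0" if "j < kmax" for j
        using LIMSEQ_subseq_LIMSEQ[OF c[OF that] r] by (simp add: o_def)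
      show "a i \<in> inv_part (hess (pert g (c (r i))) (x (r i))) (V (x (r i)))" for i
        using a(1)[of i] AW[of "r i"] unfolding W_def by blast
    qed
    ultimately show "a0 \<in> V z \<inter> W0" by blast
  qed (rule dimA)
  have subE: "subspace E"
  proof -
    have "E = V p \<inter> dfl g t p -` {0}" by (auto simp: E_def)
    then show ?thesis
      by (simp add: subspace_inter subspace_V linear_subspace_vimage[OF linear_dfl] subspace_single_0)
  qed
  \<comment> \<open>The kernel at \<open>p\<close> consists of eigenvectors, so it lies in
    \<open>W0\<close>, and it is orthogonal to the part of \<open>W0\<close> tangent at
    \<open>z\<close>. The lower bound for that part limits the kernel to
    \<open>dim (V p) - dim (V z)\<close>, so the image fills \<open>V z\<close>.\<close>
  have "dim E + dim (V z \<inter> W0) \<le> dim W0"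
  proof (rule dim_add_orthogonal_le[OF subE subspace_inter[OF subspace_V subW0] subW0])
    show "E \<subseteq> W0"
    proof
      fix y assume y: "y \<in> E"
      have "t *\<^sub>R hess g p y = - y" using y by (simp add: E_def dfl_def add_eq_0_iff)
      then have "(1 / t) *\<^sub>R (t *\<^sub>R hess g p y) = (1 / t) *\<^sub>R (- y)" by (simp only:)
      then have hy: "hess g p y = (- 1 / t) *\<^sub>R y" using t by simp
      show "y \<in> W0"
        unfolding W0_def by (rule eigenvector_inv_part[OF linear_hess subspace_V _ hy]) (use y in \<open>simp add: E_def\<close>)
    qed
    show "E \<subseteq> orthogonal_comp (V z \<inter> W0)"
      using kernel_orthogonal_image[OF p g, of _ t] unfolding E_def z_def mem_orthogonal_comp subset_iff by blast
  qed blast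
  then have "dim E \<le> dim (V p) - dim (V z)" using lim by linarith
  then have "dim (V z) \<le> dim (dfl g t p ` V p)"
    using dim_image_add_kernel[OF linear_dfl subspace_V, of g t p p] dimF[of 0] unfolding E_def by linarith
  then show ?thesis
    unfolding z_def using dfl_tangent[OF p g]
    by (intro subspace_dim_equal linear_subspace_image linear_dfl subspace_V) auto
qed

section \<open>Constancy of the Laplacian on fibres\<close>

lemma laplacian_eq_of_minimal:
  assumes p: "reg p" and g: "basic g" and min: "\<And>x c. reg x \<Longrightarrow> kap p g \<le> kap x (pert g c)"
    and q: "\<sigma> p = \<sigma> q"
  shows "laplacian g p = laplacian g q"
  unfolding laplacian_eq_trace[OF basic_poly[OF g]]
proof (rule trace_eq_if_eigenspaces_le[OF linear_hess hess_symmetric[OF basic_poly[OF g]] linear_hess hess_symmetric[OF basic_poly[OF g]]])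
  fix m
  \<comment> \<open>The summand shifts the Hessian by \<open>1 - m\<close>, so the eigenvalue
    \<open>m\<close> becomes 1 and belongs to the time \<open>- 1\<close>; this treats
    \<open>m = 0\<close> like every other value. The invariant parts, and with them
    \<open>kap\<close>, do not change.\<close>
  define g' where "g' x = g x + ((1 - m) / 2) * r2 x" for x
  have g': "basic g'" unfolding g'_def[abs_def] by (intro basic_add g basic_cmult basic_r2)
  have h: "hess (pert g' c) x y = hess (pert g c) x y + (1 - m) *\<^sub>R y" for c x y
  proof -
    have "hess g' x y = hess g x y + (1 - m) *\<^sub>R y"
      unfolding g'_def[abs_def] hess_add[OF basic_poly[OF g] rpf_mult[OF rpf_const real_polynomial_r2]]
        hess_cmult[OF real_polynomial_r2] hess_r2 by simp
    then show ?thesis by (simp add: hess_pert[OF g] hess_pert[OF g'])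
  qed
  have k: "kap x (pert g' c) = kap x (pert g c)" for x c
    unfolding kap_def by (simp only: inv_part_shift[OF linear_hess linear_hess subspace_V h])
  have pert0: "pert f (\<lambda>_. 0) = f" for f by (simp add: pert_def[abs_def] comb_def)
  have eig: "eig (hess g' x) 1 = eig (hess g x) m" for x
  proof -
    have "hess g' x y - 1 *\<^sub>R y = hess g x y - m *\<^sub>R y" for y
      using h[of "\<lambda>_. 0" x y] unfolding pert0 by (simp add: scaleR_diff_left)
    then have "hess g' x y = 1 *\<^sub>R y \<longleftrightarrow> hess g x y = m *\<^sub>R y" for y
      by (metis eq_iff_diff_eq_0)
    then show ?thesis unfolding eig_def by blast
  qed
  have "dfl g' (- 1) p ` V p = V (flw g' (- 1) p)"
  proof (rule minimal_submersive[OF p g'])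
    show "kap p g' \<le> kap x (pert g' c)" if "reg x" for x c
      using min[OF that, of c] k[of p "\<lambda>_. 0"] unfolding pert0 k by simp
  qed simp
  then have "V (flw g' (- 1) p) \<subseteq> range (dfl g' (- 1) p)" by blast
  from dim_eig_le[OF p q g' _ this] show "dim (eig (hess g p) m) \<le> dim (eig (hess g q) m)"
    by (simp add: eig)
qed

text \<open>Minimality is taken over all regular points and all perturbations of \<open>f\<close>.
  It persists under small further perturbations near the minimal point, so there the Laplacians of
  an open family of combinations are constant along fibres; by linearity so are those of
  \<open>bas\<close> and of \<open>f\<close> itself.\<close>

lemma laplacian_locally_basic:
  assumes f: "basic f"
  shows "\<exists>A. open A \<and> A \<noteq> {} \<and> (\<forall>p q. p \<in> A \<longrightarrow> \<sigma> p = \<sigma> q \<longrightarrow> laplacian f p = laplacian f q)"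
proof -
  define S where "S = {kap x (pert f c) |x c. reg x}"
  obtain x1 where "reg x1" using reg_dense[of UNIV] by blast
  then have "kap x1 (pert f (\<lambda>_. 0)) \<in> S" unfolding S_def by blast
  from LeastI[of "\<lambda>k. k \<in> S", OF this] obtain p0 c0 where p0: "reg p0" "kap p0 (pert f c0) = (LEAST k. k \<in> S)"
    unfolding S_def by auto
  have least: "kap p0 (pert f c0) \<le> kap x (pert f c)" if "reg x" for x c
    unfolding p0(2) by (rule Least_le) (use that in \<open>auto simp: S_def\<close>)
  define g where "g = pert f c0"
  have g: "basic g" unfolding g_def by (rule basic_pert[OF f])
  have comp: "pert (pert f a) b = pert f (\<lambda>j. a j + b j)" for a b
    by (simp add: pert_def[abs_def] comb_def distrib_right sum.distrib add.assoc)
  obtain \<epsilon> where \<epsilon>: "\<epsilon> > 0" "\<And>x c. norm (x - p0) < \<epsilon> \<Longrightarrow> (\<forall>j<kmax. \<bar>c j\<bar> < \<epsilon>) \<Longrightarrow> kap x (pert g c) \<le> kap p0 g"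
    using kap_semicontinuous[OF p0(1) g] by blast
  define A where "A = {x. reg x} \<inter> ball p0 \<epsilon>"
  have eq: "laplacian (pert g c) p = laplacian (pert g c) q"
    if pA: "p \<in> A" and pq: "\<sigma> p = \<sigma> q" and c: "\<forall>j<kmax. \<bar>c j\<bar> < \<epsilon>" for p q c
  proof (rule laplacian_eq_of_minimal[OF _ basic_pert[OF g] _ pq])
    show "reg p" using pA by (simp add: A_def)
    have "norm (p - p0) < \<epsilon>" using pA by (simp add: A_def dist_norm norm_minus_commute)
    from \<epsilon>(2)[OF this c] have "kap p (pert g c) \<le> kap p0 (pert f c0)" by (simp add: g_def)
    then show "kap p (pert g c) \<le> kap x (pert (pert g c) b)" if "reg x" for x b
      using least[OF that] unfolding g_def comp by (rule order_trans)
  qed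
  have lap: "laplacian (pert h c) x = laplacian h x + (\<Sum>j<kmax. c j * laplacian (bas j) x)" if "basic h" for h c x
  proof -
    have "laplacian (comb c) x = (\<Sum>j<kmax. laplacian (\<lambda>x. c j * bas j x) x)"
      unfolding comb_def[abs_def] by (rule laplacian_sum) (auto intro: rpf_mult rpf_const bas_poly)
    also have "\<dots> = (\<Sum>j<kmax. c j * laplacian (bas j) x)"
      by (rule sum.cong) (auto simp: laplacian_cmult bas_poly)
    finally show ?thesis
      unfolding pert_def[abs_def] by (simp add: laplacian_add basic_poly[OF that] basic_poly[OF basic_comb])
  qed
  have "laplacian f p = laplacian f q" if pq: "p \<in> A" "\<sigma> p = \<sigma> q" for p q
  proof -
    have 0: "laplacian g p = laplacian g q"
      using eq[OF pq, of "\<lambda>_. 0"] \<epsilon>(1) by (simp add: lap[OF g])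
    have bas: "laplacian (bas j) p = laplacian (bas j) q" if j: "j < kmax" for j
    proof -
      define c where "c i = (if i = j then \<epsilon> / 2 else 0)" for i
      have s: "(\<Sum>i<kmax. c i * laplacian (bas i) x) = \<epsilon> / 2 * laplacian (bas j) x" for x
      proof -
        have "(\<Sum>i<kmax. c i * laplacian (bas i) x) = (\<Sum>i<kmax. if i = j then \<epsilon> / 2 * laplacian (bas j) x else 0)"
          by (rule sum.cong) (auto simp: c_def)
        then show ?thesis using j by simp
      qed
      have "laplacian (pert g c) p = laplacian (pert g c) q"
        by (rule eq[OF pq]) (use \<epsilon>(1) in \<open>simp add: c_def\<close>)
      then show ?thesis using 0 \<epsilon>(1) by (simp add: lap[OF g] s)
    qed
    have "(\<Sum>j<kmax. c0 j * laplacian (bas j) p) = (\<Sum>j<kmax. c0 j * laplacian (bas j) q)"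
      by (rule sum.cong) (simp_all add: bas)
    then show ?thesis using 0 unfolding g_def lap[OF f] by simp
  qed
  moreover have "open A" using open_reg by (simp add: A_def open_Int)
  moreover have "p0 \<in> A" using p0(1) \<epsilon>(1) by (simp add: A_def)
  ultimately show ?thesis by blast
qed

theorem basic_laplacian:
  assumes f: "basic f"
  shows "basic (laplacian f)"
  unfolding basic_iff
proof (intro conjI allI impI)
  note lp = real_polynomial_laplacian[OF basic_poly[OF f]]
  show "real_polynomial_function (laplacian f)" by (rule lp)
  fix x y assume xy: "\<sigma> x = \<sigma> y"
  obtain A where A: "open A" "A \<noteq> {}" "\<And>p q. p \<in> A \<Longrightarrow> \<sigma> p = \<sigma> q \<Longrightarrow> laplacian f p = laplacian f q"
    using laplacian_locally_basic[OF f] by blast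
  obtain u0 where u0: "u0 \<in> A" using A(2) by blast
  obtain u where u: "\<sigma> u = \<sigma> u0" "dist x u = dist (\<sigma> x) (\<sigma> u0)" using lift_point by blast
  define v where "v = u - x"
  have min: "dist (\<sigma> x) (\<sigma> (x + v)) = norm v" using u by (simp add: v_def dist_norm norm_minus_commute)
  have satA: "\<And>w. w \<in> sat A \<longleftrightarrow> (\<exists>a\<in>A. \<sigma> w = \<sigma> a)" by (auto simp: sat_def)
  define T where "T = (\<lambda>s::real. x + s *\<^sub>R v) -` sat A"
  have "open T" unfolding T_def by (intro open_vimage open_sat A(1) continuous_intros)
  moreover have "1 \<in> T" using u(1) u0 by (auto simp: T_def v_def satA)
  ultimately obtain e where e: "e > 0" "ball 1 e \<subseteq> T" using openE by blast
  define s1 where "s1 = max 0 (1 - e)"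
  \<comment> \<open>Lifts are controlled only up to a parameter strictly below 1, while the segment
    is known to meet good fibres only near 1; \<open>s1 < s0 < 1\<close> leaves an interval for
    both.\<close>
  define s0 where "s0 = (1 + s1) / 2"
  have s: "0 \<le> s1" "s1 < s0" "s0 < 1" "0 < s0" using e(1) by (auto simp: s1_def s0_def)
  obtain w where w: "\<And>s. s \<in> {0..s0} \<Longrightarrow> \<sigma> (y + s *\<^sub>R w) = \<sigma> (x + s *\<^sub>R v)"
    using segment_lift[OF min xy s(4,3)] by blast
  have "laplacian f (x + s *\<^sub>R v) = laplacian f (y + s *\<^sub>R w)" if st: "s1 < s" "s < s0" for s
  proof -
    have "s \<in> ball 1 e" using st s by (auto simp: s1_def dist_real_def)
    then have "s \<in> T" using e(2) by blast
    then obtain a where a: "a \<in> A" "\<sigma> (x + s *\<^sub>R v) = \<sigma> a" by (auto simp: T_def satA)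
    have sw: "\<sigma> (y + s *\<^sub>R w) = \<sigma> (x + s *\<^sub>R v)" by (rule w) (use st s in auto)
    have "laplacian f a = laplacian f (x + s *\<^sub>R v)" by (rule A(3)[OF a(1) a(2)[symmetric]])
    moreover have "laplacian f a = laplacian f (y + s *\<^sub>R w)" by (rule A(3)[OF a(1)]) (simp only: a(2) sw)
    ultimately show ?thesis by simp
  qed
  from real_polynomial_eq_interval[OF real_polynomial_line[OF lp, of x v] real_polynomial_line[OF lp, of y w] s(2) this, of 0]
  show "laplacian f x = laplacian f y" by simp
qed

end

section \<open>Integration\<close>

lemma integrable_continuous_support:
  fixes f :: "'a::euclidean_space \<Rightarrow> real"
  assumes "continuous_on UNIV f" "\<And>x. norm x > R \<Longrightarrow> f x = 0"
  shows "integrable lborel f"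
proof -
  have "integrable lborel (\<lambda>x. indicator (cball 0 R) x *\<^sub>R f x)"
    by (rule borel_integrable_compact[OF compact_cball continuous_on_subset[OF assms(1)]]) simp
  moreover have "(\<lambda>x. indicator (cball 0 R) x *\<^sub>R f x) = f"
    by (rule ext) (use assms(2) in \<open>auto simp: indicator_def\<close>)
  ultimately show ?thesis by simp
qed

lemma integral_translation:
  fixes f :: "'a::euclidean_space \<Rightarrow> real"
  assumes "f \<in> borel_measurable borel"
  shows "(\<integral>x. f (x + c) \<partial>lborel) = (\<integral>x. f x \<partial>lborel)"
proof -
  have "(\<integral>x. f x \<partial>distr lborel borel ((+) c)) = (\<integral>x. f (c + x) \<partial>lborel)"
    by (rule integral_distr) (use assms in auto)
  then show ?thesis by (simp add: lborel_distr_plus add.commute)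
qed

text \<open>The difference quotients integrate to zero by translation invariance, and they converge
  to \<open>d\<close> with a common bound on a ball of radius larger by 1, the largest step.\<close>

lemma integral_derivative_zero:
  fixes \<psi> d :: "'a::euclidean_space \<Rightarrow> real"
  assumes der: "\<And>x t. ((\<lambda>t. \<psi> (x + t *\<^sub>R b)) has_real_derivative d (x + t *\<^sub>R b)) (at t)"
    and c\<psi>: "continuous_on UNIV \<psi>" and cd: "continuous_on UNIV d"
    and s\<psi>: "\<And>x. norm x > R \<Longrightarrow> \<psi> x = 0" and sd: "\<And>x. norm x > R \<Longrightarrow> d x = 0" and b: "norm b = 1"
  shows "(\<integral>x. d x \<partial>lborel) = 0"
proof -
  have "compact (d ` cball 0 R)"
    by (rule compact_continuous_image[OF continuous_on_subset[OF cd] compact_cball]) simp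
  then have "bounded (d ` cball 0 R)" by (rule compact_imp_bounded)
  then obtain L0 where L0: "\<And>x. x \<in> cball 0 R \<Longrightarrow> norm (d x) \<le> L0"
    unfolding bounded_iff by blast
  define L where "L = max L0 0"
  have L: "\<bar>d x\<bar> \<le> L" for x
    using L0[of x] sd[of x] by (cases "norm x \<le> R") (auto simp: L_def)
  define h where "h n = inverse (real (Suc n))" for n
  have h: "0 < h n" "h n \<le> 1" for n by (simp_all add: h_def field_simps)
  have hlim: "h \<longlonglongrightarrow> 0" unfolding h_def by (rule LIMSEQ_inverse_real_of_nat)
  define Q where "Q n x = (\<psi> (x + h n *\<^sub>R b) - \<psi> x) / h n" for n x
  have lip: "\<bar>Q n x\<bar> \<le> L * indicator (cball 0 (R + 1)) x" for n x
  proof (cases "norm x \<le> R + 1")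
    case True
    obtain z where z: "\<psi> (x + h n *\<^sub>R b) - \<psi> (x + 0 *\<^sub>R b) = (h n - 0) * d (x + z *\<^sub>R b)"
      using MVT2[OF h(1)[of n], of "\<lambda>t. \<psi> (x + t *\<^sub>R b)" "\<lambda>t. d (x + t *\<^sub>R b)"] der by blast
    then have "Q n x = d (x + z *\<^sub>R b)" using h(1)[of n] by (simp add: Q_def)
    then show ?thesis using L[of "x + z *\<^sub>R b"] True by simp
  next
    case False
    have "norm x \<le> norm (x + h n *\<^sub>R b) + norm (h n *\<^sub>R b)"
      using norm_triangle_ineq4[of "x + h n *\<^sub>R b" "h n *\<^sub>R b"] by simp
    then have "norm (x + h n *\<^sub>R b) > R" using False h[of n] b by simp
    then have "Q n x = 0" using False s\<psi>[of x] s\<psi>[of "x + h n *\<^sub>R b"] by (simp add: Q_def)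
    then show ?thesis using False by simp
  qed
  have m\<psi>: "\<psi> \<in> borel_measurable borel" by (rule borel_measurable_continuous_onI[OF c\<psi>])
  have i\<psi>: "integrable lborel \<psi>" by (rule integrable_continuous_support[OF c\<psi> s\<psi>])
  have cshift: "continuous_on UNIV (\<lambda>x. \<psi> (x + c))" for c
    by (rule continuous_on_compose2[OF c\<psi>]) (auto intro: continuous_intros)
  have ishift: "integrable lborel (\<lambda>x. \<psi> (x + c))" for c
  proof (rule integrable_continuous_support[OF cshift])
    fix x :: 'a assume "norm x > R + norm c"
    moreover have "norm x \<le> norm (x + c) + norm c" using norm_triangle_ineq4[of "x + c" c] by simp
    ultimately show "\<psi> (x + c) = 0" by (intro s\<psi>) simp
  qed
  have Q0: "(\<integral>x. Q n x \<partial>lborel) = 0" for n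
  proof -
    have "(\<integral>x. Q n x \<partial>lborel) = ((\<integral>x. \<psi> (x + h n *\<^sub>R b) \<partial>lborel) - (\<integral>x. \<psi> x \<partial>lborel)) / h n"
      unfolding Q_def by (simp add: Bochner_Integration.integral_diff[OF ishift i\<psi>])
    then show ?thesis by (simp add: integral_translation[OF m\<psi>])
  qed
  have "(\<lambda>n. \<integral>x. Q n x \<partial>lborel) \<longlonglongrightarrow> (\<integral>x. d x \<partial>lborel)"
  proof (rule integral_dominated_convergence[where w = "\<lambda>x. L * indicator (cball 0 (R + 1)) x"])
    show "d \<in> borel_measurable lborel" using borel_measurable_continuous_onI[OF cd] by simp
    show "Q n \<in> borel_measurable lborel" for n
      unfolding Q_def using borel_measurable_continuous_onI[OF cshift] m\<psi> by measurable
    have "emeasure lborel (cball (0::'a) (R + 1)) < \<infinity>" by (rule emeasure_bounded_finite) simp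
    then show "integrable lborel (\<lambda>x::'a. L * indicator (cball 0 (R + 1)) x)"
      by (intro integrable_mult_right) (simp add: integrable_indicator_iff)
    show "AE x in lborel. (\<lambda>n. Q n x) \<longlonglongrightarrow> d x"
    proof (rule AE_I2)
      fix x
      have "((\<lambda>t. (\<psi> (x + (0 + t) *\<^sub>R b) - \<psi> (x + 0 *\<^sub>R b)) / t) \<longlongrightarrow> d (x + 0 *\<^sub>R b)) (at 0)"
        using der[of x 0] unfolding DERIV_def by simp
      then have lim: "((\<lambda>t. (\<psi> (x + t *\<^sub>R b) - \<psi> x) / t) \<longlongrightarrow> d x) (at 0)" by simp
      have "filterlim h (at 0) sequentially"
        using hlim h(1) by (auto simp: filterlim_at intro!: always_eventually less_imp_neq[THEN not_sym])
      from filterlim_compose[OF lim this] show "(\<lambda>n. Q n x) \<longlonglongrightarrow> d x" by (simp add: Q_def)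
    qed
    show "AE x in lborel. norm (Q n x) \<le> L * indicator (cball 0 (R + 1)) x" for n
      using lip by simp
  qed
  then show ?thesis using LIMSEQ_unique tendsto_const unfolding Q0 by blast
qed

lemma continuous_integral_zero:
  fixes f :: "'a::euclidean_space \<Rightarrow> real"
  assumes cont: "continuous_on UNIV f" and int: "integrable lborel f" and nonneg: "\<And>x. 0 \<le> f x"
    and zero: "(\<integral>x. f x \<partial>lborel) = 0"
  shows "f x = 0"
proof (rule ccontr)
  assume "f x \<noteq> 0"
  have ae: "AE x in lborel. f x = 0"
    using integral_nonneg_eq_0_iff_AE[OF int] nonneg zero by simp
  have "open (f -` (- {0}))" by (rule open_vimage[OF _ cont]) auto
  moreover have "f -` (- {0}) = {x. f x \<noteq> 0}" by auto
  ultimately have op: "open {x. f x \<noteq> 0}" by simp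
  have sets: "{x \<in> space lborel. \<not> f x = 0} \<in> sets lborel" using op by simp
  have "{x \<in> space lborel. \<not> f x = 0} \<in> null_sets lborel"
    using AE_iff_null[OF sets] ae by blast
  then have "{x. f x \<noteq> 0} \<in> null_sets lebesgue" by (simp add: null_sets_completionI)
  then have "negligible {x. f x \<noteq> 0}" by (simp add: negligible_iff_null_sets)
  then show False using open_not_negligible[OF op] \<open>f x \<noteq> 0\<close> by blast
qed

subsection \<open>A symmetric operator on polynomials\<close>

text \<open>The square makes the weight continuously differentiable across the sphere of radius
  \<open>R\<close>, so that integration by parts over the whole space leaves no boundary
  term.\<close>

definition wgt :: "real \<Rightarrow> 'a::euclidean_space \<Rightarrow> real" where
  "wgt R x = (max 0 (R\<^sup>2 - x \<bullet> x))\<^sup>2"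

definition euler :: "('a::euclidean_space \<Rightarrow> real) \<Rightarrow> 'a \<Rightarrow> real" where
  "euler f x = x \<bullet> grad f x"

text \<open>The constants make the operator symmetric for the weight: \<open>DIM('a)\<close> is the divergence of the
  position field and \<open>4\<close> comes from differentiating \<open>wgt R\<close>.\<close>

definition sop :: "real \<Rightarrow> ('a::euclidean_space \<Rightarrow> real) \<Rightarrow> 'a \<Rightarrow> real" where
  "sop R f x = R\<^sup>2 * laplacian f x - euler (euler f) x - (real DIM('a) + 4) * euler f x"

definition ip :: "real \<Rightarrow> ('a::euclidean_space \<Rightarrow> real) \<Rightarrow> ('a \<Rightarrow> real) \<Rightarrow> real" where
  "ip R f g = (\<integral>x. wgt R x * f x * g x \<partial>lborel)"

lemma continuous_rpf:
  assumes "real_polynomial_function f"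
  shows "continuous_on A f"
  using continuous_on_polymonial_function assms real_polynomial_function_eq by blast

lemma continuous_wgt: "continuous_on A (wgt R)"
  unfolding wgt_def by (intro continuous_intros)

lemma wgt_support: "0 \<le> R \<Longrightarrow> norm x > R \<Longrightarrow> wgt R x = 0"
proof -
  assume "0 \<le> R" "norm x > R"
  then have "R\<^sup>2 \<le> (norm x)\<^sup>2" by (intro power_mono) auto
  then show ?thesis by (simp add: wgt_def dot_square_norm)
qed

lemma integrable_wgt:
  assumes "0 \<le> R" "continuous_on UNIV f"
  shows "integrable lborel (\<lambda>x. wgt R x * f x)"
  by (rule integrable_continuous_support[of _ R]) (use assms in \<open>auto intro!: continuous_intros continuous_wgt simp: wgt_support\<close>)

lemma real_polynomial_euler:
  assumes "real_polynomial_function f"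
  shows "real_polynomial_function (euler f)"
  unfolding euler_def[abs_def] by (intro real_polynomial_inner polynomial_function_id polynomial_function_grad assms)

lemma euler_eq_grad_inner: "grad_inner r2 f x = 2 * euler f x"
  by (simp add: grad_inner_eq grad_r2 euler_def)

lemma real_polynomial_sop:
  assumes "real_polynomial_function f"
  shows "real_polynomial_function (sop R f)"
  unfolding sop_def[abs_def]
  by (intro real_polynomial_function_diff rpf_mult rpf_const real_polynomial_laplacian real_polynomial_euler assms)

lemma DERIV_pos_part_square: "((\<lambda>s::real. (max 0 s)\<^sup>2) has_real_derivative 2 * max 0 s) (at s)"
proof (cases s "0 :: real" rule: linorder_cases)
  case less
  have "((\<lambda>s::real. 0) has_real_derivative 2 * max 0 s) (at s)" using less by simp
  then show ?thesis
    by (rule has_field_derivative_transform_within_open[of _ _ _ "{..<0}"]) (use less in auto)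
next
  case greater
  have "((\<lambda>s::real. s\<^sup>2) has_real_derivative 2 * max 0 s) (at s)"
    using greater by (auto intro!: derivative_eq_intros)
  then show ?thesis
    by (rule has_field_derivative_transform_within_open[of _ _ _ "{0<..}"]) (use greater in auto)
next
  case equal
  have "((\<lambda>h. ((max 0 (0 + h))\<^sup>2 - (max 0 0)\<^sup>2) / h) \<longlongrightarrow> 0) (at (0::real))"
  proof (rule Lim_null_comparison)
    show "\<forall>\<^sub>F h in at 0. norm (((max 0 (0 + h))\<^sup>2 - (max 0 0)\<^sup>2) / h) \<le> \<bar>h::real\<bar>"
      by (rule always_eventually) (auto simp: max_def power2_eq_square)
    have "((\<lambda>h::real. \<bar>h\<bar>) \<longlongrightarrow> \<bar>0\<bar>) (at 0)" by (intro tendsto_intros)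
    then show "((\<lambda>h::real. \<bar>h\<bar>) \<longlongrightarrow> 0) (at 0)" by simp
  qed
  then show ?thesis unfolding DERIV_def equal by simp
qed

lemma DERIV_wgt:
  fixes x b :: "'a::euclidean_space"
  shows "((\<lambda>t. wgt R (x + t *\<^sub>R b)) has_real_derivative
    - 4 * max 0 (R\<^sup>2 - (x + t *\<^sub>R b) \<bullet> (x + t *\<^sub>R b)) * ((x + t *\<^sub>R b) \<bullet> b)) (at t)"
proof -
  have "((\<lambda>t. r2 (x + t *\<^sub>R b)) has_real_derivative (b \<bullet> grad r2 (x + t *\<^sub>R b))) (at t)"
    by (rule has_derivative_line[OF real_polynomial_r2])
  then have "((\<lambda>t. R\<^sup>2 - (x + t *\<^sub>R b) \<bullet> (x + t *\<^sub>R b)) has_real_derivative (0 - b \<bullet> (2 *\<^sub>R (x + t *\<^sub>R b)))) (at t)"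
    unfolding r2_eq grad_r2 by (intro DERIV_diff DERIV_const)
  from DERIV_chain2[OF DERIV_pos_part_square this] show ?thesis
    unfolding wgt_def by (simp add: inner_commute[of b] mult_ac)
qed

text \<open>The left side is the divergence of the weight times the field with components
  \<open>p b\<close>. The radial part of the field is \<open>g\<close> times
  \<open>(R^2 - |x|^2)\<close> times the Euler derivative of \<open>f\<close>; multiplied by the
  derivative of the weight it reproduces the weight, with the factor 4.\<close>

lemma divergence_identity:
  fixes f g :: "'a::euclidean_space \<Rightarrow> real" and R :: real
  assumes f: "real_polynomial_function f" and g: "real_polynomial_function g"
  defines "p \<equiv> \<lambda>b x. g x * (R\<^sup>2 * partial_deriv b f x - (x \<bullet> b) * euler f x)"
  shows "(\<Sum>b\<in>Basis. wgt R x * (b \<bullet> grad (p b) x) - 4 * max 0 (R\<^sup>2 - x \<bullet> x) * (x \<bullet> b) * p b x)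
    = wgt R x * g x * sop R f x + wgt R x * (R\<^sup>2 * (grad f x \<bullet> grad g x) - euler f x * euler g x)"
proof -
  define q where "q b x = R\<^sup>2 * partial_deriv b f x - (x \<bullet> b) * euler f x" for b x
  have lin: "real_polynomial_function (\<lambda>x. x \<bullet> b)" for b :: 'a
    by (rule rpf_linear) (rule bounded_linear_inner_left)
  note fs = f g real_polynomial_partial_deriv[OF f] real_polynomial_euler[OF f] lin
  have pq: "real_polynomial_function (q b)" for b
    unfolding q_def[abs_def] by (intro real_polynomial_function_diff rpf_mult rpf_const fs)
  have gq: "b \<bullet> grad (q b) x = R\<^sup>2 * partial_deriv b (partial_deriv b f) x - (x \<bullet> b) * (b \<bullet> grad (euler f) x) - euler f x"
    if b: "b \<in> Basis" for b
  proof -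
    have eq: "q b = (\<lambda>x. R\<^sup>2 * partial_deriv b f x + (- 1) * ((x \<bullet> b) * euler f x))" by (simp add: q_def[abs_def])
    have "grad (q b) x = R\<^sup>2 *\<^sub>R grad (partial_deriv b f) x + (- 1) *\<^sub>R ((x \<bullet> b) *\<^sub>R grad (euler f) x + euler f x *\<^sub>R b)"
      unfolding eq by (simp only: grad_add grad_cmult grad_mult grad_linear fs rpf_mult rpf_const)
    then show ?thesis
      using b by (simp add: inner_add_right inner_diff_right partial_deriv_eq[OF fs(3)])
  qed
  have gp: "b \<bullet> grad (p b) x = g x * (b \<bullet> grad (q b) x) + q b x * (b \<bullet> grad g x)" for b
  proof -
    have "p b = (\<lambda>x. g x * q b x)" by (simp add: p_def q_def)
    then show ?thesis by (simp add: grad_mult[OF g pq] inner_add_right)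
  qed
  have pv: "p b x = g x * q b x" for b by (simp add: p_def q_def)
  have comp: "u \<bullet> v = (\<Sum>b\<in>Basis. (u \<bullet> b) * (v \<bullet> b))" for u v :: 'a by (rule euclidean_inner)
  have pd: "partial_deriv b h x = grad h x \<bullet> b" if "real_polynomial_function h" for b h
    unfolding partial_deriv_eq[OF that] by (rule inner_commute)
  have s1: "(\<Sum>b\<in>Basis. b \<bullet> grad (q b) x) = R\<^sup>2 * laplacian f x - euler (euler f) x - real DIM('a) * euler f x"
  proof -
    have "(\<Sum>b\<in>Basis. b \<bullet> grad (q b) x) = (\<Sum>b\<in>Basis. R\<^sup>2 * partial_deriv b (partial_deriv b f) x
       - (x \<bullet> b) * (grad (euler f) x \<bullet> b) - euler f x)"
      by (rule sum.cong[OF refl]) (simp add: gq inner_commute[of _ "grad (euler f) x"])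
    then show ?thesis
      by (simp add: sum_subtractf sum_distrib_left[symmetric] laplacian_def comp[symmetric] euler_def[of "euler f"])
  qed
  have s2: "(\<Sum>b\<in>Basis. q b x * (b \<bullet> grad g x)) = R\<^sup>2 * (grad f x \<bullet> grad g x) - euler f x * euler g x"
  proof -
    have "(\<Sum>b\<in>Basis. q b x * (b \<bullet> grad g x)) = (\<Sum>b\<in>Basis. R\<^sup>2 * ((grad f x \<bullet> b) * (grad g x \<bullet> b)) - euler f x * ((x \<bullet> b) * (grad g x \<bullet> b)))"
      by (rule sum.cong[OF refl]) (simp add: q_def pd[OF f] inner_commute[of _ "grad g x"] algebra_simps)
    then show ?thesis
      by (simp add: sum_subtractf sum_distrib_left[symmetric] comp[symmetric] euler_def[of g])
  qed
  have s3: "(\<Sum>b\<in>Basis. (x \<bullet> b) * q b x) = (R\<^sup>2 - x \<bullet> x) * euler f x"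
  proof -
    have "(\<Sum>b\<in>Basis. (x \<bullet> b) * q b x) = (\<Sum>b\<in>Basis. R\<^sup>2 * ((x \<bullet> b) * (grad f x \<bullet> b)) - euler f x * ((x \<bullet> b) * (x \<bullet> b)))"
      by (rule sum.cong[OF refl]) (simp add: q_def pd[OF f] algebra_simps)
    then have "(\<Sum>b\<in>Basis. (x \<bullet> b) * q b x) = R\<^sup>2 * (x \<bullet> grad f x) - euler f x * (x \<bullet> x)"
      by (simp add: sum_subtractf sum_distrib_left[symmetric] comp[symmetric])
    then show ?thesis by (simp add: euler_def algebra_simps)
  qed
  have m: "max 0 (R\<^sup>2 - x \<bullet> x) * (R\<^sup>2 - x \<bullet> x) = wgt R x"
    by (simp add: wgt_def max_def power2_eq_square)
  have "(\<Sum>b\<in>Basis. wgt R x * (b \<bullet> grad (p b) x) - 4 * max 0 (R\<^sup>2 - x \<bullet> x) * (x \<bullet> b) * p b x)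
    = (\<Sum>b\<in>Basis. wgt R x * g x * (b \<bullet> grad (q b) x) + wgt R x * (q b x * (b \<bullet> grad g x))
        - 4 * max 0 (R\<^sup>2 - x \<bullet> x) * g x * ((x \<bullet> b) * q b x))"
    by (rule sum.cong[OF refl]) (simp add: gp pv algebra_simps)
  also have "\<dots> = wgt R x * g x * (\<Sum>b\<in>Basis. b \<bullet> grad (q b) x) + wgt R x * (\<Sum>b\<in>Basis. q b x * (b \<bullet> grad g x))
        - 4 * max 0 (R\<^sup>2 - x \<bullet> x) * g x * (\<Sum>b\<in>Basis. (x \<bullet> b) * q b x)"
    by (simp only: sum.distrib sum_subtractf sum_distrib_left[symmetric])
  also have "\<dots> = wgt R x * g x * sop R f x + wgt R x * (R\<^sup>2 * (grad f x \<bullet> grad g x) - euler f x * euler g x)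
     - 4 * g x * euler f x * (max 0 (R\<^sup>2 - x \<bullet> x) * (R\<^sup>2 - x \<bullet> x) - wgt R x)"
    unfolding s1 s2 s3 sop_def by (simp add: algebra_simps)
  finally show ?thesis by (simp add: m)
qed

text \<open>The divergence of a compactly supported field integrates to zero; what remains on the
  right is visibly symmetric in \<open>f\<close> and \<open>g\<close>.\<close>

lemma ip_sop:
  fixes f g :: "'a::euclidean_space \<Rightarrow> real"
  assumes R: "0 \<le> R" and f: "real_polynomial_function f" and g: "real_polynomial_function g"
  shows "ip R (sop R f) g = - (\<integral>x. wgt R x * (R\<^sup>2 * (grad f x \<bullet> grad g x) - euler f x * euler g x) \<partial>lborel)"
proof -
  define p where "p b x = g x * (R\<^sup>2 * partial_deriv b f x - (x \<bullet> b) * euler f x)" for b x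
  define d where "d b x = wgt R x * (b \<bullet> grad (p b) x) - 4 * max 0 (R\<^sup>2 - x \<bullet> x) * (x \<bullet> b) * p b x" for b x
  have pp: "real_polynomial_function (p b)" for b
    unfolding p_def[abs_def]
    by (intro real_polynomial_function_diff rpf_mult rpf_const g real_polynomial_partial_deriv f real_polynomial_euler
        rpf_linear bounded_linear_inner_left)
  have cg: "continuous_on UNIV (\<lambda>x. b \<bullet> grad (p b) x)" for b
    by (intro continuous_intros continuous_on_polymonial_function polynomial_function_grad pp)
  have cd: "continuous_on UNIV (d b)" for b
    unfolding d_def[abs_def] by (intro continuous_intros continuous_wgt cg continuous_rpf[OF pp])
  have sd: "d b x = 0" if "norm x > R" for b x
  proof -
    have "R\<^sup>2 \<le> (norm x)\<^sup>2" using that R by (intro power_mono) auto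
    then show ?thesis using wgt_support[OF R that] by (simp add: d_def dot_square_norm)
  qed
  have z: "(\<integral>x. d b x \<partial>lborel) = 0" if b: "b \<in> Basis" for b
  proof (rule integral_derivative_zero[where \<psi> = "\<lambda>x. wgt R x * p b x" and b = b and R = R])
    fix x t
    show "((\<lambda>t. wgt R (x + t *\<^sub>R b) * p b (x + t *\<^sub>R b)) has_real_derivative d b (x + t *\<^sub>R b)) (at t)"
    proof (rule DERIV_cong[OF DERIV_mult[OF DERIV_wgt has_derivative_line[OF pp]]])
      define y where "y = x + t *\<^sub>R b"
      show "- 4 * max 0 (R\<^sup>2 - (x + t *\<^sub>R b) \<bullet> (x + t *\<^sub>R b)) * ((x + t *\<^sub>R b) \<bullet> b) * p b (x + t *\<^sub>R b)
          + b \<bullet> grad (p b) (x + t *\<^sub>R b) * wgt R (x + t *\<^sub>R b) = d b (x + t *\<^sub>R b)"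
        unfolding y_def[symmetric] d_def by simp
    qed
    show "continuous_on UNIV (\<lambda>x. wgt R x * p b x)" by (intro continuous_intros continuous_wgt continuous_rpf pp)
  qed (use cd sd wgt_support[OF R] b in auto)
  have int: "integrable lborel (d b)" for b by (rule integrable_continuous_support[OF cd sd])
  have c1: "continuous_on UNIV (\<lambda>x. g x * sop R f x)"
    by (intro continuous_intros continuous_rpf g real_polynomial_sop f)
  have c2: "continuous_on UNIV (\<lambda>x. R\<^sup>2 * (grad f x \<bullet> grad g x) - euler f x * euler g x)"
    by (intro continuous_intros continuous_rpf real_polynomial_euler f g continuous_on_polymonial_function polynomial_function_grad)
  have sumd: "(\<Sum>b\<in>Basis. d b x) = wgt R x * g x * sop R f x + wgt R x * (R\<^sup>2 * (grad f x \<bullet> grad g x) - euler f x * euler g x)" for x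
    unfolding d_def p_def[abs_def] by (rule divergence_identity[OF f g])
  have "0 = (\<Sum>b\<in>Basis. \<integral>x. d b x \<partial>lborel)" using z by simp
  also have "\<dots> = (\<integral>x. (\<Sum>b\<in>Basis. d b x) \<partial>lborel)"
    by (rule Bochner_Integration.integral_sum[symmetric]) (rule int)
  also have "\<dots> = (\<integral>x. wgt R x * (g x * sop R f x) + wgt R x * (R\<^sup>2 * (grad f x \<bullet> grad g x) - euler f x * euler g x) \<partial>lborel)"
    by (simp only: sumd mult.assoc)
  also have "\<dots> = (\<integral>x. wgt R x * (g x * sop R f x) \<partial>lborel) + (\<integral>x. wgt R x * (R\<^sup>2 * (grad f x \<bullet> grad g x) - euler f x * euler g x) \<partial>lborel)"
    by (rule Bochner_Integration.integral_add[OF integrable_wgt[OF R c1] integrable_wgt[OF R c2]])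
  finally show ?thesis by (simp add: ip_def mult_ac)
qed

lemma ip_sop_symmetric:
  assumes "0 \<le> R" "real_polynomial_function f" "real_polynomial_function g"
  shows "ip R (sop R f) g = ip R f (sop R g)"
proof -
  have "ip R f (sop R g) = ip R (sop R g) f" by (simp add: ip_def mult_ac)
  then show ?thesis
    unfolding ip_sop[OF assms] ip_sop[OF assms(1,3,2)]
    by (simp add: inner_commute[of "grad f _"] mult.commute[of "euler f _"])
qed

section \<open>Filtration by degree\<close>

interpretation fun_vs: vector_space "\<lambda>(c::real) (f::'a::euclidean_space \<Rightarrow> real). (\<lambda>x. c * f x)"
  by unfold_locales (simp_all add: fun_eq_iff algebra_simps)

primrec mon :: "nat \<Rightarrow> ('a::euclidean_space \<Rightarrow> real) set" where
  "mon 0 = {\<lambda>x. 1}"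
| "mon (Suc m) = (\<lambda>(b, f) x. (x \<bullet> b) * f x) ` (Basis \<times> mon m)"

text \<open>A strict bound, so that \<open>deg_lt 0\<close> is the zero space and inductions can
  start there.\<close>

definition deg_lt :: "nat \<Rightarrow> ('a::euclidean_space \<Rightarrow> real) set" where
  "deg_lt m = fun_vs.span (\<Union>k<m. mon k)"

definition lin_closed :: "('a \<Rightarrow> real) set \<Rightarrow> bool" where
  "lin_closed T \<longleftrightarrow> (\<lambda>x. 0) \<in> T \<and> (\<forall>f\<in>T. \<forall>g\<in>T. (\<lambda>x. f x + g x) \<in> T) \<and> (\<forall>f\<in>T. \<forall>c. (\<lambda>x. c * f x) \<in> T)"

lemma lin_closed_addD: "lin_closed T \<Longrightarrow> f \<in> T \<Longrightarrow> g \<in> T \<Longrightarrow> (\<lambda>x. f x + g x) \<in> T"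
  and lin_closed_cmultD: "lin_closed T \<Longrightarrow> f \<in> T \<Longrightarrow> (\<lambda>x. c * f x) \<in> T"
  by (simp_all add: lin_closed_def)

lemma lin_closed_iff: "lin_closed (T :: ('a::euclidean_space \<Rightarrow> real) set) \<longleftrightarrow> fun_vs.subspace T"
  unfolding lin_closed_def fun_vs.subspace_def plus_fun_def zero_fun_def by blast

lemma span_least:
  fixes T A :: "('a::euclidean_space \<Rightarrow> real) set"
  assumes "lin_closed T" "A \<subseteq> T" "f \<in> fun_vs.span A"
  shows "f \<in> T"
  using fun_vs.span_minimal[OF assms(2)] assms(1,3) unfolding lin_closed_iff by blast

lemma lin_closed_span: "lin_closed (fun_vs.span (A :: ('a::euclidean_space \<Rightarrow> real) set))"
  unfolding lin_closed_iff by (rule fun_vs.subspace_span)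

lemma deg_lt_zero: "(\<lambda>x. 0) \<in> deg_lt m"
  and deg_lt_add: "f \<in> deg_lt m \<Longrightarrow> g \<in> deg_lt m \<Longrightarrow> (\<lambda>x. f x + g x) \<in> deg_lt m"
  and deg_lt_cmult: "f \<in> deg_lt m \<Longrightarrow> (\<lambda>x. c * f x) \<in> deg_lt m"
  using lin_closed_span[of "\<Union>k<m. mon k"] unfolding lin_closed_def deg_lt_def by blast+

lemma deg_lt_sum:
  assumes "finite I" "\<And>i. i \<in> I \<Longrightarrow> f i \<in> deg_lt m"
  shows "(\<lambda>x. \<Sum>i\<in>I. f i x) \<in> deg_lt m"
  using assms by (induct I rule: finite_induct) (auto intro: deg_lt_zero deg_lt_add)

lemma mon_deg_lt: "f \<in> mon k \<Longrightarrow> k < m \<Longrightarrow> f \<in> deg_lt m"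
  unfolding deg_lt_def by (rule fun_vs.span_base) blast

lemma deg_lt_mono: "m \<le> n \<Longrightarrow> f \<in> deg_lt m \<Longrightarrow> f \<in> deg_lt n"
  unfolding deg_lt_def by (rule subsetD[OF fun_vs.span_mono[OF UN_mono]]) auto

lemma deg_lt_induct:
  assumes "f \<in> deg_lt m" "lin_closed T" "\<And>k f. k < m \<Longrightarrow> f \<in> mon k \<Longrightarrow> f \<in> T"
  shows "f \<in> T"
  by (rule span_least[OF assms(2) _ assms(1)[unfolded deg_lt_def]]) (use assms(3) in blast)

lemma rpf_coordinate: "real_polynomial_function (\<lambda>x::'a::euclidean_space. x \<bullet> b)"
  by (rule rpf_linear) (rule bounded_linear_inner_left)

lemma mon_poly: "f \<in> mon m \<Longrightarrow> real_polynomial_function f"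
  by (induct m arbitrary: f) (auto intro: rpf_const rpf_mult rpf_coordinate)

lemma lin_closed_rpf: "lin_closed (Collect real_polynomial_function)"
  by (auto simp: lin_closed_def intro: rpf_const rpf_add rpf_mult)

lemma deg_lt_poly: "f \<in> deg_lt m \<Longrightarrow> real_polynomial_function f"
  using deg_lt_induct[OF _ lin_closed_rpf] mon_poly by blast

lemma finite_mon: "finite (mon m :: ('a::euclidean_space \<Rightarrow> real) set)"
  by (induct m) auto

lemma deg_lt_coordinate:
  assumes "f \<in> deg_lt m" "b \<in> Basis"
  shows "(\<lambda>x. (x \<bullet> b) * f x) \<in> deg_lt (Suc m)"
proof -
  have "f \<in> {f. (\<lambda>x. (x \<bullet> b) * f x) \<in> deg_lt (Suc m)}"
  proof (rule deg_lt_induct[OF assms(1)])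
    have "(\<lambda>x. (x \<bullet> b) * (c * f x)) = (\<lambda>x. c * ((x \<bullet> b) * f x))" for c and f :: "'a \<Rightarrow> real"
      by (simp add: mult.left_commute)
    then show "lin_closed {f. (\<lambda>x. (x \<bullet> b) * f x) \<in> deg_lt (Suc m)}"
      unfolding lin_closed_def using deg_lt_zero deg_lt_add deg_lt_cmult by (auto simp: distrib_left)
    show "f \<in> {f. (\<lambda>x. (x \<bullet> b) * f x) \<in> deg_lt (Suc m)}" if "k < m" "f \<in> mon k" for k f
      using mon_deg_lt[of "\<lambda>x. (x \<bullet> b) * f x" "Suc k" "Suc m"] that assms(2) by force
  qed
  then show ?thesis by simp
qed

lemma mon_mult_deg_lt:
  assumes "f \<in> mon k" "g \<in> deg_lt m"
  shows "(\<lambda>x. f x * g x) \<in> deg_lt (k + m)"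
  using assms(1)
proof (induct k arbitrary: f)
  case 0
  then show ?case using assms(2) by simp
next
  case (Suc k)
  then obtain b f' where f: "b \<in> Basis" "f' \<in> mon k" "f = (\<lambda>x. (x \<bullet> b) * f' x)" by auto
  have "(\<lambda>x. (x \<bullet> b) * (f' x * g x)) \<in> deg_lt (Suc (k + m))"
    by (rule deg_lt_coordinate[OF Suc(1)[OF f(2)] f(1)])
  then show ?case by (simp add: f(3) mult.assoc)
qed

lemma deg_lt_mult:
  assumes "f \<in> deg_lt k" "g \<in> deg_lt m"
  shows "(\<lambda>x. f x * g x) \<in> deg_lt (k + m)"
proof -
  have "f \<in> {f. (\<lambda>x. f x * g x) \<in> deg_lt (k + m)}"
  proof (rule deg_lt_induct[OF assms(1)])
    show "lin_closed {f. (\<lambda>x. f x * g x) \<in> deg_lt (k + m)}"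
      unfolding lin_closed_def using deg_lt_zero deg_lt_add deg_lt_cmult by (auto simp: distrib_right mult.assoc)
    show "f \<in> {f. (\<lambda>x. f x * g x) \<in> deg_lt (k + m)}" if "j < k" "f \<in> mon j" for j f
      using deg_lt_mono[OF _ mon_mult_deg_lt[OF that(2) assms(2)], of "k + m"] that(1) by simp
  qed
  then show ?thesis by simp
qed

lemma polynomial_deg_lt:
  fixes f :: "'a::euclidean_space \<Rightarrow> real"
  assumes "real_polynomial_function f"
  shows "\<exists>m. f \<in> deg_lt m"
  using assms
proof induct
  case (linear f)
  have lin: "linear f" using linear by (simp add: bounded_linear.linear)
  have "f x = (\<Sum>b\<in>Basis. f b * (x \<bullet> b))" for x
  proof -
    have "f x = f (\<Sum>b\<in>Basis. (x \<bullet> b) *\<^sub>R b)" by (simp only: euclidean_representation)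
    also have "\<dots> = (\<Sum>b\<in>Basis. (x \<bullet> b) * f b)" by (simp add: linear_sum[OF lin] linear_cmul[OF lin])
    finally show ?thesis by (simp only: mult.commute)
  qed
  then have eq: "f = (\<lambda>x. \<Sum>b\<in>Basis. f b * (x \<bullet> b))" by (rule ext)
  have "(\<lambda>x. x \<bullet> b) \<in> deg_lt 2" if "b \<in> Basis" for b :: 'a
  proof (rule mon_deg_lt)
    show "(\<lambda>x. x \<bullet> b) \<in> mon (Suc 0)" using that by force
  qed simp
  then have "(\<lambda>x. \<Sum>b\<in>Basis. f b * (x \<bullet> b)) \<in> deg_lt 2"
    by (intro deg_lt_sum deg_lt_cmult) auto
  then show ?case unfolding eq[symmetric] by blast
next
  case (const c)
  have "(\<lambda>x. c * 1) \<in> deg_lt 1" by (intro deg_lt_cmult mon_deg_lt[of _ 0]) auto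
  then show ?case by auto
next
  case (add f g)
  then obtain k m where "f \<in> deg_lt k" "g \<in> deg_lt m" by blast
  then have "f \<in> deg_lt (k + m)" "g \<in> deg_lt (k + m)" using deg_lt_mono[of k "k + m"] deg_lt_mono[of m "k + m"] by auto
  then show ?case using deg_lt_add by blast
next
  case (mult f g)
  then show ?case using deg_lt_mult by blast
qed

text \<open>The claims are proved together, since the Laplacian of a coordinate times
  \<open>g\<close> contains a partial derivative of \<open>g\<close>. The last one is Euler's
  identity for homogeneous functions.\<close>

lemma mon_derivatives:
  assumes "f \<in> mon m"
  shows "partial_deriv c f \<in> deg_lt m \<and> laplacian f \<in> deg_lt m \<and> euler f = (\<lambda>x. real m * f x)"
  using assms
proof (induct m arbitrary: f c)
  case 0
  then have f: "f = (\<lambda>x. 1)" by simp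
  have "partial_deriv c f = (\<lambda>x. 0)" unfolding f by (rule ext) (simp add: partial_deriv_eq[OF rpf_const])
  moreover have "laplacian f = (\<lambda>x. 0)" unfolding f by (rule ext) simp
  moreover have "euler f = (\<lambda>x. real 0 * f x)" unfolding f by (rule ext) (simp add: euler_def)
  ultimately show ?case using deg_lt_zero by metis
next
  case (Suc m)
  then obtain b g where g: "b \<in> Basis" "g \<in> mon m" "f = (\<lambda>x. (x \<bullet> b) * g x)" by auto
  note gp = mon_poly[OF g(2)]
  note fp = rpf_mult[OF rpf_coordinate[of b] gp]
  note IH = Suc(1)[OF g(2)]
  have gr: "grad f x = (x \<bullet> b) *\<^sub>R grad g x + g x *\<^sub>R b" for x
    unfolding g(3) by (simp only: grad_mult[OF rpf_coordinate gp] grad_linear)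
  have pd: "partial_deriv c f = (\<lambda>x. (x \<bullet> b) * partial_deriv c g x + (c \<bullet> b) * g x)" for c
    using gr unfolding g(3) by (intro ext) (simp add: partial_deriv_eq[OF fp] partial_deriv_eq[OF gp] inner_add_right)
  have "partial_deriv c f \<in> deg_lt (Suc m)"
    unfolding pd using IH g(1,2) by (intro deg_lt_add deg_lt_coordinate deg_lt_cmult) (auto intro: mon_deg_lt)
  moreover have "laplacian f = (\<lambda>x. (x \<bullet> b) * laplacian g x + 2 * partial_deriv b g x)"
  proof
    fix x
    have "partial_deriv e (\<lambda>x. x \<bullet> b) = (\<lambda>x. e \<bullet> b)" for e
      by (rule ext) (simp add: partial_deriv_eq[OF rpf_coordinate] grad_linear)
    then have "laplacian (\<lambda>x. x \<bullet> b) x = 0"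
      by (simp add: laplacian_def partial_deriv_eq[OF rpf_const])
    then show "laplacian f x = (x \<bullet> b) * laplacian g x + 2 * partial_deriv b g x"
      unfolding g(3) by (simp add: laplacian_mult[OF rpf_coordinate gp] grad_inner_eq grad_linear partial_deriv_eq[OF gp])
  qed
  then have "laplacian f \<in> deg_lt (Suc m)"
    using IH g(1) deg_lt_mono[of m "Suc m"] by (simp only:) (intro deg_lt_add deg_lt_coordinate deg_lt_cmult, auto)
  moreover have "euler f = (\<lambda>x. real (Suc m) * f x)"
  proof
    fix x
    have "euler f x = (x \<bullet> b) * euler g x + g x * (x \<bullet> b)" by (simp add: euler_def gr inner_add_right)
    also have "euler g x = real m * g x" using IH by simp
    finally show "euler f x = real (Suc m) * f x" by (simp add: g(3) algebra_simps)
  qed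
  ultimately show ?case by blast
qed

text \<open>The Euler operator acts on degree \<open>k\<close> as \<open>k\<close> and the Laplacian
  lowers degrees, so \<open>sop\<close> has \<open>- lam k\<close> on its diagonal. The type
  argument only carries the dimension.\<close>

definition lam :: "'a::euclidean_space itself \<Rightarrow> nat \<Rightarrow> real" where
  "lam _ k = real k * (real k + real DIM('a) + 4)"

lemma lam_less: "k < m \<Longrightarrow> lam TYPE('a::euclidean_space) k < lam TYPE('a) m"
  unfolding lam_def by (intro mult_strict_mono) auto

lemma euler_cmult: "real_polynomial_function f \<Longrightarrow> euler (\<lambda>x. c * f x) x = c * euler f x"
  by (simp add: euler_def grad_cmult)

lemma euler_add:
  "real_polynomial_function f \<Longrightarrow> real_polynomial_function g \<Longrightarrow> euler (\<lambda>x. f x + g x) x = euler f x + euler g x"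
  by (simp add: euler_def grad_add inner_add_right)

lemma sop_add:
  assumes "real_polynomial_function f" "real_polynomial_function g"
  shows "sop R (\<lambda>x. f x + g x) x = sop R f x + sop R g x"
proof -
  have "euler (\<lambda>x. f x + g x) = (\<lambda>x. euler f x + euler g x)" using euler_add[OF assms] by (rule ext)
  then show ?thesis
    by (simp add: sop_def laplacian_add assms euler_add real_polynomial_euler algebra_simps)
qed

lemma sop_cmult:
  assumes "real_polynomial_function f"
  shows "sop R (\<lambda>x. c * f x) x = c * sop R f x"
proof -
  have "euler (\<lambda>x. c * f x) = (\<lambda>x. c * euler f x)" using euler_cmult[OF assms] by (rule ext)
  then show ?thesis
    by (simp add: sop_def laplacian_cmult assms euler_cmult real_polynomial_euler algebra_simps)
qed

lemma sop_mon:
  fixes f :: "'a::euclidean_space \<Rightarrow> real"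
  assumes "f \<in> mon k"
  shows "(\<lambda>x. sop R f x + lam TYPE('a) k * f x) \<in> deg_lt k"
proof -
  note d = mon_derivatives[OF assms]
  have e: "euler f = (\<lambda>x. real k * f x)" using d by blast
  have "euler (euler f) x = real k * (real k * f x)" for x
    by (simp add: e euler_cmult[OF mon_poly[OF assms]])
  then have "sop R f x + lam TYPE('a) k * f x = R\<^sup>2 * laplacian f x" for x
    by (simp add: sop_def lam_def e algebra_simps)
  then show ?thesis using d by (simp add: deg_lt_cmult)
qed

lemma sop_deg_drop:
  fixes f :: "'a::euclidean_space \<Rightarrow> real"
  assumes "f \<in> deg_lt (Suc m)"
  shows "(\<lambda>x. sop R f x + lam TYPE('a) m * f x) \<in> deg_lt m"
proof -
  define l where "l = lam TYPE('a) m"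
  define T where "T = {f :: 'a \<Rightarrow> real. real_polynomial_function f \<and> (\<lambda>x. sop R f x + l * f x) \<in> deg_lt m}"
  have "f \<in> T"
  proof (rule deg_lt_induct[OF assms])
    show "lin_closed T"
      unfolding lin_closed_def
    proof (intro conjI ballI allI)
      have "sop R (\<lambda>x::'a. 0 * 0) x = 0 * sop R (\<lambda>x. 0) x" for x by (rule sop_cmult[OF rpf_const])
      then show "(\<lambda>x. 0) \<in> T" by (simp add: T_def rpf_const deg_lt_zero)
      fix f assume f: "f \<in> T"
      show "(\<lambda>x. c * f x) \<in> T" for c
      proof -
        have "(\<lambda>x. c * (sop R f x + l * f x)) \<in> deg_lt m" using f by (auto simp: T_def intro: deg_lt_cmult)
        then show ?thesis using f by (simp add: T_def sop_cmult rpf_mult rpf_const algebra_simps)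
      qed
      fix g assume g: "g \<in> T"
      have "(\<lambda>x. (sop R f x + l * f x) + (sop R g x + l * g x)) \<in> deg_lt m"
        using f g by (auto simp: T_def intro: deg_lt_add)
      then show "(\<lambda>x. f x + g x) \<in> T" using f g by (simp add: T_def sop_add rpf_add algebra_simps)
    qed
    show "f \<in> T" if "k < Suc m" "f \<in> mon k" for k f
    proof (cases "k = m")
      case True
      then show ?thesis using sop_mon[OF that(2), of R] mon_poly[OF that(2)] by (simp add: T_def l_def)
    next
      case False
      then have k: "k < m" using that(1) by simp
      have "(\<lambda>x. sop R f x + lam TYPE('a) k * f x) \<in> deg_lt m"
        by (rule deg_lt_mono[OF less_imp_le[OF k] sop_mon[OF that(2)]])
      from deg_lt_add[OF this deg_lt_cmult[OF mon_deg_lt[OF that(2) k], of "l - lam TYPE('a) k"]]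
      have "(\<lambda>x. (sop R f x + lam TYPE('a) k * f x) + (l - lam TYPE('a) k) * f x) \<in> deg_lt m" .
      then show ?thesis using mon_poly[OF that(2)] by (simp add: T_def algebra_simps)
    qed
  qed
  then show ?thesis by (simp add: T_def l_def)
qed

lemma deg_lt_0: "f \<in> deg_lt 0 \<longleftrightarrow> f = (\<lambda>x. 0)"
  unfolding deg_lt_def by (simp add: zero_fun_def)

lemma sop_deg_lt:
  fixes f :: "'a::euclidean_space \<Rightarrow> real"
  assumes "f \<in> deg_lt m"
  shows "sop R f \<in> deg_lt m"
proof (cases m)
  case 0
  then have f: "f = (\<lambda>x. 0)" using assms deg_lt_0 by metis
  have "sop R (\<lambda>x::'a. 0 * 0) x = 0 * sop R (\<lambda>x. 0) x" for x by (rule sop_cmult[OF rpf_const])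
  then have "sop R f = (\<lambda>x. 0)" unfolding f by (intro ext) simp
  then show ?thesis by (simp add: deg_lt_zero)
next
  case (Suc k)
  have "(\<lambda>x. sop R f x + lam TYPE('a) k * f x) \<in> deg_lt m"
    using sop_deg_drop[of f k R] assms deg_lt_mono[of k m] Suc by auto
  from deg_lt_add[OF this deg_lt_cmult[OF assms, of "- lam TYPE('a) k"]] show ?thesis by simp
qed

subsection \<open>Orthogonal projection\<close>

lemma ip_sym: "ip R f g = ip R g f"
  by (simp add: ip_def mult_ac)

lemma ip_int:
  assumes "0 \<le> R" "real_polynomial_function f" "real_polynomial_function g"
  shows "integrable lborel (\<lambda>x. wgt R x * f x * g x)"
  using integrable_wgt[OF assms(1) continuous_rpf[OF rpf_mult[OF assms(2,3)]]] by (simp add: mult.assoc)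

lemma ip_add:
  assumes "0 \<le> R" "real_polynomial_function f" "real_polynomial_function g" "real_polynomial_function h"
  shows "ip R (\<lambda>x. f x + g x) h = ip R f h + ip R g h"
  unfolding ip_def using Bochner_Integration.integral_add[OF ip_int[OF assms(1,2,4)] ip_int[OF assms(1,3,4)]]
  by (simp add: distrib_left distrib_right)

lemma ip_cmult: "ip R (\<lambda>x. c * f x) h = c * ip R f h"
proof -
  have "(\<lambda>x. wgt R x * (c * f x) * h x) = (\<lambda>x. c * (wgt R x * f x * h x))" by (simp add: mult_ac)
  then show ?thesis unfolding ip_def by simp
qed

lemma ip_zero: "ip R (\<lambda>x. 0) h = 0"
  by (simp add: ip_def)

lemma ip_diff:
  assumes "0 \<le> R" "real_polynomial_function f" "real_polynomial_function g" "real_polynomial_function h"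
  shows "ip R (\<lambda>x. f x - g x) h = ip R f h - ip R g h"
proof -
  have "ip R (\<lambda>x. f x + (- 1) * g x) h = ip R f h + ip R (\<lambda>x. (- 1) * g x) h"
    by (rule ip_add) (intro assms rpf_mult rpf_const)+
  then show ?thesis by (simp only: ip_cmult) simp
qed

lemma ip_span_zero:
  fixes f :: "'a::euclidean_space \<Rightarrow> real"
  assumes R: "0 \<le> R" and f: "real_polynomial_function f" and T: "T \<subseteq> Collect real_polynomial_function"
    and z: "\<And>t. t \<in> T \<Longrightarrow> ip R f t = 0" and v: "v \<in> fun_vs.span T"
  shows "ip R f v = 0"
proof -
  have "v \<in> {v. real_polynomial_function v \<and> ip R v f = 0}"
  proof (rule span_least[OF _ _ v])
    show "lin_closed {v. real_polynomial_function v \<and> ip R v f = 0}"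
      unfolding lin_closed_def by (auto simp: ip_zero ip_cmult ip_add[OF R _ _ f] intro: rpf_const rpf_mult rpf_add)
    show "T \<subseteq> {v. real_polynomial_function v \<and> ip R v f = 0}" using T z by (auto simp: ip_sym[of R _ f])
  qed
  then show ?thesis by (simp add: ip_sym[of R f])
qed

lemma ip_null:
  assumes R: "0 \<le> R" and b: "real_polynomial_function b" and z: "ip R b b = 0"
  shows "ip R f b = 0"
proof -
  have "wgt R x * b x * b x = 0" for x
  proof (rule continuous_integral_zero[where f = "\<lambda>x. wgt R x * b x * b x"])
    show "continuous_on UNIV (\<lambda>x. wgt R x * b x * b x)" by (intro continuous_intros continuous_wgt continuous_rpf b)
    show "0 \<le> wgt R x * b x * b x" for x
      using mult_nonneg_nonneg[of "wgt R x" "b x * b x"] by (simp add: wgt_def mult.assoc)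
  qed (use ip_int[OF R b b] z in \<open>auto simp: ip_def\<close>)
  then have z: "wgt R x * f x * b x = 0" for x by (metis mult_eq_0_iff)
  show ?thesis unfolding ip_def z by simp
qed

text \<open>Gram-Schmidt, one generator at a time, for a form that may have null vectors.\<close>

lemma projection_exists:
  fixes T :: "('a::euclidean_space \<Rightarrow> real) set"
  assumes R: "0 \<le> R" and "finite T" "T \<subseteq> Collect real_polynomial_function"
  shows "\<forall>h. real_polynomial_function h \<longrightarrow> (\<exists>u\<in>fun_vs.span T. \<forall>t\<in>T. ip R (\<lambda>x. h x - u x) t = 0)"
  using assms(2,3)
proof (induct T)
  case empty
  show ?case using fun_vs.span_zero by auto
next
  case (insert b T)
  have pT: "T \<subseteq> Collect real_polynomial_function" and pb: "real_polynomial_function b" using insert(4) by auto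
  note IH = insert(3)[OF pT]
  have sp: "real_polynomial_function u" if "u \<in> fun_vs.span T" for u
    using span_least[OF lin_closed_rpf pT that] by simp
  have lc: "lin_closed (fun_vs.span (insert b T))" by (rule lin_closed_span)
  have inT: "u \<in> fun_vs.span (insert b T)" if "u \<in> fun_vs.span T" for u
    using that fun_vs.span_mono[of T "insert b T"] by blast
  obtain v where v: "v \<in> fun_vs.span T" "\<forall>t\<in>T. ip R (\<lambda>x. b x - v x) t = 0" using IH pb by blast
  define b' where "b' x = b x - v x" for x
  have pb': "real_polynomial_function b'"
    unfolding b'_def[abs_def] by (intro real_polynomial_function_diff pb sp v(1))
  have b'T: "ip R b' t = 0" if "t \<in> T" for t using v(2) that by (simp add: b'_def[abs_def])
  have bsp: "b' \<in> fun_vs.span (insert b T)"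
  proof -
    have "b \<in> fun_vs.span (insert b T)" by (rule fun_vs.span_base) simp
    from lin_closed_addD[OF lc this lin_closed_cmultD[OF lc inT[OF v(1)], of "- 1"]]
    have "(\<lambda>x. b x + (- 1) * v x) \<in> fun_vs.span (insert b T)" .
    then show ?thesis by (simp add: b'_def[abs_def])
  qed
  show ?case
  proof (intro allI impI)
    fix h :: "'a \<Rightarrow> real" assume ph: "real_polynomial_function h"
    obtain u1 where u1: "u1 \<in> fun_vs.span T" "\<forall>t\<in>T. ip R (\<lambda>x. h x - u1 x) t = 0" using IH ph by blast
    define w where "w x = h x - u1 x" for x
    have pw: "real_polynomial_function w" unfolding w_def[abs_def] by (intro real_polynomial_function_diff ph sp u1(1))
    have wT: "ip R w t = 0" if "t \<in> T" for t using u1(2) that by (simp add: w_def[abs_def])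
    have wv: "ip R w v = 0" by (rule ip_span_zero[OF R pw pT wT v(1)])
    have b'v: "ip R b' v = 0" by (rule ip_span_zero[OF R pb' pT b'T v(1)])
    \<comment> \<open>If \<open>b'\<close> is a null vector the quotient is 0 by the convention for
      division, and \<open>ip_null\<close> makes the numerator vanish as well.\<close>
    define c where "c = ip R w b' / ip R b' b'"
    have cb: "ip R w b' - c * ip R b' b' = 0"
      using ip_null[OF R pb', of w] by (cases "ip R b' b' = 0") (simp_all add: c_def)
    define u where "u x = u1 x + c * b' x" for x
    have "u \<in> fun_vs.span (insert b T)"
      unfolding u_def[abs_def] by (rule lin_closed_addD[OF lc inT[OF u1(1)] lin_closed_cmultD[OF lc bsp]])
    moreover have "ip R (\<lambda>x. h x - u x) t = 0" if t: "t \<in> insert b T" for t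
    proof -
      have pt: "real_polynomial_function t" using t insert(4) by auto
      have "(\<lambda>x. h x - u x) = (\<lambda>x. w x - c * b' x)" by (simp add: u_def w_def algebra_simps)
      then have e: "ip R (\<lambda>x. h x - u x) s = ip R w s - c * ip R b' s" if "real_polynomial_function s" for s
        using ip_diff[OF R pw rpf_mult[OF rpf_const pb'] that, of c] by (simp add: ip_cmult)
      show ?thesis
      proof (cases "t = b")
        case True
        have "b = (\<lambda>x. b' x + v x)" by (simp add: b'_def)
        then have s: "ip R f b = ip R f b' + ip R f v" if "real_polynomial_function f" for f
          using ip_add[OF R pb' sp[OF v(1)] that] by (simp add: ip_sym[of R f])
        have "ip R w b - c * ip R b' b = 0" using cb wv b'v unfolding s[OF pw] s[OF pb'] by simp
        then show ?thesis unfolding True e[OF pb] .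
      next
        case False
        then have "t \<in> T" using t by blast
        then show ?thesis using wT b'T by (simp add: e[OF pt])
      qed
    qed
    ultimately show "\<exists>u\<in>fun_vs.span (insert b T). \<forall>t\<in>insert b T. ip R (\<lambda>x. h x - u x) t = 0" by blast
  qed
qed

text \<open>The part of \<open>B\<close> of bounded degree lies in the span of finitely many
  monomials, so it has a finite spanning set to project on.\<close>

lemma projection_on_deg_lt:
  fixes B :: "('a::euclidean_space \<Rightarrow> real) set"
  assumes R: "0 \<le> R" and B: "lin_closed B" "B \<subseteq> Collect real_polynomial_function" and h: "real_polynomial_function h"
  shows "\<exists>u\<in>B \<inter> deg_lt d. \<forall>b\<in>B \<inter> deg_lt d. ip R (\<lambda>x. h x - u x) b = 0"
proof -
  obtain T where T: "T \<subseteq> B \<inter> deg_lt d" "fun_vs.independent T" "B \<inter> deg_lt d \<subseteq> fun_vs.span T"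
    by (rule fun_vs.maximal_independent_subset)
  have "finite (\<Union>k<d. mon k :: ('a \<Rightarrow> real) set)" using finite_mon by blast
  then have fT: "finite T"
    using fun_vs.independent_span_bound[OF _ T(2)] T(1) unfolding deg_lt_def by blast
  have pT: "T \<subseteq> Collect real_polynomial_function" using T(1) B(2) by blast
  obtain u where u: "u \<in> fun_vs.span T" "\<forall>t\<in>T. ip R (\<lambda>x. h x - u x) t = 0"
    using projection_exists[OF R fT pT] h by blast
  have "lin_closed (B \<inter> deg_lt d)"
    using B(1) deg_lt_zero[of d] deg_lt_add[of _ d] deg_lt_cmult[of _ d] unfolding lin_closed_def by auto
  then have uB: "u \<in> B \<inter> deg_lt d" by (rule span_least[OF _ T(1) u(1)])
  have ph: "real_polynomial_function (\<lambda>x. h x - u x)"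
    using uB B(2) by (intro real_polynomial_function_diff h) auto
  have "ip R (\<lambda>x. h x - u x) b = 0" if "b \<in> B \<inter> deg_lt d" for b
    by (rule ip_span_zero[OF R ph pT]) (use u(2) T(3) that in auto)
  then show ?thesis using uB by blast
qed

text \<open>Eigenvalues of \<open>sop R\<close> strictly decrease with the degree, so orthogonality to the elements of
  degree less than \<open>d\<close> propagates to all degrees.\<close>

lemma orthogonal_all_degrees:
  fixes B :: "('a::euclidean_space \<Rightarrow> real) set"
  assumes R: "0 \<le> R" and B: "lin_closed B" "B \<subseteq> Collect real_polynomial_function" "\<And>b. b \<in> B \<Longrightarrow> sop R b \<in> B"
    and u: "u \<in> deg_lt d" "\<And>b. b \<in> B \<inter> deg_lt d \<Longrightarrow> ip R u b = 0" and b: "b \<in> B"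
  shows "ip R u b = 0"
proof -
  define X where "X = {u \<in> deg_lt d. \<forall>b\<in>B \<inter> deg_lt d. ip R u b = 0}"
  define l where "l = lam TYPE('a)"
  have pB: "real_polynomial_function b" if "b \<in> B" for b using B(2) that by blast
  have pX: "real_polynomial_function u" if "u \<in> X" for u using that by (auto simp: X_def intro: deg_lt_poly)
  have Xs: "(\<lambda>x. sop R u x + c * u x) \<in> X" if "u \<in> X" for u c
  proof -
    have "(\<lambda>x. sop R u x + c * u x) \<in> deg_lt d"
      using that by (auto simp: X_def intro: deg_lt_add deg_lt_cmult sop_deg_lt)
    moreover have "ip R (\<lambda>x. sop R u x + c * u x) b = 0" if b: "b \<in> B \<inter> deg_lt d" for b
    proof -
      have pb: "real_polynomial_function b" using b pB by blast
      have "ip R (\<lambda>x. sop R u x + c * u x) b = ip R u (sop R b) + c * ip R u b"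
        using ip_add[OF R real_polynomial_sop[OF pX[OF \<open>u \<in> X\<close>], of R] rpf_mult[OF rpf_const[of c] pX[OF \<open>u \<in> X\<close>]] pb]
          ip_sop_symmetric[OF R pX[OF \<open>u \<in> X\<close>] pb] by (simp add: ip_cmult)
      moreover have "sop R b \<in> B \<inter> deg_lt d" using b B(3) sop_deg_lt by blast
      ultimately show ?thesis using \<open>u \<in> X\<close> b by (simp add: X_def)
    qed
    ultimately show ?thesis by (simp add: X_def)
  qed
  \<comment> \<open>An element \<open>b\<close> that pairs with \<open>X\<close> like an eigenvector
    for \<open>- l m\<close> is orthogonal to \<open>X\<close>: shifting \<open>u\<close> by its own
    top eigenvalue lowers the degree, and \<open>l m - l k\<close> is non-zero since
    \<open>k < d \<le> m\<close>.\<close>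
  have kill: "ip R u b = 0"
    if m: "d \<le> m" and b: "b \<in> B" "\<And>u. u \<in> X \<Longrightarrow> ip R (sop R u) b + l m * ip R u b = 0"
      and u: "u \<in> X" "u \<in> deg_lt k" "k \<le> d" for u b k m
    using u
  proof (induct k arbitrary: u)
    case 0
    then show ?case by (simp add: deg_lt_0 ip_zero)
  next
    case (Suc k)
    have "(\<lambda>x. sop R u x + l k * u x) \<in> deg_lt k" unfolding l_def by (rule sop_deg_drop[OF Suc(3)])
    then have "ip R (\<lambda>x. sop R u x + l k * u x) b = 0" using Suc(1)[OF Xs[OF Suc(2)]] Suc(4) by simp
    then have "ip R (sop R u) b + l k * ip R u b = 0"
      using ip_add[OF R real_polynomial_sop[OF pX[OF Suc(2)]] rpf_mult[OF rpf_const pX[OF Suc(2)]] pB[OF b(1)]]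
      by (simp add: ip_cmult)
    then have "(l m - l k) * ip R u b = 0" using b(2)[OF Suc(2)] unfolding left_diff_distrib by linarith
    moreover have "l k < l m" unfolding l_def using Suc(4) m by (intro lam_less) simp
    ultimately show ?case by simp
  qed
  \<comment> \<open>Induction on the degree bound of \<open>b\<close>: the shifted element
    \<open>b'\<close> has smaller degree and is already orthogonal to \<open>X\<close>, which says
    that \<open>b\<close> pairs with \<open>X\<close> like an eigenvector.\<close>
  have main: "\<forall>b\<in>B \<inter> deg_lt m. \<forall>u\<in>X. ip R u b = 0" if "d \<le> m" for m
    using that
  proof (induct rule: dec_induct)
    case base
    then show ?case by (simp add: X_def)
  next
    case (step m)
    show ?case
    proof (intro ballI)
      fix b u assume b: "b \<in> B \<inter> deg_lt (Suc m)" and u: "u \<in> X"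
      define b' where "b' x = sop R b x + l m * b x" for x
      have "b' \<in> deg_lt m" using sop_deg_drop[of b m R] b by (simp add: b'_def[abs_def] l_def)
      moreover have "b' \<in> B"
        unfolding b'_def[abs_def] by (rule lin_closed_addD[OF B(1) B(3) lin_closed_cmultD[OF B(1)]]) (use b in auto)
      ultimately have b': "b' \<in> B \<inter> deg_lt m" by blast
      have "ip R (sop R u) b + l m * ip R u b = 0" if "u \<in> X" for u
      proof -
        have pb: "real_polynomial_function b" using b pB by blast
        have "ip R b' u = ip R (sop R b) u + l m * ip R b u"
          unfolding b'_def[abs_def]
          using ip_add[OF R real_polynomial_sop[OF pb] rpf_mult[OF rpf_const pb] pX[OF that]] by (simp add: ip_cmult)
        moreover have "ip R b' u = 0" using step(3) b' that by (simp add: ip_sym[of R b'])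
        moreover have "ip R (sop R b) u = ip R (sop R u) b"
          using ip_sop_symmetric[OF R pb pX[OF that]] by (simp add: ip_sym[of R b])
        ultimately show ?thesis by (simp add: ip_sym[of R b])
      qed
      then show "ip R u b = 0"
        using kill[OF step(1), of b u d] b u by (auto simp: X_def)
    qed
  qed
  obtain m where "b \<in> deg_lt m" using polynomial_deg_lt[OF pB[OF b]] by blast
  then have "b \<in> B \<inter> deg_lt (max d m)" using b deg_lt_mono[of m "max d m"] by simp
  moreover have "u \<in> X" using u by (simp add: X_def)
  ultimately show ?thesis using main[of "max d m"] by simp
qed

section \<open>Density and the converse direction\<close>

text \<open>Countably many elements of \<open>S\<close> separate the same points as \<open>S\<close>; they map the compact set into
  \<open>nat \<Rightarrow> real\<close>, where the usual Stone--Weierstrass theorem applies to the image.\<close>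

lemma Stone_Weierstrass_level_sets:
  fixes F :: "'a::euclidean_space \<Rightarrow> real"
  assumes B: "poly_subalgebra B" "S \<subseteq> B" "s0 \<in> S" and K: "compact K" and F: "continuous_on UNIV F"
    and const: "\<And>x y. x \<in> K \<Longrightarrow> y \<in> K \<Longrightarrow> (\<And>f. f \<in> S \<Longrightarrow> f x = f y) \<Longrightarrow> F x = F y" and e: "e > 0"
  shows "\<exists>b\<in>B. \<forall>x\<in>K. \<bar>F x - b x\<bar> < e"
proof -
  have pB: "real_polynomial_function b" if "b \<in> B" for b using B(1) that by (auto simp: poly_subalgebra_def)
  define N where "N f = {z :: 'a \<times> 'a. f (fst z) \<noteq> f (snd z)}" for f :: "'a \<Rightarrow> real"
  have opN: "open (N f)" if "f \<in> S" for f
  proof -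
    have c: "continuous_on UNIV f" using continuous_rpf pB B(2) that by blast
    have "open {z :: 'a \<times> 'a. f (fst z) \<noteq> f (snd z)}"
      by (intro open_Collect_neq continuous_on_compose2[OF c] continuous_on_fst continuous_on_snd continuous_on_id) auto
    then show ?thesis by (simp add: N_def)
  qed
  \<comment> \<open>A countable subfamily covers the same pairs of points with different values, so
    it separates as much as \<open>S\<close> does.\<close>
  obtain \<F> where \<F>: "\<F> \<subseteq> N ` S" "countable \<F>" "\<Union>\<F> = \<Union>(N ` S)"
    using Lindelof[of "N ` S"] opN by blast
  then obtain S1 where S1: "countable S1" "S1 \<subseteq> S" "\<F> = N ` S1"
    using countable_subset_image[of \<F> N S] by blast
  \<comment> \<open>\<open>s0\<close> keeps the set non-empty, so that \<open>from_nat_into\<close>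
    enumerates it, possibly with repetitions.\<close>
  define S2 where "S2 = insert s0 S1"
  have S2: "countable S2" "S2 \<noteq> {}" "S2 \<subseteq> S" using S1 B(3) by (auto simp: S2_def)
  define \<phi> where "\<phi> = from_nat_into S2"
  have \<phi>S: "\<phi> i \<in> S" for i using from_nat_into[OF S2(2)] S2(3) unfolding \<phi>_def by blast
  define \<iota> where "\<iota> x i = \<phi> i x" for x i
  have sep: "f x = f y" if "\<iota> x = \<iota> y" "f \<in> S" for f x y
  proof (rule ccontr)
    assume "f x \<noteq> f y"
    then have "(x, y) \<in> \<Union>(N ` S)" using that(2) by (auto simp: N_def)
    then have "(x, y) \<in> \<Union>(N ` S1)" unfolding \<F>(3)[symmetric] S1(3)[symmetric] .
    then obtain h where h: "h \<in> S1" "h x \<noteq> h y" by (auto simp: N_def)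
    then obtain i where "\<phi> i = h" using from_nat_into_surj[OF S2(1)] unfolding \<phi>_def S2_def by blast
    then show False using fun_cong[OF that(1), of i] h(2) by (simp add: \<iota>_def)
  qed
  have c\<iota>: "continuous_on UNIV \<iota>"
  proof (rule continuous_on_coordinatewise_then_product)
    show "continuous_on UNIV (\<lambda>x. \<iota> x i)" for i
      unfolding \<iota>_def by (rule continuous_rpf[OF pB[OF subsetD[OF B(2) \<phi>S]]])
  qed
  define K' where "K' = \<iota> ` K"
  have K': "compact K'" unfolding K'_def by (rule compact_continuous_image[OF continuous_on_subset[OF c\<iota>] K]) simp
  define F' where "F' y = F (SOME x. x \<in> K \<and> \<iota> x = y)" for y
  have F': "F' (\<iota> x) = F x" if x: "x \<in> K" for x
  proof -
    define x' where "x' = (SOME x'. x' \<in> K \<and> \<iota> x' = \<iota> x)"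
    have "x' \<in> K \<and> \<iota> x' = \<iota> x" unfolding x'_def by (rule someI[of _ x]) (use x in simp)
    then have "F x' = F x" using sep by (intro const x) auto
    then show ?thesis by (simp add: F'_def x'_def)
  qed
  \<comment> \<open>Continuity on the image comes from compactness: the preimage of a closed set is
    the image of a compact part of \<open>K\<close>, hence closed.\<close>
  have cF': "continuous_on K' F'"
    unfolding continuous_on_closed_vimage[OF compact_imp_closed[OF K']]
  proof (intro allI impI)
    fix C :: "real set" assume C: "closed C"
    have "F' -` C \<inter> K' = \<iota> ` (K \<inter> F -` C)" unfolding K'_def using F' by auto
    moreover have "compact (\<iota> ` (K \<inter> F -` C))"
      by (rule compact_continuous_image[OF continuous_on_subset[OF c\<iota>]])
        (use compact_Int_closed[OF K closed_vimage[OF C F]] in auto)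
    ultimately show "closed (F' -` C \<inter> K')" by (simp add: compact_imp_closed)
  qed
  define P where "P G \<longleftrightarrow> continuous_on K' G \<and> (\<exists>b\<in>B. \<forall>x. G (\<iota> x) = b x)" for G :: "(nat \<Rightarrow> real) \<Rightarrow> real"
  have "\<exists>G. P G \<and> (\<forall>y\<in>K'. \<bar>F' y - G y\<bar> < e)"
  proof (rule Stone_Weierstrass_HOL[OF K' _ _ _ _ _ cF' e])
    show "P (\<lambda>y. c)" for c using B(1) unfolding P_def poly_subalgebra_def by auto
    show "continuous_on K' G" if "P G" for G using that by (simp add: P_def)
    show "P (\<lambda>y. G y + H y)" if GH: "P G \<and> P H" for G H
    proof -
      obtain b c where bc: "b \<in> B" "c \<in> B" "\<And>x. G (\<iota> x) = b x" "\<And>x. H (\<iota> x) = c x"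
        using GH unfolding P_def by blast
      have "(\<lambda>x. b x + c x) \<in> B" using B(1) bc(1,2) by (simp add: poly_subalgebra_def)
      then show ?thesis using GH bc(3,4) unfolding P_def by (auto intro!: continuous_intros)
    qed
    show "P (\<lambda>y. G y * H y)" if GH: "P G \<and> P H" for G H
    proof -
      obtain b c where bc: "b \<in> B" "c \<in> B" "\<And>x. G (\<iota> x) = b x" "\<And>x. H (\<iota> x) = c x"
        using GH unfolding P_def by blast
      have "(\<lambda>x. b x * c x) \<in> B" using B(1) bc(1,2) by (simp add: poly_subalgebra_def)
      then show ?thesis using GH bc(3,4) unfolding P_def by (auto intro!: continuous_intros)
    qed
    show "\<exists>G. P G \<and> G x \<noteq> G y" if xy: "x \<in> K' \<and> y \<in> K' \<and> x \<noteq> y" for x y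
    proof -
      obtain i where "x i \<noteq> y i" using xy by blast
      moreover have "P (\<lambda>y. y i)"
        unfolding P_def
      proof
        show "continuous_on K' (\<lambda>y. y i)" by (rule continuous_on_subset[OF continuous_on_product_coordinates]) simp
        show "\<exists>b\<in>B. \<forall>x. \<iota> x i = b x" using \<phi>S[of i] B(2) by (auto simp: \<iota>_def)
      qed
      ultimately show ?thesis by blast
    qed
  qed
  then obtain G where G: "P G" "\<And>y. y \<in> K' \<Longrightarrow> \<bar>F' y - G y\<bar> < e" by blast
  obtain b where b: "b \<in> B" "\<And>x. G (\<iota> x) = b x" using G(1) unfolding P_def by blast
  have "\<bar>F x - b x\<bar> < e" if "x \<in> K" for x
    using G(2)[of "\<iota> x"] that F'[OF that] b(2) by (simp add: K'_def)
  then show ?thesis using b(1) by blast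
qed

text \<open>By compactness of \<open>K - U\<close>, finitely many members of \<open>S\<close> tell
  all its points from \<open>x0\<close>. Their sum of squared differences is bounded below there,
  and truncating it gives a bump that depends only on the values of \<open>S\<close>, which an
  arbitrary bump would not.\<close>

lemma subalgebra_bump:
  fixes S :: "('a::euclidean_space \<Rightarrow> real) set"
  assumes S: "S \<subseteq> Collect real_polynomial_function" and K: "compact K" and U: "open U" "x0 \<in> U"
    and sep: "\<And>y. (\<And>f. f \<in> S \<Longrightarrow> f y = f x0) \<Longrightarrow> y \<in> U"
  shows "\<exists>\<phi> :: 'a \<Rightarrow> real. continuous_on UNIV \<phi> \<and> (\<forall>x. 0 \<le> \<phi> x) \<and> 0 < \<phi> x0 \<and> (\<forall>x\<in>K. \<phi> x \<noteq> 0 \<longrightarrow> x \<in> U) \<and>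
    (\<forall>x y. (\<forall>f\<in>S. f x = f y) \<longrightarrow> \<phi> x = \<phi> y)"
proof -
  have cS: "continuous_on A f" if "f \<in> S" for f A using continuous_rpf S that by blast
  have "compact (K - U)" by (rule compact_diff[OF K U(1)])
  moreover have "open {y. f y \<noteq> f x0}" if "f \<in> S" for f
    using cS[OF that, of UNIV] by (intro open_Collect_neq) auto
  moreover have "K - U \<subseteq> (\<Union>f\<in>S. {y. f y \<noteq> f x0})" using sep by blast
  ultimately obtain I where I: "I \<subseteq> S" "finite I" "K - U \<subseteq> (\<Union>f\<in>I. {y. f y \<noteq> f x0})"
    by (rule compactE_image)
  define q where "q y = (\<Sum>f\<in>I. (f y - f x0)\<^sup>2)" for y
  have cq: "continuous_on A q" for A
    unfolding q_def[abs_def] using I(1) by (intro continuous_intros cS) auto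
  have qpos: "0 < q y" if y: "y \<in> K - U" for y
  proof -
    obtain f where f: "f \<in> I" "f y \<noteq> f x0" using I(3) y by blast
    have "0 < (f y - f x0)\<^sup>2" using f(2) by simp
    also have "\<dots> \<le> q y" unfolding q_def by (rule member_le_sum[OF f(1) _ I(2)]) simp
    finally show ?thesis .
  qed
  obtain \<delta> where \<delta>: "\<delta> > 0" "\<And>y. y \<in> K - U \<Longrightarrow> \<delta> \<le> q y"
  proof (cases "K - U = {}")
    case True
    then show ?thesis using that[of 1] by auto
  next
    case False
    obtain y where "y \<in> K - U" "\<forall>z\<in>K - U. q y \<le> q z"
      using continuous_attains_inf[OF \<open>compact (K - U)\<close> False cq] by blast
    then show ?thesis using that[of "q y"] qpos by blast
  qed
  define \<phi> where "\<phi> y = max 0 (\<delta> - q y)" for y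
  show ?thesis
  proof (intro exI[of _ \<phi>] conjI ballI allI impI)
    show "continuous_on UNIV \<phi>" unfolding \<phi>_def[abs_def] by (intro continuous_intros cq)
    show "0 < \<phi> x0" using \<delta>(1) by (simp add: \<phi>_def q_def)
    show "0 \<le> \<phi> x" for x by (simp add: \<phi>_def)
    show "x \<in> U" if "x \<in> K" "\<phi> x \<noteq> 0" for x
      using \<delta>(2)[of x] that by (auto simp: \<phi>_def max_def split: if_splits)
    show "\<phi> x = \<phi> y" if "\<forall>f\<in>S. f x = f y" for x y
    proof -
      have "q x = q y"
        unfolding q_def
      proof (rule sum.cong[OF refl])
        fix f assume "f \<in> I"
        then have "f x = f y" using that I(1) by blast
        then show "(f x - f x0)\<^sup>2 = (f y - f x0)\<^sup>2" by (simp only:)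
      qed
      then show ?thesis by (simp add: \<phi>_def)
    qed
  qed
qed

lemma orthogonal_imp_zero:
  fixes S :: "('a::euclidean_space \<Rightarrow> real) set"
  assumes R: "norm x0 < R" and B: "poly_subalgebra B" "S \<subseteq> B" "S \<noteq> {}" and U: "open U" "x0 \<in> U"
    and sep: "\<And>x y. x \<in> U \<Longrightarrow> (\<And>f. f \<in> S \<Longrightarrow> f y = f x) \<Longrightarrow> y \<in> U \<and> u y = u x"
    and u: "real_polynomial_function u" and orth: "\<And>b. b \<in> B \<Longrightarrow> ip R u b = 0"
  shows "u x = 0"
proof -
  have R0: "0 \<le> R" using R norm_ge_zero[of x0] by linarith
  have pB: "real_polynomial_function b" if "b \<in> B" for b using B(1) that by (auto simp: poly_subalgebra_def)
  obtain \<phi> :: "'a \<Rightarrow> real" where \<phi>: "continuous_on UNIV \<phi>" "\<And>x. 0 \<le> \<phi> x" "0 < \<phi> x0" "\<And>x. x \<in> cball 0 R \<Longrightarrow> \<phi> x \<noteq> 0 \<Longrightarrow> x \<in> U"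
    "\<And>x y. (\<forall>f\<in>S. f x = f y) \<Longrightarrow> \<phi> x = \<phi> y"
  proof -
    have "\<exists>\<phi> :: 'a \<Rightarrow> real. continuous_on UNIV \<phi> \<and> (\<forall>x. 0 \<le> \<phi> x) \<and> 0 < \<phi> x0 \<and> (\<forall>x\<in>cball 0 R. \<phi> x \<noteq> 0 \<longrightarrow> x \<in> U) \<and>
        (\<forall>x y. (\<forall>f\<in>S. f x = f y) \<longrightarrow> \<phi> x = \<phi> y)"
    proof (rule subalgebra_bump[OF _ compact_cball U])
      show "S \<subseteq> Collect real_polynomial_function" using pB B(2) by blast
      show "y \<in> U" if "\<And>f. f \<in> S \<Longrightarrow> f y = f x0" for y using sep[OF U(2), of y] that by blast
    qed
    then show ?thesis using that by blast
  qed
  define F where "F x = \<phi> x * u x" for x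
  have cF: "continuous_on A F" for A
    unfolding F_def[abs_def] by (intro continuous_on_mult continuous_on_subset[OF \<phi>(1)] continuous_rpf u) auto
  \<comment> \<open>Where the bump is non-zero the point lies in \<open>U\<close> and
    \<open>u\<close> is determined by the values of \<open>S\<close>; elsewhere the product vanishes
    on the whole level set.\<close>
  have constF: "F x = F y" if xy: "x \<in> cball 0 R" "y \<in> cball 0 R" and e: "\<And>f. f \<in> S \<Longrightarrow> f x = f y" for x y
  proof (cases "\<phi> x = 0")
    case True
    then show ?thesis using \<phi>(5)[of x y] e by (simp add: F_def)
  next
    case False
    have "u y = u x" by (rule conjunct2[OF sep[OF \<phi>(4)[OF xy(1) False]]]) (rule e[symmetric])
    then show ?thesis using \<phi>(5)[of x y] e by (simp add: F_def)
  qed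
  obtain s0 where s0: "s0 \<in> S" using B(3) by blast
  have intf: "integrable lborel (\<lambda>x. wgt R x * f x)" if "continuous_on UNIV f" for f
    by (rule integrable_wgt[OF R0 that])
  define M where "M = (\<integral>x. wgt R x * \<bar>u x\<bar> \<partial>lborel)"
  have cu: "continuous_on UNIV u" by (rule continuous_rpf[OF u])
  have w0: "0 \<le> wgt R x" for x by (simp add: wgt_def)
  have bound: "\<bar>\<integral>x. wgt R x * (u x * F x) \<partial>lborel\<bar> \<le> e * M" if e: "e > 0" for e
  proof -
    obtain b where b: "b \<in> B" "\<And>x. x \<in> cball 0 R \<Longrightarrow> \<bar>F x - b x\<bar> < e"
      using Stone_Weierstrass_level_sets[OF B(1,2) s0 compact_cball cF constF e] by blast
    have cb: "continuous_on UNIV b" by (rule continuous_rpf[OF pB[OF b(1)]])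
    have "(\<integral>x. wgt R x * (u x * F x) \<partial>lborel) = (\<integral>x. wgt R x * (u x * F x) \<partial>lborel) - ip R u b"
      using orth[OF b(1)] by simp
    also have "\<dots> = (\<integral>x. wgt R x * (u x * F x) - wgt R x * (u x * b x) \<partial>lborel)"
      unfolding ip_def mult.assoc
      by (rule Bochner_Integration.integral_diff[symmetric]) (intro intf continuous_on_mult cu cF cb)+
    finally have eq: "(\<integral>x. wgt R x * (u x * F x) \<partial>lborel) = (\<integral>x. wgt R x * (u x * (F x - b x)) \<partial>lborel)"
      by (simp add: right_diff_distrib)
    have "\<bar>\<integral>x. wgt R x * (u x * (F x - b x)) \<partial>lborel\<bar> \<le> (\<integral>x. \<bar>wgt R x * (u x * (F x - b x))\<bar> \<partial>lborel)"
      by (rule integral_abs_bound)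
    also have "\<dots> \<le> (\<integral>x. e * (wgt R x * \<bar>u x\<bar>) \<partial>lborel)"
    proof (rule integral_mono)
      show "integrable lborel (\<lambda>x. \<bar>wgt R x * (u x * (F x - b x))\<bar>)"
        by (intro integrable_abs intf continuous_on_mult continuous_on_diff cu cF cb)
      show "integrable lborel (\<lambda>x. e * (wgt R x * \<bar>u x\<bar>))"
        by (intro integrable_mult_right intf continuous_on_rabs cu)
      show "\<bar>wgt R x * (u x * (F x - b x))\<bar> \<le> e * (wgt R x * \<bar>u x\<bar>)" for x
      proof (cases "norm x \<le> R")
        case True
        then have "\<bar>F x - b x\<bar> \<le> e" using b(2)[of x] by simp
        then have "wgt R x * \<bar>u x\<bar> * \<bar>F x - b x\<bar> \<le> wgt R x * \<bar>u x\<bar> * e"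
          using w0[of x] by (intro mult_left_mono) auto
        then show ?thesis using w0[of x] by (simp add: abs_mult mult_ac)
      next
        case False
        then show ?thesis using wgt_support[OF R0, of x] by simp
      qed
    qed
    finally show ?thesis unfolding eq M_def by simp
  qed
  have "(\<integral>x. wgt R x * (u x * F x) \<partial>lborel) = 0"
  proof (rule ccontr)
    assume ne: "(\<integral>x. wgt R x * (u x * F x) \<partial>lborel) \<noteq> 0"
    define J where "J = \<bar>\<integral>x. wgt R x * (u x * F x) \<partial>lborel\<bar>"
    have J: "J > 0" using ne by (simp add: J_def)
    have M: "0 \<le> M" unfolding M_def by (rule integral_nonneg_AE, rule AE_I2, rule mult_nonneg_nonneg[OF w0 abs_ge_zero])
    \<comment> \<open>The accuracy is chosen so that the bound falls below \<open>J\<close>; adding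
      1 avoids division by zero when \<open>M = 0\<close>.\<close>
    have "J \<le> J / (2 * (M + 1)) * M" unfolding J_def by (rule bound) (use J M in \<open>simp add: J_def\<close>)
    also have "\<dots> < J" using J M by (simp add: field_simps add_nonneg_pos)
    finally show False by simp
  qed
  then have z: "wgt R x * (u x * F x) = 0" for x
  proof (rule continuous_integral_zero[rotated 3])
    show "continuous_on UNIV (\<lambda>x. wgt R x * (u x * F x))" by (intro continuous_on_mult continuous_wgt cu cF)
    show "0 \<le> wgt R x * (u x * F x)" for x
      using mult_nonneg_nonneg[OF w0 mult_nonneg_nonneg[OF \<phi>(2) zero_le_square[of "u x"]], of x x]
      by (simp add: F_def mult_ac)
  qed (intro intf continuous_on_mult cu cF)
  define A where "A = ball 0 R \<inter> \<phi> -` {0<..}"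
  have "open A" unfolding A_def by (intro open_Int open_ball open_vimage \<phi>(1)) simp
  moreover have "A \<noteq> {}" using R \<phi>(3) by (auto simp: A_def)
  moreover have "u x = 0" if x: "x \<in> A" for x
  proof -
    have "(norm x)\<^sup>2 < R\<^sup>2" using x by (intro power_strict_mono) (auto simp: A_def)
    then have "wgt R x \<noteq> 0" by (simp add: wgt_def dot_square_norm)
    moreover have "\<phi> x \<noteq> 0" using x by (auto simp: A_def)
    ultimately show ?thesis using z[of x] by (simp add: F_def)
  qed
  ultimately show ?thesis using real_polynomial_dense_nonzero[OF u] by metis
qed

lemma poly_subalgebra_lin_closed:
  assumes "poly_subalgebra B"
  shows "lin_closed B"
  unfolding lin_closed_def
proof (intro conjI ballI allI)
  have c: "(\<lambda>x. c) \<in> B" for c using assms by (simp add: poly_subalgebra_def)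
  show "(\<lambda>x. 0) \<in> B" by (rule c)
  fix f assume f: "f \<in> B"
  show "(\<lambda>x. a * f x) \<in> B" for a
    using bspec[OF bspec[OF conjunct2[OF conjunct2[OF assms[unfolded poly_subalgebra_def]]] c[of a]] f] by (rule conjunct2)
  show "(\<lambda>x. f x + g x) \<in> B" if "g \<in> B" for g
    using assms f that by (simp add: poly_subalgebra_def)
qed

theorem laplacian_closed_subalgebra_full:
  fixes B C S :: "('a::euclidean_space \<Rightarrow> real) set"
  assumes B: "poly_subalgebra B" "S \<subseteq> B" "r2 \<in> S" and C: "poly_subalgebra C" "B \<subseteq> C"
    and lap: "\<And>f. f \<in> B \<Longrightarrow> laplacian f \<in> B" and gr: "\<And>f g. f \<in> B \<Longrightarrow> g \<in> B \<Longrightarrow> grad_inner f g \<in> B"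
    and U: "open U" "U \<noteq> {}"
    and sep: "\<And>x y h. x \<in> U \<Longrightarrow> (\<And>f. f \<in> S \<Longrightarrow> f y = f x) \<Longrightarrow> h \<in> C \<Longrightarrow> y \<in> U \<and> h y = h x"
  shows "C \<subseteq> B"
proof
  fix h assume h: "h \<in> C"
  have pC: "real_polynomial_function f" if "f \<in> C" for f using C(1) that by (auto simp: poly_subalgebra_def)
  have lB: "lin_closed B" and lC: "lin_closed C" using B(1) C(1) poly_subalgebra_lin_closed by blast+
  have pBs: "B \<subseteq> Collect real_polynomial_function" using pC C(2) by blast
  obtain x0 where x0: "x0 \<in> U" using U(2) by blast
  \<comment> \<open>Any radius that puts \<open>x0\<close> strictly inside the ball would
    do.\<close>
  define R where "R = norm x0 + 1"
  have R: "norm x0 < R" "0 \<le> R" by (auto simp: R_def)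
  have r2B: "r2 \<in> B" using B by blast
  have eB: "euler f \<in> B" if "f \<in> B" for f
  proof -
    have "(\<lambda>x. (1 / 2) * grad_inner r2 f x) \<in> B" by (rule lin_closed_cmultD[OF lB gr[OF r2B that]])
    then show ?thesis by (simp add: euler_eq_grad_inner)
  qed
  have sB: "sop R f \<in> B" if f: "f \<in> B" for f
  proof -
    have "(\<lambda>x. (R\<^sup>2 * laplacian f x + (- 1) * euler (euler f) x) + (- (real DIM('a) + 4)) * euler f x) \<in> B"
      by (intro lin_closed_addD[OF lB] lin_closed_cmultD[OF lB] lap eB f)
    then show ?thesis by (simp add: sop_def[abs_def] algebra_simps)
  qed
  obtain d where d: "h \<in> deg_lt d" using polynomial_deg_lt[OF pC[OF h]] by blast
  obtain v where v: "v \<in> B \<inter> deg_lt d" "\<And>b. b \<in> B \<inter> deg_lt d \<Longrightarrow> ip R (\<lambda>x. h x - v x) b = 0"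
    using projection_on_deg_lt[OF R(2) lB pBs pC[OF h]] by blast
  define u where "u x = h x + (- 1) * v x" for x
  have uC: "u \<in> C" unfolding u_def[abs_def] using v(1) C(2) by (intro lin_closed_addD[OF lC] lin_closed_cmultD[OF lC] h) auto
  have ud: "u \<in> deg_lt d" unfolding u_def[abs_def] using v(1) d by (intro deg_lt_add deg_lt_cmult) auto
  have "u x = 0" for x
  proof (rule orthogonal_imp_zero[OF R(1) B(1,2) _ U(1) x0 _ pC[OF uC]])
    show "S \<noteq> {}" using B(3) by blast
    show "y \<in> U \<and> u y = u x" if "x \<in> U" "\<And>f. f \<in> S \<Longrightarrow> f y = f x" for x y
      using sep[of x y u] that uC by blast
    show "ip R u b = 0" if "b \<in> B" for b
    proof (rule orthogonal_all_degrees[OF R(2) lB pBs sB ud _ that])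
      show "ip R u b = 0" if "b \<in> B \<inter> deg_lt d" for b using v(2)[OF that] by (simp add: u_def[abs_def])
    qed
  qed
  then have "h = v" by (intro ext) (simp add: u_def)
  then show "h \<in> B" using v(1) by simp
qed

section \<open>Generated subalgebras\<close>

lemma poly_subalgebra_rpf: "poly_subalgebra (Collect real_polynomial_function)"
  by (auto simp: poly_subalgebra_def intro: rpf_const rpf_add rpf_mult)

lemma generated_subset: "S \<subseteq> generated_subalgebra S"
  unfolding generated_subalgebra_def by (rule hull_subset)

lemma generated_minimal: "poly_subalgebra T \<Longrightarrow> S \<subseteq> T \<Longrightarrow> generated_subalgebra S \<subseteq> T"
  unfolding generated_subalgebra_def by (rule hull_minimal)

lemma poly_subalgebra_generated:
  assumes "S \<subseteq> Collect real_polynomial_function"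
  shows "poly_subalgebra (generated_subalgebra S)"
proof -
  have gen: "f \<in> generated_subalgebra S \<longleftrightarrow> (\<forall>T. poly_subalgebra T \<longrightarrow> S \<subseteq> T \<longrightarrow> f \<in> T)" for f
    unfolding generated_subalgebra_def hull_def by blast
  have sub: "generated_subalgebra S \<subseteq> Collect real_polynomial_function"
    by (rule generated_minimal[OF poly_subalgebra_rpf assms])
  show ?thesis
    unfolding poly_subalgebra_def
  proof (intro conjI ballI allI sub)
    show "(\<lambda>x. c) \<in> generated_subalgebra S" for c unfolding gen by (simp add: poly_subalgebra_def)
    fix f g assume fg: "f \<in> generated_subalgebra S" "g \<in> generated_subalgebra S"
    show "(\<lambda>x. f x + g x) \<in> generated_subalgebra S" "(\<lambda>x. f x * g x) \<in> generated_subalgebra S"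
      using fg unfolding gen by (simp_all add: poly_subalgebra_def)
  qed
qed

text \<open>The gradient product is a derivation in each argument, so closure extends from
  \<open>S\<close> to the generated algebra first in one argument and then in the other. The
  Laplacian comes last because its product rule contains the gradient product.\<close>

lemma generated_closed:
  fixes S :: "('a::euclidean_space \<Rightarrow> real) set"
  assumes S: "S \<subseteq> Collect real_polynomial_function"
    and cl: "\<forall>f\<in>S. \<forall>g\<in>S. laplacian f \<in> generated_subalgebra S \<and> grad_inner f g \<in> generated_subalgebra S"
  shows "\<And>f g. f \<in> generated_subalgebra S \<Longrightarrow> g \<in> generated_subalgebra S \<Longrightarrow> grad_inner f g \<in> generated_subalgebra S"
    and "\<And>f. f \<in> generated_subalgebra S \<Longrightarrow> laplacian f \<in> generated_subalgebra S"
proof -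
  define B where "B = generated_subalgebra S"
  have sB: "poly_subalgebra B" unfolding B_def by (rule poly_subalgebra_generated[OF S])
  have pB: "real_polynomial_function f" if "f \<in> B" for f using sB that by (auto simp: poly_subalgebra_def)
  have const: "(\<lambda>x. c) \<in> B" for c using sB by (simp add: poly_subalgebra_def)
  have add: "(\<lambda>x. f x + g x) \<in> B" if "f \<in> B" "g \<in> B" for f g using sB that by (simp add: poly_subalgebra_def)
  have mult: "(\<lambda>x. f x * g x) \<in> B" if "f \<in> B" "g \<in> B" for f g using sB that by (simp add: poly_subalgebra_def)
  have SB: "S \<subseteq> B" unfolding B_def by (rule generated_subset)
  have min: "B \<subseteq> T" if "poly_subalgebra T" "S \<subseteq> T" for T unfolding B_def by (rule generated_minimal[OF that])
  have gi_add: "grad_inner (\<lambda>x. f x + g x) h = (\<lambda>x. grad_inner f h x + grad_inner g h x)"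
    and gi_mult: "grad_inner (\<lambda>x. f x * g x) h = (\<lambda>x. f x * grad_inner g h x + g x * grad_inner f h x)"
    if "f \<in> B" "g \<in> B" for f g h
    using pB[OF that(1)] pB[OF that(2)]
    by (simp_all add: fun_eq_iff grad_inner_eq grad_add grad_mult inner_add_left)
  have gi_const: "grad_inner (\<lambda>x. c) h = (\<lambda>x. 0)" for c and h :: "'a \<Rightarrow> real" by (simp add: fun_eq_iff grad_inner_eq)
  have gi_sym: "grad_inner f g = grad_inner g f" for f g :: "'a \<Rightarrow> real"
    by (simp add: fun_eq_iff grad_inner_def mult.commute)
  have extend: "B \<subseteq> {f \<in> B. grad_inner f h \<in> B}" if h: "\<And>f. f \<in> S \<Longrightarrow> grad_inner f h \<in> B" for h
  proof (rule min)
    show "S \<subseteq> {f \<in> B. grad_inner f h \<in> B}" using SB h by blast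
    show "poly_subalgebra {f \<in> B. grad_inner f h \<in> B}"
      unfolding poly_subalgebra_def
    proof (intro conjI ballI allI)
      show "{f \<in> B. grad_inner f h \<in> B} \<subseteq> Collect real_polynomial_function" using pB by blast
      show "(\<lambda>x. c) \<in> {f \<in> B. grad_inner f h \<in> B}" for c using const by (simp add: gi_const)
      fix f g assume "f \<in> {f \<in> B. grad_inner f h \<in> B}" "g \<in> {f \<in> B. grad_inner f h \<in> B}"
      then have fg: "f \<in> B" "g \<in> B" "grad_inner f h \<in> B" "grad_inner g h \<in> B" by auto
      show "(\<lambda>x. f x + g x) \<in> {f \<in> B. grad_inner f h \<in> B}"
        using add[OF fg(1,2)] add[OF fg(3,4)] by (simp add: gi_add[OF fg(1,2)])
      show "(\<lambda>x. f x * g x) \<in> {f \<in> B. grad_inner f h \<in> B}"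
        using mult[OF fg(1,2)] add[OF mult[OF fg(1,4)] mult[OF fg(2,3)]] by (simp add: gi_mult[OF fg(1,2)])
    qed
  qed
  have 1: "grad_inner f g \<in> B" if "f \<in> B" "g \<in> S" for f g
    using extend[of g] cl that unfolding B_def by blast
  have 2: "grad_inner f g \<in> B" if fg: "f \<in> B" "g \<in> B" for f g
  proof -
    have "grad_inner s f \<in> B" if "s \<in> S" for s using 1[OF fg(1) that] by (simp add: gi_sym[of s])
    then have "grad_inner g f \<in> B" using extend[of f] fg(2) by blast
    then show ?thesis by (simp add: gi_sym[of f])
  qed
  then show "\<And>f g. f \<in> generated_subalgebra S \<Longrightarrow> g \<in> generated_subalgebra S \<Longrightarrow> grad_inner f g \<in> generated_subalgebra S"
    unfolding B_def .
  have "B \<subseteq> {f \<in> B. laplacian f \<in> B}"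
  proof (rule min)
    show "S \<subseteq> {f \<in> B. laplacian f \<in> B}" using SB cl unfolding B_def by blast
    show "poly_subalgebra {f \<in> B. laplacian f \<in> B}"
      unfolding poly_subalgebra_def
    proof (intro conjI ballI allI)
      show "{f \<in> B. laplacian f \<in> B} \<subseteq> Collect real_polynomial_function" using pB by blast
      have "laplacian (\<lambda>x::'a. c) = (\<lambda>x. 0)" for c by (rule ext) simp
      then show "(\<lambda>x. c) \<in> {f \<in> B. laplacian f \<in> B}" for c using const by simp
      fix f g assume "f \<in> {f \<in> B. laplacian f \<in> B}" "g \<in> {f \<in> B. laplacian f \<in> B}"
      then have fg: "f \<in> B" "g \<in> B" "laplacian f \<in> B" "laplacian g \<in> B" by auto
      note p = pB[OF fg(1)] pB[OF fg(2)]
      have "laplacian (\<lambda>x. f x + g x) = (\<lambda>x. laplacian f x + laplacian g x)" by (rule ext) (rule laplacian_add[OF p])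
      then show "(\<lambda>x. f x + g x) \<in> {f \<in> B. laplacian f \<in> B}" using add[OF fg(1,2)] add[OF fg(3,4)] by simp
      have "laplacian (\<lambda>x. f x * g x) = (\<lambda>x. (f x * laplacian g x + g x * laplacian f x) + 2 * grad_inner f g x)"
        by (rule ext) (rule laplacian_mult[OF p])
      moreover have "(\<lambda>x. (f x * laplacian g x + g x * laplacian f x) + 2 * grad_inner f g x) \<in> B"
        by (intro add[OF add[OF mult[OF fg(1,4)] mult[OF fg(2,3)]] mult[OF const 2[OF fg(1,2)]]])
      ultimately show "(\<lambda>x. f x * g x) \<in> {f \<in> B. laplacian f \<in> B}" using mult[OF fg(1,2)] by simp
    qed
  qed
  then show "\<And>f. f \<in> generated_subalgebra S \<Longrightarrow> laplacian f \<in> generated_subalgebra S" unfolding B_def by blast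
qed

lemma (in submetry_map) poly_subalgebra_basic: "poly_subalgebra (basic_polynomials \<sigma>)"
proof -
  have eq: "basic_polynomials \<sigma> = {f. basic f}" by (simp add: basic_def)
  show ?thesis
    unfolding eq poly_subalgebra_def using basic_poly basic_const basic_add basic_mult by auto
qed

theorem theorem15:
  fixes \<sigma> :: "'a::euclidean_space \<Rightarrow> 'x::metric_space"
    and S :: "('a \<Rightarrow> real) set"
  assumes "infinitesimal_manifold_submetry \<sigma>"
    and "local_separating_set \<sigma> S"
    and "r2 \<in> S"
  shows "generated_subalgebra S = basic_polynomials \<sigma> \<longleftrightarrow>
    (\<forall>f\<in>S. \<forall>g\<in>S. laplacian f \<in> generated_subalgebra S \<and> grad_inner f g \<in> generated_subalgebra S)"
proof -
  have ms: "manifold_submetry \<sigma>" using assms(1) unfolding infinitesimal_manifold_submetry_def by blast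
  obtain U where Sb: "S \<subseteq> basic_polynomials \<sigma>" and U: "open U" "U \<noteq> {}" "saturated (level_partition S) U"
    "partition_within (level_partition S) U = partition_within (fibers \<sigma>) U"
    using assms(2) unfolding local_separating_set_def by blast
  define r where "r = {(v, w). \<forall>f\<in>S. f v = f w}"
  \<comment> \<open>\<open>x\<close> lies in a level set contained in \<open>U\<close>, and level
    sets inside \<open>U\<close> are fibres; so agreement on \<open>S\<close> puts \<open>y\<close>
    into the fibre of \<open>x\<close>.\<close>
  have sep: "y \<in> U \<and> \<sigma> y = \<sigma> x" if x: "x \<in> U" and xy: "\<And>f. f \<in> S \<Longrightarrow> f y = f x" for x y
  proof -
    obtain A where A: "A \<in> level_partition S" "x \<in> A" "A \<subseteq> U"
      using U(3) x unfolding saturated_def by blast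
    obtain a where a: "A = r `` {a}" using A(1) unfolding level_partition_def r_def[symmetric] by (rule quotientE)
    have ax: "f a = f x" if "f \<in> S" for f using A(2) that unfolding a r_def by auto
    have "f a = f y" if "f \<in> S" for f using ax[OF that] xy[OF that] by (rule trans[OF _ sym])
    then have "y \<in> A" unfolding a r_def by auto
    have "A \<in> partition_within (fibers \<sigma>) U"
      unfolding U(4)[symmetric] using A(1,3) by (simp add: partition_within_def)
    then obtain v where "A = \<sigma> -` {\<sigma> v}" unfolding partition_within_def fibers_def by blast
    then show ?thesis using A(2,3) \<open>y \<in> A\<close> by auto
  qed
  interpret submetry_map \<sigma>
    using ms unfolding manifold_submetry_def by unfold_locales blast
  interpret manifold_map \<sigma> U
  proof
    show "\<exists>d. embedded_submanifold d (\<sigma> -` {\<sigma> x})" for x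
      using ms unfolding manifold_submetry_def fibers_def by blast
    show "basic r2" using Sb assms(3) by (auto simp: basic_def)
    show "y \<in> U \<and> \<sigma> y = \<sigma> x" if "x \<in> U" "\<And>f. basic f \<Longrightarrow> f y = f x" for x y
      using sep[of x y] that Sb unfolding basic_def by blast
  qed (use U in auto)
  show ?thesis
  proof
    assume eq: "generated_subalgebra S = basic_polynomials \<sigma>"
    show "\<forall>f\<in>S. \<forall>g\<in>S. laplacian f \<in> generated_subalgebra S \<and> grad_inner f g \<in> generated_subalgebra S"
    proof (intro ballI conjI)
      fix f g assume "f \<in> S" "g \<in> S"
      then have "basic f" "basic g" using Sb by (auto simp: basic_def)
      then show "laplacian f \<in> generated_subalgebra S" "grad_inner f g \<in> generated_subalgebra S"
        unfolding eq using basic_laplacian basic_grad_inner by (auto simp: basic_def)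
    qed
  next
    assume cl: "\<forall>f\<in>S. \<forall>g\<in>S. laplacian f \<in> generated_subalgebra S \<and> grad_inner f g \<in> generated_subalgebra S"
    have SP: "S \<subseteq> Collect real_polynomial_function" using Sb by (auto simp: basic_polynomials_def)
    have le: "generated_subalgebra S \<subseteq> basic_polynomials \<sigma>" by (rule generated_minimal[OF poly_subalgebra_basic Sb])
    have "basic_polynomials \<sigma> \<subseteq> generated_subalgebra S"
    proof (rule laplacian_closed_subalgebra_full[OF poly_subalgebra_generated[OF SP] generated_subset assms(3)
          poly_subalgebra_basic le generated_closed(2)[OF SP cl] generated_closed(1)[OF SP cl] U(1,2)])
      show "y \<in> U \<and> h y = h x" if "x \<in> U" "\<And>f. f \<in> S \<Longrightarrow> f y = f x" "h \<in> basic_polynomials \<sigma>" for x y h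
      proof -
        have "y \<in> U \<and> \<sigma> y = \<sigma> x" using sep[of x y] that(1,2) by blast
        then show ?thesis using basic_eq[of h y x] that(3) unfolding basic_def by blast
      qed
    qed
    then show "generated_subalgebra S = basic_polynomials \<sigma>" using le by blast
  qed
qed

end
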